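(* Let $U \subset \mathbb{R}^n$ be open, and let $f_1, f_2, \dots \in C^2(U)$ converge in $L^1_{\mathrm{loc}}(U)$ to a function $f$. Suppose that the absolute integrals of all minors of the Hessians of the $f_k$ are uniformly locally bounded, i.e. for every $K \subset\subset U$ there is a constant $C(K)$, independent of $k$, such that $$\int_K \left|\det \left(\frac{\partial^2 f_k}{\partial x_i\,\partial x_j}\right)_{i\in I,\, j\in J}\right| \, dx \le C(K), \qquad k=1,2,\dots,$$ whenever $I,J\subset\{1,\dots,n\}$ have the same cardinality. Then: (1) the $f_k$ are locally uniformly bounded in $U$, i.e. for every compact $K\subset U$ one has $\sup_k\sup_K |f_k| <\infty$; (2) $f_k\to f$ pointwise almost everywhere in $U$ (with respect to Lebesgue measure); (3) both functions $\limsup_{k\to\infty} f_k$ and $\liminf_{k\to\infty} f_k$ (taken pointwise on $U$) are twice differentiable at almost every $x\in U$.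
   Context: $K\subset\subset U$ means that the closure of $K$ is compact and contained in $U$. Twice differentiability: for $U\subset\mathbb{R}^n$ open, a function $g:U\to\mathbb{R}$ is called twice differentiable at $x\in U$ if there is a quadratic polynomial $Q_x$ (a real polynomial in $n$ variables of degree at most $2$) such that $$\lim_{y\to x}\frac{g(y)-Q_x(y)}{|y-x|^2}=0.$$ *)

theory Defs
  imports "Jordan_Normal_Form.Determinant" "HOL-Analysis.Analysis"
begin

no_notation Matrix.vec_index (infixl \<open>$\<close> 100)

text \<open>
  The coordinates of \<open>\<real>\<^sup>n\<close> are indexed by a finite linearly ordered type, playing the role of
  \<open>{1, \<dots>, n}\<close>. A function on an open set \<open>U\<close> is represented by a function on the whole space;
  only its values on \<open>U\<close> are ever used.
\<close>

definition compactly_contained :: "'a::topological_space set \<Rightarrow> 'a set \<Rightarrow> bool"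
    (infix \<open>\<subset>\<subset>\<close> 50) where
  "K \<subset>\<subset> U \<longleftrightarrow> compact (closure K) \<and> closure K \<subseteq> U"

definition partial_deriv :: "'n::finite \<Rightarrow> (real^'n \<Rightarrow> real) \<Rightarrow> real^'n \<Rightarrow> real" where
  "partial_deriv i f x = deriv (\<lambda>t. f (x + t *\<^sub>R axis i 1)) 0"

primrec Ck_on :: "nat \<Rightarrow> (real^'n::finite) set \<Rightarrow> (real^'n \<Rightarrow> real) \<Rightarrow> bool" where
  "Ck_on 0 U f \<longleftrightarrow> continuous_on U f"
| "Ck_on (Suc k) U f \<longleftrightarrow> continuous_on U f \<and>
     (\<forall>i. (\<forall>x\<in>U. (\<lambda>t. f (x + t *\<^sub>R axis i 1)) differentiable (at 0)) \<and>
          Ck_on k U (partial_deriv i f))"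

definition hessian :: "(real^'n::finite \<Rightarrow> real) \<Rightarrow> real^'n \<Rightarrow> real^'n^'n" where
  "hessian f x = (\<chi> i j. partial_deriv i (partial_deriv j f) x)"

text \<open>
  The minor of \<open>A\<close> with rows \<open>I\<close> and columns \<open>J\<close>, both listed in increasing order. The determinant
  is the one for matrices whose size is a natural number; the minor for \<open>I = J = {}\<close> is \<open>1\<close>.
  It is meaningful only when \<open>card I = card J\<close>.
\<close>

definition minor ::
    "real^('n::{finite,linorder})^('n::{finite,linorder}) \<Rightarrow> 'n set \<Rightarrow> 'n set \<Rightarrow> real" where
  "minor A I J = Determinant.det
     (Matrix.mat (card I) (card J)
       (\<lambda>(a, b). A $ (sorted_list_of_set I ! a) $ (sorted_list_of_set J ! b)))"

definition locally_integrable_on :: "('a::euclidean_space) set \<Rightarrow> ('a \<Rightarrow> real) \<Rightarrow> bool" where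
  "locally_integrable_on U f \<longleftrightarrow>
     (\<forall>K. K \<in> sets lebesgue \<and> K \<subset>\<subset> U \<longrightarrow> set_integrable lebesgue K f)"

definition L1loc_tendsto ::
    "('a::euclidean_space) set \<Rightarrow> (nat \<Rightarrow> 'a \<Rightarrow> real) \<Rightarrow> ('a \<Rightarrow> real) \<Rightarrow> bool" where
  "L1loc_tendsto U f g \<longleftrightarrow>
     (\<forall>k. locally_integrable_on U (f k)) \<and> locally_integrable_on U g \<and>
     (\<forall>K. K \<in> sets lebesgue \<and> K \<subset>\<subset> U \<longrightarrow>
        (\<lambda>k. LINT x:K|lebesgue. \<bar>f k x - g x\<bar>) \<longlonglongrightarrow> 0)"

definition quadratic_polynomial :: "(real^'n::finite \<Rightarrow> real) \<Rightarrow> bool" where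
  "quadratic_polynomial Q \<longleftrightarrow>
     (\<exists>(c::real) (b::real^'n) (A::real^'n^'n).
        \<forall>y. Q y = c + (\<Sum>i\<in>UNIV. b $ i * y $ i)
                    + (\<Sum>i\<in>UNIV. \<Sum>j\<in>UNIV. A $ i $ j * y $ i * y $ j))"

text \<open>The limit is over \<open>y \<noteq> x\<close>, so the value of \<open>g\<close> at \<open>x\<close> itself is not constrained.\<close>

definition twice_differentiable_at ::
    "(real^'n::finite) set \<Rightarrow> (real^'n \<Rightarrow> real) \<Rightarrow> real^'n \<Rightarrow> bool" where
  "twice_differentiable_at U g x \<longleftrightarrow>
     (\<exists>Q. quadratic_polynomial Q \<and>
        ((\<lambda>y. (g y - Q y) / (norm (y - x))\<^sup>2) \<longlongrightarrow> 0) (at x within U))"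

text \<open>
  Upper and lower limits are taken in the extended reals. \<open>real_of_ereal\<close> sends infinite values
  to \<open>0\<close>; where the sequence is bounded, no infinite value occurs.
\<close>

definition pointwise_limsup :: "(nat \<Rightarrow> 'a \<Rightarrow> real) \<Rightarrow> 'a \<Rightarrow> real" where
  "pointwise_limsup f x = real_of_ereal (limsup (\<lambda>k. ereal (f k x)))"

definition pointwise_liminf :: "(nat \<Rightarrow> 'a \<Rightarrow> real) \<Rightarrow> 'a \<Rightarrow> real" where
  "pointwise_liminf f x = real_of_ereal (liminf (\<lambda>k. ereal (f k x)))"

end

theory Submission
  imports Defs
begin

text \<open>
  Locally, \<open>f\<close> is the \<open>L\<^sup>1\<close> limit of functions whose second derivatives are bounded in \<open>L\<^sup>1\<close>, so on almost
  every coordinate line it has a second-order expansion almost everywhere (its slope is an almost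
  everywhere limit of functions of bounded variation). Averaging over the coordinate directions one
  after the other gives, at almost every \<open>x\<close>, a quadratic polynomial \<open>q\<close> such that
  \<open>r\<^sup>-\<^sup>2 (f (x + r z) - q (r z))\<close> tends to \<open>0\<close> in measure on the unit cube as \<open>r\<close> tends to \<open>0\<close>.

  The minors turn smallness in measure into uniform smallness. If the integrals of all principal
  minors of the Hessian of \<open>h\<close> over a cube are bounded by \<open>M\<close> and \<open>h > b\<close> only on a set of measure
  \<open>\<delta>(\<epsilon>, M)\<close>, then \<open>h \<le> b + \<epsilon>\<close> on a smaller cube: by induction on the dimension this holds on a fine
  grid of hyperplanes, and inside a small cell an excess over the boundary values makes the gradient
  map cover a large set, whose volume is at most the integral of the Hessian determinant.
  Subtracting a quadratic polynomial changes all minors together by a bounded factor only.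

  At almost every \<open>x\<close> the limit of the measures with densities the minors of the Hessians of \<open>f\<^sub>k\<close>
  has bounded density. Hence, at a small scale \<open>r\<close>, infinitely many \<open>f\<^sub>k\<close> have rescaled minors with a
  bound independent of \<open>r\<close> and are uniformly close to \<open>q\<close>, which forces \<open>\<bar>f - q\<bar> \<le> \<epsilon> r\<^sup>2\<close> almost everywhere
  near \<open>x\<close> and not only in measure. A second application at the fixed scale \<open>r\<close>, where the
  exceptional sets of \<open>f\<^sub>k\<close> now shrink to null sets as \<open>k\<close> grows, gives \<open>\<bar>f\<^sub>k - q\<bar> \<le> \<epsilon> r\<^sup>2\<close> for all large
  \<open>k\<close>, and this passes to the upper and lower limits.
\<close>

subsection \<open>Limits of measures and their densities\<close>

text \<open>All minors, not only principal ones, have to be bounded: changing the entry in row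
  \<open>i\<close> and column \<open>j\<close> adds a multiple of the minor without that row and
  column, so only the full family is stable under subtracting a quadratic polynomial. The maximum
  principle itself consumes principal minors.

  It is applied twice because two requirements compete: the admissible exceptional measure depends
  on the bound for the rescaled minors. For all \<open>k\<close> at once that bound degenerates as
  the scale shrinks, and the indices with a better bound vary with the scale, so they can only serve
  to improve the limit function, not to control the tail of the sequence.

  No limit measure is extracted: superadditivity of the lower limit on disjoint balls is all that
  the covering argument uses. Similarly, variation functions on lines are replaced by their lower
  limits, so no selection theorem enters.\<close>

lemma emeasure_disjoint_UN_le:
  fixes N1 N2 :: "'a measure"
  assumes "countable C" "disjoint_family_on X C"
    and "\<And>i. i \<in> C \<Longrightarrow> X i \<in> sets N1" "sets N2 = sets N1"
    and le: "\<And>i. i \<in> C \<Longrightarrow> emeasure N1 (X i) \<le> \<kappa> * emeasure N2 (X i)"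
  shows "emeasure N1 (\<Union>i\<in>C. X i) \<le> \<kappa> * emeasure N2 (\<Union>i\<in>C. X i)"
proof -
  have "emeasure N1 (\<Union>i\<in>C. X i) = (\<integral>\<^sup>+i. emeasure N1 (X i) \<partial>count_space C)"
    using assms by (intro emeasure_UN_countable) auto
  also have "\<dots> \<le> (\<integral>\<^sup>+i. \<kappa> * emeasure N2 (X i) \<partial>count_space C)"
    by (intro nn_integral_mono) (use le in auto)
  also have "\<dots> = \<kappa> * (\<integral>\<^sup>+i. emeasure N2 (X i) \<partial>count_space C)"
    by (intro nn_integral_cmult) auto
  also have "(\<integral>\<^sup>+i. emeasure N2 (X i) \<partial>count_space C) = emeasure N2 (\<Union>i\<in>C. X i)"
    using assms by (intro emeasure_UN_countable[symmetric]) auto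
  finally show ?thesis .
qed

text \<open>Balls through \<open>x\<close> of radius below \<open>e/2\<close> stay inside
  \<open>cball x e\<close>, so a fine family can be thinned to balls inside any open
  \<open>G\<close> around \<open>S\<close>. Choosing \<open>G\<close> with small excess measure is
  what makes the later estimates sharp.\<close>

lemma Vitali_fine_cover:
  fixes S :: "'a::euclidean_space set"
  assumes G: "open G" "S \<subseteq> G"
    and fine: "\<And>x d. x \<in> S \<Longrightarrow> 0 < d \<Longrightarrow> \<exists>c r. 0 < r \<and> r < d \<and> x \<in> cball c r \<and> P c r"
  obtains C where "countable C" "disjoint_family_on (\<lambda>(c,r). cball c r) C"
    "\<And>c r. (c, r) \<in> C \<Longrightarrow> 0 < r \<and> cball c r \<subseteq> G \<and> P c r"
    "negligible (S - (\<Union>(c,r)\<in>C. cball c r))"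
proof -
  define K where "K = {(c,r). 0 < r \<and> cball c r \<subseteq> G \<and> P c r}"
  have 1: "0 < snd i" if "i \<in> K" for i using that by (auto simp: K_def)
  have 2: "\<exists>i. i \<in> K \<and> x \<in> cball (fst i) (snd i) \<and> snd i < d" if x: "x \<in> S" and d: "0 < d" for x d
  proof -
    obtain e where e: "e > 0" "cball x e \<subseteq> G"
      using x G open_contains_cball by blast
    obtain c r where cr: "0 < r" "r < min d (e/2)" "x \<in> cball c r" "P c r"
      using fine[OF x, of "min d (e/2)"] d e by auto
    have "cball c r \<subseteq> cball x e"
    proof
      fix y assume "y \<in> cball c r"
      then have "dist x y \<le> dist x c + dist c y" "dist c y \<le> r" by (auto intro: dist_triangle)
      with cr show "y \<in> cball x e" by (auto simp: dist_commute)
    qed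
    with cr e show ?thesis
      by (intro exI[of _ "(c,r)"]) (auto simp: K_def)
  qed
  obtain C where C: "countable C" "C \<subseteq> K"
     "pairwise (\<lambda>i j. disjnt (cball (fst i) (snd i)) (cball (fst j) (snd j))) C"
     "negligible(S - (\<Union>i \<in> C. cball (fst i) (snd i)))"
    by (rule Vitali_covering_theorem_cballs[of K snd S fst, OF 1 2]) auto
  show ?thesis
  proof (rule that[of C])
    show "disjoint_family_on (\<lambda>(c,r). cball c r) C"
      using C(3) by (fastforce simp: disjoint_family_on_def pairwise_def disjnt_def)
    show "0 < r \<and> cball c r \<subseteq> G \<and> P c r" if "(c, r) \<in> C" for c r
      using that C(2) by (force simp: K_def)
    show "negligible (S - (\<Union>(c,r)\<in>C. cball c r))"
      using C(4) by (simp add: case_prod_unfold)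
  qed (fact C)
qed

lemma cballs_borel: "countable C \<Longrightarrow> (\<Union>(c,r)\<in>C. cball c r) \<in> sets borel"
  by (intro sets.countable_UN') auto

lemma AE_lebesgue_not_negligible:
  assumes "negligible S" "\<And>x. x \<notin> S \<Longrightarrow> P x" shows "AE x in lebesgue. P x"
  using assms by (intro AE_I'[of S]) (auto simp: negligible_iff_null_sets)

lemma negligible_of_bounded_parts:
  fixes S :: "'a::euclidean_space set"
  assumes "\<And>R::nat. negligible (S \<inter> ball 0 (real R))"
  shows "negligible S"
proof -
  have "S = (\<Union>R::nat. S \<inter> ball 0 (real R))"
    by (auto simp: reals_Archimedean2)
  moreover have "negligible (\<Union>R::nat. S \<inter> ball 0 (real R))"
    by (rule negligible_countable_Union) (use assms in auto)
  ultimately show ?thesis by simp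
qed

text \<open>Matches the output of the Vitali covering, which captures an arbitrary set only up to a
  null set; that remainder joins the outer approximation at no cost in measure.\<close>

lemma negligible_from_cover:
  fixes S :: "'a::euclidean_space set"
  assumes "\<And>e::real. e > 0 \<Longrightarrow> \<exists>U\<in>sets borel. negligible (S - U) \<and> emeasure lborel U \<le> ennreal e"
  shows "negligible S"
  unfolding negligible_outer_le
proof (intro allI impI)
  fix e :: real assume e: "e > 0"
  obtain U where U: "U \<in> sets borel" "negligible (S - U)" "emeasure lborel U \<le> ennreal e"
    using assms[OF e] by auto
  have fin: "emeasure lborel U < \<infinity>" using U(3) by (auto simp: le_less_trans)
  have 1: "U \<in> lmeasurable" using U fin by (auto simp: fmeasurable_def)
  have 2: "S - U \<in> lmeasurable" "measure lebesgue (S - U) = 0"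
    using U(2) by (auto simp: negligible_iff_measure)
  have "measure lebesgue U \<le> e"
    using U(1,3) e by (simp add: measure_def enn2real_leI)
  moreover have "measure lebesgue (U \<union> (S - U)) \<le> measure lebesgue U + measure lebesgue (S - U)"
    using 1 2 by (intro measure_Un_le) auto
  ultimately show "\<exists>T. S \<subseteq> T \<and> T \<in> lmeasurable \<and> measure lebesgue T \<le> e"
    using fmeasurable.Un[OF 1 2(1)] 2 by (intro exI[of _ "U \<union> (S - U)"]) auto
qed

text \<open>The balls need not be centred at \<open>x\<close>, so that one-sided derivatives are covered as well.\<close>

lemma AE_liminf_measure_growth:
  fixes \<mu> :: "nat \<Rightarrow> 'a::euclidean_space measure"
  assumes sets: "\<And>k. sets (\<mu> k) = sets borel" and bd: "\<And>k. emeasure (\<mu> k) UNIV \<le> ennreal M"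
  shows "AE x in lebesgue. \<exists>N::nat. \<exists>d>0. \<forall>c r. 0 < r \<and> r < d \<and> x \<in> cball c r \<longrightarrow>
     liminf (\<lambda>k. emeasure (\<mu> k) (cball c r)) \<le> of_nat N * emeasure lborel (cball c r)"
proof -
  define S where "S = {x. \<forall>N::nat. \<forall>d>0. \<exists>c r. 0 < r \<and> r < d \<and> x \<in> cball c r \<and>
     of_nat N * emeasure lborel (cball c r) < liminf (\<lambda>k. emeasure (\<mu> k) (cball c r))}"
  have "negligible S"
  proof (rule negligible_from_cover)
    fix e :: real assume e: "e > 0"
    \<comment> \<open>Disjoint balls on which the lower limit exceeds \<open>N\<close> times
      Lebesgue measure have total volume at most \<open>M / N\<close>, and this \<open>N\<close>
      pushes that below \<open>e\<close>.\<close>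
    obtain N :: nat where N: "\<bar>M\<bar> / e < real N" "N > 0"
      by (metis reals_Archimedean2 abs_ge_zero e divide_nonneg_pos le_less_trans of_nat_0_less_iff)
    obtain C where C: "countable C" "disjoint_family_on (\<lambda>(c,r). cball c r) C"
      "\<And>c r. (c, r) \<in> C \<Longrightarrow> 0 < r \<and> cball c r \<subseteq> UNIV \<and>
         of_nat N * emeasure lborel (cball c r) < liminf (\<lambda>k. emeasure (\<mu> k) (cball c r))"
      "negligible (S - (\<Union>(c,r)\<in>C. cball c r))"
      by (rule Vitali_fine_cover[of UNIV S "\<lambda>c r. of_nat N * emeasure lborel (cball c r) < liminf (\<lambda>k. emeasure (\<mu> k) (cball c r))"])
         (auto simp: S_def)
    define B where "B = (\<lambda>i::'a \<times> real. cball (fst i) (snd i))"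
    have Bm: "B i \<in> sets borel" for i by (auto simp: B_def)
    have disj: "disjoint_family_on B C" using C(2) by (simp add: B_def case_prod_unfold)
    have fin: "of_nat N * emeasure lborel (\<Union>i\<in>F. B i) \<le> ennreal M" if F: "F \<subseteq> C" "finite F" for F
    proof -
      have dF: "disjoint_family_on B F" using disj F(1) by (rule disjoint_family_on_mono[rotated])
      have "of_nat N * emeasure lborel (\<Union>i\<in>F. B i) = (\<Sum>i\<in>F. of_nat N * emeasure lborel (B i))"
        using dF F Bm by (subst sum_emeasure[symmetric]) (auto simp: sum_distrib_left)
      also have "\<dots> \<le> (\<Sum>i\<in>F. liminf (\<lambda>k. emeasure (\<mu> k) (B i)))"
        using C(3) F by (intro sum_mono) (auto simp: B_def less_imp_le)
      \<comment> \<open>Superadditivity of the lower limit, read as Fatou's lemma for counting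
        measure on \<open>F\<close>.\<close>
      also have "\<dots> \<le> liminf (\<lambda>k. \<Sum>i\<in>F. emeasure (\<mu> k) (B i))"
        using nn_integral_liminf[of "\<lambda>k i. emeasure (\<mu> k) (B i)" "count_space F"]
        unfolding nn_integral_count_space_finite[OF F(2)] by simp
      also have "\<dots> \<le> liminf (\<lambda>k. ennreal M)"
      proof (intro Liminf_mono always_eventually allI)
        fix k
        have "(\<Sum>i\<in>F. emeasure (\<mu> k) (B i)) = emeasure (\<mu> k) (\<Union>i\<in>F. B i)"
          using dF F Bm sets by (intro sum_emeasure) auto
        also have "\<dots> \<le> emeasure (\<mu> k) UNIV"
          using sets by (intro emeasure_mono) (auto simp: )
        finally show "(\<Sum>i\<in>F. emeasure (\<mu> k) (B i)) \<le> ennreal M" using bd[of k] by auto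
      qed
      finally show ?thesis by (simp add: Liminf_const)
    qed
    \<comment> \<open>The bound for finite subfamilies is uniform, so it passes to \<open>C\<close>
      along the initial segments of an enumeration.\<close>
    have "of_nat N * emeasure lborel (\<Union>i\<in>C. B i) \<le> ennreal M"
    proof -
      define A where "A n = (\<Union>i\<in>{i\<in>C. to_nat_on C i < n}. B i)" for n
      have finA: "finite {i\<in>C. to_nat_on C i < n}" for n
        by (rule inj_on_finite[of "to_nat_on C" _ "{..<n}"])
           (use inj_on_to_nat_on[OF C(1)] in \<open>auto simp: inj_on_def\<close>)
      have inc: "incseq A" by (fastforce simp: A_def incseq_def)
      have Am: "range A \<subseteq> sets lborel" using finA Bm by (auto simp: A_def)
      have "(\<Union>n. A n) = (\<Union>i\<in>C. B i)" by (auto simp: A_def)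
      then have "of_nat N * emeasure lborel (\<Union>i\<in>C. B i) = of_nat N * (SUP n. emeasure lborel (A n))"
        using SUP_emeasure_incseq[OF Am inc] by simp
      also have "\<dots> = (SUP n. of_nat N * emeasure lborel (A n))"
        by (simp add: SUP_mult_left_ennreal)
      also have "\<dots> \<le> ennreal M"
        unfolding A_def by (intro SUP_least fin finA) auto
      finally show ?thesis .
    qed
    also have "ennreal M \<le> of_nat N * ennreal e"
      using N e by (auto simp: ennreal_mult[symmetric] ennreal_of_nat_eq_real_of_nat field_simps intro!: ennreal_leI)
    finally have "emeasure lborel (\<Union>i\<in>C. B i) \<le> ennreal e"
      using N(2) by (simp add: ennreal_mult_le_mult_iff ennreal_mult_cancel_left)
    then show "\<exists>U\<in>sets borel. negligible (S - U) \<and> emeasure lborel U \<le> ennreal e"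
      using C(1,4) cballs_borel[OF C(1)] by (intro bexI[of _ "\<Union>(c,r)\<in>C. cball c r"]) (auto simp: B_def case_prod_unfold)
  qed
  then show ?thesis
  proof (rule AE_lebesgue_not_negligible)
    fix x assume "x \<notin> S"
    then show "\<exists>N::nat. \<exists>d>0. \<forall>c r. 0 < r \<and> r < d \<and> x \<in> cball c r \<longrightarrow>
       liminf (\<lambda>k. emeasure (\<mu> k) (cball c r)) \<le> of_nat N * emeasure lborel (cball c r)"
      unfolding S_def mem_Collect_eq by (meson not_less)
  qed
qed

text \<open>If \<open>E\<close> keeps at least a fraction \<open>1/n\<close> of arbitrarily small
  balls through points outside \<open>E\<close>, such balls can be chosen disjoint inside an open
  \<open>G\<close> that exceeds the complement of \<open>E\<close> by little; their total volume is
  then at most \<open>n\<close> times that of \<open>E\<close> in \<open>G\<close>.\<close>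

lemma AE_density_outside:
  fixes E :: "'a::euclidean_space set"
  assumes E: "E \<in> sets borel"
  shows "AE x in lebesgue. x \<notin> E \<longrightarrow> (\<forall>\<epsilon>>0. \<exists>d>0. \<forall>c r. 0 < r \<and> r < d \<and> x \<in> cball c r \<longrightarrow>
     emeasure lborel (E \<inter> cball c r) \<le> ennreal \<epsilon> * emeasure lborel (cball c r))"
proof -
  define S where "S = (\<lambda>n::nat. {x. x \<notin> E \<and> (\<forall>d>0. \<exists>c r. 0 < r \<and> r < d \<and> x \<in> cball c r \<and>
     emeasure lborel (cball c r) \<le> of_nat n * emeasure lborel (E \<inter> cball c r))})"
  have "negligible (S n)" for n
  proof (rule negligible_of_bounded_parts, rule negligible_from_cover)
    fix R :: nat and e :: real assume e: "e > 0"
    have "ball 0 (real R) - E \<in> sets lebesgue" using E by auto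
    \<comment> \<open>The factor \<open>n\<close> that the covering estimate will lose is paid in
      advance.\<close>
    then obtain G where G: "open G" "ball 0 (real R) - E \<subseteq> G"
      "G - (ball 0 (real R) - E) \<in> lmeasurable"
      "emeasure lebesgue (G - (ball 0 (real R) - E)) < ennreal (e / (real n + 1))"
      by (rule sets_lebesgue_outer_open[of _ "e / (real n + 1)"]) (use e in auto)
    have GE: "emeasure lborel (E \<inter> G) \<le> ennreal (e / (real n + 1))"
    proof -
      have "emeasure lborel (E \<inter> G) = emeasure lebesgue (E \<inter> G)" using E G(1) by auto
      also have "\<dots> \<le> emeasure lebesgue (G - (ball 0 (real R) - E))"
        using E G(1) by (intro emeasure_mono) auto
      finally show ?thesis using G(4) by auto
    qed
    define \<mu> where "\<mu> = density lborel (indicator E :: 'a \<Rightarrow> ennreal)"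
    have \<mu>: "emeasure \<mu> A = emeasure lborel (E \<inter> A)" if "A \<in> sets borel" for A
      using that E by (simp add: \<mu>_def emeasure_restricted)
    obtain C where C: "countable C" "disjoint_family_on (\<lambda>(c,r). cball c r) C"
      "\<And>c r. (c, r) \<in> C \<Longrightarrow> 0 < r \<and> cball c r \<subseteq> G \<and>
          emeasure lborel (cball c r) \<le> of_nat n * emeasure lborel (E \<inter> cball c r)"
      "negligible (S n \<inter> ball 0 (real R) - (\<Union>(c,r)\<in>C. cball c r))"
      by (rule Vitali_fine_cover[of G "S n \<inter> ball 0 (real R)"
            "\<lambda>c r. emeasure lborel (cball c r) \<le> of_nat n * emeasure lborel (E \<inter> cball c r)"])
         (use G in \<open>auto simp: S_def\<close>)
    let ?U = "\<Union>(c,r)\<in>C. cball c r"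
    have U: "?U \<in> sets borel" by (rule cballs_borel[OF C(1)])
    have "emeasure lborel ?U \<le> of_nat n * emeasure \<mu> ?U"
      using C by (intro emeasure_disjoint_UN_le) (auto simp: \<mu>, auto simp: \<mu>_def)
    also have "emeasure \<mu> ?U \<le> emeasure lborel (E \<inter> G)"
      using U E G(1) C(3) by (subst \<mu>) (auto intro!: emeasure_mono)
    also note GE
    also have "of_nat n * ennreal (e / (real n + 1)) \<le> ennreal e"
      using e by (auto simp: ennreal_of_nat_eq_real_of_nat ennreal_mult[symmetric] field_simps intro!: ennreal_leI)
    finally show "\<exists>U\<in>sets borel. negligible (S n \<inter> ball 0 (real R) - U) \<and> emeasure lborel U \<le> ennreal e"
      using U C(4) by (auto simp: mult_left_mono)
  qed
  then have "negligible (\<Union>n. S n)" by (intro negligible_countable_Union) auto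
  then show ?thesis
  proof (rule AE_lebesgue_not_negligible, intro impI allI)
    fix x and \<epsilon> :: real assume x: "x \<notin> (\<Union>n. S n)" "x \<notin> E" and \<epsilon>: "\<epsilon> > 0"
    obtain n :: nat where n: "1 / \<epsilon> < real n" using reals_Archimedean2 by auto
    from x have "x \<notin> S n" by auto
    with x(2) obtain d where d: "d > 0" "\<And>c r. 0 < r \<and> r < d \<and> x \<in> cball c r \<Longrightarrow>
      \<not> emeasure lborel (cball c r) \<le> of_nat n * emeasure lborel (E \<inter> cball c r)"
      unfolding S_def by blast
    show "\<exists>d>0. \<forall>c r. 0 < r \<and> r < d \<and> x \<in> cball c r \<longrightarrow>
     emeasure lborel (E \<inter> cball c r) \<le> ennreal \<epsilon> * emeasure lborel (cball c r)"
    proof (intro exI[of _ d] conjI d(1) allI impI)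
      fix c r assume "0 < r \<and> r < d \<and> x \<in> cball c r"
      from d(2)[OF this] have 1: "of_nat n * emeasure lborel (E \<inter> cball c r) \<le> emeasure lborel (cball c r)"
        by auto
      have "emeasure lborel (E \<inter> cball c r) \<le> ennreal \<epsilon> * (of_nat n * emeasure lborel (E \<inter> cball c r))"
      proof -
        have "ennreal 1 \<le> ennreal \<epsilon> * ennreal (real n)"
          using n \<epsilon> by (auto simp: ennreal_mult[symmetric] field_simps simp del: ennreal_1 intro!: ennreal_leI)
        then have "1 * emeasure lborel (E \<inter> cball c r) \<le> (ennreal \<epsilon> * ennreal (real n)) * emeasure lborel (E \<inter> cball c r)"
          by (intro mult_right_mono) auto
        then show ?thesis by (simp add: ennreal_of_nat_eq_real_of_nat mult.assoc)
      qed
      also have "\<dots> \<le> ennreal \<epsilon> * emeasure lborel (cball c r)" by (intro mult_left_mono 1) auto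
      finally show "emeasure lborel (E \<inter> cball c r) \<le> ennreal \<epsilon> * emeasure lborel (cball c r)" .
    qed
  qed
qed

lemma emeasure_cball_pos_finite:
  fixes c :: "'a::euclidean_space" assumes "0 < r"
  shows "0 < measure lborel (cball c r)" "emeasure lborel (cball c r) = ennreal (measure lborel (cball c r))"
proof -
  show "emeasure lborel (cball c r) = ennreal (measure lborel (cball c r))"
    by (intro emeasure_eq_ennreal_measure) (use emeasure_lborel_cball_finite[of c r] in auto)
  show "0 < measure lborel (cball c r)"
    using assms content_cball_pos[of r c] by simp
qed

section \<open>Derivatives of finite measures\<close>

theorem AE_differentiable_measure:
  fixes \<mu> :: "'a::euclidean_space measure"
  assumes sets: "sets \<mu> = sets borel" and fin: "emeasure \<mu> UNIV < \<infinity>"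
  shows "AE x in lebesgue. \<exists>a. \<forall>\<epsilon>>0. \<exists>d>0. \<forall>c r. 0 < r \<and> r < d \<and> x \<in> cball c r \<longrightarrow>
     \<bar>measure \<mu> (cball c r) - a * measure lborel (cball c r)\<bar> \<le> \<epsilon> * measure lborel (cball c r)"
proof -
  interpret finite_measure \<mu>
    using sets fin sets_eq_imp_space_eq[OF sets] by (intro finite_measureI) auto
  have \<mu>em: "emeasure \<mu> A = ennreal (measure \<mu> A)" for A by (rule emeasure_eq_measure)
  define V where "V = (\<lambda>(c::'a) r. measure lborel (cball c r))"
  have Vpos: "V c r > 0" if "r > 0" for c r using emeasure_cball_pos_finite(1)[OF that] by (simp add: V_def)
  have Vem: "emeasure lborel (cball c r) = ennreal (V c r)" if "r > 0" for c r
    using emeasure_cball_pos_finite(2)[OF that] by (simp add: V_def)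
  define lo where "lo = (\<lambda>(p::real) x. \<forall>d>0. \<exists>c r. 0 < r \<and> r < d \<and> x \<in> cball c r \<and> measure \<mu> (cball c r) \<le> p * V c r)"
  define up where "up = (\<lambda>(q::real) x. \<forall>d>0. \<exists>c r. 0 < r \<and> r < d \<and> x \<in> cball c r \<and> q * V c r \<le> measure \<mu> (cball c r))"
  have upE: thesis if "up q x" "d > 0"
    "\<And>c r. 0 < r \<Longrightarrow> r < d \<Longrightarrow> x \<in> cball c r \<Longrightarrow> q * V c r \<le> measure \<mu> (cball c r) \<Longrightarrow> thesis" for q x d thesis
    using that unfolding up_def by meson
  have loE: thesis if "lo p x" "d > 0"
    "\<And>c r. 0 < r \<Longrightarrow> r < d \<Longrightarrow> x \<in> cball c r \<Longrightarrow> measure \<mu> (cball c r) \<le> p * V c r \<Longrightarrow> thesis" for p x d thesis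
    using that unfolding lo_def by meson
  have null: "negligible {x. lo p x \<and> up q x}" if pq: "0 < p" "p < q" for p q :: real
  proof (rule negligible_of_bounded_parts)
    fix R :: nat
    let ?E = "{x. lo p x \<and> up q x} \<inter> ball 0 (real R)"
    \<comment> \<open>Measurability of the exceptional set has not been shown, so a measurable hull
      of equal outer measure carries the computation.\<close>
    obtain H where H: "H \<in> sets lebesgue" "?E \<subseteq> H" "outer_measure_of lebesgue ?E = emeasure lebesgue H"
      using outer_measure_of_attain[of ?E lebesgue] by auto
    define s where "s = measure lebesgue H"
    have s: "emeasure lebesgue H = ennreal s"
    proof -
      have "emeasure lebesgue H \<le> outer_measure_of lebesgue (ball 0 (real R) :: 'a set)"
        unfolding H(3)[symmetric] by (intro outer_measure_of_mono) auto
      also have "\<dots> < \<infinity>" using emeasure_lborel_ball_finite[of 0 "real R"] by simp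
      finally show ?thesis unfolding s_def by (intro emeasure_eq_ennreal_measure) auto
    qed
    have key: "q * s \<le> p * (s + e)" if e: "e > 0" for e
    proof -
      obtain G where G: "open G" "H \<subseteq> G" "G - H \<in> lmeasurable" "emeasure lebesgue (G - H) < ennreal e"
        using sets_lebesgue_outer_open[OF H(1) e] by metis
      have Gs: "emeasure lborel G \<le> ennreal (s + e)"
      proof -
        have "emeasure lborel G = emeasure lebesgue (H \<union> (G - H))" using G(1,2) by (simp add: Un_absorb1)
        also have "\<dots> \<le> emeasure lebesgue H + emeasure lebesgue (G - H)"
          using H(1) G by (intro emeasure_subadditive) auto
        also have "\<dots> \<le> ennreal s + ennreal e" using s G(4) by (intro add_mono) auto
        finally show ?thesis using e by (simp add: s_def)
      qed
      obtain C where C: "countable C" "disjoint_family_on (\<lambda>(c,r). cball c r) C"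
        "\<And>c r. (c, r) \<in> C \<Longrightarrow> 0 < r \<and> cball c r \<subseteq> G \<and> measure \<mu> (cball c r) \<le> p * V c r"
        "negligible (?E - (\<Union>(c,r)\<in>C. cball c r))"
        by (rule Vitali_fine_cover[of G ?E "\<lambda>c r. measure \<mu> (cball c r) \<le> p * V c r"])
           (use G H(2) in \<open>auto simp: lo_def\<close>)
      let ?U = "\<Union>(c,r)\<in>C. cball c r"
      have U: "?U \<in> sets borel" by (rule cballs_borel[OF C(1)])
      have "emeasure \<mu> ?U \<le> ennreal p * emeasure lborel ?U"
        using C pq by (intro emeasure_disjoint_UN_le) (auto simp: sets \<mu>em Vem ennreal_mult[symmetric] V_def intro!: ennreal_leI)
      also have "emeasure lborel ?U \<le> emeasure lborel G"
        using G(1) U C(3) by (intro emeasure_mono) auto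
      also note Gs
      finally have 1: "emeasure \<mu> ?U \<le> ennreal p * ennreal (s + e)" by (simp add: mult_left_mono)
      \<comment> \<open>The second covering must lie inside the first and needs an open container;
        passing to open balls loses only countably many spheres, which are null.\<close>
      define O' where "O' = (\<Union>(c,r)\<in>C. ball c r)"
      have opO: "open O'" by (auto simp: O'_def)
      have neg1: "negligible (?E - O')"
      proof -
        have "?E - O' \<subseteq> (?E - ?U) \<union> (\<Union>(c,r)\<in>C. sphere c r)"
        proof
          fix x assume x: "x \<in> ?E - O'"
          show "x \<in> (?E - ?U) \<union> (\<Union>(c,r)\<in>C. sphere c r)"
          proof (cases "x \<in> ?U")
            case True
            then obtain c r where cr: "(c, r) \<in> C" "x \<in> cball c r" by auto
            have "x \<notin> ball c r" using x cr(1) by (auto simp: O'_def)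
            then have "x \<in> sphere c r" using cr(2) by simp
            then show ?thesis using cr(1) by blast
          qed (use x in blast)
        qed
        moreover have "negligible (\<Union>(c,r)\<in>C. sphere c r)"
          using C(1) by (intro negligible_countable_Union) (auto simp: negligible_sphere)
        ultimately show ?thesis using negligible_subset[OF negligible_Un[OF C(4)]] by metis
      qed
      obtain C2 where C2: "countable C2" "disjoint_family_on (\<lambda>(c,r). cball c r) C2"
        "\<And>c r. (c, r) \<in> C2 \<Longrightarrow> 0 < r \<and> cball c r \<subseteq> O' \<and> q * V c r \<le> measure \<mu> (cball c r)"
        "negligible (?E \<inter> O' - (\<Union>(c,r)\<in>C2. cball c r))"
        by (rule Vitali_fine_cover[of O' "?E \<inter> O'" "\<lambda>c r. q * V c r \<le> measure \<mu> (cball c r)"])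
           (use opO in \<open>auto simp: up_def\<close>)
      let ?U2 = "\<Union>(c,r)\<in>C2. cball c r"
      have U2: "?U2 \<in> sets borel" by (rule cballs_borel[OF C2(1)])
      have "emeasure lborel ?U2 \<le> ennreal (1/q) * emeasure \<mu> ?U2"
        using C2 pq by (intro emeasure_disjoint_UN_le)
          (auto simp: sets \<mu>em Vem ennreal_mult[symmetric] V_def field_simps intro!: ennreal_leI)
      also have "emeasure \<mu> ?U2 \<le> emeasure \<mu> ?U"
      proof (rule emeasure_mono)
        have "?U2 \<subseteq> O'" using C2(3) by blast
        also have "O' \<subseteq> ?U" unfolding O'_def using ball_subset_cball by blast
        finally show "?U2 \<subseteq> ?U" .
      qed (use U sets in simp)
      also note 1
      finally have 2: "emeasure lborel ?U2 \<le> ennreal (1/q) * (ennreal p * ennreal (s + e))" by (simp add: mult_left_mono)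
      obtain Z where Z: "Z \<in> null_sets lebesgue" "?E \<subseteq> ?U2 \<union> Z"
      proof
        show "(?E - O') \<union> (?E \<inter> O' - ?U2) \<in> null_sets lebesgue"
          using negligible_Un[OF neg1 C2(4)] by (simp add: negligible_iff_null_sets)
      qed auto
      have "ennreal s \<le> outer_measure_of lebesgue (?U2 \<union> Z)"
        unfolding s[symmetric] H(3)[symmetric] by (intro outer_measure_of_mono) (use Z in auto)
      also have "\<dots> = emeasure lebesgue (?U2 \<union> Z)"
        using U2 Z by (intro outer_measure_of_eq sets.Un) auto
      also have "\<dots> = emeasure lborel ?U2"
        using U2 Z by (subst emeasure_Un_null_set) auto
      also note 2
      also have "ennreal (1/q) * (ennreal p * ennreal (s + e)) = ennreal (1/q * (p * (s + e)))"
        using pq e measure_nonneg[of lebesgue H] unfolding s_def[symmetric] by (simp add: ennreal_mult[symmetric] del: ennreal_plus)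
      finally have "ennreal s \<le> ennreal (1/q * (p * (s + e)))" .
      then have "s \<le> 1/q * (p * (s + e))"
        using pq e by (subst (asm) ennreal_le_iff) (auto simp: s_def)
      then show ?thesis using pq by (simp add: field_simps)
    qed
    have "q * s \<le> p * s"
    proof (rule field_le_epsilon)
      fix e :: real assume "e > 0"
      then show "q * s \<le> p * s + e" using key[of "e/p"] pq by (simp add: distrib_left)
    qed
    moreover have "s \<ge> 0" by (simp add: s_def)
    ultimately have "s = 0" using pq by (auto simp: mult_le_cancel_right)
    then have "H \<in> null_sets lebesgue" using H(1) s by auto
    then have "negligible H" by (simp add: negligible_iff_null_sets)
    then show "negligible ?E" using H(2) by (rule negligible_subset)
  qed
  \<comment> \<open>The growth lemma for a constant sequence: the upper derivative is finite almost
    everywhere.\<close>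
  have gr: "AE x in lebesgue. \<exists>N::nat. \<exists>d>0. \<forall>c r. 0 < r \<and> r < d \<and> x \<in> cball c r \<longrightarrow>
     liminf (\<lambda>k. emeasure \<mu> (cball c r)) \<le> of_nat N * emeasure lborel (cball c r)"
    by (rule AE_liminf_measure_growth[of "\<lambda>_. \<mu>" "measure \<mu> UNIV"]) (auto simp: sets \<mu>em)
  have "negligible (\<Union>(p,q)\<in>{(p,q). p \<in> \<rat> \<and> q \<in> \<rat> \<and> 0 < p \<and> p < q}. {x. lo p x \<and> up q x})"
  proof (rule negligible_countable_Union)
    have "countable (\<rat> \<times> \<rat> :: (real \<times> real) set)" by (intro countable_SIGMA countable_rat)
    then show "countable ((\<lambda>(p,q). {x. lo p x \<and> up q x}) ` {(p,q). p \<in> \<rat> \<and> q \<in> \<rat> \<and> 0 < p \<and> p < q})"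
      by (intro countable_image) (erule countable_subset[rotated], auto)
  qed (auto intro: null)
  then have "AE x in lebesgue. \<forall>p\<in>\<rat>. \<forall>q\<in>\<rat>. 0 < p \<longrightarrow> p < q \<longrightarrow> \<not> (lo p x \<and> up q x)"
    by (rule AE_lebesgue_not_negligible) auto
  with gr show ?thesis
  proof eventually_elim
    case (elim x)
    obtain N :: nat and d0 where N: "d0 > 0" "\<And>c r. 0 < r \<Longrightarrow> r < d0 \<Longrightarrow> x \<in> cball c r \<Longrightarrow>
       measure \<mu> (cball c r) \<le> real N * V c r"
    proof -
      obtain N :: nat and d where d: "d > 0" and N: "\<And>c r. 0 < r \<and> r < d \<and> x \<in> cball c r \<Longrightarrow>
        emeasure \<mu> (cball c r) \<le> of_nat N * emeasure lborel (cball c r)"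
        using elim(1) by (auto simp: Liminf_const)
      have "measure \<mu> (cball c r) \<le> real N * V c r" if "0 < r" "r < d" "x \<in> cball c r" for c r
      proof -
        have "ennreal (measure \<mu> (cball c r)) \<le> ennreal (real N * V c r)"
          using N[of r c] that Vpos[of r c] by (simp add: \<mu>em Vem ennreal_mult ennreal_of_nat_eq_real_of_nat)
        then show ?thesis using Vpos[OF that(1), of c] by (subst (asm) ennreal_le_iff) auto
      qed
      with d that show ?thesis by blast
    qed
    let ?Q = "{q. up q x}"
    have Q0: "0 \<in> ?Q"
    proof -
      have "\<exists>c r. 0 < r \<and> r < d \<and> x \<in> cball c r \<and> 0 * V c r \<le> measure \<mu> (cball c r)" if "d > 0" for d
        using that by (intro exI[of _ x] exI[of _ "d/2"]) auto
      then show ?thesis by (auto simp: up_def)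
    qed
    have Qb: "q \<le> N + 1" if Q: "q \<in> ?Q" for q
    proof (rule ccontr)
      assume "\<not> q \<le> N + 1"
      have "up q x" using Q by simp
      then show False
      proof (rule upE[OF _ N(1)])
        fix c r assume cr: "0 < r" "r < d0" "x \<in> cball c r" "q * V c r \<le> measure \<mu> (cball c r)"
        then have "q * V c r \<le> real N * V c r" using N(2)[of r c] by auto
        with Vpos[OF cr(1), of c] \<open>\<not> q \<le> N + 1\<close> show False by auto
      qed
    qed
    have bdd: "bdd_above ?Q" using Qb by (auto simp: bdd_above_def)
    define a where "a = Sup ?Q"
    have a0: "a \<ge> 0" unfolding a_def using Q0 bdd by (rule cSup_upper)
    have upmono: "up q' x" if "up q x" "q' \<le> q" for q q'
      unfolding up_def
    proof (intro allI impI)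
      fix d :: real assume "d > 0"
      then obtain c r where cr: "0 < r" "r < d" "x \<in> cball c r" "q * V c r \<le> measure \<mu> (cball c r)"
        using upE[OF \<open>up q x\<close>] by metis
      then have "q' * V c r \<le> measure \<mu> (cball c r)"
        using \<open>q' \<le> q\<close> Vpos[of r c] by (meson mult_right_mono less_imp_le order_trans)
      with cr show "\<exists>c r. 0 < r \<and> r < d \<and> x \<in> cball c r \<and> q' * V c r \<le> measure \<mu> (cball c r)" by blast
    qed
    show ?case
    proof (rule exI[of _ a], intro allI impI)
      fix \<epsilon> :: real assume \<epsilon>: "\<epsilon> > 0"
      have "\<not> up (a + \<epsilon>) x"
        using cSup_upper[OF _ bdd, of "a + \<epsilon>"] \<epsilon> by (auto simp: a_def)
      then obtain d1 where d1: "d1 > 0" "\<And>c r. 0 < r \<Longrightarrow> r < d1 \<Longrightarrow> x \<in> cball c r \<Longrightarrow> measure \<mu> (cball c r) < (a + \<epsilon>) * V c r"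
        unfolding up_def by (meson not_le)
      have "\<not> lo (a - \<epsilon>) x"
      proof
        assume lo: "lo (a - \<epsilon>) x"
        \<comment> \<open>Density at most \<open>a - \<epsilon>\<close> of a nonnegative measure
          forces this sign. Hence the rational \<open>p\<close> below is positive, as required to
          exclude \<open>lo p x\<close> together with \<open>up q x\<close>.\<close>
        have "0 \<le> a - \<epsilon>"
        proof -
          obtain c r where cr: "0 < r" "measure \<mu> (cball c r) \<le> (a - \<epsilon>) * V c r"
            using loE[OF lo zero_less_one_class.zero_less_one] by metis
          then have "0 \<le> (a - \<epsilon>) * V c r" by (meson measure_nonneg order_trans)
          then show ?thesis using Vpos[OF cr(1), of c] by (simp add: zero_le_mult_iff)
        qed
        obtain p where p: "p \<in> \<rat>" "a - \<epsilon> < p" "p < a" using Rats_dense_in_real[of "a - \<epsilon>" a] \<epsilon> by auto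
        obtain q where q: "q \<in> \<rat>" "p < q" "q < a" using Rats_dense_in_real[of p a] p by auto
        obtain q' where "q' \<in> ?Q" "q < q'" using q(3) less_cSup_iff[OF _ bdd, of q] Q0 unfolding a_def by blast
        then have "up q x" using upmono by auto
        moreover have "lo p x" unfolding lo_def
        proof (intro allI impI)
          fix d :: real assume "d > 0"
          then obtain c r where cr: "0 < r" "r < d" "x \<in> cball c r" "measure \<mu> (cball c r) \<le> (a - \<epsilon>) * V c r"
            using loE[OF lo] by metis
          moreover have "(a - \<epsilon>) * V c r \<le> p * V c r" using p Vpos[OF cr(1), of c] by (intro mult_right_mono) auto
          ultimately show "\<exists>c r. 0 < r \<and> r < d \<and> x \<in> cball c r \<and> measure \<mu> (cball c r) \<le> p * V c r"
            by (intro exI[of _ c] exI[of _ r]) auto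
        qed
        ultimately show False using elim(2) p q \<open>0 \<le> a - \<epsilon>\<close> by auto
      qed
      then obtain d2 where d2: "d2 > 0" "\<And>c r. 0 < r \<Longrightarrow> r < d2 \<Longrightarrow> x \<in> cball c r \<Longrightarrow> (a - \<epsilon>) * V c r < measure \<mu> (cball c r)"
        unfolding lo_def by (meson not_le)
      show "\<exists>d>0. \<forall>c r. 0 < r \<and> r < d \<and> x \<in> cball c r \<longrightarrow>
          \<bar>measure \<mu> (cball c r) - a * measure lborel (cball c r)\<bar> \<le> \<epsilon> * measure lborel (cball c r)"
      proof (intro exI[of _ "min d1 d2"] conjI allI impI)
        show "0 < min d1 d2" using d1(1) d2(1) by simp
        fix c r assume "0 < r \<and> r < min d1 d2 \<and> x \<in> cball c r"
        then show "\<bar>measure \<mu> (cball c r) - a * measure lborel (cball c r)\<bar> \<le> \<epsilon> * measure lborel (cball c r)"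
          using d1(2)[of r c] d2(2)[of r c] by (auto simp: V_def abs_le_iff algebra_simps)
      qed
    qed
  qed
qed

subsection \<open>Second-order expansions along lines\<close>

text \<open>The derivative of \<open>F\<close> is the density of its Stieltjes measure, computed on
  intervals with endpoint \<open>x\<close>, which are balls through \<open>x\<close>.\<close>

lemma AE_monotone_right_continuous_has_derivative:
  fixes F :: "real \<Rightarrow> real"
  assumes mono: "mono F" and rc: "\<And>a. continuous (at_right a) F" and bdd: "\<And>x. \<bar>F x\<bar> \<le> B"
  shows "AE x in lebesgue. \<exists>a. (F has_real_derivative a) (at x)"
proof -
  define \<mu> where "\<mu> = interval_measure F"
  have Fle: "x \<le> y \<Longrightarrow> F x \<le> F y" for x y using mono by (rule monoD)
  have Ioc: "emeasure \<mu> {a<..b} = ennreal (F b - F a)" if "a \<le> b" for a b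
    unfolding \<mu>_def by (rule emeasure_interval_measure_Ioc[OF that Fle rc]) auto
  have sets[simp]: "sets \<mu> = sets borel" by (simp add: \<mu>_def)
  have "emeasure \<mu> UNIV \<le> ennreal (2 * B)"
  proof -
    have inc: "incseq (\<lambda>n::nat. {- real n<..real n})" by (auto simp: incseq_def)
    have "(\<Union>n::nat. {- real n<..real n}) = UNIV"
    proof (rule equalityI[OF subset_UNIV subsetI])
      fix x :: real
      obtain n :: nat where "\<bar>x\<bar> < n" using reals_Archimedean2 by blast
      then show "x \<in> (\<Union>n::nat. {- real n<..real n})" by (auto intro!: exI[of _ n])
    qed
    then have "emeasure \<mu> UNIV = (SUP n::nat. emeasure \<mu> {- real n<..real n})"
      using SUP_emeasure_incseq[OF _ inc, of \<mu>] by fastforce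
    also have "\<dots> \<le> ennreal (2 * B)"
    proof (intro SUP_least)
      fix n :: nat
      show "emeasure \<mu> {- real n<..real n} \<le> ennreal (2 * B)"
        using bdd[of n] bdd[of "- real n"] by (simp add: Ioc abs_le_iff ennreal_leI)
    qed
    finally show ?thesis .
  qed
  then have fin: "emeasure \<mu> UNIV < \<infinity>" by (simp add: le_less_trans)
  interpret finite_measure \<mu> using fin by (intro finite_measureI) (auto simp: \<mu>_def)
  have mIoc: "measure \<mu> {a<..b} = F b - F a" if "a \<le> b" for a b
    using Ioc[OF that] Fle[OF that] by (simp add: measure_def)
  show ?thesis
    using AE_differentiable_measure[OF sets fin]
  proof eventually_elim
    case (elim x)
    then obtain a where a: "\<And>\<epsilon>. \<epsilon> > 0 \<Longrightarrow> \<exists>d>0. \<forall>c r. 0 < r \<and> r < d \<and> x \<in> cball c r \<longrightarrow>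
       \<bar>measure \<mu> (cball c r) - a * measure lborel (cball c r)\<bar> \<le> \<epsilon> * measure lborel (cball c r)" by blast
    have a': "\<exists>d>0. \<forall>p q. p \<le> x \<and> x \<le> q \<and> p < q \<and> q - p < d \<longrightarrow>
        \<bar>measure \<mu> {p..q} - a * (q - p)\<bar> \<le> \<epsilon> * (q - p)" if \<epsilon>: "\<epsilon> > 0" for \<epsilon>
    proof -
      obtain d where d: "d > 0" "\<And>c r. 0 < r \<and> r < d \<and> x \<in> cball c r \<Longrightarrow>
       \<bar>measure \<mu> (cball c r) - a * measure lborel (cball c r)\<bar> \<le> \<epsilon> * measure lborel (cball c r)"
        using a[OF \<epsilon>] by blast
      show ?thesis
      proof (intro exI[of _ d] conjI d(1) allI impI)
        fix p q assume pq: "p \<le> x \<and> x \<le> q \<and> p < q \<and> q - p < d"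
        have eq: "cball ((p + q)/2) ((q - p)/2) = {p..q}"
          by (simp add: cball_eq_atLeastAtMost field_simps)
        have "x \<in> cball ((p + q)/2) ((q - p)/2)" unfolding eq using pq by auto
        with d(2)[of "(q - p)/2" "(p + q)/2"] pq
        show "\<bar>measure \<mu> {p..q} - a * (q - p)\<bar> \<le> \<epsilon> * (q - p)" by (simp add: eq)
      qed
    qed
    \<comment> \<open>A finite density excludes an atom at \<open>x\<close>, so closed intervals to
      the right of \<open>x\<close> measure increments of \<open>F\<close> exactly.\<close>
    have x0: "measure \<mu> {x} = 0"
    proof -
      obtain d where d: "d > 0" "\<And>p q. p \<le> x \<and> x \<le> q \<and> p < q \<and> q - p < d \<Longrightarrow>
        \<bar>measure \<mu> {p..q} - a * (q - p)\<bar> \<le> 1 * (q - p)" using a'[of 1] by auto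
      have "measure \<mu> {x} \<le> e" if e: "e > 0" for e
      proof -
        define h where "h = min (d/2) (e / (\<bar>a\<bar> + 1))"
        have "h \<le> e / (\<bar>a\<bar> + 1)" by (simp add: h_def)
        then have "h * (\<bar>a\<bar> + 1) \<le> e" by (subst (asm) pos_le_divide_eq) auto
        then have h: "h > 0" "h < d" "h * (\<bar>a\<bar> + 1) \<le> e" using d(1) e by (auto simp: h_def)
        have "measure \<mu> {x} \<le> measure \<mu> {x..x+h}" using h by (intro finite_measure_mono) auto
        also have "\<dots> \<le> a * h + h" using d(2)[of x "x+h"] h by (auto simp: abs_le_iff)
        also have "\<dots> \<le> (\<bar>a\<bar> + 1) * h" using h by (auto simp: algebra_simps abs_if mult_le_0_iff)
        finally show ?thesis using h by (simp add: mult.commute)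
      qed
      then have "measure \<mu> {x} \<le> 0" using field_le_epsilon by (metis add_0)
      then show ?thesis by (simp add: measure_le_0_iff)
    qed
    have main: "\<exists>d>0. \<forall>y. y \<noteq> x \<and> \<bar>y - x\<bar> < d \<longrightarrow> \<bar>F y - F x - a * (y - x)\<bar> \<le> \<epsilon> * \<bar>y - x\<bar>" if \<epsilon>: "\<epsilon> > 0" for \<epsilon>
    proof -
      obtain d where d: "d > 0" "\<And>p q. p \<le> x \<Longrightarrow> x \<le> q \<Longrightarrow> p < q \<Longrightarrow> q - p < d \<Longrightarrow>
        \<bar>measure \<mu> {p..q} - a * (q - p)\<bar> \<le> \<epsilon> * (q - p)" using a'[OF \<epsilon>] by auto
      show ?thesis
      proof (intro exI[of _ d] conjI d(1) allI impI)
        fix y assume y: "y \<noteq> x \<and> \<bar>y - x\<bar> < d"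
        show "\<bar>F y - F x - a * (y - x)\<bar> \<le> \<epsilon> * \<bar>y - x\<bar>"
        proof (cases "x < y")
          case True
          have eq: "{x..y} = {x} \<union> {x<..y}" using True by auto
          have "measure \<mu> {x..y} = measure \<mu> {x} + measure \<mu> {x<..y}"
            unfolding eq by (rule finite_measure_Union) auto
          then have "measure \<mu> {x..y} = F y - F x" using True x0 by (simp add: mIoc)
          with d(2)[of x y] True y show ?thesis by simp
        next
          case False
          then have yx: "y < x" using y by auto
          have up: "F x - F y \<le> (a + \<epsilon>) * (x - y)"
          proof -
            have "F x - F y \<le> measure \<mu> {y..x}"
              unfolding mIoc[OF less_imp_le[OF yx], symmetric] by (intro finite_measure_mono) auto
            with d(2)[of y x] yx y show ?thesis by (auto simp: abs_le_iff algebra_simps)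
          qed
          \<comment> \<open>On the left an atom at \<open>y\<close> may make \<open>{y..x}\<close>
            too heavy, so the lower bound comes from the shorter intervals \<open>{x - w..x}\<close>
            with \<open>w\<close> approaching \<open>x - y\<close>. A nonpositive factor
            \<open>a - \<epsilon>\<close> is covered by monotonicity.\<close>
          have lo: "(a - \<epsilon>) * (x - y) \<le> F x - F y"
          proof (cases "a - \<epsilon> \<le> 0")
            case True
            then have "(a - \<epsilon>) * (x - y) \<le> 0" using yx by (intro mult_nonpos_nonneg) auto
            also have "0 \<le> F x - F y" using Fle yx by simp
            finally show ?thesis .
          next
            case False
            have "x - y \<le> (F x - F y) / (a - \<epsilon>)"
            proof (rule dense_le_bounded[of 0])
              fix w assume w: "0 < w" "w < x - y"
              have "measure \<mu> {x - w..x} \<le> measure \<mu> {y<..x}"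
                using w by (intro finite_measure_mono) auto
              also have "\<dots> = F x - F y" using yx by (simp add: mIoc)
              finally have "a * w - \<epsilon> * w \<le> F x - F y"
                using d(2)[of "x - w" x] w y yx by (auto simp: abs_le_iff)
              then show "w \<le> (F x - F y) / (a - \<epsilon>)" using False by (simp add: field_simps)
            qed (use yx in auto)
            then show ?thesis using False by (simp add: field_simps)
          qed
          from up lo yx show ?thesis by (auto simp: abs_le_iff algebra_simps)
        qed
      qed
    qed
    have "((\<lambda>y. (F y - F x) / (y - x)) \<longlongrightarrow> a) (at x)"
    proof (rule tendstoI)
      fix e :: real assume e: "e > 0"
      obtain d where d: "d > 0" "\<And>y. y \<noteq> x \<and> \<bar>y - x\<bar> < d \<Longrightarrow> \<bar>F y - F x - a * (y - x)\<bar> \<le> e/2 * \<bar>y - x\<bar>"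
        using main[of "e/2"] e by auto
      show "\<forall>\<^sub>F y in at x. dist ((F y - F x) / (y - x)) a < e"
        unfolding eventually_at
      proof (intro exI[of _ d] conjI d(1) ballI impI)
        fix y assume "y \<noteq> x \<and> dist y x < d"
        then have y: "y \<noteq> x" "\<bar>y - x\<bar> < d" by (auto simp: dist_real_def)
        have "dist ((F y - F x) / (y - x)) a = \<bar>F y - F x - a * (y - x)\<bar> / \<bar>y - x\<bar>"
          using y by (simp add: dist_real_def field_simps flip: abs_divide)
        also have "\<dots> \<le> e/2" using d(2)[of y] y by (simp add: field_simps)
        finally show "dist ((F y - F x) / (y - x)) a < e" using e by simp
      qed
    qed
    then show ?case by (auto simp: has_field_derivative_iff)
  qed
qed

lemma AE_meets_interval:
  fixes \<alpha> \<beta> :: real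
  assumes "AE t in lebesgue. t \<in> {\<alpha><..<\<beta>} \<longrightarrow> t \<in> G" "\<alpha> < \<beta>"
  obtains t where "t \<in> G" "\<alpha> < t" "t < \<beta>"
proof -
  have "\<exists>t. t \<in> G \<and> \<alpha> < t \<and> t < \<beta>"
  proof (rule ccontr)
    assume "\<not> ?thesis"
    then have "AE t in lebesgue. t \<notin> {\<alpha><..<\<beta>}"
      using assms(1) by (auto elim!: eventually_mono)
    then have "emeasure lebesgue {\<alpha><..<\<beta>} = 0"
      by (subst (asm) AE_iff_measurable[of "{\<alpha><..<\<beta>}"]) auto
    then show False using assms(2) by simp
  qed
  then show ?thesis using that by blast
qed

text \<open>\<open>F\<close> is monotone only on a set \<open>G\<close> of full measure. Its
  right-continuous extension \<open>Fp\<close>, the infimum of the values further right, is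
  differentiable almost everywhere. At such a point of \<open>G\<close>, \<open>Fp\<close> agrees
  with \<open>F\<close>, and nearby \<open>F\<close> is squeezed between two values of
  \<open>Fp\<close>.\<close>

lemma AE_mono_on_has_derivative_within:
  fixes F :: "real \<Rightarrow> real"
  assumes G: "AE t in lebesgue. t \<in> {\<alpha><..<\<beta>} \<longrightarrow> t \<in> G" and sub: "G \<subseteq> {\<alpha><..<\<beta>}"
    and mono: "mono_on G F"
  shows "AE t in lebesgue. t \<in> {\<alpha><..<\<beta>} \<longrightarrow> (\<exists>a. ((\<lambda>s. (F s - F t) / (s - t)) \<longlongrightarrow> a) (at t within G))"
proof -
  have Fle: "s \<in> G \<Longrightarrow> t \<in> G \<Longrightarrow> s \<le> t \<Longrightarrow> F s \<le> F t" for s t using mono by (rule mono_onD)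
  have 1: "AE t in lebesgue. t \<in> {p<..<q} \<longrightarrow> (\<exists>a. ((\<lambda>s. (F s - F t) / (s - t)) \<longlongrightarrow> a) (at t within G))"
    if pq: "p \<in> G" "q \<in> G" "p < q" for p q
  proof -
    \<comment> \<open>Inserting \<open>F q\<close> keeps the set nonempty and \<open>Fp\<close>
      bounded also for \<open>t\<close> beyond \<open>q\<close>.\<close>
    define A where "A t = insert (F q) (F ` {s\<in>G. p \<le> s \<and> s \<le> q \<and> t < s})" for t
    define Fp where "Fp t = Inf (A t)" for t
    have ne: "A t \<noteq> {}" for t by (auto simp: A_def)
    have bnd: "F p \<le> v \<and> v \<le> F q" if "v \<in> A t" for v t
      using that pq Fle by (auto simp: A_def)
    have bdd: "bdd_below (A t)" for t using bnd by (auto simp: bdd_below_def)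
    have mn: "mono Fp"
    proof (rule monoI)
      fix s t :: real assume "s \<le> t"
      then have "A t \<subseteq> A s" by (auto simp: A_def)
      then show "Fp s \<le> Fp t" unfolding Fp_def by (intro cInf_superset_mono ne bdd)
    qed
    have FpB: "F p \<le> Fp t" "Fp t \<le> F q" for t
      unfolding Fp_def by (rule cInf_greatest[OF ne], use bnd in blast)
        (rule cInf_lower[OF _ bdd], simp add: A_def)
    have rc: "continuous (at_right t) Fp" for t
      unfolding continuous_within
    proof (rule tendstoI)
      fix e :: real assume e: "e > 0"
      have "Inf (A t) < Fp t + e" using e by (simp add: Fp_def)
      then obtain v where v: "v \<in> A t" "v < Fp t + e" using cInf_lessD[OF ne] by blast
      have "\<forall>\<^sub>F t' in at_right t. v \<in> A t'"
      proof (cases "v = F q")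
        case True then show ?thesis by (simp add: A_def)
      next
        case False
        then obtain s where s: "s \<in> G" "p \<le> s" "s \<le> q" "t < s" "v = F s" using v by (auto simp: A_def)
        have "\<forall>\<^sub>F t' in at_right t. t' < s" using s(4) by (auto simp: eventually_at_right)
        then show ?thesis by eventually_elim (use s in \<open>auto simp: A_def\<close>)
      qed
      then show "\<forall>\<^sub>F t' in at_right t. dist (Fp t') (Fp t) < e"
        using eventually_at_right_less[of t]
      proof eventually_elim
        case (elim t')
        have "Fp t' \<le> v" unfolding Fp_def by (rule cInf_lower[OF elim(1) bdd])
        moreover have "Fp t \<le> Fp t'" using monoD[OF mn, of t t'] elim(2) by simp
        ultimately show ?case using v(2) by (auto simp: dist_real_def)
      qed
    qed
    have F_le: "F s \<le> Fp s" if "s \<in> G" "s \<le> q" for s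
      unfolding Fp_def by (rule cInf_greatest[OF ne]) (use that pq Fle in \<open>auto simp: A_def\<close>)
    have le_F: "Fp t \<le> F s" if "s \<in> G" "t < s" "p \<le> s" "s \<le> q" for s t
      unfolding Fp_def by (rule cInf_lower[OF _ bdd]) (use that in \<open>auto simp: A_def\<close>)
    have "\<bar>Fp x\<bar> \<le> max \<bar>F p\<bar> \<bar>F q\<bar>" for x using FpB[of x] by (auto simp: max_def abs_if)
    from AE_monotone_right_continuous_has_derivative[OF mn rc this] G
    show ?thesis
    proof eventually_elim
      case (elim t)
      show ?case
      proof
        assume t: "t \<in> {p<..<q}"
        then have tG: "t \<in> G" using elim(2) sub pq by fastforce
        obtain a where a: "(Fp has_real_derivative a) (at t)" using elim(1) by blast
        have cont: "(Fp \<longlongrightarrow> Fp t) (at_left t)"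
          using DERIV_isCont[OF a] by (auto simp: isCont_def filterlim_at_split)
        \<comment> \<open>Continuity of \<open>Fp\<close> at \<open>t\<close> rules out a jump
          there, which is the only way \<open>Fp t\<close> could exceed \<open>F t\<close>.\<close>
        have "\<forall>\<^sub>F t' in at_left t. Fp t' \<le> F t"
          unfolding eventually_at_filter by (intro always_eventually) (use t tG in \<open>auto intro!: le_F\<close>)
        then have "Fp t \<le> F t" by (rule tendsto_upperbound[OF cont]) simp
        then have Ft: "Fp t = F t" using F_le[OF tG] t by auto
        have D: "((\<lambda>s. (Fp s - Fp t) / (s - t)) \<longlongrightarrow> a) (at t)"
          using a by (simp add: has_field_derivative_iff)
        have "((\<lambda>s. (F s - F t) / (s - t)) \<longlongrightarrow> a) (at t within G)"
        proof (rule tendstoI)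
          fix e :: real assume e: "e > 0"
          have "\<forall>\<^sub>F s in at t. dist ((Fp s - Fp t) / (s - t)) a < e/4"
            using tendstoD[OF D, of "e/4"] e by simp
          then obtain d where d: "d > 0" "\<And>s. s \<noteq> t \<Longrightarrow> \<bar>s - t\<bar> < d \<Longrightarrow> \<bar>(Fp s - Fp t) / (s - t) - a\<bar> < e/4"
            by (auto simp: eventually_at dist_real_def)
          have d': "\<bar>Fp s - F t - a * (s - t)\<bar> \<le> e/4 * \<bar>s - t\<bar>" if "\<bar>s - t\<bar> < d" for s
          proof (cases "s = t")
            case False
            have "\<bar>Fp s - F t - a * (s - t)\<bar> = \<bar>(Fp s - Fp t) / (s - t) - a\<bar> * \<bar>s - t\<bar>"
              using False by (simp add: Ft abs_mult[symmetric] field_simps)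
            also have "\<dots> \<le> e/4 * \<bar>s - t\<bar>" using d(2)[OF False that] by (intro mult_right_mono) auto
            finally show ?thesis .
          qed (simp add: Ft)
          \<comment> \<open>\<open>d/2\<close> and \<open>1/2\<close> keep the comparison point
            \<open>s - h\<^sup>2\<close> within distance \<open>d\<close> of \<open>t\<close>, the
            third bound makes \<open>a * h\<^sup>2\<close> at most
            \<open>e/4 * \<bar>h\<bar>\<close>, and the last two keep \<open>s\<close> between
            \<open>p\<close> and \<open>q\<close>.\<close>
          define \<delta> where "\<delta> = Min {d/2, 1/2, e / (4 * (\<bar>a\<bar> + 1)), t - p, q - t}"
          have \<delta>: "\<delta> > 0" "\<delta> \<le> d/2" "\<delta> \<le> 1/2" "\<delta> \<le> e / (4 * (\<bar>a\<bar> + 1))" "\<delta> \<le> t - p" "\<delta> \<le> q - t"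
          proof -
            have "\<delta> \<le> z" if "z \<in> {d/2, 1/2, e / (4 * (\<bar>a\<bar> + 1)), t - p, q - t}" for z
              unfolding \<delta>_def using that by (intro Min_le) auto
            then show "\<delta> \<le> d/2" "\<delta> \<le> 1/2" "\<delta> \<le> e / (4 * (\<bar>a\<bar> + 1))" "\<delta> \<le> t - p" "\<delta> \<le> q - t"
              by blast+
            show "\<delta> > 0" using d(1) e t by (auto simp: \<delta>_def)
          qed
          show "\<forall>\<^sub>F s in at t within G. dist ((F s - F t) / (s - t)) a < e"
            unfolding eventually_at
          proof (intro exI[of _ \<delta>] conjI \<delta>(1) ballI impI)
            fix s assume s: "s \<in> G" "s \<noteq> t \<and> dist s t < \<delta>"
            define h where "h = s - t"
            have h: "h \<noteq> 0" "\<bar>h\<bar> < \<delta>" using s by (auto simp: h_def dist_real_def)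
            have hh: "h\<^sup>2 \<le> \<bar>h\<bar> * (1/2)" "h\<^sup>2 > 0"
            proof -
              have "h\<^sup>2 = \<bar>h\<bar> * \<bar>h\<bar>" by (simp add: power2_eq_square)
              also have "\<dots> \<le> \<bar>h\<bar> * (1/2)" using h \<delta>(3) by (intro mult_left_mono) auto
              finally show "h\<^sup>2 \<le> \<bar>h\<bar> * (1/2)" .
            qed (use h in simp)
            have spq: "p < s" "s < q" using h \<delta>(5,6) t by (auto simp: h_def abs_if split: if_splits)
            have up: "F s - F t - a * h \<le> e/4 * \<bar>h\<bar>"
            proof -
              have "\<bar>s - t\<bar> < d" using h \<delta>(1,2) by (simp add: h_def)
              from abs_le_D1[OF d'[OF this]] F_le[OF s(1)] spq show ?thesis unfolding h_def by linarith
            qed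
            have lo: "- (3 * e / 4) * \<bar>h\<bar> \<le> F s - F t - a * h"
            proof -
              \<comment> \<open>\<open>Fp s\<close> may exceed \<open>F s\<close>, but
                \<open>Fp\<close> at a point strictly left of \<open>s\<close> does not; shifting by
                the square of \<open>h\<close> costs only an error of lower order.\<close>
              let ?s = "s - h\<^sup>2"
              have eq: "?s - t = h - h\<^sup>2" by (simp add: h_def)
              have ab: "\<bar>h - h\<^sup>2\<bar> \<le> 2 * \<bar>h\<bar>" using abs_triangle_ineq4[of h "h\<^sup>2"] hh by simp
              then have "\<bar>?s - t\<bar> < d" using h \<delta>(1,2) unfolding eq by auto
              from abs_le_D2[OF d'[OF this]] have "a * (h - h\<^sup>2) - e/4 * \<bar>h - h\<^sup>2\<bar> \<le> Fp ?s - F t"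
                unfolding eq by linarith
              moreover have "Fp ?s \<le> F s" by (rule le_F) (use s spq hh in auto)
              moreover have "e/4 * \<bar>h - h\<^sup>2\<bar> \<le> e/4 * (2 * \<bar>h\<bar>)" using ab e by (intro mult_left_mono) auto
              moreover have "a * h\<^sup>2 \<le> e/4 * \<bar>h\<bar>"
              proof -
                have "a * h\<^sup>2 \<le> (\<bar>a\<bar> + 1) * h\<^sup>2" by (intro mult_right_mono) auto
                also have "h\<^sup>2 = \<bar>h\<bar> * \<bar>h\<bar>" by (simp add: power2_eq_square)
                finally have "a * h\<^sup>2 \<le> (\<bar>a\<bar> + 1) * (\<bar>h\<bar> * \<bar>h\<bar>)" by (simp add: power2_eq_square)
                also have "\<dots> \<le> (\<bar>a\<bar> + 1) * (e / (4 * (\<bar>a\<bar> + 1)) * \<bar>h\<bar>)"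
                  using h \<delta>(4) by (intro mult_left_mono mult_right_mono) auto
                also have "\<dots> = e/4 * \<bar>h\<bar>" by (auto simp: field_simps)
                finally show ?thesis .
              qed
              ultimately show ?thesis by (auto simp: algebra_simps)
            qed
            have "\<bar>F s - F t - a * h\<bar> \<le> 3 * e / 4 * \<bar>h\<bar>"
            proof (rule abs_leI)
              have "e * \<bar>h\<bar> \<ge> 0" using e by simp
              then show "F s - F t - a * h \<le> 3 * e / 4 * \<bar>h\<bar>" using up by linarith
              show "- (F s - F t - a * h) \<le> 3 * e / 4 * \<bar>h\<bar>" using lo by linarith
            qed
            then have "\<bar>F s - F t - a * h\<bar> / \<bar>h\<bar> \<le> 3 * e / 4" using h by (simp add: field_simps)
            moreover have "dist ((F s - F t) / (s - t)) a = \<bar>F s - F t - a * h\<bar> / \<bar>h\<bar>"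
              using h by (simp add: dist_real_def h_def field_simps flip: abs_divide)
            ultimately show "dist ((F s - F t) / (s - t)) a < e" using e by linarith
          qed
        qed
        then show "\<exists>a. ((\<lambda>s. (F s - F t) / (s - t)) \<longlongrightarrow> a) (at t within G)" by blast
      qed
    qed
  qed
  have 2: "AE t in lebesgue. t \<in> {u<..<v} \<longrightarrow> (\<exists>a. ((\<lambda>s. (F s - F t) / (s - t)) \<longlongrightarrow> a) (at t within G))"
    if uv: "\<alpha> < u" "u < v" "v < \<beta>" for u v
  proof -
    obtain p where p: "p \<in> G" "\<alpha> < p" "p < u"
      by (rule AE_meets_interval[of \<alpha> u G]) (use G uv in \<open>auto elim!: eventually_mono\<close>)
    obtain q where q: "q \<in> G" "v < q" "q < \<beta>"
      by (rule AE_meets_interval[of v \<beta> G]) (use G uv in \<open>auto elim!: eventually_mono\<close>)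
    show ?thesis using 1[OF p(1) q(1)] p q uv by (auto elim!: eventually_mono)
  qed
  have "AE t in lebesgue. \<forall>u\<in>\<rat>. \<forall>v\<in>\<rat>. \<alpha> < u \<longrightarrow> u < v \<longrightarrow> v < \<beta> \<longrightarrow> t \<in> {u<..<v} \<longrightarrow>
     (\<exists>a. ((\<lambda>s. (F s - F t) / (s - t)) \<longlongrightarrow> a) (at t within G))"
    using 2 by (simp add: AE_ball_countable countable_rat)
  then show ?thesis
  proof eventually_elim
    case (elim t)
    show ?case
    proof
      assume t: "t \<in> {\<alpha><..<\<beta>}"
      obtain u where "u \<in> \<rat>" "\<alpha> < u" "u < t" using Rats_dense_in_real[of \<alpha> t] t by auto
      moreover obtain v where "v \<in> \<rat>" "t < v" "v < \<beta>" using Rats_dense_in_real[of t \<beta>] t by auto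
      ultimately show "\<exists>a. ((\<lambda>s. (F s - F t) / (s - t)) \<longlongrightarrow> a) (at t within G)"
        using elim by force
    qed
  qed
qed

text \<open>\<open>W\<close> is the lower limit of the variation functions \<open>V k\<close>. The
  inequality between increments survives this limit, so \<open>W\<close> and \<open>W - u\<close>
  are monotone on \<open>G\<close>, and \<open>u\<close> is their difference. With the lower limit
  no convergent subsequence of the \<open>V k\<close> has to be selected.\<close>

lemma AE_limit_bounded_variation_has_derivative_within:
  fixes v :: "nat \<Rightarrow> real \<Rightarrow> real" and V :: "nat \<Rightarrow> real \<Rightarrow> real"
  assumes G: "AE t in lebesgue. t \<in> {\<alpha><..<\<beta>} \<longrightarrow> t \<in> G" and sub: "G \<subseteq> {\<alpha><..<\<beta>}"
    and V: "\<And>k s t. \<alpha> < s \<Longrightarrow> s \<le> t \<Longrightarrow> t < \<beta> \<Longrightarrow> \<bar>v k t - v k s\<bar> \<le> V k t - V k s"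
    and V0: "\<And>k t. \<alpha> < t \<Longrightarrow> t < \<beta> \<Longrightarrow> 0 \<le> V k t"
    and VC: "\<And>k t. \<alpha> < t \<Longrightarrow> t < \<beta> \<Longrightarrow> V k t \<le> C"
    and lim: "\<And>t. t \<in> G \<Longrightarrow> (\<lambda>k. v k t) \<longlonglongrightarrow> u t"
  shows "AE t in lebesgue. t \<in> {\<alpha><..<\<beta>} \<longrightarrow> (\<exists>a. ((\<lambda>s. (u s - u t) / (s - t)) \<longlongrightarrow> a) (at t within G))"
proof -
  define W where "W t = Sup {c. eventually (\<lambda>k. c \<le> V k t) sequentially}" for t
  have bdd: "bdd_above {c. eventually (\<lambda>k. c \<le> V k t) sequentially}" if "t \<in> G" for t
  proof (rule bdd_aboveI)
    fix c assume "c \<in> {c. eventually (\<lambda>k. c \<le> V k t) sequentially}"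
    then obtain k where "c \<le> V k t" by (auto simp: eventually_sequentially)
    also have "\<dots> \<le> C" using that sub by (intro VC) auto
    finally show "c \<le> C" .
  qed
  have up: "c \<le> W t" if "eventually (\<lambda>k. c \<le> V k t) sequentially" "t \<in> G" for c t
    unfolding W_def using that bdd by (intro cSup_upper) auto
  have lo: "eventually (\<lambda>k. c \<le> V k t) sequentially" if "c < W t" "t \<in> G" for c t
  proof -
    have "{c. eventually (\<lambda>k. c \<le> V k t) sequentially} \<noteq> {}"
      using V0[of t] that sub by (auto intro!: exI[of _ 0])
    then obtain c' where c': "c < c'" "eventually (\<lambda>k. c' \<le> V k t) sequentially"
      using \<open>c < W t\<close> less_cSup_iff[OF _ bdd[OF \<open>t \<in> G\<close>]] unfolding W_def by blast
    from c'(2) show ?thesis by eventually_elim (use c'(1) in auto)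
  qed
  have key: "\<bar>u t - u s\<bar> \<le> W t - W s" if st: "s \<in> G" "t \<in> G" "s \<le> t" for s t
  proof (rule field_le_epsilon)
    fix e :: real assume e: "e > 0"
    have "(\<lambda>k. \<bar>v k t - v k s\<bar>) \<longlonglongrightarrow> \<bar>u t - u s\<bar>" using lim st by (intro tendsto_intros)
    then have "eventually (\<lambda>k. \<bar>u t - u s\<bar> - e/2 < \<bar>v k t - v k s\<bar>) sequentially"
      using e by (intro order_tendstoD) auto
    moreover have "eventually (\<lambda>k. W s - e/2 \<le> V k s) sequentially" using e st by (intro lo) auto
    ultimately have "eventually (\<lambda>k. W s + \<bar>u t - u s\<bar> - e \<le> V k t) sequentially"
    proof eventually_elim
      case (elim k)
      then show ?case using V[of s t k] st sub by fastforce
    qed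
    from up[OF this st(2)] show "\<bar>u t - u s\<bar> \<le> W t - W s + e" by simp
  qed
  have "mono_on G W" by (rule mono_onI) (use key in fastforce)
  note 1 = AE_mono_on_has_derivative_within[OF G sub this]
  have "mono_on G (\<lambda>t. W t - u t)" by (rule mono_onI) (use key in fastforce)
  note 2 = AE_mono_on_has_derivative_within[OF G sub this]
  from 1 2 show ?thesis
  proof eventually_elim
    case (elim t)
    show ?case
    proof
      assume "t \<in> {\<alpha><..<\<beta>}"
      then obtain a b where "((\<lambda>s. (W s - W t) / (s - t)) \<longlongrightarrow> a) (at t within G)"
        "((\<lambda>s. ((W s - u s) - (W t - u t)) / (s - t)) \<longlongrightarrow> b) (at t within G)" using elim by auto
      from tendsto_diff[OF this] have "((\<lambda>s. (u s - u t) / (s - t)) \<longlongrightarrow> a - b) (at t within G)"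
        by (simp add: diff_divide_distrib[symmetric] algebra_simps)
      then show "\<exists>a. ((\<lambda>s. (u s - u t) / (s - t)) \<longlongrightarrow> a) (at t within G)" by blast
    qed
  qed
qed

section \<open>Expansions for sequences of functions on one line\<close>

lemma AE_translation:
  fixes c :: "'a::euclidean_space"
  assumes "AE x in lebesgue. P x" shows "AE x in lebesgue. P (c + x)"
proof -
  obtain N where N: "{x. \<not> P x} \<subseteq> N" "N \<in> null_sets lebesgue"
    using assms unfolding eventually_ae_filter by auto
  have "negligible ((+) (- c) ` N)"
    using N(2) by (intro negligible_translation) (simp add: negligible_iff_null_sets)
  then show ?thesis
  proof (rule AE_lebesgue_not_negligible)
    fix x assume "x \<notin> (+) (- c) ` N"
    then have "c + x \<notin> N" by (force simp: image_iff)
    then show "P (c + x)" using N(1) by blast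
  qed
qed

lemma continuous_nn_integral_abs:
  fixes w :: "real \<Rightarrow> real"
  assumes "continuous_on {a..b} w"
  shows "(\<integral>\<^sup>+t\<in>{a..b}. ennreal \<bar>w t\<bar> \<partial>lborel) = ennreal (integral {a..b} (\<lambda>t. \<bar>w t\<bar>))"
proof -
  have c: "continuous_on {a..b} (\<lambda>t. \<bar>w t\<bar>)" using assms by (intro continuous_intros)
  have i: "set_integrable lborel {a..b} (\<lambda>t. \<bar>w t\<bar>)" using c by (intro borel_integrable_atLeastAtMost') auto
  have "integral {a..b} (\<lambda>t. \<bar>w t\<bar>) = (LINT t:{a..b}|lborel. \<bar>w t\<bar>)"
    using set_borel_integral_eq_integral(2)[OF i] by simp
  also have "ennreal \<dots> = (\<integral>\<^sup>+t\<in>{a..b}. ennreal \<bar>w t\<bar> \<partial>lborel)"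
    using i unfolding set_lebesgue_integral_def set_integrable_def
    by (subst nn_integral_eq_integral[symmetric]) (auto intro!: nn_integral_cong split: split_indicator)
  finally show ?thesis by simp
qed

lemma FTC_subinterval:
  fixes F :: "real \<Rightarrow> real"
  assumes der: "\<And>t. t \<in> {\<alpha>..\<beta>} \<Longrightarrow> (F has_real_derivative v t) (at t within {\<alpha>..\<beta>})"
    and "\<alpha> \<le> p" "p \<le> q" "q \<le> \<beta>"
  shows "(v has_integral (F q - F p)) {p..q}"
proof (rule fundamental_theorem_of_calculus[OF assms(3)])
  fix t assume "t \<in> {p..q}"
  then have "(F has_real_derivative v t) (at t within {p..q})"
    using assms by (intro DERIV_subset[OF der]) auto
  then show "(F has_vector_derivative v t) (at t within {p..q})"
    by (simp add: has_real_derivative_iff_has_vector_derivative)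
qed

text \<open>Along a subsequence the derivatives \<open>w k\<close> have bounded integrals, which
  bounds the variation of \<open>v k\<close>. The subsequence depends on the line, but the limit
  \<open>u\<close> does not, since the full sequence converges.\<close>

lemma AE_line_first_order:
  fixes v w :: "nat \<Rightarrow> real \<Rightarrow> real"
  assumes der: "\<And>k t. t \<in> {-\<rho>..\<rho>} \<Longrightarrow> (v k has_real_derivative w k t) (at t within {-\<rho>..\<rho>})"
    and cont: "\<And>k. continuous_on {-\<rho>..\<rho>} (w k)"
    and fin: "liminf (\<lambda>k. \<integral>\<^sup>+t\<in>{-\<rho>..\<rho>}. ennreal \<bar>w k t\<bar> \<partial>lborel) < \<infinity>"
    and lim: "AE t in lebesgue. t \<in> {-\<rho><..<\<rho>} \<longrightarrow> (\<lambda>k. v k t) \<longlonglongrightarrow> u t"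
  shows "AE t in lebesgue. t \<in> {-\<rho><..<\<rho>} \<longrightarrow> (\<exists>a. \<forall>\<epsilon>>0. \<exists>d>0. AE h in lebesgue. \<bar>h\<bar> < d \<longrightarrow>
     \<bar>u (t + h) - u t - a * h\<bar> \<le> \<epsilon> * \<bar>h\<bar>)"
proof -
  let ?X = "\<lambda>k. \<integral>\<^sup>+t\<in>{-\<rho>..\<rho>}. ennreal \<bar>w k t\<bar> \<partial>lborel"
  obtain C :: real where C: "liminf ?X < ennreal C" "C \<ge> 0"
    using fin by (cases "liminf ?X") (auto simp: ennreal_less_iff intro!: that[of "enn2real (liminf ?X) + 1"])
  have "\<not> (\<forall>\<^sub>F k in sequentially. ennreal C \<le> ?X k)"
    using C(1) Liminf_bounded[of "ennreal C" ?X sequentially] by auto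
  then have "\<exists>\<^sub>F k in sequentially. ?X k < ennreal C" by (simp add: frequently_def not_less)
  then have "infinite {k. ?X k < ennreal C}" by (simp add: cofinite_eq_sequentially[symmetric] frequently_cofinite)
  then obtain \<sigma> where \<sigma>: "strict_mono \<sigma>" "\<And>k::nat. ?X (\<sigma> k) < ennreal C"
    using infinite_enumerate[of "{k. ?X k < ennreal C}"] by auto
  \<comment> \<open>The total variation of \<open>v (\<sigma> k)\<close> counted from the left
    end.\<close>
  define V where "V k t = integral {-\<rho>..t} (\<lambda>s. \<bar>w (\<sigma> k) s\<bar>)" for k t
  define G where "G = {t\<in>{-\<rho><..<\<rho>}. (\<lambda>k. v k t) \<longlonglongrightarrow> u t}"
  have ci: "(\<lambda>s. \<bar>w k s\<bar>) integrable_on {a..b}" "w k integrable_on {a..b}" if "-\<rho> \<le> a" "b \<le> \<rho>" for k a b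
    using that cont[of k] by (auto intro!: integrable_continuous_real continuous_intros elim: continuous_on_subset)
  have VC: "V k t \<le> C" if "t < \<rho>" for k t
  proof -
    have "V k t \<le> integral {-\<rho>..\<rho>} (\<lambda>s. \<bar>w (\<sigma> k) s\<bar>)"
      unfolding V_def using that by (intro integral_subset_le ci) auto
    also have "ennreal \<dots> \<le> ennreal C"
      using \<sigma>(2)[of k] continuous_nn_integral_abs[OF cont[of "\<sigma> k"]] by simp
    then have "integral {-\<rho>..\<rho>} (\<lambda>s. \<bar>w (\<sigma> k) s\<bar>) \<le> C" using C(2) by (simp add: ennreal_le_iff)
    finally show ?thesis .
  qed
  have VV: "\<bar>v (\<sigma> k) t - v (\<sigma> k) s\<bar> \<le> V k t - V k s" if st: "-\<rho> < s" "s \<le> t" "t < \<rho>" for k s t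
  proof -
    have "(w (\<sigma> k) has_integral (v (\<sigma> k) t - v (\<sigma> k) s)) {s..t}"
      by (rule FTC_subinterval[OF der]) (use st in auto)
    then have "v (\<sigma> k) t - v (\<sigma> k) s = integral {s..t} (w (\<sigma> k))" by (simp add: integral_unique)
    also have "\<bar>\<dots>\<bar> \<le> integral {s..t} (\<lambda>s. \<bar>w (\<sigma> k) s\<bar>)"
      using integral_norm_bound_integral[of "w (\<sigma> k)" "{s..t}" "\<lambda>s. \<bar>w (\<sigma> k) s\<bar>"] ci[of s t] st by auto
    also have "\<dots> = V k t - V k s"
      using Henstock_Kurzweil_Integration.integral_combine[of "-\<rho>" s t "\<lambda>s. \<bar>w (\<sigma> k) s\<bar>"] ci[of "-\<rho>" t "\<sigma> k"] st
      by (simp add: V_def)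
    finally show ?thesis .
  qed
  have AEG: "AE t in lebesgue. t \<in> {-\<rho><..<\<rho>} \<longrightarrow> t \<in> G"
    using lim by eventually_elim (simp add: G_def)
  have "AE t in lebesgue. t \<in> {-\<rho><..<\<rho>} \<longrightarrow> (\<exists>a. ((\<lambda>s. (u s - u t) / (s - t)) \<longlongrightarrow> a) (at t within G))"
  proof (rule AE_limit_bounded_variation_has_derivative_within[where v = "\<lambda>k. v (\<sigma> k)" and V = V and C = C, OF AEG _ VV _ VC])
    show "0 \<le> V k t" if "-\<rho> < t" "t < \<rho>" for k t
      unfolding V_def by (intro Henstock_Kurzweil_Integration.integral_nonneg ci) (use that in auto)
    show "(\<lambda>k. v (\<sigma> k) t) \<longlonglongrightarrow> u t" if "t \<in> G" for t
      using that LIMSEQ_subseq_LIMSEQ[OF _ \<sigma>(1), of "\<lambda>k. v k t"] by (auto simp: G_def o_def)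
  qed (auto simp: G_def)
  with AEG show ?thesis
  proof eventually_elim
    case (elim t)
    show ?case
    proof
      assume t: "t \<in> {-\<rho><..<\<rho>}"
      then obtain a where a: "((\<lambda>s. (u s - u t) / (s - t)) \<longlongrightarrow> a) (at t within G)" using elim by auto
      show "\<exists>a. \<forall>\<epsilon>>0. \<exists>d>0. AE h in lebesgue. \<bar>h\<bar> < d \<longrightarrow> \<bar>u (t + h) - u t - a * h\<bar> \<le> \<epsilon> * \<bar>h\<bar>"
      proof (rule exI[of _ a], intro allI impI)
        fix \<epsilon> :: real assume \<epsilon>: "\<epsilon> > 0"
        obtain d where d: "d > 0" "\<And>s. s \<in> G \<Longrightarrow> s \<noteq> t \<Longrightarrow> \<bar>s - t\<bar> < d \<Longrightarrow> \<bar>(u s - u t) / (s - t) - a\<bar> < \<epsilon>"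
          using tendstoD[OF a \<epsilon>] by (auto simp: eventually_at dist_real_def)
        define \<delta> where "\<delta> = Min {d, \<rho> - t, t + \<rho>}"
        have \<delta>: "\<delta> > 0" "\<delta> \<le> d" "\<delta> \<le> \<rho> - t" "\<delta> \<le> t + \<rho>" using d(1) t by (auto simp: \<delta>_def)
        have "AE h in lebesgue. \<bar>h\<bar> < \<delta> \<longrightarrow> \<bar>u (t + h) - u t - a * h\<bar> \<le> \<epsilon> * \<bar>h\<bar>"
          using AE_translation[OF AEG, of t]
        proof eventually_elim
          case (elim h)
          show ?case
          proof
            assume h: "\<bar>h\<bar> < \<delta>"
            then have "t + h \<in> G" using elim \<delta> by auto
            then show "\<bar>u (t + h) - u t - a * h\<bar> \<le> \<epsilon> * \<bar>h\<bar>"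
            proof (cases "h = 0")
              case False
              have "\<bar>u (t + h) - u t - a * h\<bar> = \<bar>(u (t + h) - u t) / h - a\<bar> * \<bar>h\<bar>"
                using False by (simp add: abs_mult[symmetric] field_simps)
              also have "\<dots> \<le> \<epsilon> * \<bar>h\<bar>"
                using d(2)[OF \<open>t + h \<in> G\<close>] False h \<delta> by (intro mult_right_mono) auto
              finally show ?thesis .
            qed simp
          qed
        qed
        then show "\<exists>d>0. AE h in lebesgue. \<bar>h\<bar> < d \<longrightarrow> \<bar>u (t + h) - u t - a * h\<bar> \<le> \<epsilon> * \<bar>h\<bar>"
          using \<delta>(1) by blast
      qed
    qed
  qed
qed

text \<open>Between almost all points, increments of \<open>f\<close> are integrals of
  \<open>u\<close>, so integrating the first-order expansion of \<open>u\<close> gives the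
  second-order expansion of \<open>f\<close>. The slope \<open>a\<close> stays universally
  quantified, so that it can later be identified with a coefficient that is Borel in the base
  point.\<close>

lemma AE_line_second_order:
  fixes F v :: "nat \<Rightarrow> real \<Rightarrow> real"
  assumes der: "\<And>k t. t \<in> {-\<rho>..\<rho>} \<Longrightarrow> (F k has_real_derivative v k t) (at t within {-\<rho>..\<rho>})"
    and cont: "\<And>k. continuous_on {-\<rho>..\<rho>} (v k)"
    and fin: "(\<Sum>k. \<integral>\<^sup>+t\<in>{-\<rho>..\<rho>}. ennreal \<bar>v (Suc k) t - v k t\<bar> \<partial>lborel) < \<infinity>"
    and u[measurable]: "u \<in> borel_measurable borel"
    and limF: "AE t in lebesgue. t \<in> {-\<rho><..<\<rho>} \<longrightarrow> (\<lambda>k. F k t) \<longlonglongrightarrow> f t"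
    and limv: "AE t in lborel. t \<in> {-\<rho><..<\<rho>} \<longrightarrow> (\<lambda>k. v k t) \<longlonglongrightarrow> u t"
  shows "AE t in lebesgue. t \<in> {-\<rho><..<\<rho>} \<longrightarrow> (\<forall>a.
     (\<forall>\<epsilon>>0. \<exists>d>0. AE h in lebesgue. \<bar>h\<bar> < d \<longrightarrow> \<bar>u (t + h) - u t - a * h\<bar> \<le> \<epsilon> * \<bar>h\<bar>) \<longrightarrow>
     (\<forall>\<epsilon>>0. \<exists>d>0. AE h in lebesgue. \<bar>h\<bar> < d \<longrightarrow> \<bar>f (t + h) - f t - u t * h - a / 2 * h\<^sup>2\<bar> \<le> \<epsilon> * h\<^sup>2))"
proof -
  let ?I = "{-\<rho>..\<rho>}"
  define G where "G = {t\<in>{-\<rho><..<\<rho>}. (\<lambda>k. F k t) \<longlonglongrightarrow> f t}"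
  have AEG: "AE t in lebesgue. t \<in> {-\<rho><..<\<rho>} \<longrightarrow> t \<in> G"
    using limF by eventually_elim (simp add: G_def)
  define vv where "vv k t = indicator ?I t * v k t" for k t
  have [measurable]: "vv k \<in> borel_measurable borel" for k
    unfolding vv_def using borel_measurable_continuous_on_indicator[OF _ cont[of k]] by simp
  \<comment> \<open>The telescoping majorant dominates every \<open>v k\<close> at once; it is
    integrable because the consecutive differences have summable integrals, which is why a fast
    subsequence will be used.\<close>
  define D where "D t = ennreal \<bar>vv 0 t\<bar> + (\<Sum>k. ennreal \<bar>vv (Suc k) t - vv k t\<bar>)" for t
  have [measurable]: "D \<in> borel_measurable borel" unfolding D_def by measurable
  have "(\<integral>\<^sup>+t. D t \<partial>lborel) < \<infinity>"
  proof -
    have "(\<integral>\<^sup>+t. D t \<partial>lborel) = (\<integral>\<^sup>+t. ennreal \<bar>vv 0 t\<bar> \<partial>lborel) + (\<Sum>k. \<integral>\<^sup>+t. ennreal \<bar>vv (Suc k) t - vv k t\<bar> \<partial>lborel)"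
      unfolding D_def by (simp add: nn_integral_add nn_integral_suminf)
    also have "(\<integral>\<^sup>+t. ennreal \<bar>vv 0 t\<bar> \<partial>lborel) = (\<integral>\<^sup>+t\<in>?I. ennreal \<bar>v 0 t\<bar> \<partial>lborel)"
      by (intro nn_integral_cong) (auto simp: vv_def split: split_indicator)
    also have "\<dots> = ennreal (integral ?I (\<lambda>t. \<bar>v 0 t\<bar>))" by (rule continuous_nn_integral_abs[OF cont])
    also have "(\<lambda>k. \<integral>\<^sup>+t. ennreal \<bar>vv (Suc k) t - vv k t\<bar> \<partial>lborel) = (\<lambda>k. \<integral>\<^sup>+t\<in>?I. ennreal \<bar>v (Suc k) t - v k t\<bar> \<partial>lborel)"
      by (intro ext nn_integral_cong) (auto simp: vv_def split: split_indicator)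
    finally show ?thesis using fin by simp
  qed
  then have AED: "AE t in lborel. D t \<noteq> \<infinity>" by (intro nn_integral_PInf_AE) auto
  have intD: "integrable lborel (\<lambda>t. enn2real (D t))"
  proof (rule integrableI_nonneg)
    have "(\<integral>\<^sup>+t. ennreal (enn2real (D t)) \<partial>lborel) \<le> (\<integral>\<^sup>+t. D t \<partial>lborel)"
      by (intro nn_integral_mono) (simp add: ennreal_enn2real_if)
    also note \<open>(\<integral>\<^sup>+t. D t \<partial>lborel) < \<infinity>\<close>
    finally show "(\<integral>\<^sup>+t. ennreal (enn2real (D t)) \<partial>lborel) < \<infinity>" .
  qed auto
  have vvD: "ennreal \<bar>vv k t\<bar> \<le> D t" for k t
  proof -
    have "ennreal \<bar>vv k t\<bar> \<le> ennreal \<bar>vv 0 t\<bar> + (\<Sum>j<k. ennreal \<bar>vv (Suc j) t - vv j t\<bar>)"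
    proof (induction k)
      case (Suc k)
      have "ennreal \<bar>vv (Suc k) t\<bar> \<le> ennreal (\<bar>vv k t\<bar> + \<bar>vv (Suc k) t - vv k t\<bar>)"
        by (intro ennreal_leI) auto
      also have "\<dots> = ennreal \<bar>vv k t\<bar> + ennreal \<bar>vv (Suc k) t - vv k t\<bar>" by simp
      finally show ?case using Suc by (auto simp: add.assoc[symmetric] intro: order_trans add_right_mono)
    qed simp
    also have "\<dots> \<le> D t" unfolding D_def by (intro add_left_mono sum_le_suminf) auto
    finally show ?thesis .
  qed
  have AEu: "AE t in lborel. t \<in> {-\<rho><..<\<rho>} \<longrightarrow> \<bar>u t\<bar> \<le> enn2real (D t)"
    using limv AED
  proof eventually_elim
    case (elim t)
    show ?case
    proof
      assume t: "t \<in> {-\<rho><..<\<rho>}"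
      have "\<bar>v k t\<bar> \<le> enn2real (D t)" for k
      proof -
        have "ennreal \<bar>v k t\<bar> \<le> D t" using vvD[of k t] t by (simp add: vv_def)
        also have "D t = ennreal (enn2real (D t))" using elim(2) by (simp add: ennreal_enn2real_if)
        finally show ?thesis by (subst (asm) ennreal_le_iff) auto
      qed
      moreover have "(\<lambda>k. \<bar>v k t\<bar>) \<longlonglongrightarrow> \<bar>u t\<bar>" using elim(1) t by (intro tendsto_intros) auto
      ultimately show "\<bar>u t\<bar> \<le> enn2real (D t)" by (intro tendsto_upperbound) auto
    qed
  qed
  \<comment> \<open>The fundamental theorem passes to the limit by dominated convergence, between
    endpoints where \<open>F k\<close> converges.\<close>
  have FTC: "set_integrable lborel {p..q} u \<and> (LINT s:{p..q}|lborel. u s) = f q - f p" if pq: "p \<in> G" "q \<in> G" "p \<le> q" for p q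
  proof -
    have sub: "{p..q} \<subseteq> {-\<rho><..<\<rho>}" using pq by (auto simp: G_def)
    have lim: "(\<lambda>k. LINT s:{p..q}|lborel. v k s) \<longlonglongrightarrow> (LINT s:{p..q}|lborel. u s)"
      unfolding set_lebesgue_integral_def
    proof (rule integral_dominated_convergence[where w = "\<lambda>t. enn2real (D t)"])
      show "AE s in lborel. (\<lambda>k. indicator {p..q} s *\<^sub>R v k s) \<longlonglongrightarrow> indicator {p..q} s *\<^sub>R u s"
        using limv by eventually_elim (use sub in \<open>auto split: split_indicator intro!: tendsto_intros\<close>)
      show "AE s in lborel. norm (indicator {p..q} s *\<^sub>R v k s) \<le> enn2real (D s)" for k
        using AED
      proof eventually_elim
        case (elim s)
        have "ennreal \<bar>vv k s\<bar> \<le> ennreal (enn2real (D s))" using vvD[of k s] elim by (simp add: ennreal_enn2real_if)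
        then have "\<bar>vv k s\<bar> \<le> enn2real (D s)" by (subst (asm) ennreal_le_iff) auto
        then show ?case using sub by (auto simp: vv_def split: split_indicator)
      qed
      have "(\<lambda>s. indicator {p..q} s *\<^sub>R v k s) = (\<lambda>s. indicator {p..q} s *\<^sub>R vv k s)" for k
        using sub by (auto simp: vv_def fun_eq_iff split: split_indicator)
      then show "(\<lambda>s. indicator {p..q} s *\<^sub>R v k s) \<in> borel_measurable lborel" for k by simp
    qed (use intD in auto)
    have eq: "(LINT s:{p..q}|lborel. v k s) = F k q - F k p" for k
    proof -
      have c: "continuous_on {p..q} (v k)" using cont[of k] by (rule continuous_on_subset) (use sub in auto)
      have "(v k has_integral (F k q - F k p)) {p..q}"
        by (rule FTC_subinterval[OF der]) (use pq in \<open>auto simp: G_def\<close>)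
      moreover have "set_integrable lborel {p..q} (v k)" by (intro borel_integrable_atLeastAtMost' c)
      ultimately show ?thesis by (simp add: set_borel_integral_eq_integral(2) integral_unique)
    qed
    have "(\<lambda>k. F k q - F k p) \<longlonglongrightarrow> f q - f p" using pq by (intro tendsto_intros) (auto simp: G_def)
    then have "(LINT s:{p..q}|lborel. u s) = f q - f p" using lim eq LIMSEQ_unique by simp
    moreover have "set_integrable lborel {p..q} u"
      unfolding set_integrable_def
    proof (rule Bochner_Integration.integrable_bound[OF intD])
      show "AE s in lborel. norm (indicator {p..q} s *\<^sub>R u s) \<le> norm (enn2real (D s))"
        using AEu by eventually_elim (use sub in \<open>auto split: split_indicator\<close>)
    qed auto
    ultimately show ?thesis by simp
  qed
  show ?thesis
    using AEG
  proof eventually_elim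
    case (elim t)
    show ?case
    proof (rule impI, rule allI, rule impI, rule allI, rule impI)
      fix a \<epsilon> :: real
      assume t: "t \<in> {-\<rho><..<\<rho>}" and "\<forall>\<epsilon>>0. \<exists>d>0. AE h in lebesgue. \<bar>h\<bar> < d \<longrightarrow> \<bar>u (t + h) - u t - a * h\<bar> \<le> \<epsilon> * \<bar>h\<bar>"
        and \<epsilon>: "\<epsilon> > 0"
      then obtain d where d: "d > 0" "AE h in lebesgue. \<bar>h\<bar> < d \<longrightarrow> \<bar>u (t + h) - u t - a * h\<bar> \<le> \<epsilon> * \<bar>h\<bar>"
        by blast
      have tG: "t \<in> G" using elim t by auto
      define \<Phi> where "\<Phi> s = u s - (u t + a * (s - t))" for s
      have AE\<Phi>: "AE s in lborel. \<bar>s - t\<bar> < d \<longrightarrow> \<bar>\<Phi> s\<bar> \<le> \<epsilon> * \<bar>s - t\<bar>"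
      proof -
        have "AE s in lebesgue. \<bar>s - t\<bar> < d \<longrightarrow> \<bar>\<Phi> s\<bar> \<le> \<epsilon> * \<bar>s - t\<bar>"
          using AE_translation[OF d(2), of "-t"] by eventually_elim (simp add: \<Phi>_def algebra_simps)
        moreover have "{s. \<bar>s - t\<bar> < d \<longrightarrow> \<bar>\<Phi> s\<bar> \<le> \<epsilon> * \<bar>s - t\<bar>} \<in> sets borel"
          unfolding \<Phi>_def by measurable
        ultimately show ?thesis by (subst (asm) AE_completion_iff) auto
      qed
      \<comment> \<open>One endpoint is \<open>t\<close> itself, so on the whole interval the error
        in the expansion of \<open>u\<close> is at most \<open>\<epsilon>\<close> times its
        length.\<close>
      have bound: "\<bar>f q - f p - u t * (q - p) - a * ((q\<^sup>2 - p\<^sup>2) / 2 - t * (q - p))\<bar> \<le> \<epsilon> * (q - p)\<^sup>2"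
        if pq: "p \<in> G" "q \<in> G" "p \<le> q" "t = p \<or> t = q" "q - p < d" for p q
      proof -
        let ?L = "\<lambda>s. u t + a * (s - t)"
        have cL: "continuous_on {p..q} ?L" by (intro continuous_intros)
        have iL: "set_integrable lborel {p..q} ?L" by (intro borel_integrable_atLeastAtMost' cL)
        have "(?L has_integral ((u t * q + a * (q - t)\<^sup>2 / 2) - (u t * p + a * (p - t)\<^sup>2 / 2))) {p..q}"
          using pq by (intro fundamental_theorem_of_calculus)
             (auto simp flip: has_real_derivative_iff_has_vector_derivative intro!: derivative_eq_intros)
        then have L: "(LINT s:{p..q}|lborel. ?L s) = (u t * q + a * (q - t)\<^sup>2 / 2) - (u t * p + a * (p - t)\<^sup>2 / 2)"
          using set_borel_integral_eq_integral(2)[OF iL] by (simp add: integral_unique)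
        have i\<Phi>: "set_integrable lborel {p..q} \<Phi>"
          unfolding \<Phi>_def using FTC[OF pq(1-3)] iL by (intro set_integral_diff) auto
        have "(LINT s:{p..q}|lborel. \<Phi> s) = f q - f p - (LINT s:{p..q}|lborel. ?L s)"
          unfolding \<Phi>_def using FTC[OF pq(1-3)] iL by (subst set_integral_diff) auto
        moreover have "norm (LINT s:{p..q}|lborel. \<Phi> s) \<le> (LINT s:{p..q}|lborel. \<epsilon> * (q - p))"
          unfolding set_lebesgue_integral_def
        proof (rule order_trans[OF integral_norm_bound integral_mono_AE])
          show "AE s in lborel. norm (indicat_real {p..q} s *\<^sub>R \<Phi> s) \<le> indicat_real {p..q} s *\<^sub>R (\<epsilon> * (q - p))"
            using AE\<Phi>
          proof eventually_elim
            case (elim s)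
            show ?case
            proof (cases "s \<in> {p..q}")
              case True
              then have "\<bar>s - t\<bar> \<le> q - p" using pq(4) by auto
              then have "\<bar>\<Phi> s\<bar> \<le> \<epsilon> * \<bar>s - t\<bar>" "\<epsilon> * \<bar>s - t\<bar> \<le> \<epsilon> * (q - p)" using elim pq(5) \<epsilon> by auto
              with True show ?thesis by simp
            qed simp
          qed
          show "integrable lborel (\<lambda>s. norm (indicat_real {p..q} s *\<^sub>R \<Phi> s))"
            using i\<Phi> unfolding set_integrable_def by (rule integrable_norm)
        qed (use pq in auto)
        moreover have "(LINT s:{p..q}|lborel. \<epsilon> * (q - p)) = \<epsilon> * (q - p)\<^sup>2"
          using pq by (simp add: set_lebesgue_integral_def power2_eq_square)
        ultimately have *: "\<bar>f q - f p - ((u t * q + a * (q - t)\<^sup>2 / 2) - (u t * p + a * (p - t)\<^sup>2 / 2))\<bar> \<le> \<epsilon> * (q - p)\<^sup>2"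
          unfolding L real_norm_def by metis
        have "f q - f p - ((u t * q + a * (q - t)\<^sup>2 / 2) - (u t * p + a * (p - t)\<^sup>2 / 2)) =
           f q - f p - u t * (q - p) - a * ((q\<^sup>2 - p\<^sup>2) / 2 - t * (q - p))"
          by (simp add: power2_eq_square field_simps)
        with * show ?thesis by simp
      qed
      define \<delta> where "\<delta> = min d (min (\<rho> - t) (t + \<rho>))"
      have \<delta>: "\<delta> > 0" "\<delta> \<le> d" "\<delta> \<le> \<rho> - t" "\<delta> \<le> t + \<rho>" using d(1) t by (auto simp: \<delta>_def)
      have "AE h in lebesgue. \<bar>h\<bar> < \<delta> \<longrightarrow> \<bar>f (t + h) - f t - u t * h - a / 2 * h\<^sup>2\<bar> \<le> \<epsilon> * h\<^sup>2"
        using AE_translation[OF AEG, of t]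
      proof eventually_elim
        case (elim h)
        show ?case
        proof
          assume h: "\<bar>h\<bar> < \<delta>"
          then have hG: "t + h \<in> G" using elim \<delta> by auto
          show "\<bar>f (t + h) - f t - u t * h - a / 2 * h\<^sup>2\<bar> \<le> \<epsilon> * h\<^sup>2"
          proof (cases "h \<ge> 0")
            case True
            have "f (t + h) - f t - u t * h - a / 2 * h\<^sup>2 =
              f (t + h) - f t - u t * ((t + h) - t) - a * (((t + h)\<^sup>2 - t\<^sup>2) / 2 - t * ((t + h) - t))"
              by (simp add: power2_eq_square field_simps)
            also have "\<bar>\<dots>\<bar> \<le> \<epsilon> * ((t + h) - t)\<^sup>2"
              by (rule bound[OF tG hG]) (use True h \<delta> in auto)
            finally show ?thesis by simp
          next
            case False
            have "- (f (t + h) - f t - u t * h - a / 2 * h\<^sup>2) =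
              f t - f (t + h) - u t * (t - (t + h)) - a * ((t\<^sup>2 - (t + h)\<^sup>2) / 2 - t * (t - (t + h)))"
              by (simp add: power2_eq_square field_simps)
            also have "\<bar>\<dots>\<bar> \<le> \<epsilon> * (t - (t + h))\<^sup>2"
              by (rule bound[OF hG tG]) (use False h \<delta> in auto)
            finally show ?thesis by (simp only: abs_minus_cancel) simp
          qed
        qed
      qed
      then show "\<exists>d>0. AE h in lebesgue. \<bar>h\<bar> < d \<longrightarrow> \<bar>f (t + h) - f t - u t * h - a / 2 * h\<^sup>2\<bar> \<le> \<epsilon> * h\<^sup>2"
        using \<delta>(1) by blast
    qed
  qed
qed

subsection \<open>Averages along coordinate directions\<close>

lemma nn_integral_lborel_translation:
  fixes f :: "'a::euclidean_space \<Rightarrow> ennreal"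
  assumes [measurable]: "f \<in> borel_measurable borel"
  shows "(\<integral>\<^sup>+x. f (x + c) \<partial>lborel) = (\<integral>\<^sup>+x. f x \<partial>lborel)"
proof -
  have "(\<integral>\<^sup>+x. f x \<partial>lborel) = (\<integral>\<^sup>+x. f x \<partial>distr lborel borel ((+) c))"
    by (simp add: lborel_distr_plus)
  also have "\<dots> = (\<integral>\<^sup>+x. f (c + x) \<partial>lborel)"
    by (rule nn_integral_distr) auto
  finally show ?thesis by (simp add: add.commute)
qed

lemma nn_integral_segment_swap:
  fixes G :: "'a::euclidean_space \<Rightarrow> real \<Rightarrow> ennreal"
  assumes [measurable]: "case_prod G \<in> borel_measurable (borel \<Otimes>\<^sub>M borel)"
  shows "(\<integral>\<^sup>+x. (\<integral>\<^sup>+t. G x t \<partial>lborel) \<partial>lborel) = (\<integral>\<^sup>+t. (\<integral>\<^sup>+x. G x t \<partial>lborel) \<partial>lborel)"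
  by (rule lborel_pair.Fubini'[symmetric]) simp

text \<open>Slicing by all translates of a segment replaces the splitting of the space into one
  coordinate and the others; translation invariance makes the inner integral independent of
  \<open>t\<close>.\<close>

lemma nn_integral_translation_Fubini:
  fixes G :: "'a::euclidean_space \<Rightarrow> ennreal"
  assumes [measurable]: "G \<in> borel_measurable borel" "T \<in> sets borel"
  shows "(\<integral>\<^sup>+x. (\<integral>\<^sup>+t\<in>T. G (x + t *\<^sub>R e) \<partial>lborel) \<partial>lborel) = emeasure lborel T * (\<integral>\<^sup>+x. G x \<partial>lborel)"
proof -
  have "(\<integral>\<^sup>+x. (\<integral>\<^sup>+t\<in>T. G (x + t *\<^sub>R e) \<partial>lborel) \<partial>lborel)
      = (\<integral>\<^sup>+t. (\<integral>\<^sup>+x. G (x + t *\<^sub>R e) * indicator T t \<partial>lborel) \<partial>lborel)"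
    by (rule nn_integral_segment_swap) measurable
  also have "\<dots> = (\<integral>\<^sup>+t. (\<integral>\<^sup>+x. G x \<partial>lborel) * indicator T t \<partial>lborel)"
    by (intro nn_integral_cong) (simp add: nn_integral_multc nn_integral_lborel_translation)
  also have "\<dots> = emeasure lborel T * (\<integral>\<^sup>+x. G x \<partial>lborel)"
    by (subst nn_integral_cmult) (simp_all add: mult.commute)
  finally show ?thesis .
qed

text \<open>Integrating the exceptional length over all base points counts the exceptional set with
  the factor \<open>2 * \<rho>\<close>, the length of a segment.\<close>

lemma AE_of_AE_segments:
  fixes P :: "'a::euclidean_space \<Rightarrow> bool"
  assumes [measurable]: "Measurable.pred borel P" and \<rho>: "\<rho> > 0"
    and AE: "AE x in lborel. AE t in lborel. t \<in> {-\<rho><..<\<rho>} \<longrightarrow> P (x + t *\<^sub>R e)"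
  shows "AE x in lborel. P x"
proof -
  have "emeasure lborel {-\<rho><..<\<rho>} * (\<integral>\<^sup>+x. indicator {x. \<not> P x} x \<partial>lborel)
     = (\<integral>\<^sup>+x. (\<integral>\<^sup>+t\<in>{-\<rho><..<\<rho>}. indicator {x. \<not> P x} (x + t *\<^sub>R e) \<partial>lborel) \<partial>lborel)"
    by (rule nn_integral_translation_Fubini[symmetric]) auto
  also have "\<dots> = (\<integral>\<^sup>+x. 0 \<partial>(lborel :: 'a measure))"
  proof (rule nn_integral_cong_AE)
    show "AE x in lborel. (\<integral>\<^sup>+t\<in>{-\<rho><..<\<rho>}. indicator {x. \<not> P x} (x + t *\<^sub>R e) \<partial>lborel) = (0::ennreal)"
      using AE
    proof eventually_elim
      case (elim x)
      then have "(\<integral>\<^sup>+t\<in>{-\<rho><..<\<rho>}. indicator {x. \<not> P x} (x + t *\<^sub>R e) \<partial>lborel) = (\<integral>\<^sup>+t. 0 \<partial>(lborel::real measure))"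
        by (intro nn_integral_cong_AE) (auto elim!: eventually_mono split: split_indicator)
      then show ?case by simp
    qed
  qed
  finally have "emeasure lborel {x. \<not> P x} = 0" using \<rho> by simp
  then show ?thesis by (intro AE_I[of _ _ "{x. \<not> P x}"]) auto
qed

lemma AE_segments_of_AE:
  fixes P :: "'a::euclidean_space \<Rightarrow> bool"
  assumes [measurable]: "Measurable.pred borel P" and AE: "AE x in lborel. P x"
  shows "AE x in lborel. AE t in lborel. P (x + t *\<^sub>R e)"
proof -
  have "(\<integral>\<^sup>+x. (\<integral>\<^sup>+t\<in>UNIV. indicator {x. \<not> P x} (x + t *\<^sub>R e) \<partial>lborel) \<partial>lborel)
      = emeasure lborel (UNIV :: real set) * (\<integral>\<^sup>+x. indicator {x. \<not> P x} x \<partial>lborel)"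
    by (rule nn_integral_translation_Fubini) auto
  also have "(\<integral>\<^sup>+x. indicator {x. \<not> P x} x \<partial>lborel) = (\<integral>\<^sup>+x. 0 \<partial>(lborel::'a measure))"
    using AE by (intro nn_integral_cong_AE) (auto elim!: eventually_mono)
  finally have "(\<integral>\<^sup>+x. (\<integral>\<^sup>+t. indicator {x. \<not> P x} (x + t *\<^sub>R e) \<partial>lborel) \<partial>lborel) = 0"
    by simp
  then have "AE x in lborel. (\<integral>\<^sup>+t. indicator {x. \<not> P x} (x + t *\<^sub>R e) \<partial>lborel) = 0"
    by (subst (asm) nn_integral_0_iff_AE) auto
  then show ?thesis
  proof eventually_elim
    case (elim x)
    then have "AE t in lborel. indicator {x. \<not> P x} (x + t *\<^sub>R e) = (0::ennreal)"
      by (subst (asm) nn_integral_0_iff_AE) auto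
    then show ?case by eventually_elim (auto simp: indicator_eq_0_iff)
  qed
qed

section \<open>Averages on shrinking segments\<close>

lemma tendsto_0_ennrealI:
  fixes a :: "nat \<Rightarrow> ennreal"
  assumes "\<And>\<epsilon>::real. \<epsilon> > 0 \<Longrightarrow> \<forall>\<^sub>F m in sequentially. a m \<le> ennreal \<epsilon>"
  shows "a \<longlonglongrightarrow> 0"
proof (rule order_tendstoI)
  fix y :: ennreal assume "0 < y"
  then obtain e where e: "0 < e" "e < y" using dense by blast
  then obtain \<epsilon> where \<epsilon>: "e = ennreal \<epsilon>" "\<epsilon> \<ge> 0" by (cases e) auto
  with e have "\<epsilon> > 0" by auto
  from assms[OF this] show "\<forall>\<^sub>F m in sequentially. a m < y"
    by eventually_elim (use e \<epsilon> in auto)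
qed simp

lemma tendsto_0_ennrealD:
  fixes a :: "nat \<Rightarrow> ennreal"
  assumes "a \<longlonglongrightarrow> 0" "\<epsilon> > 0" shows "\<forall>\<^sub>F m in sequentially. a m \<le> ennreal \<epsilon>"
  using order_tendstoD(2)[OF assms(1), of "ennreal \<epsilon>"] assms(2) by (auto elim: eventually_mono)

lemma tendsto_0_ennreal_le:
  fixes a b :: "nat \<Rightarrow> ennreal"
  assumes "\<forall>\<^sub>F m in sequentially. a m \<le> b m" "b \<longlonglongrightarrow> 0" shows "a \<longlonglongrightarrow> 0"
  by (rule tendsto_sandwich[OF _ assms(1) tendsto_const assms(2)]) simp

lemma pred_tendsto_0_ennreal [measurable]:
  fixes a :: "'a \<Rightarrow> nat \<Rightarrow> ennreal"
  assumes [measurable]: "\<And>m. (\<lambda>x. a x m) \<in> borel_measurable M"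
  shows "Measurable.pred M (\<lambda>x. a x \<longlonglongrightarrow> 0)"
proof -
  have eq: "a x \<longlonglongrightarrow> 0 \<longleftrightarrow> limsup (a x) = 0" for x
  proof
    assume "a x \<longlonglongrightarrow> 0" then show "limsup (a x) = 0" by (rule lim_imp_Limsup[rotated]) simp
  next
    assume "limsup (a x) = 0"
    then show "a x \<longlonglongrightarrow> 0" by (rule tendsto_0_if_Limsup_eq_0_ennreal)
  qed
  show ?thesis unfolding eq by measurable
qed

lemma AE_line_density:
  fixes E :: "real set"
  assumes E: "E \<in> sets borel" and r: "r \<longlonglongrightarrow> 0" "\<And>m::nat. r m > 0"
  shows "AE t in lborel. t \<notin> E \<longrightarrow> (\<lambda>m. \<integral>\<^sup>+\<tau>\<in>{-1..1}. indicator E (t + r m * \<tau>) \<partial>lborel) \<longlonglongrightarrow> 0"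
proof -
  have [measurable]: "E \<in> sets borel" by (fact E)
  have "AE t in lebesgue. t \<notin> E \<longrightarrow> (\<lambda>m. \<integral>\<^sup>+\<tau>\<in>{-1..1}. indicator E (t + r m * \<tau>) \<partial>lborel) \<longlonglongrightarrow> 0"
    using AE_density_outside[OF E]
  proof eventually_elim
    case (elim t)
    show ?case
    proof (intro impI tendsto_0_ennrealI)
      fix \<epsilon> :: real assume t: "t \<notin> E" and \<epsilon>: "\<epsilon> > 0"
      have "\<exists>d>0. \<forall>c r. 0 < r \<and> r < d \<and> t \<in> cball c r \<longrightarrow>
         emeasure lborel (E \<inter> cball c r) \<le> ennreal (\<epsilon>/2) * emeasure lborel (cball c r)"
        using elim t \<epsilon> by (auto dest!: spec[of _ "\<epsilon>/2"])
      then obtain d where d: "d > 0" "\<And>c r. 0 < r \<Longrightarrow> r < d \<Longrightarrow> t \<in> cball c r \<Longrightarrow>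
         emeasure lborel (E \<inter> cball c r) \<le> ennreal (\<epsilon>/2) * emeasure lborel (cball c r)"
        by blast
      have "\<forall>\<^sub>F m in sequentially. r m < d" using order_tendstoD(2)[OF r(1) d(1)] .
      then show "\<forall>\<^sub>F m in sequentially. (\<integral>\<^sup>+\<tau>\<in>{-1..1}. indicator E (t + r m * \<tau>) \<partial>lborel) \<le> ennreal \<epsilon>"
      proof eventually_elim
        case (elim m)
        have rm: "r m > 0" by (rule r)
        have "ennreal (r m) * (\<integral>\<^sup>+\<tau>\<in>{-1..1}. indicator E (t + r m * \<tau>) \<partial>lborel)
          = ennreal \<bar>r m\<bar> * (\<integral>\<^sup>+\<tau>. indicator (E \<inter> cball t (r m)) (t + r m * \<tau>) \<partial>lborel)"
        proof -
          have "t + r m * \<tau> \<in> cball t (r m) \<longleftrightarrow> \<tau> \<in> {-1..1}" for \<tau>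
            using rm by (auto simp: dist_real_def abs_mult abs_le_iff)
          then show ?thesis using rm by (auto intro!: arg_cong2[of _ _ _ _ "(*)"] nn_integral_cong split: split_indicator)
        qed
        also have "\<dots> = (\<integral>\<^sup>+x. indicator (E \<inter> cball t (r m)) x \<partial>lborel)"
          using rm E by (intro nn_integral_real_affine[symmetric] borel_measurable_indicator) auto
        also have "\<dots> = emeasure lborel (E \<inter> cball t (r m))" by simp
        also have "\<dots> \<le> ennreal (\<epsilon>/2) * emeasure lborel (cball t (r m))"
          using rm elim by (intro d) auto
        also have "\<dots> = ennreal (r m) * ennreal \<epsilon>"
          using rm \<epsilon> by (simp add: cball_eq_atLeastAtMost ennreal_mult[symmetric] mult.commute)
        finally show ?case using rm by (subst (asm) ennreal_mult_le_mult_iff) auto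
      qed
    qed
  qed
  then show ?thesis by (subst (asm) AE_completion_iff) auto
qed

lemma AE_segment_density:
  fixes B :: "'a::euclidean_space set"
  assumes [measurable]: "B \<in> sets borel" and r: "r \<longlonglongrightarrow> 0" "\<And>m::nat. r m > 0"
  shows "AE x in lborel. x \<notin> B \<longrightarrow> (\<lambda>m. \<integral>\<^sup>+\<tau>\<in>{-1..1}. indicator B (x + (r m * \<tau>) *\<^sub>R e) \<partial>lborel) \<longlonglongrightarrow> 0"
proof (rule AE_of_AE_segments[where \<rho> = 1 and e = e])
  show "AE x in lborel. AE t in lborel. t \<in> {-1<..<1} \<longrightarrow> x + t *\<^sub>R e \<notin> B \<longrightarrow>
     (\<lambda>m. \<integral>\<^sup>+\<tau>\<in>{-1..1}. indicator B (x + t *\<^sub>R e + (r m * \<tau>) *\<^sub>R e) \<partial>lborel) \<longlonglongrightarrow> 0"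
  proof (rule AE_I2)
    fix x
    let ?E = "{t. x + t *\<^sub>R e \<in> B}"
    have "?E \<in> sets borel" by measurable
    from AE_line_density[OF this r]
    show "AE t in lborel. t \<in> {-1<..<1} \<longrightarrow> x + t *\<^sub>R e \<notin> B \<longrightarrow>
      (\<lambda>m. \<integral>\<^sup>+\<tau>\<in>{-1..1}. indicator B (x + t *\<^sub>R e + (r m * \<tau>) *\<^sub>R e) \<partial>lborel) \<longlonglongrightarrow> 0"
      by eventually_elim (simp add: indicator_def scaleR_add_left add.assoc)
  qed
qed auto

text \<open>In place of uniform convergence off a small set: \<open>B j M\<close> collects the
  points where some \<open>w m\<close> with \<open>m \<ge> M\<close> exceeds
  \<open>1 / Suc j\<close>. For each \<open>j\<close>, almost every \<open>x\<close> avoids some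
  \<open>B j M\<close>, which then has density zero at \<open>x\<close> along the line, while off
  \<open>B j M\<close> the integrand is small.\<close>

lemma AE_segment_average_tendsto_0:
  fixes w :: "nat \<Rightarrow> 'a::euclidean_space \<Rightarrow> ennreal"
  assumes [measurable]: "\<And>m. w m \<in> borel_measurable borel" and w1: "\<And>m x. w m x \<le> 1"
    and w0: "AE x in lborel. (\<lambda>m. w m x) \<longlonglongrightarrow> 0"
    and r: "r \<longlonglongrightarrow> 0" "\<And>m::nat. r m > 0"
  shows "AE x in lborel. (\<lambda>m. \<integral>\<^sup>+\<tau>\<in>{-1..1}. w m (x + (r m * \<tau>) *\<^sub>R e) \<partial>lborel) \<longlonglongrightarrow> 0"
proof -
  define B where "B j M = {x. \<exists>m\<ge>M. ennreal (1 / Suc j) < w m x}" for j M :: nat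
  have [measurable]: "B j M \<in> sets borel" for j M unfolding B_def by measurable
  have "AE x in lborel. \<forall>j M. x \<notin> B j M \<longrightarrow>
     (\<lambda>m. \<integral>\<^sup>+\<tau>\<in>{-1..1}. indicator (B j M) (x + (r m * \<tau>) *\<^sub>R e) \<partial>lborel) \<longlonglongrightarrow> 0"
    unfolding AE_all_countable by (intro allI AE_segment_density r) auto
  with w0 show ?thesis
  proof eventually_elim
    case (elim x)
    show ?case
    proof (rule tendsto_0_ennrealI)
      fix \<epsilon> :: real assume \<epsilon>: "\<epsilon> > 0"
      \<comment> \<open>The interval has length two, so \<open>\<epsilon>/4\<close> for the
        integrand and \<open>\<epsilon>/2\<close> for the share of \<open>B j M\<close> add up to
        \<open>\<epsilon>\<close>.\<close>
      obtain j :: nat where j: "1 / real (Suc j) < \<epsilon> / 4" using \<epsilon> nat_approx_posE[of "\<epsilon>/4"] by auto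
      have "\<forall>\<^sub>F m in sequentially. w m x \<le> ennreal (1 / Suc j)"
        by (rule tendsto_0_ennrealD[OF elim(1)]) simp
      then obtain M where "\<And>m. m \<ge> M \<Longrightarrow> w m x \<le> ennreal (1 / Suc j)" by (auto simp: eventually_sequentially)
      then have "x \<notin> B j M" by (auto simp: B_def not_less)
      then have "\<forall>\<^sub>F m in sequentially. (\<integral>\<^sup>+\<tau>\<in>{-1..1}. indicator (B j M) (x + (r m * \<tau>) *\<^sub>R e) \<partial>lborel) \<le> ennreal (\<epsilon>/2)"
        using elim(2) \<epsilon> by (intro tendsto_0_ennrealD) auto
      then show "\<forall>\<^sub>F m in sequentially. (\<integral>\<^sup>+\<tau>\<in>{-1..1}. w m (x + (r m * \<tau>) *\<^sub>R e) \<partial>lborel) \<le> ennreal \<epsilon>"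
        using eventually_ge_at_top[of M]
      proof eventually_elim
        case (elim m)
        have le: "w m y \<le> ennreal (\<epsilon>/4) + indicator (B j M) y" for y
        proof (cases "y \<in> B j M")
          case True then show ?thesis using w1[of m y] by (auto intro: add_increasing)
        next
          case False
          then have "w m y \<le> ennreal (1 / Suc j)" using elim(2) by (auto simp: B_def not_less)
          also have "\<dots> \<le> ennreal (\<epsilon>/4)" using j by (intro ennreal_leI) simp
          finally show ?thesis using False by simp
        qed
        have "(\<integral>\<^sup>+\<tau>\<in>{-1..1}. w m (x + (r m * \<tau>) *\<^sub>R e) \<partial>lborel)
          \<le> (\<integral>\<^sup>+\<tau>. ennreal (\<epsilon>/4) * indicator {-1..1} \<tau> + indicator (B j M) (x + (r m * \<tau>) *\<^sub>R e) * indicator {-1..1} \<tau> \<partial>lborel)"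
          by (intro nn_integral_mono) (use le in \<open>auto split: split_indicator\<close>)
        also have "\<dots> = ennreal (\<epsilon>/4) * 2 + (\<integral>\<^sup>+\<tau>\<in>{-1..1}. indicator (B j M) (x + (r m * \<tau>) *\<^sub>R e) \<partial>lborel)"
          by (subst nn_integral_add) (auto simp: nn_integral_cmult)
        also have "\<dots> \<le> ennreal (\<epsilon>/4) * 2 + ennreal (\<epsilon>/2)" using elim(1) by (intro add_left_mono)
        also have "\<dots> = ennreal \<epsilon>"
          using \<epsilon> by (simp add: ennreal_plus[symmetric] ennreal_mult'[symmetric] ennreal_numeral[symmetric] del: ennreal_plus ennreal_numeral)
        finally show ?case .
      qed
    qed
  qed
qed

text \<open>Level sets around rational values reduce approximate continuity along the line to
  countably many density statements: if \<open>x\<close> avoids \<open>B q j\<close>, then off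
  \<open>B q j\<close> the function stays within \<open>2 / Suc j\<close> of
  \<open>a x\<close>.\<close>

lemma AE_segment_approximate_continuity:
  fixes a :: "'a::euclidean_space \<Rightarrow> real"
  assumes [measurable]: "a \<in> borel_measurable borel" and r: "r \<longlonglongrightarrow> 0" "\<And>m::nat. r m > 0"
  shows "AE x in lborel. (\<lambda>m. \<integral>\<^sup>+\<tau>\<in>{-1..1}. ennreal (min 1 \<bar>a (x + (r m * \<tau>) *\<^sub>R e) - a x\<bar>) \<partial>lborel) \<longlonglongrightarrow> 0"
proof -
  define B where "B q j = {x. \<bar>a x - real_of_rat q\<bar> \<ge> 1 / Suc j}" for q and j :: nat
  have [measurable]: "B q j \<in> sets borel" for q j unfolding B_def by measurable
  have "AE x in lborel. \<forall>q j. x \<notin> B q j \<longrightarrow>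
     (\<lambda>m. \<integral>\<^sup>+\<tau>\<in>{-1..1}. indicator (B q j) (x + (r m * \<tau>) *\<^sub>R e) \<partial>lborel) \<longlonglongrightarrow> 0"
    unfolding AE_all_countable by (intro allI AE_segment_density r) auto
  then show ?thesis
  proof eventually_elim
    case (elim x)
    show ?case
    proof (rule tendsto_0_ennrealI)
      fix \<epsilon> :: real assume \<epsilon>: "\<epsilon> > 0"
      obtain j :: nat where j: "1 / real (Suc j) < \<epsilon> / 8" using \<epsilon> nat_approx_posE[of "\<epsilon>/8"] by auto
      obtain q where q: "a x - 1 / Suc j < real_of_rat q" "real_of_rat q < a x"
        using of_rat_dense[of "a x - 1 / Suc j" "a x"] by auto
      then have xB: "x \<notin> B q j" by (auto simp: B_def)
      then have "\<forall>\<^sub>F m in sequentially. (\<integral>\<^sup>+\<tau>\<in>{-1..1}. indicator (B q j) (x + (r m * \<tau>) *\<^sub>R e) \<partial>lborel) \<le> ennreal (\<epsilon>/2)"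
        using elim \<epsilon> by (intro tendsto_0_ennrealD) auto
      then show "\<forall>\<^sub>F m in sequentially. (\<integral>\<^sup>+\<tau>\<in>{-1..1}. ennreal (min 1 \<bar>a (x + (r m * \<tau>) *\<^sub>R e) - a x\<bar>) \<partial>lborel) \<le> ennreal \<epsilon>"
      proof eventually_elim
        case (elim m)
        have le: "ennreal (min 1 \<bar>a y - a x\<bar>) \<le> ennreal (\<epsilon>/4) + indicator (B q j) y" for y
        proof (cases "y \<in> B q j")
          case True then show ?thesis by (auto intro!: add_increasing ennreal_le_1[THEN iffD2])
        next
          case False
          then have "\<bar>a y - a x\<bar> \<le> \<epsilon>/4" using xB j unfolding B_def mem_Collect_eq not_le by linarith
          then have "ennreal (min 1 \<bar>a y - a x\<bar>) \<le> ennreal (\<epsilon>/4)" by (intro ennreal_leI) linarith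
          then show ?thesis using False by simp
        qed
        have "(\<integral>\<^sup>+\<tau>\<in>{-1..1}. ennreal (min 1 \<bar>a (x + (r m * \<tau>) *\<^sub>R e) - a x\<bar>) \<partial>lborel)
          \<le> (\<integral>\<^sup>+\<tau>. ennreal (\<epsilon>/4) * indicator {-1..1} \<tau> + indicator (B q j) (x + (r m * \<tau>) *\<^sub>R e) * indicator {-1..1} \<tau> \<partial>lborel)"
          by (intro nn_integral_mono) (use le in \<open>auto split: split_indicator\<close>)
        also have "\<dots> = ennreal (\<epsilon>/4) * 2 + (\<integral>\<^sup>+\<tau>\<in>{-1..1}. indicator (B q j) (x + (r m * \<tau>) *\<^sub>R e) \<partial>lborel)"
          by (subst nn_integral_add) (auto simp: nn_integral_cmult)
        also have "\<dots> \<le> ennreal (\<epsilon>/4) * 2 + ennreal (\<epsilon>/2)" using elim by (intro add_left_mono)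
        also have "\<dots> = ennreal \<epsilon>"
          using \<epsilon> by (simp add: ennreal_plus[symmetric] ennreal_mult'[symmetric] ennreal_numeral[symmetric] del: ennreal_plus ennreal_numeral)
        finally show ?case .
      qed
    qed
  qed
qed

section \<open>Averages on cubes, one coordinate at a time\<close>

definition cube :: "real \<Rightarrow> (real^'n) set" where
  "cube s = {z. \<forall>i. \<bar>z $ i\<bar> \<le> s}"

text \<open>Partial vectors stay in the full space, so that inductions over the set of active
  coordinates change neither the type nor the measure.\<close>

definition coord_proj :: "'n set \<Rightarrow> real^'n \<Rightarrow> real^'n" where
  "coord_proj J z = (\<chi> i. if i \<in> J then z $ i else 0)"

lemma cube_eq_cbox: "cube s = cbox (\<chi> i. -s) (\<chi> i. s)"
  by (auto simp: cube_def mem_box_cart abs_le_iff minus_le_iff)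

lemma cube_borel [measurable, simp]: "cube s \<in> sets borel"
  by (simp add: cube_eq_cbox)

lemma emeasure_cube: "s \<ge> 0 \<Longrightarrow> emeasure lborel (cube s :: (real^'n) set) = ennreal ((2 * s) ^ CARD('n))"
proof -
  assume s: "s \<ge> 0"
  then have "0 \<in> (cube s :: (real^'n) set)" by (simp add: cube_def)
  then have "(cube s :: (real^'n) set) \<noteq> {}" by blast
  then have "measure lborel (cube s :: (real^'n) set) = (2 * s) ^ CARD('n)"
    unfolding cube_eq_cbox by (simp add: content_cbox_cart)
  moreover have "emeasure lborel (cube s :: (real^'n) set) \<noteq> \<infinity>"
    unfolding cube_eq_cbox using emeasure_lborel_cbox_finite by (simp add: less_top)
  ultimately show ?thesis by (simp add: emeasure_eq_ennreal_measure)
qed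

lemma borel_measurable_vec_nth [measurable (raw)]:
  fixes f :: "'a \<Rightarrow> real^'n"
  shows "f \<in> borel_measurable M \<Longrightarrow> (\<lambda>x. f x $ i) \<in> borel_measurable M"
  by (rule measurable_compose[of f M borel "\<lambda>x. x $ i"])
     (auto intro!: borel_measurable_continuous_onI continuous_intros)

lemma coord_proj_borel [measurable]: "(coord_proj J :: real^'n \<Rightarrow> real^'n) \<in> borel_measurable borel"
proof -
  have "continuous_on UNIV (coord_proj J :: real^'n \<Rightarrow> real^'n)"
    unfolding coord_proj_def
  proof (rule continuous_on_vec_lambda)
    fix i show "continuous_on UNIV (\<lambda>x::real^'n. if i \<in> J then x $ i else 0)"
      by (cases "i \<in> J") (auto intro!: continuous_intros)
  qed
  then show ?thesis by (rule borel_measurable_continuous_onI)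
qed

text \<open>Integrating also over the old value of the replaced coordinate costs the factor
  \<open>2 * s\<close> but allows Fubini in one coordinate on the whole space.\<close>

lemma nn_integral_cube_resample:
  fixes G :: "real^'n \<Rightarrow> ennreal"
  assumes [measurable]: "G \<in> borel_measurable borel" and s: "s > 0"
  shows "(\<integral>\<^sup>+z\<in>cube s. (\<integral>\<^sup>+t\<in>{-s..s}. G (z + (t - z $ i) *\<^sub>R axis i 1) \<partial>lborel) \<partial>lborel)
     = ennreal (2 * s) * (\<integral>\<^sup>+z\<in>cube s. G z \<partial>lborel)"
proof -
  define H where "H z = G z * indicator (cube s) z" for z
  have [measurable]: "H \<in> borel_measurable borel" unfolding H_def by measurable
  have "(\<integral>\<^sup>+z\<in>cube s. (\<integral>\<^sup>+t\<in>{-s..s}. G (z + (t - z $ i) *\<^sub>R axis i 1) \<partial>lborel) \<partial>lborel)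
     = (\<integral>\<^sup>+z. (\<integral>\<^sup>+t. H (z + t *\<^sub>R axis i 1) * indicator {-s..s} (z $ i) \<partial>lborel) \<partial>lborel)"
  proof (rule nn_integral_cong)
    fix z :: "real^'n"
    have "(\<integral>\<^sup>+t\<in>{-s..s}. G (z + (t - z $ i) *\<^sub>R axis i 1) \<partial>lborel) * indicator (cube s) z
       = (\<integral>\<^sup>+t. H (z + (t - z $ i) *\<^sub>R axis i 1) * indicator {-s..s} (z $ i) \<partial>lborel)"
    proof (subst nn_integral_multc[symmetric])
      \<comment> \<open>Old and new value of the coordinate play symmetric roles: both range over
        the same interval.\<close>
      have "z + (t - z $ i) *\<^sub>R axis i 1 \<in> cube s \<and> z $ i \<in> {-s..s} \<longleftrightarrow> t \<in> {-s..s} \<and> z \<in> cube s" for t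
      proof -
        have "(z + (t - z $ i) *\<^sub>R axis i 1) $ j = (if j = i then t else z $ j)" for j
          by (simp add: axis_def)
        then show ?thesis by (auto simp: cube_def abs_le_iff minus_le_iff split: if_splits)
      qed
      then show "(\<integral>\<^sup>+t. G (z + (t - z $ i) *\<^sub>R axis i 1) * indicator {-s..s} t * indicator (cube s) z \<partial>lborel)
         = (\<integral>\<^sup>+t. H (z + (t - z $ i) *\<^sub>R axis i 1) * indicator {-s..s} (z $ i) \<partial>lborel)"
        unfolding H_def by (intro nn_integral_cong) (auto split: split_indicator)
    qed measurable
    also have "\<dots> = (\<integral>\<^sup>+t. H (z + t *\<^sub>R axis i 1) * indicator {-s..s} (z $ i) \<partial>lborel)"
      using nn_integral_lborel_translation[of "\<lambda>t. H (z + t *\<^sub>R axis i 1) * indicator {-s..s} (z $ i)" "- (z $ i)"]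
      by simp
    finally show "(\<integral>\<^sup>+t\<in>{-s..s}. G (z + (t - z $ i) *\<^sub>R axis i 1) \<partial>lborel) * indicator (cube s) z =
       (\<integral>\<^sup>+t. H (z + t *\<^sub>R axis i 1) * indicator {-s..s} (z $ i) \<partial>lborel)" .
  qed
  also have "\<dots> = (\<integral>\<^sup>+t. (\<integral>\<^sup>+z. H (z + t *\<^sub>R axis i 1) * indicator {-s..s} (z $ i) \<partial>lborel) \<partial>lborel)"
    by (rule nn_integral_segment_swap) measurable
  also have "\<dots> = (\<integral>\<^sup>+t. (\<integral>\<^sup>+z. H z * indicator {-s..s} (z $ i - t) \<partial>lborel) \<partial>lborel)"
  proof (rule nn_integral_cong)
    fix t :: real
    show "(\<integral>\<^sup>+z. H (z + t *\<^sub>R axis i 1) * indicator {-s..s} (z $ i) \<partial>lborel) = (\<integral>\<^sup>+z. H z * indicator {-s..s} (z $ i - t) \<partial>lborel)"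
      using nn_integral_lborel_translation[of "\<lambda>z. H z * indicator {-s..s} (z $ i - t)" "t *\<^sub>R axis i 1"]
      by (simp add: axis_def)
  qed
  also have "\<dots> = (\<integral>\<^sup>+z. (\<integral>\<^sup>+t. H z * indicator {-s..s} (z $ i - t) \<partial>lborel) \<partial>lborel)"
    by (rule nn_integral_segment_swap[symmetric]) measurable
  also have "\<dots> = (\<integral>\<^sup>+z. H z * ennreal (2 * s) \<partial>lborel)"
  proof (rule nn_integral_cong)
    fix z
    have "(\<lambda>t. indicator {-s..s} (z $ i - t)) = (indicator {z $ i - s..z $ i + s} :: real \<Rightarrow> ennreal)"
      by (auto simp: fun_eq_iff split: split_indicator)
    then show "(\<integral>\<^sup>+t. H z * indicator {-s..s} (z $ i - t) \<partial>lborel) = H z * ennreal (2 * s)"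
      using s by (subst nn_integral_cmult) auto
  qed
  also have "\<dots> = ennreal (2 * s) * (\<integral>\<^sup>+z\<in>cube s. G z \<partial>lborel)"
    by (subst nn_integral_multc) (simp_all add: H_def[abs_def] mult.commute)
  finally show ?thesis .
qed

lemma nn_integral_coord_proj_insert:
  fixes G :: "real^'n \<Rightarrow> ennreal"
  assumes [measurable]: "G \<in> borel_measurable borel" and "i \<notin> J"
  shows "2 * (\<integral>\<^sup>+z\<in>cube 1. G (coord_proj (insert i J) z) \<partial>lborel)
     = (\<integral>\<^sup>+z\<in>cube 1. (\<integral>\<^sup>+t\<in>{-1..1}. G (coord_proj J z + t *\<^sub>R axis i 1) \<partial>lborel) \<partial>lborel)"
proof -
  have "coord_proj (insert i J) (z + (t - z $ i) *\<^sub>R axis i 1) = coord_proj J z + t *\<^sub>R axis i 1" for z :: "real^'n" and t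
    using assms(2) by (auto simp: coord_proj_def vec_eq_iff axis_def)
  then show ?thesis
    using nn_integral_cube_resample[of "\<lambda>z. G (coord_proj (insert i J) z)" 1 i] by simp
qed

lemma coord_proj_cube_bound:
  fixes z :: "real^'n"
  assumes "z \<in> cube 1" shows "norm (coord_proj J z) \<le> CARD('n)"
proof -
  have "norm (coord_proj J z) \<le> (\<Sum>i\<in>UNIV. \<bar>coord_proj J z $ i\<bar>)" by (rule norm_le_l1_cart)
  also have "\<dots> \<le> (\<Sum>i\<in>(UNIV::'n set). 1)"
    by (intro sum_mono) (use assms in \<open>auto simp: coord_proj_def cube_def\<close>)
  finally show ?thesis by simp
qed

text \<open>The average over the new coordinate is taken first, turning \<open>w\<close> into
  \<open>W\<close>, which again tends to zero almost everywhere; the induction hypothesis then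
  averages \<open>W\<close> over the old coordinates. Halving keeps the bound one.\<close>

lemma AE_cube_average_tendsto_0:
  fixes w :: "nat \<Rightarrow> real^'n \<Rightarrow> ennreal"
  assumes "finite J" and meas: "\<And>m. w m \<in> borel_measurable borel" and w1: "\<And>m x. w m x \<le> 1"
    and w0: "AE x in lborel. (\<lambda>m. w m x) \<longlonglongrightarrow> 0"
    and r: "r \<longlonglongrightarrow> 0" "\<And>m::nat. r m > 0"
  shows "AE x in lborel. (\<lambda>m. \<integral>\<^sup>+z\<in>cube 1. w m (x + r m *\<^sub>R coord_proj J z) \<partial>lborel) \<longlonglongrightarrow> 0"
  using assms(1-4)
proof (induction J arbitrary: w rule: finite_induct)
  case empty
  note [measurable] = empty(1)
  from empty(3) show ?case
  proof eventually_elim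
    case (elim x)
    have "(\<lambda>m. w m x * emeasure lborel (cube 1 :: (real^'n) set)) \<longlonglongrightarrow> 0 * emeasure lborel (cube 1 :: (real^'n) set)"
      by (intro tendsto_mult_ennreal elim tendsto_const) (auto simp: emeasure_cube)
    then show ?case by (simp add: coord_proj_def nn_integral_cmult zero_vec_def[symmetric])
  qed
next
  case (insert i J)
  note [measurable] = insert.prems(1)
  define W where "W m y = (\<integral>\<^sup>+t\<in>{-1..1}. w m (y + (r m * t) *\<^sub>R axis i 1) \<partial>lborel) / 2" for m y
  have [measurable]: "W m \<in> borel_measurable borel" for m unfolding W_def by measurable
  have "AE x in lborel. (\<lambda>m. \<integral>\<^sup>+z\<in>cube 1. W m (x + r m *\<^sub>R coord_proj J z) \<partial>lborel) \<longlonglongrightarrow> 0"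
  proof (rule insert.IH)
    show "W m y \<le> 1" for m y
    proof -
      have "(\<integral>\<^sup>+t\<in>{-1..1}. w m (y + (r m * t) *\<^sub>R axis i 1) \<partial>lborel) \<le> (\<integral>\<^sup>+t\<in>{-1..1}. 1 \<partial>(lborel::real measure))"
        by (intro nn_integral_mono) (use insert.prems(2) in \<open>auto split: split_indicator\<close>)
      also have "\<dots> = 2" by simp
      finally show ?thesis unfolding W_def by (simp add: divide_le_posI_ennreal)
    qed
    show "AE x in lborel. (\<lambda>m. W m x) \<longlonglongrightarrow> 0"
      using AE_segment_average_tendsto_0[OF insert.prems r, of "axis i 1"]
    proof eventually_elim
      case (elim x)
      have "(\<lambda>m. (\<integral>\<^sup>+t\<in>{-1..1}. w m (x + (r m * t) *\<^sub>R axis i 1) \<partial>lborel) * inverse 2) \<longlonglongrightarrow> 0 * inverse 2"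
        by (intro tendsto_mult_ennreal elim tendsto_const) auto
      then show ?case by (simp add: W_def divide_ennreal_def)
    qed
  qed measurable
  then show ?case
  proof eventually_elim
    case (elim x)
    have "(\<integral>\<^sup>+z\<in>cube 1. w m (x + r m *\<^sub>R coord_proj (insert i J) z) \<partial>lborel)
       = (\<integral>\<^sup>+z\<in>cube 1. W m (x + r m *\<^sub>R coord_proj J z) \<partial>lborel)" for m
    proof -
      have "2 * (\<integral>\<^sup>+z\<in>cube 1. w m (x + r m *\<^sub>R coord_proj (insert i J) z) \<partial>lborel)
        = (\<integral>\<^sup>+z\<in>cube 1. (\<integral>\<^sup>+t\<in>{-1..1}. w m (x + r m *\<^sub>R (coord_proj J z + t *\<^sub>R axis i 1)) \<partial>lborel) \<partial>lborel)"
        using insert.hyps by (intro nn_integral_coord_proj_insert[of "\<lambda>h. w m (x + r m *\<^sub>R h)"]) auto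
      also have "\<dots> = (\<integral>\<^sup>+z\<in>cube 1. 2 * W m (x + r m *\<^sub>R coord_proj J z) \<partial>lborel)"
        unfolding W_def by (simp add: scaleR_add_right add.assoc ennreal_times_divide ennreal_divide_times ennreal_mult_divide_eq mult.commute[of 2])
      also have "\<dots> = 2 * (\<integral>\<^sup>+z\<in>cube 1. W m (x + r m *\<^sub>R coord_proj J z) \<partial>lborel)"
        by (subst nn_integral_cmult[symmetric]) (auto simp: mult.assoc)
      finally show ?thesis by (simp add: ennreal_mult_cancel_left)
    qed
    then show ?case using elim by simp
  qed
qed

text \<open>Localization: a sufficiently small cube around a point of \<open>O'\<close> does not see
  the cut-off at the boundary. The bound two is the length of the interval over which the functions
  to be inserted are integrated.\<close>

lemma AE_cube_average_tendsto_0_open: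
  fixes w :: "nat \<Rightarrow> real^'n \<Rightarrow> ennreal"
  assumes [measurable]: "\<And>m. w m \<in> borel_measurable borel" and w2: "\<And>m x. w m x \<le> 2"
    and "open O'" and w0: "AE x in lborel. x \<in> O' \<longrightarrow> (\<lambda>m. w m x) \<longlonglongrightarrow> 0"
    and r: "r \<longlonglongrightarrow> 0" "\<And>m::nat. r m > 0"
  shows "AE x in lborel. x \<in> O' \<longrightarrow> (\<lambda>m. \<integral>\<^sup>+z\<in>cube 1. w m (x + r m *\<^sub>R coord_proj J z) \<partial>lborel) \<longlonglongrightarrow> 0"
proof -
  have [measurable]: "O' \<in> sets borel" using assms(3) by simp
  define v where "v m x = w m x / 2 * indicator O' x" for m x
  have [measurable]: "v m \<in> borel_measurable borel" for m unfolding v_def by measurable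
  have "AE x in lborel. (\<lambda>m. \<integral>\<^sup>+z\<in>cube 1. v m (x + r m *\<^sub>R coord_proj J z) \<partial>lborel) \<longlonglongrightarrow> 0"
  proof (rule AE_cube_average_tendsto_0[OF _ _ _ _ r])
    show "v m x \<le> 1" for m x
      using w2[of m x] by (auto simp: v_def divide_le_posI_ennreal split: split_indicator)
    show "AE x in lborel. (\<lambda>m. v m x) \<longlonglongrightarrow> 0"
      using w0
    proof eventually_elim
      case (elim x)
      show ?case
      proof (cases "x \<in> O'")
        case True
        have "(\<lambda>m. w m x * inverse 2) \<longlonglongrightarrow> 0 * inverse 2"
          by (intro tendsto_mult_ennreal tendsto_const) (use elim True in auto)
        with True show ?thesis by (simp add: v_def divide_ennreal_def)
      qed (simp add: v_def)
    qed
  qed auto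
  then show ?thesis
  proof eventually_elim
    case (elim x)
    show ?case
    proof
      assume x: "x \<in> O'"
      obtain d where d: "d > 0" "ball x d \<subseteq> O'" using x assms(3) openE by blast
      have "\<forall>\<^sub>F m in sequentially. r m < d / (CARD('n) + 1)"
        using d by (intro order_tendstoD(2)[OF r(1)]) auto
      then have "\<forall>\<^sub>F m in sequentially. (\<integral>\<^sup>+z\<in>cube 1. w m (x + r m *\<^sub>R coord_proj J z) \<partial>lborel)
          = 2 * (\<integral>\<^sup>+z\<in>cube 1. v m (x + r m *\<^sub>R coord_proj J z) \<partial>lborel)"
      proof eventually_elim
        case (elim m)
        have "w m (x + r m *\<^sub>R coord_proj J z) = 2 * v m (x + r m *\<^sub>R coord_proj J z)" if z: "z \<in> cube 1" for z
        proof -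
          have "norm (r m *\<^sub>R coord_proj J z) \<le> r m * CARD('n)"
            using coord_proj_cube_bound[OF z, of J] r(2)[of m] by (simp add: mult_left_mono)
          also have "\<dots> < d" using elim r(2)[of m] by (simp add: field_simps)
          finally have "x + r m *\<^sub>R coord_proj J z \<in> O'"
            using d(2) by (auto simp: dist_norm subset_iff)
          then show ?thesis by (simp add: v_def ennreal_times_divide ennreal_mult_divide_eq mult.commute[of 2])
        qed
        then have "(\<integral>\<^sup>+z\<in>cube 1. w m (x + r m *\<^sub>R coord_proj J z) \<partial>lborel)
          = (\<integral>\<^sup>+z. 2 * (v m (x + r m *\<^sub>R coord_proj J z) * indicator (cube 1) z) \<partial>lborel)"
          by (intro nn_integral_cong) (auto split: split_indicator)
        then show ?case by (simp add: nn_integral_cmult)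
      qed
      moreover have "(\<lambda>m. 2 * (\<integral>\<^sup>+z\<in>cube 1. v m (x + r m *\<^sub>R coord_proj J z) \<partial>lborel)) \<longlonglongrightarrow> 2 * 0"
        by (intro tendsto_mult_ennreal elim tendsto_const) auto
      ultimately show "(\<lambda>m. \<integral>\<^sup>+z\<in>cube 1. w m (x + r m *\<^sub>R coord_proj J z) \<partial>lborel) \<longlonglongrightarrow> 0"
        by (simp add: tendsto_cong)
    qed
  qed
qed

text \<open>The step shared by all coordinate inductions. \<open>\<Theta>\<close> is the error of
  moving along the new direction from the displaced point \<open>x + r m *\<^sub>R h\<close>, and
  \<open>\<Psi>\<close> the error already made in reaching it. The first is small on average
  although its base point moves with \<open>m\<close>, by the preceding averaging lemma.\<close>

lemma AE_coord_proj_insert_step: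
  fixes \<Phi> \<Psi> :: "nat \<Rightarrow> real^'n \<Rightarrow> real^'n \<Rightarrow> ennreal" and \<Theta> :: "nat \<Rightarrow> real^'n \<Rightarrow> real \<Rightarrow> ennreal"
  assumes "i \<notin> J" "open O'" and r: "r \<longlonglongrightarrow> 0" "\<And>m::nat. r m > 0"
    and [measurable]: "\<And>m. case_prod (\<Theta> m) \<in> borel_measurable (borel \<Otimes>\<^sub>M borel)"
    and [measurable]: "\<And>m x. \<Phi> m x \<in> borel_measurable borel" "\<And>m x. \<Psi> m x \<in> borel_measurable borel"
    and \<Theta>1: "\<And>m x t. \<Theta> m x t \<le> 1"
    and \<Theta>: "AE x in lborel. x \<in> O' \<longrightarrow> (\<lambda>m. \<integral>\<^sup>+t\<in>{-1..1}. \<Theta> m x t \<partial>lborel) \<longlonglongrightarrow> 0"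
    and \<Psi>: "AE x in lborel. x \<in> O' \<longrightarrow> (\<lambda>m. \<integral>\<^sup>+z\<in>cube 1. \<Psi> m x (coord_proj J z) \<partial>lborel) \<longlonglongrightarrow> 0"
    and step: "\<And>m x z t. z \<in> cube 1 \<Longrightarrow> \<bar>t\<bar> \<le> 1 \<Longrightarrow>
       \<Phi> m x (coord_proj J z + t *\<^sub>R axis i 1) \<le> \<Theta> m (x + r m *\<^sub>R coord_proj J z) t + \<Psi> m x (coord_proj J z)"
  shows "AE x in lborel. x \<in> O' \<longrightarrow> (\<lambda>m. \<integral>\<^sup>+z\<in>cube 1. \<Phi> m x (coord_proj (insert i J) z) \<partial>lborel) \<longlonglongrightarrow> 0"
proof -
  define w where "w m x = (\<integral>\<^sup>+t\<in>{-1..1}. \<Theta> m x t \<partial>lborel)" for m x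
  have [measurable]: "w m \<in> borel_measurable borel" for m unfolding w_def by measurable
  have "AE x in lborel. x \<in> O' \<longrightarrow> (\<lambda>m. \<integral>\<^sup>+z\<in>cube 1. w m (x + r m *\<^sub>R coord_proj J z) \<partial>lborel) \<longlonglongrightarrow> 0"
  proof (rule AE_cube_average_tendsto_0_open[OF _ _ assms(2) _ r])
    show "w m x \<le> 2" for m x
    proof -
      have "w m x \<le> (\<integral>\<^sup>+t\<in>{-1..1}. 1 \<partial>(lborel::real measure))"
        unfolding w_def by (intro nn_integral_mono) (use \<Theta>1 in \<open>auto split: split_indicator\<close>)
      also have "\<dots> = 2" by simp
      finally show ?thesis .
    qed
  qed (use \<Theta> in \<open>auto simp: w_def[symmetric]\<close>)
  with \<Psi> show ?thesis
  proof eventually_elim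
    case (elim x)
    show ?case
    proof
      assume x: "x \<in> O'"
      let ?A = "\<lambda>m. \<integral>\<^sup>+z\<in>cube 1. \<Phi> m x (coord_proj (insert i J) z) \<partial>lborel"
      let ?B = "\<lambda>m. (\<integral>\<^sup>+z\<in>cube 1. w m (x + r m *\<^sub>R coord_proj J z) \<partial>lborel)
            + 2 * (\<integral>\<^sup>+z\<in>cube 1. \<Psi> m x (coord_proj J z) \<partial>lborel)"
      have le: "?A m \<le> ?B m" for m
      proof -
        \<comment> \<open>The doubled integral is the one that splits into the old coordinates and
          the new one.\<close>
        have "?A m \<le> 2 * ?A m" using mult_right_mono[of 1 2 "?A m"] by simp
        also have "\<dots> = (\<integral>\<^sup>+z\<in>cube 1. (\<integral>\<^sup>+t\<in>{-1..1}. \<Phi> m x (coord_proj J z + t *\<^sub>R axis i 1) \<partial>lborel) \<partial>lborel)"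
          by (rule nn_integral_coord_proj_insert[OF _ assms(1)]) measurable
        also have "\<dots> \<le> (\<integral>\<^sup>+z. w m (x + r m *\<^sub>R coord_proj J z) * indicator (cube 1) z
            + 2 * (\<Psi> m x (coord_proj J z) * indicator (cube 1) z) \<partial>lborel)"
        proof (rule nn_integral_mono)
          fix z :: "real^'n"
          have "(\<integral>\<^sup>+t\<in>{-1..1}. \<Phi> m x (coord_proj J z + t *\<^sub>R axis i 1) \<partial>lborel)
            \<le> w m (x + r m *\<^sub>R coord_proj J z) + 2 * \<Psi> m x (coord_proj J z)" if z: "z \<in> cube 1"
          proof -
            have "(\<integral>\<^sup>+t\<in>{-1..1}. \<Phi> m x (coord_proj J z + t *\<^sub>R axis i 1) \<partial>lborel)
              \<le> (\<integral>\<^sup>+t. \<Theta> m (x + r m *\<^sub>R coord_proj J z) t * indicator {-1..1} t + \<Psi> m x (coord_proj J z) * indicator {-1..1} t \<partial>lborel)"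
              by (intro nn_integral_mono) (use step[OF z] in \<open>auto split: split_indicator\<close>)
            also have "\<dots> = w m (x + r m *\<^sub>R coord_proj J z) + \<Psi> m x (coord_proj J z) * 2"
              by (subst nn_integral_add) (auto simp: w_def nn_integral_cmult)
            finally show ?thesis by (simp add: mult.commute)
          qed
          then show "(\<integral>\<^sup>+t\<in>{-1..1}. \<Phi> m x (coord_proj J z + t *\<^sub>R axis i 1) \<partial>lborel) * indicator (cube 1) z
            \<le> w m (x + r m *\<^sub>R coord_proj J z) * indicator (cube 1) z + 2 * (\<Psi> m x (coord_proj J z) * indicator (cube 1) z)"
            by (auto split: split_indicator)
        qed
        also have "\<dots> = ?B m" by (subst nn_integral_add) (auto simp: nn_integral_cmult)
        finally show ?thesis .
      qed
      have "(\<lambda>m. 2 * (\<integral>\<^sup>+z\<in>cube 1. \<Psi> m x (coord_proj J z) \<partial>lborel)) \<longlonglongrightarrow> 2 * 0"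
        by (intro tendsto_mult_ennreal tendsto_const) (use elim x in auto)
      then have "?B \<longlonglongrightarrow> 0 + 2 * 0" using elim x by (intro tendsto_add) auto
      then show "?A \<longlonglongrightarrow> 0" by (intro tendsto_0_ennreal_le[of ?A ?B] always_eventually allI le) simp
    qed
  qed
qed

lemma coord_proj_empty [simp]: "coord_proj {} z = 0"
  by (simp add: coord_proj_def vec_eq_iff)

lemma coord_proj_UNIV [simp]: "coord_proj UNIV z = z"
  by (simp add: coord_proj_def vec_eq_iff)

lemma ennreal_min_1_add_le:
  assumes "x \<le> y + z" "0 \<le> y" "0 \<le> z"
  shows "ennreal (min 1 x) \<le> ennreal (min 1 y) + ennreal (min 1 z)"
proof -
  have "min 1 x \<le> min 1 y + min 1 z" using assms by (auto simp: min_def)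
  then have "ennreal (min 1 x) \<le> ennreal (min 1 y + min 1 z)" by (rule ennreal_leI)
  also have "\<dots> = ennreal (min 1 y) + ennreal (min 1 z)" using assms by (intro ennreal_plus) auto
  finally show ?thesis .
qed

lemma AE_cube_approximate_continuity:
  fixes a :: "real^'n \<Rightarrow> real"
  assumes "finite J" and [measurable]: "a \<in> borel_measurable borel" and r: "r \<longlonglongrightarrow> 0" "\<And>m::nat. r m > 0"
  shows "AE x in lborel. x \<in> UNIV \<longrightarrow> (\<lambda>m. \<integral>\<^sup>+z\<in>cube 1. ennreal (min 1 \<bar>a (x + r m *\<^sub>R coord_proj J z) - a x\<bar>) \<partial>lborel) \<longlonglongrightarrow> 0"
  using assms(1)
proof (induction J rule: finite_induct)
  case (insert i J)
  let ?\<Phi> = "\<lambda>m x h. ennreal (min 1 \<bar>a (x + r m *\<^sub>R h) - a x\<bar>)"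
  show ?case
  proof (rule AE_coord_proj_insert_step[where \<Phi> = ?\<Phi> and \<Psi> = ?\<Phi> and
        \<Theta> = "\<lambda>m x t. ennreal (min 1 \<bar>a (x + (r m * t) *\<^sub>R axis i 1) - a x\<bar>)", OF insert.hyps(2) open_UNIV r _ _ _ _ _ insert.IH])
    show "AE x in lborel. x \<in> UNIV \<longrightarrow> (\<lambda>m. \<integral>\<^sup>+t\<in>{-1..1}. ennreal (min 1 \<bar>a (x + (r m * t) *\<^sub>R axis i 1) - a x\<bar>) \<partial>lborel) \<longlonglongrightarrow> 0"
      using AE_segment_approximate_continuity[OF assms(2) r, of "axis i 1"] by simp
    show "ennreal (min 1 \<bar>a (x + r m *\<^sub>R (coord_proj J z + t *\<^sub>R axis i 1)) - a x\<bar>)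
       \<le> ennreal (min 1 \<bar>a (x + r m *\<^sub>R coord_proj J z + (r m * t) *\<^sub>R axis i 1) - a (x + r m *\<^sub>R coord_proj J z)\<bar>) +
          ennreal (min 1 \<bar>a (x + r m *\<^sub>R coord_proj J z) - a x\<bar>)" for m x z t
      by (rule ennreal_min_1_add_le) (auto simp: scaleR_add_right add.assoc)
  qed measurable
qed simp

section \<open>Expansions in space from expansions along coordinate lines\<close>

text \<open>Moving along \<open>i\<close> from \<open>y = x + r m *\<^sub>R h\<close> uses the slope
  at \<open>y\<close> rather than at \<open>x\<close>; the discrepancy is controlled by the
  approximate continuity of \<open>a i\<close>. Truncation at one keeps the integrands bounded and
  is subadditive.\<close>

lemma AE_first_order_assembly:
  fixes u :: "real^'n \<Rightarrow> real" and a :: "'n \<Rightarrow> real^'n \<Rightarrow> real"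
  assumes [measurable]: "u \<in> borel_measurable borel" "\<And>i. a i \<in> borel_measurable borel"
    and "open O'" and r: "r \<longlonglongrightarrow> 0" "\<And>m::nat. r m > 0"
    and H: "\<And>i. AE x in lborel. x \<in> O' \<longrightarrow> (\<lambda>m. \<integral>\<^sup>+t\<in>{-1..1}.
        ennreal (min 1 (\<bar>u (x + (r m * t) *\<^sub>R axis i 1) - u x - r m * t * a i x\<bar> / r m)) \<partial>lborel) \<longlonglongrightarrow> 0"
    and "finite J"
  shows "AE x in lborel. x \<in> O' \<longrightarrow> (\<lambda>m. \<integral>\<^sup>+z\<in>cube 1.
     ennreal (min 1 (\<bar>u (x + r m *\<^sub>R coord_proj J z) - u x - r m * (\<Sum>i\<in>UNIV. a i x * coord_proj J z $ i)\<bar> / r m)) \<partial>lborel) \<longlonglongrightarrow> 0"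
  using assms(7)
proof (induction J rule: finite_induct)
  case (insert i J)
  let ?\<Phi> = "\<lambda>m x h. ennreal (min 1 (\<bar>u (x + r m *\<^sub>R h) - u x - r m * (\<Sum>i\<in>UNIV. a i x * h $ i)\<bar> / r m))"
  let ?c = "\<lambda>m x h. ennreal (min 1 \<bar>a i (x + r m *\<^sub>R h) - a i x\<bar>)"
  have \<Psi>: "AE x in lborel. x \<in> O' \<longrightarrow> (\<lambda>m. \<integral>\<^sup>+z\<in>cube 1. ?c m x (coord_proj J z) + ?\<Phi> m x (coord_proj J z) \<partial>lborel) \<longlonglongrightarrow> 0"
    using insert.IH AE_cube_approximate_continuity[OF insert.hyps(1) assms(2)[of i] r]
  proof eventually_elim
    case (elim x)
    show ?case
    proof
      assume x: "x \<in> O'"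
      have "(\<lambda>m. (\<integral>\<^sup>+z\<in>cube 1. ?c m x (coord_proj J z) \<partial>lborel) + (\<integral>\<^sup>+z\<in>cube 1. ?\<Phi> m x (coord_proj J z) \<partial>lborel)) \<longlonglongrightarrow> 0 + 0"
        using elim x by (intro tendsto_add) auto
      moreover have "(\<integral>\<^sup>+z\<in>cube 1. ?c m x (coord_proj J z) + ?\<Phi> m x (coord_proj J z) \<partial>lborel)
        = (\<integral>\<^sup>+z\<in>cube 1. ?c m x (coord_proj J z) \<partial>lborel) + (\<integral>\<^sup>+z\<in>cube 1. ?\<Phi> m x (coord_proj J z) \<partial>lborel)" for m
        by (subst nn_integral_add[symmetric]) (auto simp: distrib_right)
      ultimately show "(\<lambda>m. \<integral>\<^sup>+z\<in>cube 1. ?c m x (coord_proj J z) + ?\<Phi> m x (coord_proj J z) \<partial>lborel) \<longlonglongrightarrow> 0"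
        by simp
    qed
  qed
  show ?case
  proof (rule AE_coord_proj_insert_step[where \<Phi> = ?\<Phi> and \<Psi> = "\<lambda>m x h. ?c m x h + ?\<Phi> m x h" and
        \<Theta> = "\<lambda>m x t. ennreal (min 1 (\<bar>u (x + (r m * t) *\<^sub>R axis i 1) - u x - r m * t * a i x\<bar> / r m))",
        OF insert.hyps(2) assms(3) r _ _ _ _ H[of i] \<Psi>])
    show "?\<Phi> m x (coord_proj J z + t *\<^sub>R axis i 1) \<le>
       ennreal (min 1 (\<bar>u (x + r m *\<^sub>R coord_proj J z + (r m * t) *\<^sub>R axis i 1) - u (x + r m *\<^sub>R coord_proj J z)
          - r m * t * a i (x + r m *\<^sub>R coord_proj J z)\<bar> / r m)) +
       (?c m x (coord_proj J z) + ?\<Phi> m x (coord_proj J z))" if t: "\<bar>t\<bar> \<le> 1" for m x z t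
    proof -
      define h where "h = coord_proj J z"
      define y where "y = x + r m *\<^sub>R h"
      have rm: "r m > 0" by (rule r)
      define A where "A = u (y + (r m * t) *\<^sub>R axis i 1) - u y - r m * t * a i y"
      define D where "D = u y - u x - r m * (\<Sum>i\<in>UNIV. a i x * h $ i)"
      have "(\<Sum>j\<in>UNIV. a j x * (h + t *\<^sub>R axis i 1) $ j) = (\<Sum>j\<in>UNIV. a j x * h $ j + (if j = i then a i x * t else 0))"
        by (intro sum.cong) (auto simp: axis_def algebra_simps)
      also have "\<dots> = (\<Sum>j\<in>UNIV. a j x * h $ j) + a i x * t" by (simp add: sum.distrib)
      finally have eq: "u (x + r m *\<^sub>R (h + t *\<^sub>R axis i 1)) - u x - r m * (\<Sum>j\<in>UNIV. a j x * (h + t *\<^sub>R axis i 1) $ j)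
        = A + r m * t * (a i y - a i x) + D"
        by (simp add: A_def D_def y_def scaleR_add_right add.assoc algebra_simps)
      have "\<bar>A + r m * t * (a i y - a i x) + D\<bar> / r m \<le> \<bar>A\<bar> / r m + (\<bar>a i y - a i x\<bar> + \<bar>D\<bar> / r m)"
      proof -
        have "\<bar>r m * t * (a i y - a i x)\<bar> \<le> r m * \<bar>a i y - a i x\<bar>"
          using rm t by (simp add: abs_mult mult_left_le_one_le mult.assoc)
        then have "\<bar>A + r m * t * (a i y - a i x) + D\<bar> \<le> \<bar>A\<bar> + (r m * \<bar>a i y - a i x\<bar> + \<bar>D\<bar>)" by linarith
        then have "\<bar>A + r m * t * (a i y - a i x) + D\<bar> / r m \<le> (\<bar>A\<bar> + (r m * \<bar>a i y - a i x\<bar> + \<bar>D\<bar>)) / r m"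
          using rm by (intro divide_right_mono) auto
        then show ?thesis using rm by (simp add: add_divide_distrib)
      qed
      then have "ennreal (min 1 (\<bar>A + r m * t * (a i y - a i x) + D\<bar> / r m))
          \<le> ennreal (min 1 (\<bar>A\<bar> / r m)) + ennreal (min 1 (\<bar>a i y - a i x\<bar> + \<bar>D\<bar> / r m))"
        by (rule ennreal_min_1_add_le) (use rm in auto)
      also have "\<dots> \<le> ennreal (min 1 (\<bar>A\<bar> / r m)) + (ennreal (min 1 \<bar>a i y - a i x\<bar>) + ennreal (min 1 (\<bar>D\<bar> / r m)))"
        by (intro add_left_mono ennreal_min_1_add_le) (use rm in auto)
      finally have "ennreal (min 1 (\<bar>A + r m * t * (a i y - a i x) + D\<bar> / r m))
          \<le> ennreal (min 1 (\<bar>A\<bar> / r m)) + (ennreal (min 1 \<bar>a i y - a i x\<bar>) + ennreal (min 1 (\<bar>D\<bar> / r m)))" .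
      then show ?thesis unfolding h_def[symmetric] eq y_def[symmetric] A_def[symmetric] D_def[symmetric] .
    qed
  qed measurable
qed (simp add: r(2)[THEN less_imp_le])

definition quad_form :: "real^'n^'n \<Rightarrow> real^'n \<Rightarrow> real" where
  "quad_form A h = (\<Sum>k\<in>UNIV. \<Sum>l\<in>UNIV. A $ k $ l * h $ k * h $ l)"

lemma quad_form_borel [measurable]: "quad_form A \<in> borel_measurable borel"
  unfolding quad_form_def by measurable

text \<open>Only the values of the form matter, so all mixed terms with the new coordinate go into
  row \<open>i\<close> and the matrix is in general not symmetric; it gets symmetrized when a
  Hessian is formed.\<close>

lemma quad_form_extend:
  fixes B :: "real^'n^'n"
  assumes "i \<notin> J"
  obtains B' where "\<And>t h. (\<And>k. k \<notin> J \<Longrightarrow> h $ k = 0) \<Longrightarrow>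
    quad_form B' (h + t *\<^sub>R axis i 1) = quad_form B h + t * (\<Sum>l\<in>UNIV. \<alpha> l * h $ l) + \<beta> * t\<^sup>2"
proof
  define B' where "B' = (\<chi> k l. if k \<in> J \<and> l \<in> J then B $ k $ l else if k = i \<and> l \<in> J then \<alpha> l
      else if k = i \<and> l = i then \<beta> else 0)"
  fix t and h :: "real^'n" assume h: "\<And>k. k \<notin> J \<Longrightarrow> h $ k = 0"
  let ?h = "h + t *\<^sub>R axis i 1"
  have "B' $ k $ l * ?h $ k * ?h $ l = B $ k $ l * h $ k * h $ l + ((if k = i then t * (\<alpha> l * h $ l) else 0)
      + (if k = i then if l = i then \<beta> * t\<^sup>2 else 0 else 0))" for k l
    using assms h[of k] h[of l] h[of i] by (auto simp: B'_def axis_def power2_eq_square)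
  then have "quad_form B' ?h = quad_form B h + ((\<Sum>k\<in>UNIV. \<Sum>l\<in>UNIV. if k = i then t * (\<alpha> l * h $ l) else 0)
      + (\<Sum>k\<in>UNIV. \<Sum>l\<in>UNIV. if k = i then if l = i then \<beta> * t\<^sup>2 else 0 else 0))"
    unfolding quad_form_def by (simp only: sum.distrib)
  also have "(\<Sum>k\<in>UNIV. \<Sum>l\<in>UNIV. if k = i then t * (\<alpha> l * h $ l) else 0) = t * (\<Sum>l\<in>UNIV. \<alpha> l * h $ l)"
    by (subst sum.swap) (simp add: sum_distrib_left)
  also have "(\<Sum>k\<in>UNIV. \<Sum>l\<in>UNIV. if k = i then if l = i then \<beta> * t\<^sup>2 else 0 else 0) = \<beta> * t\<^sup>2"
    by (subst sum.swap) simp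
  finally show "quad_form B' ?h = quad_form B h + t * (\<Sum>l\<in>UNIV. \<alpha> l * h $ l) + \<beta> * t\<^sup>2" by simp
qed

text \<open>The linear coefficient for a step in direction \<open>i\<close> is \<open>u i\<close> at
  the displaced point; expanding it back at \<open>x\<close> by the first-order statement supplies
  the mixed terms of the quadratic form. The pure terms come from \<open>a i i\<close>.\<close>

lemma AE_second_order_assembly:
  fixes f :: "real^'n \<Rightarrow> real" and u :: "'n \<Rightarrow> real^'n \<Rightarrow> real" and a :: "'n \<Rightarrow> 'n \<Rightarrow> real^'n \<Rightarrow> real"
  assumes [measurable]: "f \<in> borel_measurable borel" "\<And>i. u i \<in> borel_measurable borel"
      "\<And>i j. a i j \<in> borel_measurable borel"
    and "open O'" and r: "r \<longlonglongrightarrow> 0" "\<And>m::nat. r m > 0"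
    and Hu: "\<And>i j. AE x in lborel. x \<in> O' \<longrightarrow> (\<lambda>m. \<integral>\<^sup>+t\<in>{-1..1}.
        ennreal (min 1 (\<bar>u j (x + (r m * t) *\<^sub>R axis i 1) - u j x - r m * t * a i j x\<bar> / r m)) \<partial>lborel) \<longlonglongrightarrow> 0"
    and Hf: "\<And>i. AE x in lborel. x \<in> O' \<longrightarrow> (\<lambda>m. \<integral>\<^sup>+t\<in>{-1..1}.
        ennreal (min 1 (\<bar>f (x + (r m * t) *\<^sub>R axis i 1) - f x - r m * t * u i x - (r m * t)\<^sup>2 / 2 * a i i x\<bar> / (r m)\<^sup>2)) \<partial>lborel) \<longlonglongrightarrow> 0"
    and "finite J"
  shows "\<exists>B. AE x in lborel. x \<in> O' \<longrightarrow> (\<lambda>m. \<integral>\<^sup>+z\<in>cube 1.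
     ennreal (min 1 (\<bar>f (x + r m *\<^sub>R coord_proj J z) - f x - r m * (\<Sum>i\<in>UNIV. u i x * coord_proj J z $ i)
       - (r m)\<^sup>2 * quad_form (B x) (coord_proj J z)\<bar> / (r m)\<^sup>2)) \<partial>lborel) \<longlonglongrightarrow> 0"
  using assms(9)
proof (induction J rule: finite_induct)
  case empty
  show ?case by (simp add: quad_form_def)
next
  case (insert i J)
  define \<Phi> where "\<Phi> B m x h = ennreal (min 1 (\<bar>f (x + r m *\<^sub>R h) - f x - r m * (\<Sum>i\<in>UNIV. u i x * h $ i)
       - (r m)\<^sup>2 * quad_form (B x) h\<bar> / (r m)\<^sup>2))" for B :: "real^'n \<Rightarrow> real^'n^'n" and m x and h :: "real^'n"
  have [measurable]: "\<Phi> B m x \<in> borel_measurable borel" for B m x unfolding \<Phi>_def by measurable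
  define c where "c m x h = ennreal (min 1 \<bar>a i i (x + r m *\<^sub>R h) - a i i x\<bar>)" for m x h
  have [measurable]: "c m x \<in> borel_measurable borel" for m x unfolding c_def by measurable
  define d where "d m x h = ennreal (min 1 (\<bar>u i (x + r m *\<^sub>R h) - u i x - r m * (\<Sum>j\<in>UNIV. a j i x * h $ j)\<bar> / r m))" for m x h
  have [measurable]: "d m x \<in> borel_measurable borel" for m x unfolding d_def by measurable
  obtain B where B: "AE x in lborel. x \<in> O' \<longrightarrow> (\<lambda>m. \<integral>\<^sup>+z\<in>cube 1. \<Phi> B m x (coord_proj J z) \<partial>lborel) \<longlonglongrightarrow> 0"
    using insert.IH unfolding \<Phi>_def ..
  \<comment> \<open>The matrix may depend on \<open>x\<close> but not on \<open>h\<close> or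
    \<open>t\<close>, so one choice per point serves all increments.\<close>
  define P where "P x B' \<longleftrightarrow> (\<forall>t h. (\<forall>k. k \<notin> J \<longrightarrow> h $ k = 0) \<longrightarrow>
    quad_form B' (h + t *\<^sub>R axis i 1) = quad_form (B x) h + t * (\<Sum>l\<in>UNIV. a l i x * h $ l) + (a i i x / 2) * t\<^sup>2)" for x B'
  have "\<exists>B'. P x B'" for x
  proof (rule quad_form_extend[OF insert.hyps(2), of "B x" "\<lambda>l. a l i x" "a i i x / 2"])
    fix B' :: "real^'n^'n"
    assume "\<And>t h. (\<And>k. k \<notin> J \<Longrightarrow> h $ k = 0) \<Longrightarrow>
      quad_form B' (h + t *\<^sub>R axis i 1) = quad_form (B x) h + t * (\<Sum>l\<in>UNIV. a l i x * h $ l) + (a i i x / 2) * t\<^sup>2"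
    then have "P x B'" by (simp add: P_def)
    then show "\<exists>B'. P x B'" ..
  qed
  then obtain B' where "\<And>x. P x (B' x)" by metis
  then have B': "\<And>x t h. (\<forall>k. k \<notin> J \<longrightarrow> h $ k = 0) \<Longrightarrow>
    quad_form (B' x) (h + t *\<^sub>R axis i 1) = quad_form (B x) h + t * (\<Sum>l\<in>UNIV. a l i x * h $ l) + (a i i x / 2) * t\<^sup>2"
    unfolding P_def by simp
  have \<Psi>: "AE x in lborel. x \<in> O' \<longrightarrow> (\<lambda>m. \<integral>\<^sup>+z\<in>cube 1.
      d m x (coord_proj J z) + (c m x (coord_proj J z) + \<Phi> B m x (coord_proj J z)) \<partial>lborel) \<longlonglongrightarrow> 0"
    using B AE_cube_approximate_continuity[OF insert.hyps(1) assms(3)[of i i] r]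
      AE_first_order_assembly[OF assms(2)[of i] assms(3)[of _ i] assms(4) r Hu insert.hyps(1)]
  proof eventually_elim
    case (elim x)
    show ?case
    proof
      assume x: "x \<in> O'"
      have "(\<lambda>m. (\<integral>\<^sup>+z\<in>cube 1. d m x (coord_proj J z) \<partial>lborel) + ((\<integral>\<^sup>+z\<in>cube 1. c m x (coord_proj J z) \<partial>lborel)
           + (\<integral>\<^sup>+z\<in>cube 1. \<Phi> B m x (coord_proj J z) \<partial>lborel))) \<longlonglongrightarrow> 0 + (0 + 0)"
        using elim x unfolding c_def d_def by (intro tendsto_add) auto
      moreover have "(\<integral>\<^sup>+z\<in>cube 1. d m x (coord_proj J z) + (c m x (coord_proj J z) + \<Phi> B m x (coord_proj J z)) \<partial>lborel)
        = (\<integral>\<^sup>+z\<in>cube 1. d m x (coord_proj J z) \<partial>lborel) + ((\<integral>\<^sup>+z\<in>cube 1. c m x (coord_proj J z) \<partial>lborel)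
           + (\<integral>\<^sup>+z\<in>cube 1. \<Phi> B m x (coord_proj J z) \<partial>lborel))" for m
        by (simp add: distrib_right nn_integral_add)
      ultimately show "(\<lambda>m. \<integral>\<^sup>+z\<in>cube 1.
         d m x (coord_proj J z) + (c m x (coord_proj J z) + \<Phi> B m x (coord_proj J z)) \<partial>lborel) \<longlonglongrightarrow> 0"
        by simp
    qed
  qed
  have "AE x in lborel. x \<in> O' \<longrightarrow> (\<lambda>m. \<integral>\<^sup>+z\<in>cube 1. \<Phi> B' m x (coord_proj (insert i J) z) \<partial>lborel) \<longlonglongrightarrow> 0"
  proof (rule AE_coord_proj_insert_step[where \<Phi> = "\<Phi> B'" and \<Psi> = "\<lambda>m x h. d m x h + (c m x h + \<Phi> B m x h)" and
        \<Theta> = "\<lambda>m x t. ennreal (min 1 (\<bar>f (x + (r m * t) *\<^sub>R axis i 1) - f x - r m * t * u i x - (r m * t)\<^sup>2 / 2 * a i i x\<bar> / (r m)\<^sup>2))",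
        OF insert.hyps(2) assms(4) r _ _ _ _ Hf[of i] \<Psi>])
    show "\<Phi> B' m x (coord_proj J z + t *\<^sub>R axis i 1) \<le>
       ennreal (min 1 (\<bar>f (x + r m *\<^sub>R coord_proj J z + (r m * t) *\<^sub>R axis i 1) - f (x + r m *\<^sub>R coord_proj J z)
          - r m * t * u i (x + r m *\<^sub>R coord_proj J z) - (r m * t)\<^sup>2 / 2 * a i i (x + r m *\<^sub>R coord_proj J z)\<bar> / (r m)\<^sup>2)) +
       (d m x (coord_proj J z) + (c m x (coord_proj J z) + \<Phi> B m x (coord_proj J z)))" if t: "\<bar>t\<bar> \<le> 1" for m x z t
    proof -
      define h where "h = coord_proj J z"
      define y where "y = x + r m *\<^sub>R h"
      have rm: "r m > 0" by (rule r)
      have h0: "\<forall>k. k \<notin> J \<longrightarrow> h $ k = 0" by (simp add: h_def coord_proj_def)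
      define A where "A = f (y + (r m * t) *\<^sub>R axis i 1) - f y - r m * t * u i y - (r m * t)\<^sup>2 / 2 * a i i y"
      define D where "D = f y - f x - r m * (\<Sum>i\<in>UNIV. u i x * h $ i) - (r m)\<^sup>2 * quad_form (B x) h"
      \<comment> \<open>The error in the slope is multiplied by \<open>r m * t\<close>, so it is
        measured relative to \<open>r m\<close> and not to its square.\<close>
      define E where "E = u i y - u i x - r m * (\<Sum>j\<in>UNIV. a j i x * h $ j)"
      have "(\<Sum>j\<in>UNIV. u j x * (h + t *\<^sub>R axis i 1) $ j) = (\<Sum>j\<in>UNIV. u j x * h $ j + (if j = i then u i x * t else 0))"
        by (intro sum.cong) (auto simp: axis_def algebra_simps)
      also have "\<dots> = (\<Sum>j\<in>UNIV. u j x * h $ j) + u i x * t" by (simp add: sum.distrib)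
      finally have eq: "f (x + r m *\<^sub>R (h + t *\<^sub>R axis i 1)) - f x - r m * (\<Sum>j\<in>UNIV. u j x * (h + t *\<^sub>R axis i 1) $ j)
            - (r m)\<^sup>2 * quad_form (B' x) (h + t *\<^sub>R axis i 1)
        = A + r m * t * E + (r m * t)\<^sup>2 / 2 * (a i i y - a i i x) + D"
        unfolding B'[OF h0] A_def D_def E_def y_def
        by (simp add: scaleR_add_right add.assoc) (simp add: algebra_simps power2_eq_square)
      have "\<bar>A + r m * t * E + (r m * t)\<^sup>2 / 2 * (a i i y - a i i x) + D\<bar> / (r m)\<^sup>2
          \<le> \<bar>A\<bar> / (r m)\<^sup>2 + (\<bar>E\<bar> / r m + (\<bar>a i i y - a i i x\<bar> + \<bar>D\<bar> / (r m)\<^sup>2))"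
      proof -
        have 1: "\<bar>r m * t * E\<bar> \<le> r m * \<bar>E\<bar>"
          using rm t by (simp add: abs_mult mult_left_le_one_le mult.assoc)
        have "t\<^sup>2 \<le> 1" using t by (simp add: abs_square_le_1)
        then have "t\<^sup>2 / 2 \<le> 1" by simp
        then have "(r m)\<^sup>2 * (t\<^sup>2 / 2 * \<bar>a i i y - a i i x\<bar>) \<le> (r m)\<^sup>2 * \<bar>a i i y - a i i x\<bar>"
          by (intro mult_left_mono mult_left_le_one_le) auto
        then have 2: "\<bar>(r m * t)\<^sup>2 / 2 * (a i i y - a i i x)\<bar> \<le> (r m)\<^sup>2 * \<bar>a i i y - a i i x\<bar>"
          by (simp add: abs_mult power_mult_distrib)
        from 1 2 have "\<bar>A + r m * t * E + (r m * t)\<^sup>2 / 2 * (a i i y - a i i x) + D\<bar>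
          \<le> \<bar>A\<bar> + (r m * \<bar>E\<bar> + ((r m)\<^sup>2 * \<bar>a i i y - a i i x\<bar> + \<bar>D\<bar>))" by linarith
        then have "\<bar>A + r m * t * E + (r m * t)\<^sup>2 / 2 * (a i i y - a i i x) + D\<bar> / (r m)\<^sup>2
          \<le> (\<bar>A\<bar> + (r m * \<bar>E\<bar> + ((r m)\<^sup>2 * \<bar>a i i y - a i i x\<bar> + \<bar>D\<bar>))) / (r m)\<^sup>2"
          by (intro divide_right_mono) auto
        then show ?thesis using rm by (simp add: add_divide_distrib power2_eq_square)
      qed
      then have "ennreal (min 1 (\<bar>A + r m * t * E + (r m * t)\<^sup>2 / 2 * (a i i y - a i i x) + D\<bar> / (r m)\<^sup>2))
          \<le> ennreal (min 1 (\<bar>A\<bar> / (r m)\<^sup>2)) + ennreal (min 1 (\<bar>E\<bar> / r m + (\<bar>a i i y - a i i x\<bar> + \<bar>D\<bar> / (r m)\<^sup>2)))"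
        by (rule ennreal_min_1_add_le) (use rm in auto)
      also have "\<dots> \<le> ennreal (min 1 (\<bar>A\<bar> / (r m)\<^sup>2)) + (ennreal (min 1 (\<bar>E\<bar> / r m)) + ennreal (min 1 (\<bar>a i i y - a i i x\<bar> + \<bar>D\<bar> / (r m)\<^sup>2)))"
        by (intro add_left_mono ennreal_min_1_add_le) (use rm in auto)
      also have "\<dots> \<le> ennreal (min 1 (\<bar>A\<bar> / (r m)\<^sup>2)) + (ennreal (min 1 (\<bar>E\<bar> / r m)) + (ennreal (min 1 \<bar>a i i y - a i i x\<bar>) + ennreal (min 1 (\<bar>D\<bar> / (r m)\<^sup>2))))"
        by (intro add_left_mono ennreal_min_1_add_le) (use rm in auto)
      finally show ?thesis
        unfolding \<Phi>_def c_def d_def h_def[symmetric] eq y_def[symmetric] A_def[symmetric] D_def[symmetric] E_def[symmetric] .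
    qed
  qed measurable
  then show ?case unfolding \<Phi>_def by (rule exI[of _ B'])
qed

subsection \<open>Second-order expansions in measure\<close>

lemma Ck_on_2D:
  fixes f :: "real^'n::finite \<Rightarrow> real"
  assumes "Ck_on 2 U f"
  shows "continuous_on U f" "continuous_on U (partial_deriv i f)"
    "continuous_on U (partial_deriv i (partial_deriv j f))"
    "x + t *\<^sub>R axis i 1 \<in> U \<Longrightarrow>
       ((\<lambda>s. f (x + s *\<^sub>R axis i 1)) has_real_derivative partial_deriv i f (x + t *\<^sub>R axis i 1)) (at t)"
    "x + t *\<^sub>R axis i 1 \<in> U \<Longrightarrow>
       ((\<lambda>s. partial_deriv j f (x + s *\<^sub>R axis i 1)) has_real_derivative
          partial_deriv i (partial_deriv j f) (x + t *\<^sub>R axis i 1)) (at t)"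
proof -
  note C = assms[unfolded numeral_2_eq_2 Ck_on.simps]
  have shift: "((\<lambda>s. h (x + s *\<^sub>R axis i 1)) has_real_derivative partial_deriv i h (x + t *\<^sub>R axis i 1)) (at t)"
    if "\<And>y. y \<in> U \<Longrightarrow> (\<lambda>t. h (y + t *\<^sub>R axis i 1)) differentiable (at 0)" "x + t *\<^sub>R axis i 1 \<in> U"
    for h :: "real^'n \<Rightarrow> real" and x i t
  proof -
    have "((\<lambda>s. h (x + t *\<^sub>R axis i 1 + s *\<^sub>R axis i 1)) has_real_derivative partial_deriv i h (x + t *\<^sub>R axis i 1)) (at 0)"
      unfolding partial_deriv_def
      using that by (simp add: DERIV_deriv_iff_real_differentiable)
    then have "((\<lambda>s. h (x + (s + t) *\<^sub>R axis i 1)) has_real_derivative partial_deriv i h (x + t *\<^sub>R axis i 1)) (at 0)"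
      by (simp add: scaleR_add_left add.assoc add.commute add.left_commute)
    then show ?thesis
      using DERIV_shift[of "\<lambda>s. h (x + s *\<^sub>R axis i 1)" "partial_deriv i h (x + t *\<^sub>R axis i 1)" 0 t] by simp
  qed
  show "continuous_on U f" "continuous_on U (partial_deriv i f)"
    "continuous_on U (partial_deriv i (partial_deriv j f))" using C by auto
  show "((\<lambda>s. f (x + s *\<^sub>R axis i 1)) has_real_derivative partial_deriv i f (x + t *\<^sub>R axis i 1)) (at t)"
    if "x + t *\<^sub>R axis i 1 \<in> U" by (rule shift[OF _ that]) (use C in auto)
  show "((\<lambda>s. partial_deriv j f (x + s *\<^sub>R axis i 1)) has_real_derivative
          partial_deriv i (partial_deriv j f) (x + t *\<^sub>R axis i 1)) (at t)"
    if "x + t *\<^sub>R axis i 1 \<in> U" by (rule shift[OF _ that]) (use C in auto)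
qed

text \<open>An interpolation inequality: the mean value theorem realizes the average slope of
  \<open>\<phi>\<close> at an intermediate point, and the integral of the second derivative bounds
  the change of slope from \<open>0\<close> to there. It turns closeness of functions and bounded
  second derivatives into closeness of gradients.\<close>

lemma derivative_interpolation:
  fixes \<phi> \<phi>' \<phi>'' :: "real \<Rightarrow> real"
  assumes \<eta>: "\<eta> > 0"
    and d1: "\<And>t. t \<in> {0..\<eta>} \<Longrightarrow> (\<phi> has_real_derivative \<phi>' t) (at t)"
    and d2: "\<And>t. t \<in> {0..\<eta>} \<Longrightarrow> (\<phi>' has_real_derivative \<phi>'' t) (at t)"
    and c: "continuous_on {0..\<eta>} \<phi>''"
  shows "ennreal (\<eta> * \<bar>\<phi>' 0\<bar>) \<le> ennreal \<bar>\<phi> \<eta>\<bar> + ennreal \<bar>\<phi> 0\<bar> + ennreal \<eta> * (\<integral>\<^sup>+t\<in>{0..\<eta>}. ennreal \<bar>\<phi>'' t\<bar> \<partial>lborel)"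
proof -
  define V where "V = integral {0..\<eta>} (\<lambda>t. \<bar>\<phi>'' t\<bar>)"
  have i: "\<phi>'' integrable_on {a..b}" "(\<lambda>t. \<bar>\<phi>'' t\<bar>) integrable_on {a..b}" if "0 \<le> a" "b \<le> \<eta>" for a b
    using that c by (auto intro!: integrable_continuous_real continuous_intros elim: continuous_on_subset)
  have V0: "V \<ge> 0" unfolding V_def by (intro Henstock_Kurzweil_Integration.integral_nonneg i) auto
  have V: "(\<integral>\<^sup>+t\<in>{0..\<eta>}. ennreal \<bar>\<phi>'' t\<bar> \<partial>lborel) = ennreal V"
    unfolding V_def by (rule continuous_nn_integral_abs[OF c])
  have b: "\<bar>\<phi>' s - \<phi>' 0\<bar> \<le> V" if s: "s \<in> {0..\<eta>}" for s
  proof -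
    have "(\<phi>'' has_integral (\<phi>' s - \<phi>' 0)) {0..s}"
      by (rule FTC_subinterval[of 0 \<eta>]) (use s d2 in \<open>auto intro: has_field_derivative_at_within\<close>)
    then have "\<phi>' s - \<phi>' 0 = integral {0..s} \<phi>''" by (simp add: integral_unique)
    also have "\<bar>\<dots>\<bar> \<le> integral {0..s} (\<lambda>t. \<bar>\<phi>'' t\<bar>)"
      using integral_norm_bound_integral[of "\<phi>''" "{0..s}" "\<lambda>t. \<bar>\<phi>'' t\<bar>"] i[of 0 s] s by auto
    also have "\<dots> \<le> V" unfolding V_def by (intro integral_subset_le i) (use s in auto)
    finally show ?thesis .
  qed
  obtain z where z: "0 < z" "z < \<eta>" "\<phi> \<eta> - \<phi> 0 = (\<eta> - 0) * \<phi>' z"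
    using MVT2[OF \<eta>, of \<phi> \<phi>'] d1 by auto
  have "\<eta> * \<bar>\<phi>' 0\<bar> \<le> \<eta> * \<bar>\<phi>' z\<bar> + \<eta> * V"
    using b[of z] z \<eta> by (simp flip: distrib_left)
  also have "\<eta> * \<bar>\<phi>' z\<bar> = \<bar>\<phi> \<eta> - \<phi> 0\<bar>" using z \<eta> by (simp add: abs_mult)
  also have "\<dots> \<le> \<bar>\<phi> \<eta>\<bar> + \<bar>\<phi> 0\<bar>" by simp
  finally have "\<eta> * \<bar>\<phi>' 0\<bar> \<le> \<bar>\<phi> \<eta>\<bar> + \<bar>\<phi> 0\<bar> + \<eta> * V" by simp
  then have "ennreal (\<eta> * \<bar>\<phi>' 0\<bar>) \<le> ennreal (\<bar>\<phi> \<eta>\<bar> + \<bar>\<phi> 0\<bar> + \<eta> * V)" by (rule ennreal_leI)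
  also have "\<dots> = ennreal \<bar>\<phi> \<eta>\<bar> + ennreal \<bar>\<phi> 0\<bar> + ennreal \<eta> * ennreal V"
    using \<eta> V0 by (simp add: ennreal_mult)
  finally show ?thesis unfolding V .
qed

text \<open>An expansion valid for almost every increment is enough for averages over segments,
  because rescaling maps null sets to null sets.\<close>

lemma segment_average_error:
  fixes E :: "real \<Rightarrow> real"
  assumes [measurable]: "E \<in> borel_measurable borel" and r: "r \<longlonglongrightarrow> 0" "\<And>m::nat. r m > 0"
    and small: "\<And>\<epsilon>. \<epsilon> > 0 \<Longrightarrow> \<exists>d>0. AE h in lborel. \<bar>h\<bar> < d \<longrightarrow> \<bar>E h\<bar> \<le> \<epsilon> * \<bar>h\<bar> ^ q"
  shows "\<epsilon> > 0 \<Longrightarrow> \<forall>\<^sub>F m in sequentially. AE \<tau> in lborel. \<tau> \<in> {-1..1} \<longrightarrow> \<bar>E (r m * \<tau>)\<bar> \<le> \<epsilon> * r m ^ q"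
    and "(\<lambda>m. \<integral>\<^sup>+\<tau>\<in>{-1..1}. ennreal (min 1 (\<bar>E (r m * \<tau>)\<bar> / r m ^ q)) \<partial>lborel) \<longlonglongrightarrow> 0"
proof -
  show 1: "\<forall>\<^sub>F m in sequentially. AE \<tau> in lborel. \<tau> \<in> {-1..1} \<longrightarrow> \<bar>E (r m * \<tau>)\<bar> \<le> \<epsilon> * r m ^ q"
    if \<epsilon>: "\<epsilon> > 0" for \<epsilon>
  proof -
    obtain d where d: "d > 0" "AE h in lborel. \<bar>h\<bar> < d \<longrightarrow> \<bar>E h\<bar> \<le> \<epsilon> * \<bar>h\<bar> ^ q" using small[OF \<epsilon>] by blast
    have "\<forall>\<^sub>F m in sequentially. r m < d" by (rule order_tendstoD(2)[OF r(1) d(1)])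
    then show ?thesis
    proof eventually_elim
      case (elim m)
      have rm: "r m > 0" by (rule r)
      have "AE \<tau> in lborel. \<bar>0 + r m * \<tau>\<bar> < d \<longrightarrow> \<bar>E (0 + r m * \<tau>)\<bar> \<le> \<epsilon> * \<bar>0 + r m * \<tau>\<bar> ^ q"
        by (rule AE_borel_affine[OF _ _ d(2)]) (use rm in auto)
      then show ?case
      proof eventually_elim
        case (elim \<tau>)
        show ?case
        proof
          assume \<tau>: "\<tau> \<in> {-1..1}"
          then have le: "\<bar>r m * \<tau>\<bar> \<le> r m" using rm by (auto simp: abs_mult mult_left_le)
          have "\<bar>E (r m * \<tau>)\<bar> \<le> \<epsilon> * \<bar>r m * \<tau>\<bar> ^ q" using elim le \<open>r m < d\<close> by auto
          also have "\<dots> \<le> \<epsilon> * r m ^ q" using le \<epsilon> by (intro mult_left_mono power_mono) auto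
          finally show "\<bar>E (r m * \<tau>)\<bar> \<le> \<epsilon> * r m ^ q" .
        qed
      qed
    qed
  qed
  show "(\<lambda>m. \<integral>\<^sup>+\<tau>\<in>{-1..1}. ennreal (min 1 (\<bar>E (r m * \<tau>)\<bar> / r m ^ q)) \<partial>lborel) \<longlonglongrightarrow> 0"
  proof (rule tendsto_0_ennrealI)
    fix \<epsilon> :: real assume \<epsilon>: "\<epsilon> > 0"
    have "\<epsilon> / 2 > 0" using \<epsilon> by simp
    from 1[OF this] show "\<forall>\<^sub>F m in sequentially. (\<integral>\<^sup>+\<tau>\<in>{-1..1}. ennreal (min 1 (\<bar>E (r m * \<tau>)\<bar> / r m ^ q)) \<partial>lborel) \<le> ennreal \<epsilon>"
    proof eventually_elim
      case (elim m)
      have rm: "r m ^ q > 0" using r(2)[of m] by simp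
      have "(\<integral>\<^sup>+\<tau>\<in>{-1..1}. ennreal (min 1 (\<bar>E (r m * \<tau>)\<bar> / r m ^ q)) \<partial>lborel) \<le> (\<integral>\<^sup>+\<tau>. ennreal (\<epsilon>/2) * indicator {-1..1} \<tau> \<partial>(lborel::real measure))"
      proof (rule nn_integral_mono_AE)
        show "AE \<tau> in lborel. ennreal (min 1 (\<bar>E (r m * \<tau>)\<bar> / r m ^ q)) * indicator {-1..1} \<tau> \<le> ennreal (\<epsilon>/2) * indicator {-1..1} \<tau>"
          using elim
        proof eventually_elim
          case (elim \<tau>)
          have "min 1 (\<bar>E (r m * \<tau>)\<bar> / r m ^ q) \<le> \<epsilon>/2" if "\<tau> \<in> {-1..1}"
          proof -
            have "\<bar>E (r m * \<tau>)\<bar> / r m ^ q \<le> \<epsilon>/2" using elim that rm by (subst pos_divide_le_eq) auto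
            then show ?thesis by (rule min.coboundedI2)
          qed
          then show ?case by (auto split: split_indicator intro!: ennreal_leI)
        qed
      qed
      also have "\<dots> = ennreal (\<epsilon>/2) * 2" by (simp add: nn_integral_cmult)
      also have "\<dots> = ennreal \<epsilon>" using ennreal_mult[of "\<epsilon>/2" 2] \<epsilon> by simp
      finally show ?case .
    qed
  qed
qed

text \<open>Recovers the slope by integrals, hence by a formula that is Borel in further parameters.
  The weight \<open>\<tau>\<close> annihilates the constant term, and its square integrates to
  \<open>2/3\<close> over the interval, whence the factor.\<close>

lemma segment_average_slope:
  fixes \<phi> :: "real \<Rightarrow> real"
  assumes [measurable]: "\<phi> \<in> borel_measurable borel" and r: "r \<longlonglongrightarrow> 0" "\<And>m::nat. r m > 0"
    and small: "\<And>\<epsilon>. \<epsilon> > 0 \<Longrightarrow> \<exists>d>0. AE h in lborel. \<bar>h\<bar> < d \<longrightarrow> \<bar>\<phi> h - \<phi> 0 - a * h\<bar> \<le> \<epsilon> * \<bar>h\<bar>"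
  shows "(\<lambda>m. 3 / (2 * r m) * (LINT \<tau>:{-1..1}|lborel. \<tau> * \<phi> (r m * \<tau>))) \<longlonglongrightarrow> a"
proof (rule tendstoI)
  fix e :: real assume e: "e > 0"
  define E where "E h = \<phi> h - \<phi> 0 - a * h" for h
  have [measurable]: "E \<in> borel_measurable borel" unfolding E_def by measurable
  have "\<forall>\<^sub>F m in sequentially. AE \<tau> in lborel. \<tau> \<in> {-1..1} \<longrightarrow> \<bar>E (r m * \<tau>)\<bar> \<le> (e/4) * r m ^ 1"
    using small e by (intro segment_average_error(1)[OF _ r]) (auto simp: E_def)
  then show "\<forall>\<^sub>F m in sequentially. dist (3 / (2 * r m) * (LINT \<tau>:{-1..1}|lborel. \<tau> * \<phi> (r m * \<tau>))) a < e"
  proof eventually_elim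
    case (elim m)
    have rm: "r m > 0" by (rule r)
    let ?L = "\<lambda>\<tau>. \<tau> * (\<phi> 0 + a * (r m * \<tau>))"
    have iL: "set_integrable lborel {-1..1} ?L" by (intro borel_integrable_atLeastAtMost' continuous_intros)
    have "(?L has_integral ((\<phi> 0 * 1\<^sup>2 / 2 + a * r m * 1 ^ 3 / 3) - (\<phi> 0 * (-1)\<^sup>2 / 2 + a * r m * (-1) ^ 3 / 3))) {-1..1}"
      by (intro fundamental_theorem_of_calculus)
         (auto simp flip: has_real_derivative_iff_has_vector_derivative
           intro!: derivative_eq_intros simp: power2_eq_square algebra_simps)
    then have L: "(LINT \<tau>:{-1..1}|lborel. ?L \<tau>) = 2 / 3 * (a * r m)"
      using set_borel_integral_eq_integral(2)[OF iL] by (simp add: integral_unique)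
    have bnd: "AE \<tau> in lborel. norm (indicator {-1..1} \<tau> *\<^sub>R (\<tau> * E (r m * \<tau>))) \<le> indicator {-1..1} \<tau> *\<^sub>R (e/4 * r m)"
      using elim
    proof eventually_elim
      case (elim \<tau>)
      show ?case
      proof (cases "\<tau> \<in> {-1..1}")
        case True
        then have "\<bar>\<tau>\<bar> * \<bar>E (r m * \<tau>)\<bar> \<le> 1 * (e/4 * r m)" using elim by (intro mult_mono) auto
        with True show ?thesis by (simp add: abs_mult)
      qed simp
    qed
    have ic: "integrable lborel (\<lambda>\<tau>::real. indicator {-1..1} \<tau> *\<^sub>R (e/4 * r m))"
      by (intro integrable_scaleR_left impI integrable_real_indicator) auto
    have iE: "set_integrable lborel {-1..1} (\<lambda>\<tau>. \<tau> * E (r m * \<tau>))"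
      unfolding set_integrable_def
      by (rule Bochner_Integration.integrable_bound[OF ic]) (use bnd in \<open>auto elim!: eventually_mono intro: order_trans\<close>)
    have "\<bar>LINT \<tau>:{-1..1}|lborel. \<tau> * E (r m * \<tau>)\<bar> \<le> (LINT \<tau>:({-1..1}::real set)|lborel. e/4 * r m)"
      using order_trans[OF integral_norm_bound integral_mono_AE[OF integrable_norm[OF iE[unfolded set_integrable_def]] ic bnd]]
      unfolding set_lebesgue_integral_def by simp
    also have "\<dots> = e/2 * r m" by (simp add: set_lebesgue_integral_def)
    finally have 1: "\<bar>LINT \<tau>:{-1..1}|lborel. \<tau> * E (r m * \<tau>)\<bar> \<le> e/2 * r m" .
    have "(LINT \<tau>:{-1..1}|lborel. \<tau> * \<phi> (r m * \<tau>)) = (LINT \<tau>:{-1..1}|lborel. \<tau> * E (r m * \<tau>) + ?L \<tau>)"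
      by (simp add: E_def algebra_simps)
    also have "\<dots> = (LINT \<tau>:{-1..1}|lborel. \<tau> * E (r m * \<tau>)) + 2/3 * (a * r m)"
      by (subst set_integral_add(2)[OF iE iL]) (simp add: L)
    finally have "3 / (2 * r m) * (LINT \<tau>:{-1..1}|lborel. \<tau> * \<phi> (r m * \<tau>)) - a
        = 3 / (2 * r m) * (LINT \<tau>:{-1..1}|lborel. \<tau> * E (r m * \<tau>))"
      using rm by (simp add: field_simps)
    also have "\<bar>\<dots>\<bar> = 3 / (2 * r m) * \<bar>LINT \<tau>:{-1..1}|lborel. \<tau> * E (r m * \<tau>)\<bar>"
      using rm by (simp add: abs_mult)
    also have "\<dots> \<le> 3 / (2 * r m) * (e/2 * r m)" using 1 rm by (intro mult_left_mono) auto
    also have "\<dots> < e" using rm e by simp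
    finally show ?case by (simp add: dist_real_def)
  qed
qed

lemma AE_summable_of_L1_geometric:
  fixes h :: "nat \<Rightarrow> 'a \<Rightarrow> ennreal"
  assumes [measurable]: "\<And>n. h n \<in> borel_measurable M" and le: "\<And>n. (\<integral>\<^sup>+x. h n x \<partial>M) \<le> ennreal (c * (1/2)^n)" and "c \<ge> 0"
  shows "AE x in M. (\<Sum>n. h n x) < \<infinity>"
proof -
  have "(\<integral>\<^sup>+x. (\<Sum>n. h n x) \<partial>M) = (\<Sum>n. \<integral>\<^sup>+x. h n x \<partial>M)" by (rule nn_integral_suminf) auto
  also have "\<dots> \<le> (\<Sum>n. ennreal (c * (1/2)^n))" by (intro suminf_le le) auto
  also have "\<dots> = ennreal (\<Sum>n. c * (1/2)^n)"
    using assms(3) by (intro suminf_ennreal2 summable_mult summable_geometric) auto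
  also have "\<dots> < \<infinity>" by simp
  finally have "AE x in M. (\<Sum>n. h n x) \<noteq> \<infinity>" by (intro nn_integral_PInf_AE) auto
  then show ?thesis by (simp add: less_top)
qed

section \<open>Sequences with Hessians bounded in the mean\<close>

text \<open>Nested cubes provide the margins: expansions are claimed inside \<open>Q 1\<close>,
  segments of half-length \<open>\<rho>\<close> start in \<open>Q 2\<close> and stay in
  \<open>Q 3\<close>, and the gradients converge on \<open>Q 3\<close> because the interpolation
  there looks one step further, into \<open>Q 4\<close>. The bound on second derivatives will come
  from the minors of size one.\<close>

locale bounded_hessians =
  fixes U :: "(real^'n::finite) set" and f :: "nat \<Rightarrow> real^'n \<Rightarrow> real" and g :: "real^'n \<Rightarrow> real"
    and x0 :: "real^'n" and \<rho> C :: real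
  assumes \<rho>: "\<rho> > 0" and C0: "C \<ge> 0" and openU: "open U"
    and sub: "\<And>x. x - x0 \<in> cube (4 * \<rho>) \<Longrightarrow> x \<in> U"
    and Ck: "\<And>k. Ck_on 2 U (f k)"
    and g_meas [measurable]: "g \<in> borel_measurable borel"
    and conv: "(\<lambda>k. \<integral>\<^sup>+x. ennreal \<bar>f k x - g x\<bar> * indicator {x. x - x0 \<in> cube (4 * \<rho>)} x \<partial>lborel) \<longlonglongrightarrow> 0"
    and hess: "\<And>k i j. (\<integral>\<^sup>+x. ennreal \<bar>partial_deriv i (partial_deriv j (f k)) x\<bar> * indicator {x. x - x0 \<in> cube (4 * \<rho>)} x \<partial>lborel) \<le> ennreal C"
begin

definition Q :: "real \<Rightarrow> (real^'n) set" where "Q s = {x. x - x0 \<in> cube (s * \<rho>)}"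

lemma Q_borel [measurable, simp]: "Q s \<in> sets borel"
  unfolding Q_def by measurable

lemma Q4_sub: "Q 4 \<subseteq> U" using sub by (auto simp: Q_def)

lemma Q_step: "x \<in> Q s \<Longrightarrow> \<bar>t\<bar> \<le> \<rho> \<Longrightarrow> x + t *\<^sub>R axis i 1 \<in> Q (s + 1)"
proof -
  assume x: "x \<in> Q s" and t: "\<bar>t\<bar> \<le> \<rho>"
  have "\<bar>(x + t *\<^sub>R axis i 1 - x0) $ j\<bar> \<le> (s + 1) * \<rho>" for j
  proof -
    have "\<bar>(x - x0) $ j\<bar> \<le> s * \<rho>" using x by (simp add: Q_def cube_def)
    moreover have "\<bar>(t *\<^sub>R axis i 1 :: real^'n) $ j\<bar> \<le> \<rho>" using t \<rho> by (auto simp: axis_def)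
    moreover have "(x + t *\<^sub>R axis i 1 - x0) $ j = (x - x0) $ j + (t *\<^sub>R axis i 1 :: real^'n) $ j" by simp
    ultimately show ?thesis by (simp only: distrib_right)
  qed
  then show ?thesis by (simp add: Q_def cube_def)
qed

lemma Q_mono: "s \<le> s' \<Longrightarrow> Q s \<subseteq> Q s'"
proof
  fix x assume "s \<le> s'" "x \<in> Q s"
  then have "\<bar>(x - x0) $ j\<bar> \<le> s * \<rho>" "s * \<rho> \<le> s' * \<rho>" for j
    using \<rho> by (auto simp: Q_def cube_def)
  then show "x \<in> Q s'" unfolding Q_def cube_def by (auto intro: order_trans)
qed

text \<open>The cut-off makes the functions Borel on the whole space while leaving them unchanged on
  \<open>Q 4\<close>.\<close>

definition F :: "nat \<Rightarrow> real^'n \<Rightarrow> real" where "F k x = indicator (Q 4) x * f k x"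
definition G :: "'n \<Rightarrow> nat \<Rightarrow> real^'n \<Rightarrow> real" where "G j k x = indicator (Q 4) x * partial_deriv j (f k) x"
definition H :: "'n \<Rightarrow> 'n \<Rightarrow> nat \<Rightarrow> real^'n \<Rightarrow> real" where
  "H i j k x = indicator (Q 4) x * partial_deriv i (partial_deriv j (f k)) x"

lemma FGH_borel [measurable]: "F k \<in> borel_measurable borel" "G j k \<in> borel_measurable borel" "H i j k \<in> borel_measurable borel"
proof -
  have "(\<lambda>x. indicator (Q 4) x *\<^sub>R h x) \<in> borel_measurable borel" if "continuous_on U h" for h :: "real^'n \<Rightarrow> real"
    using that Q4_sub by (intro borel_measurable_continuous_on_indicator) (auto intro: continuous_on_subset)
  from this[OF Ck_on_2D(1)[OF Ck]] this[OF Ck_on_2D(2)[OF Ck]] this[OF Ck_on_2D(3)[OF Ck]]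
  show "F k \<in> borel_measurable borel" "G j k \<in> borel_measurable borel" "H i j k \<in> borel_measurable borel"
    by (simp_all add: F_def[abs_def] G_def[abs_def] H_def[abs_def])
qed

lemma FGH_eq: "x \<in> Q 4 \<Longrightarrow> F k x = f k x" "x \<in> Q 4 \<Longrightarrow> G j k x = partial_deriv j (f k) x"
   "x \<in> Q 4 \<Longrightarrow> H i j k x = partial_deriv i (partial_deriv j (f k)) x"
  by (simp_all add: F_def G_def H_def)

lemma conv': "(\<lambda>k. \<integral>\<^sup>+x\<in>Q 4. ennreal \<bar>F k x - g x\<bar> \<partial>lborel) \<longlonglongrightarrow> 0"
proof -
  have "(\<integral>\<^sup>+x\<in>Q 4. ennreal \<bar>F k x - g x\<bar> \<partial>lborel) = (\<integral>\<^sup>+x. ennreal \<bar>f k x - g x\<bar> * indicator {x. x - x0 \<in> cube (4 * \<rho>)} x \<partial>lborel)" for k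
    by (intro nn_integral_cong) (auto simp: Q_def[symmetric] F_def split: split_indicator)
  then show ?thesis using conv by simp
qed

lemma hess': "(\<integral>\<^sup>+x. ennreal \<bar>H i j k x\<bar> \<partial>lborel) \<le> ennreal C"
proof -
  have "(\<integral>\<^sup>+x. ennreal \<bar>H i j k x\<bar> \<partial>lborel) = (\<integral>\<^sup>+x. ennreal \<bar>partial_deriv i (partial_deriv j (f k)) x\<bar> * indicator {x. x - x0 \<in> cube (4 * \<rho>)} x \<partial>lborel)"
    by (intro nn_integral_cong) (auto simp: Q_def[symmetric] H_def split: split_indicator)
  then show ?thesis using hess by simp
qed

lemma line_FG:
  assumes "x \<in> Q 2" "t \<in> {-\<rho>..\<rho>}"
  shows "((\<lambda>s. F k (x + s *\<^sub>R axis i 1)) has_real_derivative G i k (x + t *\<^sub>R axis i 1)) (at t within {-\<rho>..\<rho>})"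
    "((\<lambda>s. G j k (x + s *\<^sub>R axis i 1)) has_real_derivative H i j k (x + t *\<^sub>R axis i 1)) (at t within {-\<rho>..\<rho>})"
proof -
  have Q: "x + s *\<^sub>R axis i 1 \<in> Q 4" if "s \<in> {-\<rho>..\<rho>}" for s
    using Q_step[OF assms(1), of s i] Q_mono[of 3 4] that by auto
  have U: "x + t *\<^sub>R axis i 1 \<in> U" using Q[OF assms(2)] Q4_sub by auto
  have "((\<lambda>s. f k (x + s *\<^sub>R axis i 1)) has_real_derivative G i k (x + t *\<^sub>R axis i 1)) (at t within {-\<rho>..\<rho>})"
    using Ck_on_2D(4)[OF Ck U] FGH_eq(2)[OF Q[OF assms(2)]] by (simp add: has_field_derivative_at_within)
  then show "((\<lambda>s. F k (x + s *\<^sub>R axis i 1)) has_real_derivative G i k (x + t *\<^sub>R axis i 1)) (at t within {-\<rho>..\<rho>})"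
    by (rule has_field_derivative_transform_within[where d = 1]) (use assms Q FGH_eq(1) in auto)
  have "((\<lambda>s. partial_deriv j (f k) (x + s *\<^sub>R axis i 1)) has_real_derivative H i j k (x + t *\<^sub>R axis i 1)) (at t within {-\<rho>..\<rho>})"
    using Ck_on_2D(5)[OF Ck U] FGH_eq(3)[OF Q[OF assms(2)]] by (simp add: has_field_derivative_at_within)
  then show "((\<lambda>s. G j k (x + s *\<^sub>R axis i 1)) has_real_derivative H i j k (x + t *\<^sub>R axis i 1)) (at t within {-\<rho>..\<rho>})"
    by (rule has_field_derivative_transform_within[where d = 1]) (use assms Q FGH_eq(2) in auto)
qed

lemma line_continuous:
  assumes "x \<in> Q 2"
  shows "continuous_on {-\<rho>..\<rho>} (\<lambda>t. G j k (x + t *\<^sub>R axis i 1))" "continuous_on {-\<rho>..\<rho>} (\<lambda>t. H i j k (x + t *\<^sub>R axis i 1))"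
proof -
  have Q: "x + s *\<^sub>R axis i 1 \<in> Q 4" if "s \<in> {-\<rho>..\<rho>}" for s
    using Q_step[OF assms(1), of s i] Q_mono[of 3 4] that by auto
  show "continuous_on {-\<rho>..\<rho>} (\<lambda>t. G j k (x + t *\<^sub>R axis i 1))"
    unfolding continuous_on_eq_continuous_within
    using line_FG(2)[OF assms] DERIV_continuous by blast
  have "continuous_on {-\<rho>..\<rho>} (\<lambda>t. partial_deriv i (partial_deriv j (f k)) (x + t *\<^sub>R axis i 1))"
    using Q Q4_sub by (intro continuous_on_compose2[OF Ck_on_2D(3)[OF Ck]] continuous_intros) auto
  then show "continuous_on {-\<rho>..\<rho>} (\<lambda>t. H i j k (x + t *\<^sub>R axis i 1))"
    by (rule continuous_on_eq) (use Q FGH_eq(3) in auto)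
qed

text \<open>The interpolation inequality integrated over \<open>Q 3\<close>. Integrating the second
  derivatives over a segment of length \<open>\<eta>\<close> yields another factor
  \<open>\<eta>\<close>, so their contribution is quadratic and can be beaten by dividing by
  \<open>\<eta>\<close>.\<close>

lemma gradient_Cauchy_bound:
  assumes \<eta>: "0 < \<eta>" "\<eta> \<le> \<rho>"
  shows "ennreal \<eta> * (\<integral>\<^sup>+x\<in>Q 3. ennreal \<bar>G i k x - G i l x\<bar> \<partial>lborel)
     \<le> 2 * (\<integral>\<^sup>+x\<in>Q 4. ennreal \<bar>F k x - F l x\<bar> \<partial>lborel) + ennreal (2 * \<eta>\<^sup>2 * C)"
proof -
  let ?e = "axis i 1 :: real^'n"
  let ?D = "\<lambda>x. ennreal \<bar>F k x - F l x\<bar> * indicator (Q 4) x"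
  let ?K = "\<lambda>x. \<integral>\<^sup>+t\<in>{0..\<eta>}. ennreal \<bar>H i i k (x + t *\<^sub>R ?e) - H i i l (x + t *\<^sub>R ?e)\<bar> \<partial>lborel"
  have pw: "ennreal (\<eta> * \<bar>G i k x - G i l x\<bar>) \<le> ?D (x + \<eta> *\<^sub>R ?e) + ?D x + ennreal \<eta> * ?K x" if x: "x \<in> Q 3" for x
  proof -
    have Q: "x + s *\<^sub>R ?e \<in> Q 4" if "s \<in> {0..\<eta>}" for s
      using Q_step[OF x, of s i] \<eta> that by auto
    let ?\<phi> = "\<lambda>t. f k (x + t *\<^sub>R ?e) - f l (x + t *\<^sub>R ?e)"
    let ?\<phi>' = "\<lambda>t. partial_deriv i (f k) (x + t *\<^sub>R ?e) - partial_deriv i (f l) (x + t *\<^sub>R ?e)"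
    let ?\<phi>'' = "\<lambda>t. partial_deriv i (partial_deriv i (f k)) (x + t *\<^sub>R ?e) - partial_deriv i (partial_deriv i (f l)) (x + t *\<^sub>R ?e)"
    have "ennreal (\<eta> * \<bar>?\<phi>' 0\<bar>) \<le> ennreal \<bar>?\<phi> \<eta>\<bar> + ennreal \<bar>?\<phi> 0\<bar> + ennreal \<eta> * (\<integral>\<^sup>+t\<in>{0..\<eta>}. ennreal \<bar>?\<phi>'' t\<bar> \<partial>lborel)"
    proof (rule derivative_interpolation[OF \<eta>(1)])
      fix t assume "t \<in> {0..\<eta>}"
      then have U: "x + t *\<^sub>R ?e \<in> U" using Q Q4_sub by blast
      show "(?\<phi> has_real_derivative ?\<phi>' t) (at t)"
        by (intro DERIV_diff Ck_on_2D(4)[OF Ck] U)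
      show "(?\<phi>' has_real_derivative ?\<phi>'' t) (at t)"
        by (intro DERIV_diff Ck_on_2D(5)[OF Ck] U)
    next
      show "continuous_on {0..\<eta>} ?\<phi>''"
        using Q Q4_sub by (intro continuous_on_diff continuous_on_compose2[OF Ck_on_2D(3)[OF Ck]] continuous_intros) auto
    qed
    also have "(\<integral>\<^sup>+t\<in>{0..\<eta>}. ennreal \<bar>?\<phi>'' t\<bar> \<partial>lborel) = ?K x"
      by (intro nn_integral_cong) (use Q in \<open>auto simp: FGH_eq split: split_indicator\<close>)
    finally show ?thesis using Q[of \<eta>] Q[of 0] \<eta> by (simp add: FGH_eq)
  qed
  have K: "(\<integral>\<^sup>+x. ?K x \<partial>lborel) \<le> ennreal \<eta> * (ennreal C + ennreal C)"
  proof -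
    have "(\<integral>\<^sup>+x. ?K x \<partial>lborel) = emeasure lborel {0..\<eta>} * (\<integral>\<^sup>+x. ennreal \<bar>H i i k x - H i i l x\<bar> \<partial>lborel)"
      by (rule nn_integral_translation_Fubini[of "\<lambda>x. ennreal \<bar>H i i k x - H i i l x\<bar>"]) measurable
    also have "(\<integral>\<^sup>+x. ennreal \<bar>H i i k x - H i i l x\<bar> \<partial>lborel) \<le> (\<integral>\<^sup>+x. ennreal \<bar>H i i k x\<bar> + ennreal \<bar>H i i l x\<bar> \<partial>lborel)"
      by (intro nn_integral_mono) (auto simp flip: ennreal_plus intro!: ennreal_leI)
    also have "\<dots> \<le> ennreal C + ennreal C"
      by (subst nn_integral_add) (auto intro!: add_mono hess')
    finally show ?thesis using \<eta> by (simp add: mult_left_mono)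
  qed
  have "ennreal \<eta> * (\<integral>\<^sup>+x\<in>Q 3. ennreal \<bar>G i k x - G i l x\<bar> \<partial>lborel)
      = (\<integral>\<^sup>+x\<in>Q 3. ennreal (\<eta> * \<bar>G i k x - G i l x\<bar>) \<partial>lborel)"
    using \<eta> by (subst nn_integral_cmult[symmetric]) (auto simp: ennreal_mult mult.assoc)
  also have "\<dots> \<le> (\<integral>\<^sup>+x. ?D (x + \<eta> *\<^sub>R ?e) + (?D x + ennreal \<eta> * ?K x) \<partial>lborel)"
  proof (rule nn_integral_mono)
    fix x
    show "ennreal (\<eta> * \<bar>G i k x - G i l x\<bar>) * indicator (Q 3) x \<le> ?D (x + \<eta> *\<^sub>R ?e) + (?D x + ennreal \<eta> * ?K x)"
    proof (cases "x \<in> Q 3")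
      case True
      then have "indicator (Q 3) x = (1::ennreal)" by simp
      then show ?thesis using pw[OF True] by (simp only: mult_1_right add.assoc)
    next
      case False
      then have "indicator (Q 3) x = (0::ennreal)" by simp
      then show ?thesis by (simp only: mult_zero_right zero_le)
    qed
  qed
  also have "\<dots> = (\<integral>\<^sup>+x. ?D (x + \<eta> *\<^sub>R ?e) \<partial>lborel) + ((\<integral>\<^sup>+x. ?D x \<partial>lborel) + ennreal \<eta> * (\<integral>\<^sup>+x. ?K x \<partial>lborel))"
    by (simp add: nn_integral_add nn_integral_cmult)
  also have "(\<integral>\<^sup>+x. ?D (x + \<eta> *\<^sub>R ?e) \<partial>lborel) = (\<integral>\<^sup>+x. ?D x \<partial>lborel)"
    by (rule nn_integral_lborel_translation) measurable
  also have "(\<integral>\<^sup>+x. ?D x \<partial>lborel) + ((\<integral>\<^sup>+x. ?D x \<partial>lborel) + ennreal \<eta> * (\<integral>\<^sup>+x. ?K x \<partial>lborel))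
     \<le> (\<integral>\<^sup>+x. ?D x \<partial>lborel) + ((\<integral>\<^sup>+x. ?D x \<partial>lborel) + ennreal \<eta> * (ennreal \<eta> * (ennreal C + ennreal C)))"
    by (intro add_left_mono mult_left_mono K) auto
  also have "ennreal \<eta> * (ennreal \<eta> * (ennreal C + ennreal C)) = ennreal (2 * \<eta>\<^sup>2 * C)"
    using \<eta> C0 by (simp add: ennreal_plus[symmetric] ennreal_mult[symmetric] power2_eq_square mult_ac del: ennreal_plus)
  finally show ?thesis unfolding mult_2 add.assoc .
qed

lemma gradient_Cauchy:
  assumes "\<epsilon> > 0"
  obtains K where "\<And>k l i. K \<le> k \<Longrightarrow> K \<le> l \<Longrightarrow> (\<integral>\<^sup>+x\<in>Q 3. ennreal \<bar>G i k x - G i l x\<bar> \<partial>lborel) \<le> ennreal \<epsilon>"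
proof -
  \<comment> \<open>The factor \<open>4 * (C + 1)\<close> makes the second-derivative term at most
    half of \<open>\<eta> * \<epsilon>\<close>; the other half is left for the function term, which
    is small once \<open>k\<close> and \<open>l\<close> are large.\<close>
  define \<eta> where "\<eta> = min \<rho> (\<epsilon> / (4 * (C + 1)))"
  have \<eta>: "\<eta> > 0" "\<eta> \<le> \<rho>" using \<rho> assms C0 by (auto simp: \<eta>_def)
  have "\<eta> \<le> \<epsilon> / (4 * (C + 1))" by (simp add: \<eta>_def)
  then have "\<eta> * (4 * (C + 1)) \<le> \<epsilon>" using C0 by (subst (asm) pos_le_divide_eq) auto
  then have \<eta>2: "2 * \<eta>\<^sup>2 * C \<le> \<eta> * \<epsilon> / 2"
  proof -
    have "2 * \<eta>\<^sup>2 * C \<le> \<eta> * (\<eta> * (4 * (C + 1))) / 2"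
      using \<eta> C0 by (simp add: power2_eq_square algebra_simps)
    also have "\<dots> \<le> \<eta> * \<epsilon> / 2"
      using \<open>\<eta> * (4 * (C + 1)) \<le> \<epsilon>\<close> \<eta> by (intro divide_right_mono mult_left_mono) auto
    finally show ?thesis .
  qed
  have "\<forall>\<^sub>F k in sequentially. (\<integral>\<^sup>+x\<in>Q 4. ennreal \<bar>F k x - g x\<bar> \<partial>lborel) \<le> ennreal (\<eta> * \<epsilon> / 8)"
    using conv' \<eta> assms by (intro tendsto_0_ennrealD) auto
  then obtain K where K: "\<And>k. k \<ge> K \<Longrightarrow> (\<integral>\<^sup>+x\<in>Q 4. ennreal \<bar>F k x - g x\<bar> \<partial>lborel) \<le> ennreal (\<eta> * \<epsilon> / 8)"
    by (auto simp: eventually_sequentially)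
  show ?thesis
  proof (rule that)
    fix k l i assume kl: "K \<le> k" "K \<le> l"
    have "(\<integral>\<^sup>+x\<in>Q 4. ennreal \<bar>F k x - F l x\<bar> \<partial>lborel)
       \<le> (\<integral>\<^sup>+x. ennreal \<bar>F k x - g x\<bar> * indicator (Q 4) x + ennreal \<bar>F l x - g x\<bar> * indicator (Q 4) x \<partial>lborel)"
      by (intro nn_integral_mono) (auto simp flip: ennreal_plus intro!: ennreal_leI split: split_indicator)
    also have "\<dots> \<le> ennreal (\<eta> * \<epsilon> / 8) + ennreal (\<eta> * \<epsilon> / 8)"
      using add_mono[OF K[OF kl(1)] K[OF kl(2)]] by (subst nn_integral_add) measurable
    also have "\<dots> = ennreal (\<eta> * \<epsilon> / 4)" using \<eta> assms by (simp flip: ennreal_plus)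
    finally have "2 * (\<integral>\<^sup>+x\<in>Q 4. ennreal \<bar>F k x - F l x\<bar> \<partial>lborel) \<le> 2 * ennreal (\<eta> * \<epsilon> / 4)"
      by (rule mult_left_mono) simp
    also have "2 * ennreal (\<eta> * \<epsilon> / 4) = ennreal (\<eta> * \<epsilon> / 2)"
      using ennreal_mult[of 2 "\<eta> * \<epsilon> / 4"] \<eta> assms by (simp add: mult.commute)
    finally have "ennreal \<eta> * (\<integral>\<^sup>+x\<in>Q 3. ennreal \<bar>G i k x - G i l x\<bar> \<partial>lborel) \<le> ennreal (\<eta> * \<epsilon> / 2) + ennreal (2 * \<eta>\<^sup>2 * C)"
      using gradient_Cauchy_bound[OF \<eta>, of i k l] by (meson add_right_mono order_trans)
    also have "\<dots> \<le> ennreal (\<eta> * \<epsilon> / 2) + ennreal (\<eta> * \<epsilon> / 2)" by (intro add_left_mono ennreal_leI \<eta>2)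
    also have "\<dots> = ennreal \<eta> * ennreal \<epsilon>" using \<eta> assms by (simp flip: ennreal_plus ennreal_mult)
    finally show "(\<integral>\<^sup>+x\<in>Q 3. ennreal \<bar>G i k x - G i l x\<bar> \<partial>lborel) \<le> ennreal \<epsilon>"
      using \<eta> by (subst (asm) ennreal_mult_le_mult_iff) auto
  qed
qed

lemma fast_subsequence:
  obtains \<sigma> :: "nat \<Rightarrow> nat" where "strict_mono \<sigma>"
    "\<And>n. (\<integral>\<^sup>+x\<in>Q 4. ennreal \<bar>F (\<sigma> n) x - g x\<bar> \<partial>lborel) \<le> ennreal ((1/2)^n)"
    "\<And>n i. (\<integral>\<^sup>+x\<in>Q 3. ennreal \<bar>G i (\<sigma> (Suc n)) x - G i (\<sigma> n) x\<bar> \<partial>lborel) \<le> ennreal ((1/2)^n)"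
proof -
  define P where "P n K \<longleftrightarrow> (\<forall>k\<ge>K. (\<integral>\<^sup>+x\<in>Q 4. ennreal \<bar>F k x - g x\<bar> \<partial>lborel) \<le> ennreal ((1/2)^n)) \<and>
     (\<forall>k\<ge>K. \<forall>l\<ge>K. \<forall>i. (\<integral>\<^sup>+x\<in>Q 3. ennreal \<bar>G i k x - G i l x\<bar> \<partial>lborel) \<le> ennreal ((1/2)^n))" for n K :: nat
  have "\<exists>K. P n K" for n
  proof -
    have "\<forall>\<^sub>F k in sequentially. (\<integral>\<^sup>+x\<in>Q 4. ennreal \<bar>F k x - g x\<bar> \<partial>lborel) \<le> ennreal ((1/2)^n)"
      using conv' by (intro tendsto_0_ennrealD) auto
    then obtain K1 where K1: "\<And>k. k \<ge> K1 \<Longrightarrow> (\<integral>\<^sup>+x\<in>Q 4. ennreal \<bar>F k x - g x\<bar> \<partial>lborel) \<le> ennreal ((1/2)^n)"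
      by (auto simp: eventually_sequentially)
    obtain K2 where K2: "\<And>k l i. K2 \<le> k \<Longrightarrow> K2 \<le> l \<Longrightarrow> (\<integral>\<^sup>+x\<in>Q 3. ennreal \<bar>G i k x - G i l x\<bar> \<partial>lborel) \<le> ennreal ((1/2)^n)"
    proof (rule gradient_Cauchy)
      show "(0::real) < (1/2)^n" by simp
    qed (rule that, assumption)
    have "P n (max K1 K2)" unfolding P_def using K1 K2 by auto
    then show ?thesis ..
  qed
  then obtain K where K: "\<And>n. P n (K n)" by metis
  \<comment> \<open>Summing the thresholds makes \<open>\<sigma>\<close> strictly increasing and at
    least \<open>K n\<close>, whether or not \<open>K\<close> is monotone.\<close>
  define \<sigma> where "\<sigma> n = (\<Sum>m\<le>n. Suc (K m))" for n
  have "strict_mono \<sigma>" unfolding strict_mono_Suc_iff by (simp add: \<sigma>_def)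
  moreover have KP: "K n \<le> \<sigma> n" for n
    using member_le_sum[of n "{..n}" "\<lambda>m. Suc (K m)"] by (auto simp: \<sigma>_def)
  moreover have "K n \<le> \<sigma> (Suc n)" for n using KP[of n] by (simp add: \<sigma>_def)
  ultimately show ?thesis using K unfolding P_def by (intro that[of \<sigma>]) blast+
qed

lemma Q_interior_step:
  assumes "x \<notin> Q 2" "\<bar>t\<bar> \<le> \<rho>" shows "x + t *\<^sub>R axis i 1 \<notin> Q 1"
proof
  assume "x + t *\<^sub>R axis i 1 \<in> Q 1"
  from Q_step[OF this, of "-t" i] assms show False by simp
qed

text \<open>The slopes \<open>u\<close> and the second derivatives \<open>a\<close> are defined as
  limits of Borel expressions ahead of any line. The one-dimensional results, whose coefficients
  depend on the line, then merely identify their values, and measurability lets Fubini pass from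
  lines to points.\<close>

theorem AE_approximate_Taylor:
  assumes r: "r \<longlonglongrightarrow> 0" "\<And>m::nat. r m > 0"
  shows "\<exists>u B. AE x in lborel. x \<in> interior (Q 1) \<longrightarrow> (\<lambda>m. \<integral>\<^sup>+z\<in>cube 1.
     ennreal (min 1 (\<bar>g (x + r m *\<^sub>R z) - g x - r m * (\<Sum>i\<in>UNIV. u i x * z $ i)
       - (r m)\<^sup>2 * quad_form (B x) z\<bar> / (r m)\<^sup>2)) \<partial>lborel) \<longlonglongrightarrow> 0"
proof -
  obtain \<sigma> :: "nat \<Rightarrow> nat" where \<sigma>: "strict_mono \<sigma>"
    "\<And>n. (\<integral>\<^sup>+x\<in>Q 4. ennreal \<bar>F (\<sigma> n) x - g x\<bar> \<partial>lborel) \<le> ennreal ((1/2)^n)"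
    "\<And>n i. (\<integral>\<^sup>+x\<in>Q 3. ennreal \<bar>G i (\<sigma> (Suc n)) x - G i (\<sigma> n) x\<bar> \<partial>lborel) \<le> ennreal ((1/2)^n)"
    by (rule fast_subsequence) (rule that)
  define u where "u j x = lim (\<lambda>n. indicator (Q 3) x * G j (\<sigma> n) x)" for j x
  have [measurable]: "u j \<in> borel_measurable borel" for j unfolding u_def by measurable
  define dG where "dG j n x = ennreal \<bar>G j (\<sigma> (Suc n)) x - G j (\<sigma> n) x\<bar> * indicator (Q 3) x" for j n x
  have [measurable]: "dG j n \<in> borel_measurable borel" for j n unfolding dG_def by measurable
  have limF: "AE x in lborel. x \<in> Q 4 \<longrightarrow> (\<lambda>n. F (\<sigma> n) x) \<longlonglongrightarrow> g x"
  proof -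
    have "AE x in lborel. (\<Sum>n. ennreal \<bar>F (\<sigma> n) x - g x\<bar> * indicator (Q 4) x) < \<infinity>"
      by (rule AE_summable_of_L1_geometric[where c = 1]) (use \<sigma>(2) in auto)
    then show ?thesis
    proof eventually_elim
      case (elim x)
      show ?case
      proof
        assume x: "x \<in> Q 4"
        then have "(\<Sum>n. ennreal \<bar>F (\<sigma> n) x - g x\<bar>) < \<infinity>" using elim by auto
        then have "summable (\<lambda>n. \<bar>F (\<sigma> n) x - g x\<bar>)" by (intro summable_suminf_not_top) auto
        then have "(\<lambda>n. \<bar>F (\<sigma> n) x - g x\<bar>) \<longlonglongrightarrow> 0" by (rule summable_LIMSEQ_zero)
        then have "(\<lambda>n. F (\<sigma> n) x - g x) \<longlonglongrightarrow> 0" by (simp add: tendsto_rabs_zero_iff)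
        then show "(\<lambda>n. F (\<sigma> n) x) \<longlonglongrightarrow> g x" by (simp add: LIM_zero_iff)
      qed
    qed
  qed
  have limG: "AE x in lborel. x \<in> Q 3 \<longrightarrow> (\<lambda>n. G j (\<sigma> n) x) \<longlonglongrightarrow> u j x" for j
  proof -
    have "AE x in lborel. (\<Sum>n. dG j n x) < \<infinity>"
      by (rule AE_summable_of_L1_geometric[where c = 1]) (use \<sigma>(3) in \<open>auto simp: dG_def\<close>)
    then show ?thesis
    proof eventually_elim
      case (elim x)
      show ?case
      proof
        assume x: "x \<in> Q 3"
        then have "(\<Sum>n. ennreal \<bar>G j (\<sigma> (Suc n)) x - G j (\<sigma> n) x\<bar>) < \<infinity>" using elim by (auto simp: dG_def)
        then have "summable (\<lambda>n. \<bar>G j (\<sigma> (Suc n)) x - G j (\<sigma> n) x\<bar>)" by (intro summable_suminf_not_top) auto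
        then have "summable (\<lambda>n. G j (\<sigma> (Suc n)) x - G j (\<sigma> n) x)" by (rule summable_rabs_cancel)
        then have "convergent (\<lambda>n. \<Sum>m<n. G j (\<sigma> (Suc m)) x - G j (\<sigma> m) x)"
          by (simp add: summable_iff_convergent)
        then have "convergent (\<lambda>n. G j (\<sigma> n) x - G j (\<sigma> 0) x)" unfolding sum_lessThan_telescope[of "\<lambda>m. G j (\<sigma> m) x"] .
        from convergent_add[OF this convergent_const[of "G j (\<sigma> 0) x"]]
        have "convergent (\<lambda>n. G j (\<sigma> n) x)" by simp
        then show "(\<lambda>n. G j (\<sigma> n) x) \<longlonglongrightarrow> u j x" using x by (simp add: u_def convergent_LIMSEQ_iff)
      qed
    qed
  qed
  \<comment> \<open>By \<open>segment_average_slope\<close> this is the slope of \<open>u j\<close>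
    in direction \<open>i\<close> wherever such a slope exists.\<close>
  define a where "a i j y = lim (\<lambda>m. 3 / (2 * r m) * (LINT \<tau>:{-1..1}|lborel. \<tau> * u j (y + (r m * \<tau>) *\<^sub>R axis i 1)))" for i j y
  have [measurable]: "a i j \<in> borel_measurable borel" for i j unfolding a_def set_lebesgue_integral_def by measurable
  let ?e1 = "\<lambda>i j x m. \<integral>\<^sup>+t\<in>{-1..1}.
        ennreal (min 1 (\<bar>u j (x + (r m * t) *\<^sub>R axis i 1) - u j x - r m * t * a i j x\<bar> / r m)) \<partial>lborel"
  let ?e2 = "\<lambda>i x m. \<integral>\<^sup>+t\<in>{-1..1}.
        ennreal (min 1 (\<bar>g (x + (r m * t) *\<^sub>R axis i 1) - g x - r m * t * u i x - (r m * t)\<^sup>2 / 2 * a i i x\<bar> / (r m)\<^sup>2)) \<partial>lborel"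
  \<comment> \<open>The first-order expansion concerns every pair \<open>i\<close>,
    \<open>j\<close>; the second-order one concerns \<open>g\<close> along a line whose direction
    matches the derivative \<open>u i\<close>.\<close>
  have lines: "AE x in lborel. AE t in lborel. t \<in> {-\<rho><..<\<rho>} \<longrightarrow>
     (x + t *\<^sub>R axis i 1 \<in> interior (Q 1) \<longrightarrow>
      (\<lambda>m. ?e1 i j (x + t *\<^sub>R axis i 1) m) \<longlonglongrightarrow> 0 \<and>
      (i = j \<longrightarrow> (\<lambda>m. ?e2 i (x + t *\<^sub>R axis i 1) m) \<longlonglongrightarrow> 0))" for i j
  proof -
    let ?e = "axis i 1 :: real^'n"
    have A1: "AE x in lborel. AE t in lborel. x + t *\<^sub>R ?e \<in> Q 4 \<longrightarrow> (\<lambda>n. F (\<sigma> n) (x + t *\<^sub>R ?e)) \<longlonglongrightarrow> g (x + t *\<^sub>R ?e)"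
      by (rule AE_segments_of_AE[OF _ limF]) measurable
    have A2: "AE x in lborel. AE t in lborel. x + t *\<^sub>R ?e \<in> Q 3 \<longrightarrow> (\<lambda>n. G j (\<sigma> n) (x + t *\<^sub>R ?e)) \<longlonglongrightarrow> u j (x + t *\<^sub>R ?e)"
      by (rule AE_segments_of_AE[OF _ limG]) measurable
    \<comment> \<open>Fatou's lemma: the second derivatives need not converge, but on almost every
      line their integrals stay bounded along a subsequence.\<close>
    have A3: "AE x in lborel. (liminf (\<lambda>n. \<integral>\<^sup>+t\<in>{-\<rho>..\<rho>}. ennreal \<bar>H i j (\<sigma> n) (x + t *\<^sub>R ?e)\<bar> \<partial>lborel)) < \<infinity>"
    proof -
      have "(\<integral>\<^sup>+x. liminf (\<lambda>n. \<integral>\<^sup>+t\<in>{-\<rho>..\<rho>}. ennreal \<bar>H i j (\<sigma> n) (x + t *\<^sub>R ?e)\<bar> \<partial>lborel) \<partial>lborel)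
        \<le> liminf (\<lambda>n. \<integral>\<^sup>+x. (\<integral>\<^sup>+t\<in>{-\<rho>..\<rho>}. ennreal \<bar>H i j (\<sigma> n) (x + t *\<^sub>R ?e)\<bar> \<partial>lborel) \<partial>lborel)"
        by (rule nn_integral_liminf) measurable
      also have "\<dots> \<le> liminf (\<lambda>n::nat. ennreal (2 * \<rho> * C))"
      proof (intro Liminf_mono always_eventually allI)
        fix n
        have "(\<integral>\<^sup>+x. (\<integral>\<^sup>+t\<in>{-\<rho>..\<rho>}. ennreal \<bar>H i j (\<sigma> n) (x + t *\<^sub>R ?e)\<bar> \<partial>lborel) \<partial>lborel)
          = emeasure lborel {-\<rho>..\<rho>} * (\<integral>\<^sup>+x. ennreal \<bar>H i j (\<sigma> n) x\<bar> \<partial>lborel)"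
          by (rule nn_integral_translation_Fubini[of "\<lambda>x. ennreal \<bar>H i j (\<sigma> n) x\<bar>"]) measurable
        also have "\<dots> \<le> ennreal (2 * \<rho>) * ennreal C"
          using \<rho> hess' by (intro mult_mono) auto
        finally show "(\<integral>\<^sup>+x. (\<integral>\<^sup>+t\<in>{-\<rho>..\<rho>}. ennreal \<bar>H i j (\<sigma> n) (x + t *\<^sub>R ?e)\<bar> \<partial>lborel) \<partial>lborel) \<le> ennreal (2 * \<rho> * C)"
          using \<rho> C0 by (simp add: ennreal_mult)
      qed
      also have "\<dots> < \<infinity>" by (simp add: Liminf_const)
      finally have "AE x in lborel. liminf (\<lambda>n. \<integral>\<^sup>+t\<in>{-\<rho>..\<rho>}. ennreal \<bar>H i j (\<sigma> n) (x + t *\<^sub>R ?e)\<bar> \<partial>lborel) \<noteq> \<infinity>"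
        by (intro nn_integral_PInf_AE) auto
      then show ?thesis by (simp add: less_top)
    qed
    have A4: "AE x in lborel. (\<Sum>n. \<integral>\<^sup>+t\<in>{-\<rho>..\<rho>}. dG i n (x + t *\<^sub>R ?e) \<partial>lborel) < \<infinity>"
    proof (rule AE_summable_of_L1_geometric[where c = "2 * \<rho>"])
      fix n
      have "(\<integral>\<^sup>+x. (\<integral>\<^sup>+t\<in>{-\<rho>..\<rho>}. dG i n (x + t *\<^sub>R ?e) \<partial>lborel) \<partial>lborel) = emeasure lborel {-\<rho>..\<rho>} * (\<integral>\<^sup>+x. dG i n x \<partial>lborel)"
        by (rule nn_integral_translation_Fubini) measurable
      also have "\<dots> \<le> ennreal (2 * \<rho>) * ennreal ((1/2)^n)"
        using \<rho> \<sigma>(3)[of i n] by (intro mult_mono) (auto simp: dG_def)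
      finally show "(\<integral>\<^sup>+x. (\<integral>\<^sup>+t\<in>{-\<rho>..\<rho>}. dG i n (x + t *\<^sub>R ?e) \<partial>lborel) \<partial>lborel) \<le> ennreal (2 * \<rho> * (1/2)^n)"
        using \<rho> by (simp add: ennreal_mult)
    qed (use \<rho> in auto)
    from A1 A2 A3 A4 show ?thesis
    proof eventually_elim
      case (elim x)
      show ?case
      proof (cases "x \<in> Q 2")
        \<comment> \<open>A base point outside \<open>Q 2\<close> cannot reach \<open>Q 1\<close> by
          a step of length at most \<open>\<rho>\<close>.\<close>
        case False
        have "x + t *\<^sub>R ?e \<notin> interior (Q 1)" if "t \<in> {-\<rho><..<\<rho>}" for t
          using Q_interior_step[OF False, of t i] that interior_subset[of "Q 1"] by (auto simp: abs_le_iff)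
        then show ?thesis by (intro AE_I2) blast
      next
        case True
        have Q3: "x + t *\<^sub>R ?e \<in> Q 3" if "t \<in> {-\<rho>..\<rho>}" for t
          using Q_step[OF True, of t i] that by auto
        have Q4: "x + t *\<^sub>R ?e \<in> Q 4" if "t \<in> {-\<rho>..\<rho>}" for t
          using Q3[OF that] Q_mono[of 3 4] by auto
        let ?u = "\<lambda>j t. u j (x + t *\<^sub>R ?e)"
        have lu: "AE t in lborel. t \<in> {-\<rho><..<\<rho>} \<longrightarrow> (\<lambda>n. G j (\<sigma> n) (x + t *\<^sub>R ?e)) \<longlonglongrightarrow> ?u j t"
          using elim(2) by eventually_elim (use Q3 in auto)
        have lF: "AE t in lborel. t \<in> {-\<rho><..<\<rho>} \<longrightarrow> (\<lambda>n. F (\<sigma> n) (x + t *\<^sub>R ?e)) \<longlonglongrightarrow> g (x + t *\<^sub>R ?e)"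
          using elim(1) by eventually_elim (use Q4 in auto)
        have D1: "AE t in lebesgue. t \<in> {-\<rho><..<\<rho>} \<longrightarrow> (\<exists>\<alpha>. \<forall>\<epsilon>>0. \<exists>d>0. AE h in lebesgue. \<bar>h\<bar> < d \<longrightarrow>
           \<bar>?u j (t + h) - ?u j t - \<alpha> * h\<bar> \<le> \<epsilon> * \<bar>h\<bar>)"
          by (rule AE_line_first_order[where v = "\<lambda>n t. G j (\<sigma> n) (x + t *\<^sub>R ?e)" and w = "\<lambda>n t. H i j (\<sigma> n) (x + t *\<^sub>R ?e)",
                OF line_FG(2)[OF True] line_continuous(2)[OF True] elim(3) AE_completion[OF lu]])
        have D2: "AE t in lebesgue. t \<in> {-\<rho><..<\<rho>} \<longrightarrow> (\<forall>\<alpha>.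
           (\<forall>\<epsilon>>0. \<exists>d>0. AE h in lebesgue. \<bar>h\<bar> < d \<longrightarrow> \<bar>?u i (t + h) - ?u i t - \<alpha> * h\<bar> \<le> \<epsilon> * \<bar>h\<bar>) \<longrightarrow>
           (\<forall>\<epsilon>>0. \<exists>d>0. AE h in lebesgue. \<bar>h\<bar> < d \<longrightarrow> \<bar>g (x + (t + h) *\<^sub>R ?e) - g (x + t *\<^sub>R ?e) - ?u i t * h - \<alpha> / 2 * h\<^sup>2\<bar> \<le> \<epsilon> * h\<^sup>2))"
          if "i = j"
        proof (rule AE_line_second_order[where F = "\<lambda>n t. F (\<sigma> n) (x + t *\<^sub>R ?e)" and v = "\<lambda>n t. G i (\<sigma> n) (x + t *\<^sub>R ?e)"
                and f = "\<lambda>t. g (x + t *\<^sub>R ?e)", OF line_FG(1)[OF True] line_continuous(1)[OF True] _ _ AE_completion[OF lF]])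
          have "(\<Sum>n. \<integral>\<^sup>+t\<in>{-\<rho>..\<rho>}. dG i n (x + t *\<^sub>R ?e) \<partial>lborel)
             = (\<Sum>n. \<integral>\<^sup>+t\<in>{-\<rho>..\<rho>}. ennreal \<bar>G i (\<sigma> (Suc n)) (x + t *\<^sub>R ?e) - G i (\<sigma> n) (x + t *\<^sub>R ?e)\<bar> \<partial>lborel)"
            by (intro suminf_cong nn_integral_cong) (use Q3 in \<open>auto simp: dG_def split: split_indicator\<close>)
          then show "(\<Sum>n. \<integral>\<^sup>+t\<in>{-\<rho>..\<rho>}. ennreal \<bar>G i (\<sigma> (Suc n)) (x + t *\<^sub>R ?e) - G i (\<sigma> n) (x + t *\<^sub>R ?e)\<bar> \<partial>lborel) < \<infinity>"
            using elim(4) by simp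
        qed (use lu that in auto)
        have D2': "AE t in lebesgue. i = j \<longrightarrow> t \<in> {-\<rho><..<\<rho>} \<longrightarrow> (\<forall>\<alpha>.
           (\<forall>\<epsilon>>0. \<exists>d>0. AE h in lebesgue. \<bar>h\<bar> < d \<longrightarrow> \<bar>?u i (t + h) - ?u i t - \<alpha> * h\<bar> \<le> \<epsilon> * \<bar>h\<bar>) \<longrightarrow>
           (\<forall>\<epsilon>>0. \<exists>d>0. AE h in lebesgue. \<bar>h\<bar> < d \<longrightarrow> \<bar>g (x + (t + h) *\<^sub>R ?e) - g (x + t *\<^sub>R ?e) - ?u i t * h - \<alpha> / 2 * h\<^sup>2\<bar> \<le> \<epsilon> * h\<^sup>2))"
          using D2 by (cases "i = j") auto
        have "AE t in lebesgue. t \<in> {-\<rho><..<\<rho>} \<longrightarrow> (\<lambda>m. ?e1 i j (x + t *\<^sub>R ?e) m) \<longlonglongrightarrow> 0 \<and>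
            (i = j \<longrightarrow> (\<lambda>m. ?e2 i (x + t *\<^sub>R ?e) m) \<longlonglongrightarrow> 0)"
          using D1 D2'
        proof eventually_elim
          case (elim t)
          show ?case
          proof
            assume t: "t \<in> {-\<rho><..<\<rho>}"
            define y where "y = x + t *\<^sub>R ?e"
            have yh: "x + (t + h) *\<^sub>R ?e = y + h *\<^sub>R ?e" for h by (simp add: y_def scaleR_add_left add.assoc)
            obtain \<alpha> where \<alpha>: "\<And>\<epsilon>. \<epsilon> > 0 \<Longrightarrow> \<exists>d>0. AE h in lebesgue. \<bar>h\<bar> < d \<longrightarrow>
              \<bar>u j (y + h *\<^sub>R ?e) - u j y - \<alpha> * h\<bar> \<le> \<epsilon> * \<bar>h\<bar>"
              using elim(1) t unfolding yh y_def[symmetric] by blast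
            have \<alpha>': "\<exists>d>0. AE h in lborel. \<bar>h\<bar> < d \<longrightarrow> \<bar>u j (y + h *\<^sub>R ?e) - u j (y + 0 *\<^sub>R ?e) - \<alpha> * h\<bar> \<le> \<epsilon> * \<bar>h\<bar>" if "\<epsilon> > 0" for \<epsilon>
              using \<alpha>[OF that] by (subst (asm) AE_completion_iff) auto
            have "(\<lambda>m. 3 / (2 * r m) * (LINT \<tau>:{-1..1}|lborel. \<tau> * u j (y + (r m * \<tau>) *\<^sub>R ?e))) \<longlonglongrightarrow> \<alpha>"
              by (rule segment_average_slope[OF _ r \<alpha>']) measurable
            then have a\<alpha>: "a i j y = \<alpha>" unfolding a_def by (rule limI)
            have "(\<lambda>m. \<integral>\<^sup>+\<tau>\<in>{-1..1}. ennreal (min 1 (\<bar>u j (y + (r m * \<tau>) *\<^sub>R ?e) - u j y - \<alpha> * (r m * \<tau>)\<bar> / r m ^ 1)) \<partial>lborel) \<longlonglongrightarrow> 0"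
              by (rule segment_average_error(2)[OF _ r]) (use \<alpha>' in auto)
            then have e1: "(\<lambda>m. ?e1 i j y m) \<longlonglongrightarrow> 0" by (simp add: a\<alpha> mult.commute)
            have e2: "(\<lambda>m. ?e2 i y m) \<longlonglongrightarrow> 0" if ij: "i = j"
            proof -
              have \<beta>: "\<exists>d>0. AE h in lebesgue. \<bar>h\<bar> < d \<longrightarrow>
                \<bar>g (y + h *\<^sub>R ?e) - g y - u i y * h - \<alpha> / 2 * h\<^sup>2\<bar> \<le> \<epsilon> * h\<^sup>2" if "\<epsilon> > 0" for \<epsilon>
                using elim(2) t \<alpha> ij that unfolding yh y_def[symmetric] by blast
              have "(\<lambda>m. \<integral>\<^sup>+\<tau>\<in>{-1..1}. ennreal (min 1 (\<bar>g (y + (r m * \<tau>) *\<^sub>R ?e) - g y - u i y * (r m * \<tau>) - \<alpha> / 2 * (r m * \<tau>)\<^sup>2\<bar> / r m ^ 2)) \<partial>lborel) \<longlonglongrightarrow> 0"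
              proof (rule segment_average_error(2)[OF _ r])
                show "\<exists>d>0. AE h in lborel. \<bar>h\<bar> < d \<longrightarrow> \<bar>g (y + h *\<^sub>R ?e) - g y - u i y * h - \<alpha> / 2 * h\<^sup>2\<bar> \<le> \<epsilon> * \<bar>h\<bar> ^ 2" if "\<epsilon> > 0" for \<epsilon>
                  using \<beta>[OF that] by (subst (asm) AE_completion_iff) auto
              qed measurable
              then show ?thesis using a\<alpha> ij by (simp add: mult_ac)
            qed
            show "(\<lambda>m. ?e1 i j (x + t *\<^sub>R ?e) m) \<longlonglongrightarrow> 0 \<and> (i = j \<longrightarrow> (\<lambda>m. ?e2 i (x + t *\<^sub>R ?e) m) \<longlonglongrightarrow> 0)"
              using e1 e2 unfolding y_def by blast
          qed
        qed
        then have "AE t in lborel. t \<in> {-\<rho><..<\<rho>} \<longrightarrow> (\<lambda>m. ?e1 i j (x + t *\<^sub>R ?e) m) \<longlonglongrightarrow> 0 \<and>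
            (i = j \<longrightarrow> (\<lambda>m. ?e2 i (x + t *\<^sub>R ?e) m) \<longlonglongrightarrow> 0)"
          by (subst (asm) AE_completion_iff) auto
        then show ?thesis by eventually_elim blast
      qed
    qed
  qed
  have E12: "AE x in lborel. x \<in> interior (Q 1) \<longrightarrow> (\<lambda>m. ?e1 i j x m) \<longlonglongrightarrow> 0 \<and> (i = j \<longrightarrow> (\<lambda>m. ?e2 i x m) \<longlonglongrightarrow> 0)" for i j
  proof (rule AE_of_AE_segments[OF _ \<rho> lines])
    have "Measurable.pred borel (\<lambda>x. (\<lambda>m. ?e1 i j x m) \<longlonglongrightarrow> 0)"
      "Measurable.pred borel (\<lambda>x. (\<lambda>m. ?e2 i x m) \<longlonglongrightarrow> 0)"
      by (rule pred_tendsto_0_ennreal, measurable)+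
    moreover have "Measurable.pred borel (\<lambda>x. x \<in> interior (Q 1))"
      unfolding pred_def by simp
    ultimately show "Measurable.pred borel (\<lambda>x. x \<in> interior (Q 1) \<longrightarrow>
      (\<lambda>m. ?e1 i j x m) \<longlonglongrightarrow> 0 \<and> (i = j \<longrightarrow> (\<lambda>m. ?e2 i x m) \<longlonglongrightarrow> 0))"
      by (intro pred_intros_logic) auto
  qed
  have E1: "AE x in lborel. x \<in> interior (Q 1) \<longrightarrow> (\<lambda>m. ?e1 i j x m) \<longlonglongrightarrow> 0" for i j
    using E12[where i = i and j = j] by eventually_elim blast
  have E2: "AE x in lborel. x \<in> interior (Q 1) \<longrightarrow> (\<lambda>m. ?e2 i x m) \<longlonglongrightarrow> 0" for i
    using E12[where i = i and j = i] by eventually_elim blast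
  show ?thesis
    using AE_second_order_assembly[OF _ _ _ open_interior r E1 E2, of UNIV] by (intro exI[of _ u]) simp
qed

end

subsection \<open>The maximum principle\<close>

text \<open>Coordinates are switched on one at a time; each step is a mean value along one axis, and
  continuity of that partial derivative at \<open>x\<close> controls its error.\<close>

lemma has_derivative_of_continuous_partials:
  fixes h :: "real^'n::finite \<Rightarrow> real" and p :: "'n \<Rightarrow> real^'n \<Rightarrow> real"
  assumes U: "open U" "x \<in> U"
    and d: "\<And>i y. y \<in> U \<Longrightarrow> ((\<lambda>t. h (y + t *\<^sub>R axis i 1)) has_real_derivative p i y) (at 0)"
    and c: "\<And>i. continuous_on U (p i)"
  shows "(h has_derivative (\<lambda>v. \<Sum>i\<in>UNIV. v $ i * p i x)) (at x)"
proof -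
  have main: "\<exists>\<delta>>0. \<forall>v. norm v < \<delta> \<longrightarrow> \<bar>h (x + coord_proj J v) - h x - (\<Sum>i\<in>J. v $ i * p i x)\<bar> \<le> \<epsilon> * norm v"
    if "finite J" "\<epsilon> > 0" for J :: "'n set" and \<epsilon> :: real
    using that
  proof (induction J arbitrary: \<epsilon> rule: finite_induct)
    case empty
    then show ?case by (intro exI[of _ 1]) auto
  next
    case (insert i J)
    obtain \<delta>1 where \<delta>1: "\<delta>1 > 0" "\<And>v. norm v < \<delta>1 \<Longrightarrow> \<bar>h (x + coord_proj J v) - h x - (\<Sum>i\<in>J. v $ i * p i x)\<bar> \<le> \<epsilon>/2 * norm v"
      using insert.IH[of "\<epsilon>/2"] insert.prems by auto
    obtain \<delta>2 where \<delta>2: "\<delta>2 > 0" "ball x \<delta>2 \<subseteq> U" using U openE by blast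
    have "isCont (p i) x" using c[of i] U continuous_on_eq_continuous_at by blast
    then obtain \<delta>3 where \<delta>3: "\<delta>3 > 0" "\<And>y. dist y x < \<delta>3 \<Longrightarrow> dist (p i y) (p i x) < \<epsilon>/2"
      using insert.prems by (fastforce simp: continuous_at_eps_delta dest: spec[of _ "\<epsilon>/2"])
    show ?case
    proof (intro exI[of _ "min \<delta>1 (min \<delta>2 \<delta>3)"] conjI allI impI)
      show "0 < min \<delta>1 (min \<delta>2 \<delta>3)" using \<delta>1 \<delta>2 \<delta>3 by simp
      fix v :: "real^'n" assume v: "norm v < min \<delta>1 (min \<delta>2 \<delta>3)"
      define y where "y = x + coord_proj J v"
      have ye: "x + coord_proj (insert i J) v = y + (v $ i) *\<^sub>R axis i 1"
        using insert.hyps(2) by (auto simp: y_def coord_proj_def vec_eq_iff axis_def)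
      have near: "dist (y + \<theta> *\<^sub>R axis i 1) x \<le> norm v" if "\<bar>\<theta>\<bar> \<le> \<bar>v $ i\<bar>" for \<theta>
      proof -
        have "norm (coord_proj J v + \<theta> *\<^sub>R axis i 1) \<le> norm v"
          using that insert.hyps(2) by (intro norm_le_componentwise_cart) (auto simp: coord_proj_def axis_def)
        then show ?thesis by (simp add: y_def dist_norm)
      qed
      have inU: "y + \<theta> *\<^sub>R axis i 1 \<in> U" if "\<bar>\<theta>\<bar> \<le> \<bar>v $ i\<bar>" for \<theta>
        using near[OF that] v \<delta>2(2) by (auto simp: dist_commute subset_iff)
      have der: "((\<lambda>t. h (y + t *\<^sub>R axis i 1)) has_real_derivative p i (y + \<theta> *\<^sub>R axis i 1)) (at \<theta>)" if "\<bar>\<theta>\<bar> \<le> \<bar>v $ i\<bar>" for \<theta>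
      proof -
        have "((\<lambda>s. h (y + (s + \<theta>) *\<^sub>R axis i 1)) has_real_derivative p i (y + \<theta> *\<^sub>R axis i 1)) (at 0)"
          using d[OF inU[OF that], of i] by (simp add: scaleR_add_left add.assoc add.commute add.left_commute)
        then show ?thesis
          using DERIV_shift[of "\<lambda>s. h (y + s *\<^sub>R axis i 1)" "p i (y + \<theta> *\<^sub>R axis i 1)" 0 \<theta>] by simp
      qed
      have "\<exists>\<theta>. \<bar>\<theta>\<bar> \<le> \<bar>v $ i\<bar> \<and> h (y + (v $ i) *\<^sub>R axis i 1) - h y = v $ i * p i (y + \<theta> *\<^sub>R axis i 1)"
      proof (cases "v $ i" "0::real" rule: linorder_cases)
        case less
        then obtain z where "v $ i < z" "z < 0" "h (y + 0 *\<^sub>R axis i 1) - h (y + (v $ i) *\<^sub>R axis i 1) = (0 - v $ i) * p i (y + z *\<^sub>R axis i 1)"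
          using MVT2[OF less, of "\<lambda>t. h (y + t *\<^sub>R axis i 1)" "\<lambda>z. p i (y + z *\<^sub>R axis i 1)"] der by auto
        then show ?thesis using less by (intro exI[of _ z]) auto
      next
        case greater
        then obtain z where "0 < z" "z < v $ i" "h (y + (v $ i) *\<^sub>R axis i 1) - h (y + 0 *\<^sub>R axis i 1) = (v $ i - 0) * p i (y + z *\<^sub>R axis i 1)"
          using MVT2[OF greater, of "\<lambda>t. h (y + t *\<^sub>R axis i 1)" "\<lambda>z. p i (y + z *\<^sub>R axis i 1)"] der by auto
        then show ?thesis using greater by (intro exI[of _ z]) auto
      qed auto
      then obtain \<theta> where \<theta>: "\<bar>\<theta>\<bar> \<le> \<bar>v $ i\<bar>" "h (y + (v $ i) *\<^sub>R axis i 1) - h y = v $ i * p i (y + \<theta> *\<^sub>R axis i 1)" by blast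
      have "\<bar>p i (y + \<theta> *\<^sub>R axis i 1) - p i x\<bar> \<le> \<epsilon>/2"
        using \<delta>3(2)[of "y + \<theta> *\<^sub>R axis i 1"] near[OF \<theta>(1)] v by (auto simp: dist_real_def)
      then have "\<bar>v $ i\<bar> * \<bar>p i (y + \<theta> *\<^sub>R axis i 1) - p i x\<bar> \<le> norm v * (\<epsilon>/2)"
        by (intro mult_mono component_le_norm_cart) auto
      then have "\<bar>v $ i * p i (y + \<theta> *\<^sub>R axis i 1) - v $ i * p i x\<bar> \<le> \<epsilon>/2 * norm v"
        by (simp add: abs_mult[symmetric] right_diff_distrib mult.commute)
      moreover have "\<bar>h y - h x - (\<Sum>i\<in>J. v $ i * p i x)\<bar> \<le> \<epsilon>/2 * norm v"
        using \<delta>1(2)[of v] v by (simp add: y_def)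
      ultimately have "\<bar>h (y + (v $ i) *\<^sub>R axis i 1) - h x - (v $ i * p i x + (\<Sum>i\<in>J. v $ i * p i x))\<bar> \<le> \<epsilon>/2 * norm v + \<epsilon>/2 * norm v"
        using \<theta>(2) by linarith
      then show "\<bar>h (x + coord_proj (insert i J) v) - h x - (\<Sum>i\<in>insert i J. v $ i * p i x)\<bar> \<le> \<epsilon> * norm v"
        using insert.hyps by (simp add: ye)
    qed
  qed
  show ?thesis
    unfolding has_derivative_at_alt
  proof (intro conjI allI impI)
    show "bounded_linear (\<lambda>v. \<Sum>i\<in>UNIV. v $ i * p i x)"
      by (intro bounded_linear_sum bounded_linear_mult_const bounded_linear_vec_nth)
    fix e :: real assume "0 < e"
    then obtain \<delta> where \<delta>: "\<delta> > 0" "\<And>v. norm v < \<delta> \<Longrightarrow> \<bar>h (x + v) - h x - (\<Sum>i\<in>UNIV. v $ i * p i x)\<bar> \<le> e * norm v"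
      using main[of UNIV e] by auto
    then show "\<exists>d>0. \<forall>y. norm (y - x) < d \<longrightarrow> norm (h y - h x - (\<Sum>i\<in>UNIV. (y - x) $ i * p i x)) \<le> e * norm (y - x)"
    proof (intro exI[of _ \<delta>] conjI allI impI \<delta>(1))
      fix y assume "norm (y - x) < \<delta>"
      from \<delta>(2)[OF this] show "norm (h y - h x - (\<Sum>i\<in>UNIV. (y - x) $ i * p i x)) \<le> e * norm (y - x)" by simp
    qed
  qed
qed

section \<open>Slices, principal minors and the gradient map\<close>

text \<open>Lower-dimensional restrictions stay functions on the full space, so that the induction
  over \<open>I\<close> remains within one type.\<close>

definition slice :: "real^'n \<Rightarrow> 'n set \<Rightarrow> real^'n \<Rightarrow> real^'n" where
  "slice c I z = (\<chi> i. if i \<in> I then z $ i else c $ i)"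

text \<open>Padding with the identity makes a full-size determinant equal to the minor of the block,
  so that the change of variables can take place in the full space; for \<open>J = {}\<close> the
  determinant is one.\<close>

definition principal_block :: "'n set \<Rightarrow> real^'n^'n \<Rightarrow> real^'n^'n" where
  "principal_block J A = (\<chi> i j. if i \<in> J \<and> j \<in> J then A $ i $ j else if i = j then 1 else 0)"

definition principal_minor :: "'n::finite set \<Rightarrow> real^'n^'n \<Rightarrow> real" where
  "principal_minor J A = Determinants.det (principal_block J A)"

lemma slice_nth [simp]: "slice c I z $ i = (if i \<in> I then z $ i else c $ i)"
  by (simp add: slice_def)

lemma continuous_on_slice: "continuous_on S (slice c I :: real^'n \<Rightarrow> real^'n)"
  unfolding slice_def
proof (rule continuous_on_vec_lambda)
  fix i show "continuous_on S (\<lambda>z::real^'n. if i \<in> I then z $ i else c $ i)"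
    by (cases "i \<in> I") (auto intro!: continuous_intros)
qed

lemma slice_cube: "c \<in> cube s \<Longrightarrow> z \<in> cube s \<Longrightarrow> slice c I z \<in> cube s"
  by (auto simp: cube_def)

lemma continuous_on_det:
  fixes A :: "'a::topological_space \<Rightarrow> real^'n::finite^'n"
  assumes "\<And>i j. continuous_on S (\<lambda>x. A x $ i $ j)"
  shows "continuous_on S (\<lambda>x. Determinants.det (A x))"
  unfolding Determinants.det_def by (intro continuous_intros assms)

lemma continuous_on_principal_minor:
  fixes h :: "real^'n::finite \<Rightarrow> real"
  assumes "Ck_on 2 U h" "\<And>z. z \<in> S \<Longrightarrow> slice c I z \<in> U"
  shows "continuous_on S (\<lambda>z. principal_minor J (hessian h (slice c I z)))"
  unfolding principal_minor_def
proof (rule continuous_on_det)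
  fix i j
  have "continuous_on S (\<lambda>z. partial_deriv i (partial_deriv j h) (slice c I z))"
    using assms(2) by (intro continuous_on_compose2[OF Ck_on_2D(3)[OF assms(1)] continuous_on_slice]) auto
  then show "continuous_on S (\<lambda>x. principal_block J (hessian h (slice c I x)) $ i $ j)"
    by (cases "i \<in> J \<and> j \<in> J") (auto simp: principal_block_def hessian_def)
qed

lemma nn_integral_continuous_cbox:
  fixes f :: "'a::euclidean_space \<Rightarrow> real"
  assumes "continuous_on (cbox a b) f" "\<And>x. x \<in> cbox a b \<Longrightarrow> 0 \<le> f x"
  shows "(\<integral>\<^sup>+x\<in>cbox a b. ennreal (f x) \<partial>lborel) = ennreal (integral (cbox a b) f)"
proof -
  have i: "set_integrable lborel (cbox a b) f"
    unfolding set_integrable_def using assms(1) by (intro borel_integrable_compact) auto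
  have "integral (cbox a b) f = (LINT x:cbox a b|lborel. f x)"
    using set_borel_integral_eq_integral(2)[OF i] by simp
  also have "ennreal \<dots> = (\<integral>\<^sup>+x\<in>cbox a b. ennreal (f x) \<partial>lborel)"
    using i assms(2) unfolding set_lebesgue_integral_def set_integrable_def
    by (subst nn_integral_eq_integral[symmetric]) (auto intro!: nn_integral_cong split: split_indicator)
  finally show ?thesis by simp
qed

text \<open>Alexandrov's maximum principle in the coordinates \<open>I\<close>: a large excess of \<open>h\<close> over its boundary
  values forces the gradient to cover a large cube. The unused coordinates are carried along by the
  identity, so that the change of variables takes place in the full space.\<close>

lemma Alexandrov_cell:
  fixes h :: "real^'n::{finite,wellorder} \<Rightarrow> real"
  assumes U: "open U" and Ck: "Ck_on 2 U h" and I: "I \<noteq> {}"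
    and inU: "\<And>z. (\<And>i. i \<in> I \<Longrightarrow> lo $ i \<le> z $ i \<and> z $ i \<le> hi $ i) \<Longrightarrow> slice c I z \<in> U"
    and width: "\<And>i. i \<in> I \<Longrightarrow> hi $ i - lo $ i \<le> \<omega>" and \<omega>: "\<omega> > 0"
    and x: "\<And>i. i \<in> I \<Longrightarrow> lo $ i < x $ i \<and> x $ i < hi $ i"
    and bdry: "\<And>z i. (\<And>i. i \<in> I \<Longrightarrow> lo $ i \<le> z $ i \<and> z $ i \<le> hi $ i) \<Longrightarrow> i \<in> I \<Longrightarrow>
        z $ i = lo $ i \<or> z $ i = hi $ i \<Longrightarrow> h (slice c I z) \<le> b"
    and \<eta>: "\<eta> > 0" "b + \<eta> \<le> h (slice c I x)"
    and s: "1/2 \<le> s" and w: "1/2 \<le> w" "w * (real CARD('n) * \<omega>) < \<eta>"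
  shows "ennreal (2 * w) \<le> (\<integral>\<^sup>+z\<in>{z. (\<forall>i\<in>I. lo $ i \<le> z $ i \<and> z $ i \<le> hi $ i) \<and> (\<forall>i. i \<notin> I \<longrightarrow> \<bar>z $ i\<bar> \<le> s)}.
      ennreal \<bar>principal_minor I (hessian h (slice c I z))\<bar> \<partial>lborel)"
proof -
  define L where "L = (\<chi> i. if i \<in> I then lo $ i else -s)"
  define R where "R = (\<chi> i. if i \<in> I then hi $ i else s)"
  have K: "{z. (\<forall>i\<in>I. lo $ i \<le> z $ i \<and> z $ i \<le> hi $ i) \<and> (\<forall>i. i \<notin> I \<longrightarrow> \<bar>z $ i\<bar> \<le> s)} = cbox L R"
    by (auto simp: L_def R_def mem_box_cart abs_le_iff minus_le_iff split: if_splits)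
  have KU: "slice c I z \<in> U" if "z \<in> cbox L R" for z
    using that by (intro inU) (auto simp: L_def R_def mem_box_cart split: if_splits)
  \<comment> \<open>The gradient in the coordinates \<open>I\<close> and the identity in the others;
    up to sign its Jacobian is the principal minor.\<close>
  define Gm where "Gm z = (\<chi> i. if i \<in> I then partial_deriv i h (slice c I z) else z $ i)" for z :: "real^'n::_"
  define DG where "DG z v = (\<chi> i. if i \<in> I then (\<Sum>j\<in>UNIV. (coord_proj I v) $ j * partial_deriv j (partial_deriv i h) (slice c I z)) else v $ i)"
    for z v :: "real^'n::_"
  have der: "(Gm has_derivative DG z) (at z within cbox L R)" if z: "z \<in> cbox L R" for z
  proof (rule has_derivative_at_withinI)
    have sl: "(slice c I has_derivative coord_proj I) (at z)"
    proof (rule has_derivative_componentwise_within[THEN iffD2], rule ballI)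
      fix b :: "real^'n::_" assume "b \<in> Basis"
      then obtain i where b: "b = axis i 1" by (auto simp: Basis_vec_def)
      have "((\<lambda>y. slice c I y $ i) has_derivative (\<lambda>v. coord_proj I v $ i)) (at z)"
        by (cases "i \<in> I") (auto simp: coord_proj_def intro!: derivative_eq_intros bounded_linear_imp_has_derivative)
      then show "((\<lambda>y. slice c I y \<bullet> b) has_derivative (\<lambda>v. coord_proj I v \<bullet> b)) (at z)"
        by (simp add: b inner_axis)
    qed
    have pd: "((\<lambda>y. partial_deriv i h (slice c I y)) has_derivative
        (\<lambda>v. \<Sum>j\<in>UNIV. (coord_proj I v) $ j * partial_deriv j (partial_deriv i h) (slice c I z))) (at z)" for i
    proof -
      have "(partial_deriv i h has_derivative (\<lambda>v. \<Sum>j\<in>UNIV. v $ j * partial_deriv j (partial_deriv i h) (slice c I z))) (at (slice c I z))"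
        using Ck_on_2D(5)[OF Ck, of _ 0] Ck_on_2D(3)[OF Ck]
        by (intro has_derivative_of_continuous_partials[OF U KU[OF z]]) auto
      from has_derivative_compose[OF sl this] show ?thesis by simp
    qed
    show "(Gm has_derivative DG z) (at z)"
    proof (rule has_derivative_componentwise_within[THEN iffD2], rule ballI)
      fix b :: "real^'n::_" assume "b \<in> Basis"
      then obtain i where b: "b = axis i 1" by (auto simp: Basis_vec_def)
      have "((\<lambda>y. Gm y $ i) has_derivative (\<lambda>v. DG z v $ i)) (at z)"
        using pd[of i] by (cases "i \<in> I") (auto simp: Gm_def DG_def intro!: bounded_linear_imp_has_derivative bounded_linear_vec_nth)
      then show "((\<lambda>y. Gm y \<bullet> b) has_derivative (\<lambda>v. DG z v \<bullet> b)) (at z)"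
        by (simp add: b inner_axis)
    qed
  qed
  have mat: "\<bar>Determinants.det (matrix (DG z))\<bar> = \<bar>principal_minor I (hessian h (slice c I z))\<bar>" for z
  proof -
    have eq: "(\<Sum>j\<in>UNIV. coord_proj I (axis k 1) $ j * q j) = (if k \<in> I then q k else 0)" for k and q :: "'n \<Rightarrow> real"
    proof -
      have "coord_proj I (axis k 1) $ j * q j = (if j = k then (if k \<in> I then q k else 0) else 0)" for j
        by (simp add: coord_proj_def axis_def)
      then show ?thesis by simp
    qed
    have "matrix (DG z) = Finite_Cartesian_Product.transpose (principal_block I (hessian h (slice c I z)))"
      unfolding matrix_def DG_def eq
      by (auto simp: vec_eq_iff Finite_Cartesian_Product.transpose_def principal_block_def hessian_def axis_def)
    then show ?thesis by (simp add: principal_minor_def Determinants.det_transpose)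
  qed
  have cont: "continuous_on (cbox L R) (\<lambda>z. \<bar>principal_minor I (hessian h (slice c I z))\<bar>)"
    using continuous_on_principal_minor[OF Ck KU] by (intro continuous_intros) auto
  have int: "(\<lambda>z. \<bar>Determinants.det (matrix (DG z))\<bar>) integrable_on cbox L R"
    unfolding mat by (rule integrable_continuous[OF cont])
  define W where "W = (\<chi> i. if i \<in> I then w else s)"
  \<comment> \<open>Each slope \<open>p\<close> is attained: subtract from \<open>h\<close> the
    linear function with slope \<open>p\<close> and maximize over the cell. The excess
    \<open>\<eta>\<close> beats the variation of the linear function, so the maximum is interior in
    the coordinates \<open>I\<close> and the gradient there is \<open>p\<close>.\<close>
  have cover: "cbox (-W) W \<subseteq> Gm ` cbox L R"
  proof
    fix p assume p: "p \<in> cbox (-W) W"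
    then have pI: "\<bar>p $ i\<bar> \<le> w" if "i \<in> I" for i using that by (auto simp: W_def mem_box_cart abs_le_iff minus_le_iff dest: spec[of _ i])
    have pI': "\<bar>p $ i\<bar> \<le> s" if "i \<notin> I" for i using p that by (auto simp: W_def mem_box_cart abs_le_iff minus_le_iff dest: spec[of _ i])
    define \<psi> where "\<psi> z = h (slice c I z) - (\<Sum>i\<in>I. p $ i * z $ i)" for z
    \<comment> \<open>In the coordinates outside \<open>I\<close> the box degenerates to the value
      of \<open>p\<close>, where \<open>Gm\<close> is the identity.\<close>
    define L' where "L' = (\<chi> i. if i \<in> I then lo $ i else p $ i)"
    define R' where "R' = (\<chi> i. if i \<in> I then hi $ i else p $ i)"
    have K': "z \<in> cbox L' R' \<longleftrightarrow> (\<forall>i\<in>I. lo $ i \<le> z $ i \<and> z $ i \<le> hi $ i) \<and> (\<forall>i. i \<notin> I \<longrightarrow> z $ i = p $ i)" for z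
      by (auto simp: L'_def R'_def mem_box_cart split: if_splits intro: antisym)
    have K'sub: "cbox L' R' \<subseteq> cbox L R" unfolding K[symmetric] using pI' by (auto simp: K')
    have "continuous_on (cbox L' R') \<psi>"
      unfolding \<psi>_def using KU K'sub
      by (intro continuous_intros continuous_on_compose2[OF Ck_on_2D(1)[OF Ck] continuous_on_slice]) auto
    moreover define x' where "x' = (\<chi> i. if i \<in> I then x $ i else p $ i)"
    have x': "x' \<in> cbox L' R'" using x by (auto simp: K' x'_def less_imp_le)
    ultimately obtain z where z: "z \<in> cbox L' R'" "\<And>y. y \<in> cbox L' R' \<Longrightarrow> \<psi> y \<le> \<psi> z"
      using continuous_attains_sup[OF compact_cbox, of L' R' \<psi>] by blast
    have zI: "\<And>i. i \<in> I \<Longrightarrow> lo $ i \<le> z $ i \<and> z $ i \<le> hi $ i" using z(1) by (auto simp: K')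
    have strict: "lo $ i < z $ i \<and> z $ i < hi $ i" if i: "i \<in> I" for i
    proof (rule ccontr)
      assume "\<not> ?thesis"
      then have "z $ i = lo $ i \<or> z $ i = hi $ i" using zI[OF i] by auto
      from bdry[OF zI i this] have "h (slice c I z) \<le> b" .
      moreover have "slice c I x' = slice c I x" by (simp add: vec_eq_iff x'_def)
      ultimately have "\<eta> \<le> (\<Sum>i\<in>I. p $ i * x' $ i) - (\<Sum>i\<in>I. p $ i * z $ i)"
        using z(2)[OF x'] \<eta>(2) by (simp add: \<psi>_def)
      also have "\<dots> = (\<Sum>i\<in>I. p $ i * (x' $ i - z $ i))" by (simp add: sum_subtractf right_diff_distrib)
      also have "\<dots> \<le> (\<Sum>i\<in>I. w * \<omega>)"
      proof (rule sum_mono)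
        fix i assume i: "i \<in> I"
        have "p $ i * (x' $ i - z $ i) \<le> \<bar>p $ i\<bar> * \<bar>x' $ i - z $ i\<bar>" by (simp flip: abs_mult)
        also have "\<dots> \<le> w * \<omega>"
          using pI[OF i] zI[OF i] x[OF i] width[OF i] w i by (intro mult_mono) (auto simp: x'_def)
        finally show "p $ i * (x' $ i - z $ i) \<le> w * \<omega>" .
      qed
      also have "\<dots> \<le> real CARD('n) * (w * \<omega>)"
        using w \<omega> by (simp add: card_mono mult_right_mono)
      finally show False using w by (simp add: mult_ac)
    qed
    have grad: "partial_deriv i h (slice c I z) = p $ i" if i: "i \<in> I" for i
    proof -
      have sl: "slice c I (z + t *\<^sub>R axis i 1) = slice c I z + t *\<^sub>R axis i 1" for t
        using i by (auto simp: vec_eq_iff axis_def)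
      have su: "(\<Sum>j\<in>I. p $ j * (z + t *\<^sub>R axis i 1) $ j) = (\<Sum>j\<in>I. p $ j * z $ j) + p $ i * t" for t
      proof -
        have "(\<Sum>j\<in>I. p $ j * (z + t *\<^sub>R axis i 1) $ j) = (\<Sum>j\<in>I. p $ j * z $ j + (if j = i then p $ i * t else 0))"
          by (intro sum.cong) (auto simp: axis_def algebra_simps)
        also have "\<dots> = (\<Sum>j\<in>I. p $ j * z $ j) + p $ i * t"
          using i by (simp add: sum.distrib)
        finally show ?thesis .
      qed
      have d: "((\<lambda>t. \<psi> (z + t *\<^sub>R axis i 1)) has_real_derivative (partial_deriv i h (slice c I z) - p $ i)) (at 0)"
        unfolding \<psi>_def sl su
        using Ck_on_2D(4)[OF Ck, of "slice c I z" 0 i] KU z(1) K'sub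
        by (auto intro!: derivative_eq_intros)
      define \<delta> where "\<delta> = min (z $ i - lo $ i) (hi $ i - z $ i)"
      have "\<delta> > 0" using strict[OF i] by (simp add: \<delta>_def)
      have "partial_deriv i h (slice c I z) - p $ i = 0"
      proof (rule DERIV_local_max[OF d \<open>\<delta> > 0\<close>], intro allI impI)
        fix t assume t: "\<bar>0 - t\<bar> < \<delta>"
        have "z + t *\<^sub>R axis i 1 \<in> cbox L' R'"
          using z(1) t i by (auto simp: K' axis_def \<delta>_def abs_less_iff)
        from z(2)[OF this] show "\<psi> (z + t *\<^sub>R axis i 1) \<le> \<psi> (z + 0 *\<^sub>R axis i 1)" by simp
      qed
      then show ?thesis by simp
    qed
    have "Gm z = p" using grad z(1) by (auto simp: Gm_def vec_eq_iff K')
    then show "p \<in> Gm ` cbox L R" using z(1) K'sub by blast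
  qed
  \<comment> \<open>All edges of the covered box have length at least one, so its volume is at least
    any single edge, here \<open>2 * w\<close>.\<close>
  have W0: "W $ i \<ge> 1/2" for i using w s by (simp add: W_def)
  have "2 * w \<le> measure lebesgue (cbox (-W) W)"
  proof -
    obtain i where i: "i \<in> I" using I by blast
    have "0 \<in> cbox (-W) W" using W0 by (auto simp: mem_box_cart intro: order_trans[OF _ W0])
    then have "cbox (-W) W \<noteq> {}" by blast
    then have "measure lebesgue (cbox (-W) W) = (\<Prod>i\<in>UNIV. 2 * W $ i)"
      by (simp add: content_cbox_cart)
    also have "\<dots> = 2 * W $ i * (\<Prod>j\<in>UNIV - {i}. 2 * W $ j)" by (simp add: prod.remove)
    also have "\<dots> \<ge> 2 * W $ i * 1"
      using W0 by (intro mult_left_mono prod_ge_1) (auto intro: order_trans[OF _ W0] simp: field_simps)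
    finally show ?thesis using i by (simp add: W_def)
  qed
  also have "\<dots> \<le> measure lebesgue (Gm ` cbox L R)"
    using cover measurable_differentiable_image[OF _ der int] by (intro measure_mono_fmeasurable) auto
  also have "\<dots> \<le> integral (cbox L R) (\<lambda>z. \<bar>Determinants.det (matrix (DG z))\<bar>)"
    by (rule measure_differentiable_image[OF _ der int]) auto
  finally have "ennreal (2 * w) \<le> ennreal (integral (cbox L R) (\<lambda>z. \<bar>principal_minor I (hessian h (slice c I z))\<bar>))"
    unfolding mat by (rule ennreal_leI)
  then show ?thesis unfolding K nn_integral_continuous_cbox[OF cont, simplified] .
qed

section \<open>From smallness in measure to a uniform upper bound\<close>

text \<open>Averaging over the height \<open>t\<close> in an interval of length
  \<open>\<omega>\<close>. The slice integral still runs over the replaced coordinate, whose range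
  has length at most two; adding one to \<open>M\<close> makes the contradiction strict.\<close>

lemma exists_good_slice:
  fixes \<Phi> :: "real^'n::finite \<Rightarrow> ennreal"
  assumes [measurable]: "\<Phi> \<in> borel_measurable borel" and s: "0 < s" "s \<le> 1"
    and T: "{t0<..<t0 + \<omega>} \<subseteq> {-s..s}" "\<omega> > 0"
    and le: "(\<integral>\<^sup>+z\<in>cube s. \<Phi> z \<partial>lborel) \<le> ennreal M" and M: "M \<ge> 0"
  obtains t where "t0 < t" "t < t0 + \<omega>"
    "(\<integral>\<^sup>+z\<in>cube s. \<Phi> (z + (t - z $ i) *\<^sub>R axis i 1) \<partial>lborel) \<le> ennreal (2 * (M + 1) / \<omega>)"
proof -
  have "\<exists>t\<in>{t0<..<t0 + \<omega>}. (\<integral>\<^sup>+z\<in>cube s. \<Phi> (z + (t - z $ i) *\<^sub>R axis i 1) \<partial>lborel) \<le> ennreal (2 * (M + 1) / \<omega>)"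
  proof (rule ccontr)
    assume "\<not> ?thesis"
    then have gt: "ennreal (2 * (M + 1) / \<omega>) \<le> (\<integral>\<^sup>+z\<in>cube s. \<Phi> (z + (t - z $ i) *\<^sub>R axis i 1) \<partial>lborel)"
      if "t \<in> {t0<..<t0 + \<omega>}" for t using that by (auto simp: not_le intro: less_imp_le)
    have "ennreal (2 * (M + 1)) = (\<integral>\<^sup>+t. ennreal (2 * (M + 1) / \<omega>) * indicator {t0<..<t0 + \<omega>} t \<partial>lborel)"
      using T(2) M by (simp add: nn_integral_cmult ennreal_mult[symmetric])
    also have "\<dots> \<le> (\<integral>\<^sup>+t. (\<integral>\<^sup>+z. \<Phi> (z + (t - z $ i) *\<^sub>R axis i 1) * indicator (cube s) z * indicator {-s..s} t \<partial>lborel) \<partial>lborel)"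
    proof (rule nn_integral_mono)
      fix t
      show "ennreal (2 * (M + 1) / \<omega>) * indicator {t0<..<t0 + \<omega>} t
        \<le> (\<integral>\<^sup>+z. \<Phi> (z + (t - z $ i) *\<^sub>R axis i 1) * indicator (cube s) z * indicator {-s..s} t \<partial>lborel)"
        using gt[of t] T(1) by (auto simp: subset_iff split: split_indicator)
    qed
    also have "\<dots> = (\<integral>\<^sup>+z. (\<integral>\<^sup>+t. \<Phi> (z + (t - z $ i) *\<^sub>R axis i 1) * indicator (cube s) z * indicator {-s..s} t \<partial>lborel) \<partial>lborel)"
      by (rule nn_integral_segment_swap[symmetric]) measurable
    also have "\<dots> = (\<integral>\<^sup>+z\<in>cube s. (\<integral>\<^sup>+t\<in>{-s..s}. \<Phi> (z + (t - z $ i) *\<^sub>R axis i 1) \<partial>lborel) \<partial>lborel)"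
      by (intro nn_integral_cong, subst nn_integral_multc[symmetric]) (auto intro!: nn_integral_cong simp: mult_ac)
    also have "\<dots> = ennreal (2 * s) * (\<integral>\<^sup>+z\<in>cube s. \<Phi> z \<partial>lborel)"
      by (rule nn_integral_cube_resample[OF _ s(1)]) measurable
    also have "\<dots> \<le> ennreal 2 * ennreal M" using s le by (intro mult_mono ennreal_leI) auto
    also have "\<dots> = ennreal (2 * M)" using M by (simp add: ennreal_mult)
    finally show False using M by (simp add: ennreal_le_iff)
  qed
  then show ?thesis using that by auto
qed

text \<open>Summing over all subsets makes the quantity monotone in \<open>I\<close>, so one bound
  serves all lower-dimensional slices in the induction.\<close>

definition minor_sum :: "'n::finite set \<Rightarrow> real^'n^'n \<Rightarrow> real" where
  "minor_sum I A = (\<Sum>J\<in>Pow I. \<bar>principal_minor J A\<bar>)"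

lemma minor_sum_mono: "I \<subseteq> I' \<Longrightarrow> minor_sum I A \<le> minor_sum I' A"
  unfolding minor_sum_def by (intro sum_mono2) auto

lemma principal_minor_le_minor_sum: "\<bar>principal_minor I A\<bar> \<le> minor_sum I A"
  unfolding minor_sum_def by (rule member_le_sum[of I "Pow I" "\<lambda>J. \<bar>principal_minor J A\<bar>"]) auto

text \<open>One-sided smallness in measure improves to one-sided smallness everywhere. In the induction on
  \<open>card I\<close> a fine grid of hyperplanes is chosen on which the statement holds in lower dimension, and
  \<open>Alexandrov_cell\<close> controls the interior of each cell.\<close>

lemma upper_bound_from_measure:
  fixes I :: "'n::{finite,wellorder} set"
  assumes "\<epsilon> > 0" "1/2 \<le> s" "s < s'" "s' \<le> 1"
  shows "\<exists>\<delta>>0. \<forall>h U c b. open U \<longrightarrow> cube 1 \<subseteq> U \<longrightarrow> Ck_on 2 U h \<longrightarrow> c \<in> cube 1 \<longrightarrow>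
     (\<integral>\<^sup>+z\<in>cube s'. ennreal (minor_sum I (hessian h (slice c I z))) \<partial>lborel) \<le> ennreal M \<longrightarrow>
     emeasure lborel {z\<in>cube s'. b < h (slice c I z)} \<le> ennreal \<delta> \<longrightarrow>
     (\<forall>z\<in>cube s. h (slice c I z) \<le> b + \<epsilon>)"
  using assms
proof (induction "card I" arbitrary: I \<epsilon> M s s' rule: less_induct)
  case less
  show ?case
  proof (cases "I = {}")
    \<comment> \<open>Without free coordinates the function is constant; an excess would fill the
      whole cube, whose volume is at least one.\<close>
    case True
    show ?thesis
    proof (intro exI[of _ "1/2"] conjI allI impI ballI)
      fix h :: "real^'n::_ \<Rightarrow> real" and U and c :: "real^'n::_" and b and z :: "real^'n::_"
      assume small: "emeasure lborel {z\<in>cube s'. b < h (slice c I z)} \<le> ennreal (1/2)"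
      have sl: "slice c I z = c" for z using True by (simp add: vec_eq_iff)
      have "\<not> b < h c"
      proof
        assume "b < h c"
        then have "{z\<in>cube s'. b < h (slice c I z)} = (cube s' :: (real^'n::_) set)" by (auto simp: sl)
        then have "ennreal ((2 * s') ^ CARD('n)) \<le> ennreal (1/2)"
          using small less.prems by (simp add: emeasure_cube)
        moreover have "1 \<le> (2 * s') ^ CARD('n)" using less.prems by (intro one_le_power) auto
        ultimately show False by (subst (asm) ennreal_le_iff) auto
      qed
      then show "h (slice c I z) \<le> b + \<epsilon>" using less.prems by (simp add: sl)
    qed simp
  next
    case False
    \<comment> \<open>Slopes up to \<open>M0\<close> fill a volume of at least
      \<open>2 * M0\<close>, more than the integral of the minors allows. The maximum with one
      respects the lower bound on \<open>w\<close> in \<open>Alexandrov_cell\<close>.\<close>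
    define M0 where "M0 = max M 1"
    define n where "n = real CARD('n)"
    have n: "n \<ge> 1" by (simp add: n_def Suc_leI)
    \<comment> \<open>The good hyperplanes will be controlled on \<open>cube s1\<close>, which
      leaves room for cells around every point of \<open>cube s\<close>.\<close>
    define s1 where "s1 = (s + s') / 2"
    have s1: "s < s1" "s1 < s'" "1/2 \<le> s1" using less.prems by (auto simp: s1_def)
    \<comment> \<open>Cells have width less than \<open>4 * \<kappa>\<close>: the first bound keeps
      them inside \<open>cube s1\<close>, the second keeps linear functions with slopes up to
      \<open>M0\<close> from varying by \<open>\<epsilon>/2\<close> on them.\<close>
    define \<kappa> where "\<kappa> = min ((s1 - s) / 2) (\<epsilon> / (16 * n * M0))"
    have M0: "M0 \<ge> 1" "M \<le> M0" by (auto simp: M0_def)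
    have "\<kappa> \<le> (s1 - s) / 2" unfolding \<kappa>_def by (rule min.cobounded1)
    then have \<kappa>: "\<kappa> > 0" "2 * \<kappa> \<le> s1 - s" using s1 less.prems n M0 by (simp_all add: \<kappa>_def)
    have \<kappa>2: "M0 * (n * (4 * \<kappa>)) < \<epsilon> / 2"
    proof -
      have "\<kappa> \<le> \<epsilon> / (16 * n * M0)" unfolding \<kappa>_def by (rule min.cobounded2)
      then have "\<kappa> * (16 * n * M0) \<le> \<epsilon>" using n M0 by (subst (asm) pos_le_divide_eq) auto
      then have "4 * (M0 * (n * (4 * \<kappa>))) \<le> \<epsilon>" by (simp add: mult_ac)
      then show ?thesis using less.prems(1) by linarith
    qed
    \<comment> \<open>The bound that \<open>exists_good_slice\<close> gives for the combined mass
      \<open>M0 + 1\<close> on an interval of length \<open>\<kappa>\<close>.\<close>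
    define M' where "M' = 2 * (M0 + 1 + 1) / \<kappa>"
    have M': "M' > 0" using M0 \<kappa> by (simp add: M'_def)
    define P where "P i \<delta> \<longleftrightarrow> (\<forall>h U c b. open U \<longrightarrow> cube 1 \<subseteq> U \<longrightarrow> Ck_on 2 U h \<longrightarrow> c \<in> cube 1 \<longrightarrow>
       (\<integral>\<^sup>+z\<in>cube s'. ennreal (minor_sum (I - {i}) (hessian h (slice c (I - {i}) z))) \<partial>lborel) \<le> ennreal M' \<longrightarrow>
       emeasure lborel {z\<in>cube s'. b < h (slice c (I - {i}) z)} \<le> ennreal \<delta> \<longrightarrow>
       (\<forall>z\<in>cube s1. h (slice c (I - {i}) z) \<le> b + \<epsilon>/2))" for i \<delta>
    have "\<forall>i\<in>I. \<exists>\<delta>. \<delta> > 0 \<and> P i \<delta>"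
    proof
      fix i assume "i \<in> I"
      show "\<exists>\<delta>>0. P i \<delta>"
        unfolding P_def
      proof (rule less.hyps)
        show "card (I - {i}) < card I" using \<open>i \<in> I\<close> by (intro psubset_card_mono) auto
      qed (use less.prems s1 in auto)
    qed
    from bchoice[OF this] obtain d where dP: "\<forall>i\<in>I. d i > 0 \<and> P i (d i)" ..
    then have d: "\<And>i. i \<in> I \<Longrightarrow> d i > 0" by blast
    define d0 where "d0 = Min (d ` I)"
    have d0: "d0 > 0" "\<And>i. i \<in> I \<Longrightarrow> d0 \<le> d i" using d False by (auto simp: d0_def)
    \<comment> \<open>With the weight \<open>1 / \<delta>\<close> used below, the slice bound
      \<open>M'\<close> makes the exceptional set on the slice at most \<open>d0\<close>.\<close>
    define \<delta> where "\<delta> = d0 / M'"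
    have \<delta>: "\<delta> > 0" using d0 M' by (simp add: \<delta>_def)
    show ?thesis
    proof (intro exI[of _ \<delta>] conjI \<delta> allI impI ballI)
      fix h :: "real^'n::_ \<Rightarrow> real" and U and c :: "real^'n::_" and b and x :: "real^'n::_"
      assume U: "open U" "cube 1 \<subseteq> U" and Ck: "Ck_on 2 U h" and c: "c \<in> cube 1" and x: "x \<in> cube s"
        and minors: "(\<integral>\<^sup>+z\<in>cube s'. ennreal (minor_sum I (hessian h (slice c I z))) \<partial>lborel) \<le> ennreal M"
        and bad: "emeasure lborel {z\<in>cube s'. b < h (slice c I z)} \<le> ennreal \<delta>"
      have cube_le: "cube s \<subseteq> (cube t :: (real^'n::_) set)" if "s \<le> t" for s t using that by (auto simp: cube_def intro: order_trans)
      have slU: "slice c I z \<in> U" if "z \<in> cube s'" for z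
        using slice_cube[OF c, of z I] that cube_le[of s' 1] less.prems U(2) by auto
      define A where "A z = indicator (cube s') z *\<^sub>R minor_sum I (hessian h (slice c I z))" for z
      define B where "B = {z\<in>cube s'. b < h (slice c I z)}"
      have [measurable]: "A \<in> borel_measurable borel"
        unfolding A_def minor_sum_def using continuous_on_principal_minor[OF Ck slU]
        by (intro borel_measurable_continuous_on_indicator continuous_intros) auto
      have [measurable]: "B \<in> sets borel"
      proof -
        have "continuous_on (cube s') (\<lambda>z. h (slice c I z))"
          using slU by (intro continuous_on_compose2[OF Ck_on_2D(1)[OF Ck] continuous_on_slice]) auto
        then have "(\<lambda>z. indicator (cube s') z *\<^sub>R h (slice c I z)) \<in> borel_measurable borel"
          by (intro borel_measurable_continuous_on_indicator) auto
        then have "{z. b < indicator (cube s') z *\<^sub>R h (slice c I z)} \<inter> cube s' \<in> sets borel"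
          by (intro sets.Int) (auto simp: pred_def)
        also have "{z. b < indicator (cube s') z *\<^sub>R h (slice c I z)} \<inter> cube s' = B" by (auto simp: B_def)
        finally show ?thesis .
      qed
      \<comment> \<open>One density combines the minors and the weighted exceptional set, so that a
        single hyperplane is good for both.\<close>
      define \<Phi> where "\<Phi> z = ennreal (A z) + ennreal (1 / \<delta>) * indicator B z" for z
      have [measurable]: "\<Phi> \<in> borel_measurable borel" unfolding \<Phi>_def by measurable
      have \<Phi>M: "(\<integral>\<^sup>+z\<in>cube s'. \<Phi> z \<partial>lborel) \<le> ennreal (M0 + 1)"
      proof -
        have "(\<integral>\<^sup>+z\<in>cube s'. \<Phi> z \<partial>lborel)
          = (\<integral>\<^sup>+z. ennreal (minor_sum I (hessian h (slice c I z))) * indicator (cube s') z + ennreal (1 / \<delta>) * indicator B z \<partial>lborel)"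
          by (intro nn_integral_cong) (auto simp: \<Phi>_def A_def B_def split: split_indicator)
        also have "\<dots> = (\<integral>\<^sup>+z. ennreal (A z) + ennreal (1 / \<delta>) * indicator B z \<partial>lborel)"
          by (intro nn_integral_cong) (auto simp: A_def split: split_indicator)
        also have "\<dots> = (\<integral>\<^sup>+z. ennreal (A z) \<partial>lborel) + ennreal (1 / \<delta>) * emeasure lborel B"
          by (subst nn_integral_add) (auto simp: nn_integral_cmult)
        also have "(\<integral>\<^sup>+z. ennreal (A z) \<partial>lborel) = (\<integral>\<^sup>+z\<in>cube s'. ennreal (minor_sum I (hessian h (slice c I z))) \<partial>lborel)"
          by (intro nn_integral_cong) (auto simp: A_def split: split_indicator)
        also have "\<dots> + ennreal (1 / \<delta>) * emeasure lborel B \<le> ennreal M + ennreal (1 / \<delta>) * ennreal \<delta>"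
          using minors bad unfolding B_def by (intro add_mono mult_left_mono) auto
        also have "\<dots> \<le> ennreal M0 + ennreal 1"
          using \<delta> M0 by (intro add_mono ennreal_leI) (auto simp flip: ennreal_mult)
        finally show ?thesis using M0 by simp
      qed
      have good: "\<exists>t. t0 < t \<and> t < t0 + \<kappa> \<and> (\<forall>z\<in>cube s1. z $ i = t \<longrightarrow> h (slice c I z) \<le> b + \<epsilon>/2)"
        if i: "i \<in> I" and t0: "{t0<..<t0 + \<kappa>} \<subseteq> {-s'..s'}" for i t0
      proof -
        obtain t where t: "t0 < t" "t < t0 + \<kappa>"
          "(\<integral>\<^sup>+z\<in>cube s'. \<Phi> (z + (t - z $ i) *\<^sub>R axis i 1) \<partial>lborel) \<le> ennreal M'"
          by (rule exists_good_slice[of \<Phi> s' t0 \<kappa> "M0 + 1" i])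
             (use t0 \<kappa> less.prems M0 \<Phi>M in \<open>auto simp: M'_def\<close>)
        have ts': "t \<in> {-s'..s'}" using t(1,2) t0 by auto
        \<comment> \<open>Freezing coordinate \<open>i\<close> at height \<open>t\<close> turns the
          slice over \<open>I\<close> into one over \<open>I - {i}\<close>, to which the induction
          hypothesis applies.\<close>
        define c' where "c' = c + (t - c $ i) *\<^sub>R axis i 1"
        have c'n: "c' $ j = (if j = i then t else c $ j)" for j by (simp add: c'_def axis_def)
        have c'1: "c' \<in> cube 1" using c ts' less.prems by (auto simp: cube_def c'n)
        have sl: "slice c I (z + (t - z $ i) *\<^sub>R axis i 1) = slice c' (I - {i}) z" for z
          using i by (auto simp: vec_eq_iff c'n axis_def)
        have up: "z + (t - z $ i) *\<^sub>R axis i 1 \<in> cube s'" if "z \<in> cube s'" for z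
          using that ts' by (auto simp: cube_def axis_def)
        have 1: "(\<integral>\<^sup>+z\<in>cube s'. ennreal (minor_sum (I - {i}) (hessian h (slice c' (I - {i}) z))) \<partial>lborel) \<le> ennreal M'"
        proof -
          have "(\<integral>\<^sup>+z\<in>cube s'. ennreal (minor_sum (I - {i}) (hessian h (slice c' (I - {i}) z))) \<partial>lborel)
             \<le> (\<integral>\<^sup>+z\<in>cube s'. \<Phi> (z + (t - z $ i) *\<^sub>R axis i 1) \<partial>lborel)"
          proof (rule nn_integral_mono)
            fix z
            have "ennreal (minor_sum (I - {i}) (hessian h (slice c' (I - {i}) z))) \<le> \<Phi> (z + (t - z $ i) *\<^sub>R axis i 1)" if z: "z \<in> cube s'"
            proof -
              have "minor_sum (I - {i}) (hessian h (slice c' (I - {i}) z)) \<le> A (z + (t - z $ i) *\<^sub>R axis i 1)"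
                using up[OF z] by (simp add: A_def sl minor_sum_mono)
              then show ?thesis unfolding \<Phi>_def by (intro add_increasing2 ennreal_leI) auto
            qed
            then show "ennreal (minor_sum (I - {i}) (hessian h (slice c' (I - {i}) z))) * indicator (cube s') z
              \<le> \<Phi> (z + (t - z $ i) *\<^sub>R axis i 1) * indicator (cube s') z" by (auto split: split_indicator)
          qed
          then show ?thesis using t(3) by (rule order_trans)
        qed
        have 2: "emeasure lborel {z\<in>cube s'. b < h (slice c' (I - {i}) z)} \<le> ennreal (d i)"
        proof -
          let ?S = "{z\<in>cube s'. b < h (slice c' (I - {i}) z)}"
          have S: "?S = {z. z + (t - z $ i) *\<^sub>R axis i 1 \<in> B} \<inter> cube s'"
            using up by (auto simp: B_def sl)
          have [measurable]: "?S \<in> sets borel" unfolding S by measurable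
          have "ennreal (1 / \<delta>) * emeasure lborel ?S = (\<integral>\<^sup>+z. ennreal (1 / \<delta>) * indicator ?S z \<partial>lborel)"
            by (simp add: nn_integral_cmult)
          also have "\<dots> \<le> (\<integral>\<^sup>+z\<in>cube s'. \<Phi> (z + (t - z $ i) *\<^sub>R axis i 1) \<partial>lborel)"
            by (intro nn_integral_mono) (auto simp: S \<Phi>_def split: split_indicator)
          also have "\<dots> \<le> ennreal (1 / \<delta>) * ennreal (\<delta> * M')"
            using t(3) \<delta> M' by (simp flip: ennreal_mult)
          finally have "emeasure lborel ?S \<le> ennreal (\<delta> * M')"
            using \<delta> by (subst (asm) ennreal_mult_le_mult_iff) auto
          also have "\<delta> * M' = d0" using M' by (simp add: \<delta>_def)
          finally show ?thesis using d0(2)[OF i] by (meson ennreal_leI order_trans)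
        qed
        have "P i (d i)" using dP i by blast
        from this[unfolded P_def, rule_format, OF U Ck c'1 1 2]
        have 3: "\<forall>z\<in>cube s1. h (slice c' (I - {i}) z) \<le> b + \<epsilon>/2" by blast
        have "h (slice c I z) \<le> b + \<epsilon>/2" if "z \<in> cube s1" "z $ i = t" for z
          using 3 that sl[of z] by auto
        then show ?thesis using t by blast
      qed
      \<comment> \<open>Good hyperplanes at distance between \<open>\<kappa>\<close> and
        \<open>2 * \<kappa>\<close> on either side of \<open>x\<close> will bound the cell.\<close>
      have lo_ex: "\<exists>lo. x $ i - 2 * \<kappa> < lo \<and> lo < x $ i - \<kappa> \<and> (\<forall>z\<in>cube s1. z $ i = lo \<longrightarrow> h (slice c I z) \<le> b + \<epsilon>/2)" if i: "i \<in> I" for i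
      proof -
        have "\<bar>x $ i\<bar> \<le> s" using x by (simp add: cube_def)
        then have "{x $ i - 2 * \<kappa><..<x $ i - 2 * \<kappa> + \<kappa>} \<subseteq> {-s'..s'}" using \<kappa> s1 by auto
        from good[OF i this] show ?thesis by auto
      qed
      from bchoice[OF ballI[OF lo_ex]] obtain lo0 where "\<forall>i\<in>I. x $ i - 2 * \<kappa> < lo0 i \<and> lo0 i < x $ i - \<kappa> \<and> (\<forall>z\<in>cube s1. z $ i = lo0 i \<longrightarrow> h (slice c I z) \<le> b + \<epsilon>/2)" ..
      note lo0 = bspec[OF this]
      have hi_ex: "\<exists>hi. x $ i + \<kappa> < hi \<and> hi < x $ i + 2 * \<kappa> \<and> (\<forall>z\<in>cube s1. z $ i = hi \<longrightarrow> h (slice c I z) \<le> b + \<epsilon>/2)" if i: "i \<in> I" for i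
      proof -
        have "\<bar>x $ i\<bar> \<le> s" using x by (simp add: cube_def)
        then have "{x $ i + \<kappa><..<x $ i + \<kappa> + \<kappa>} \<subseteq> {-s'..s'}" using \<kappa> s1 by auto
        from good[OF i this] show ?thesis by auto
      qed
      from bchoice[OF ballI[OF hi_ex]] obtain hi0 where "\<forall>i\<in>I. x $ i + \<kappa> < hi0 i \<and> hi0 i < x $ i + 2 * \<kappa> \<and> (\<forall>z\<in>cube s1. z $ i = hi0 i \<longrightarrow> h (slice c I z) \<le> b + \<epsilon>/2)" ..
      note hi0 = bspec[OF this]
      define lo :: "real^'n::_" where "lo = (\<chi> i. lo0 i)"
      define hi :: "real^'n::_" where "hi = (\<chi> i. hi0 i)"
      have cell: "\<bar>z $ i\<bar> \<le> s1" if "i \<in> I" "lo $ i \<le> z $ i" "z $ i \<le> hi $ i" for z :: "real^'n::_" and i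
      proof -
        have "\<bar>x $ i\<bar> \<le> s" using x by (simp add: cube_def)
        then show ?thesis using lo0[OF that(1)] hi0[OF that(1)] that \<kappa> by (auto simp: lo_def hi_def abs_le_iff)
      qed
      \<comment> \<open>Coordinates outside \<open>I\<close> do not affect the slice; setting them
        to zero puts the point into the cube.\<close>
      define zI where "zI z = (\<chi> i. if i \<in> I then z $ i else 0)" for z :: "real^'n::_"
      have zI: "slice c I (zI z) = slice c I z" for z by (simp add: vec_eq_iff zI_def)
      have zI1: "zI z \<in> cube s1" if "\<And>i. i \<in> I \<Longrightarrow> lo $ i \<le> z $ i \<and> z $ i \<le> hi $ i" for z
        using cell that s1 by (auto simp: cube_def zI_def)
      show "h (slice c I x) \<le> b + \<epsilon>"
      proof (rule ccontr)
        assume neg: "\<not> h (slice c I x) \<le> b + \<epsilon>"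
        have "ennreal (2 * M0) \<le> (\<integral>\<^sup>+z\<in>{z. (\<forall>i\<in>I. lo $ i \<le> z $ i \<and> z $ i \<le> hi $ i) \<and> (\<forall>i. i \<notin> I \<longrightarrow> \<bar>z $ i\<bar> \<le> s')}.
            ennreal \<bar>principal_minor I (hessian h (slice c I z))\<bar> \<partial>lborel)"
        proof (rule Alexandrov_cell[OF U(1) Ck False, where \<omega> = "4 * \<kappa>" and b = "b + \<epsilon>/2" and \<eta> = "\<epsilon>/2" and x = x])
          show "slice c I z \<in> U" if "\<And>i. i \<in> I \<Longrightarrow> lo $ i \<le> z $ i \<and> z $ i \<le> hi $ i" for z
            using slU[of "zI z"] zI1[OF that] cube_le[of s1 s'] s1 by (auto simp: zI)
          show "hi $ i - lo $ i \<le> 4 * \<kappa>" if "i \<in> I" for i using lo0[OF that] hi0[OF that] by (simp add: lo_def hi_def)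
          show "lo $ i < x $ i \<and> x $ i < hi $ i" if "i \<in> I" for i using lo0[OF that] hi0[OF that] \<kappa> by (simp add: lo_def hi_def)
          show "h (slice c I z) \<le> b + \<epsilon>/2"
            if z: "\<And>i. i \<in> I \<Longrightarrow> lo $ i \<le> z $ i \<and> z $ i \<le> hi $ i" and i: "i \<in> I" "z $ i = lo $ i \<or> z $ i = hi $ i" for z i
          proof -
            have "zI z $ i = z $ i" using i by (simp add: zI_def)
            then show ?thesis using i zI1[OF z] lo0[OF i(1)] hi0[OF i(1)] zI[of z] by (auto simp: lo_def hi_def)
          qed
          show "M0 * (real CARD('n) * (4 * \<kappa>)) < \<epsilon>/2" using \<kappa>2 by (simp add: n_def)
        qed (use \<kappa> less.prems neg M0 in auto)
        also have "\<dots> \<le> (\<integral>\<^sup>+z\<in>cube s'. ennreal (minor_sum I (hessian h (slice c I z))) \<partial>lborel)"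
        proof (rule nn_integral_mono)
          fix z :: "real^'n::_"
          let ?K = "{z. (\<forall>i\<in>I. lo $ i \<le> z $ i \<and> z $ i \<le> hi $ i) \<and> (\<forall>i. i \<notin> I \<longrightarrow> \<bar>z $ i\<bar> \<le> s')}"
          have "z \<in> cube s'" if "z \<in> ?K"
            unfolding cube_def mem_Collect_eq
          proof
            fix i show "\<bar>z $ i\<bar> \<le> s'" using that cell[of i z] s1 by (cases "i \<in> I") auto
          qed
          then show "ennreal \<bar>principal_minor I (hessian h (slice c I z))\<bar> * indicator ?K z
             \<le> ennreal (minor_sum I (hessian h (slice c I z))) * indicator (cube s') z"
            using principal_minor_le_minor_sum[of I "hessian h (slice c I z)"]
            by (auto split: split_indicator intro: ennreal_leI)
        qed
        also note minors
        also have "ennreal M \<le> ennreal M0" by (intro ennreal_leI M0)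
        finally show False using M0 by (subst (asm) ennreal_le_iff) auto
      qed
    qed
  qed
qed

subsection \<open>Minors\<close>

text \<open>The increasing enumeration of \<open>J\<close> conjugates permutations of indices into
  permutations of \<open>J\<close> with the same sign; a permutation moving a point outside
  \<open>J\<close> meets a zero of the padded matrix.\<close>

lemma minor_diagonal_eq_principal_minor:
  fixes A :: "real^'n::{finite,linorder}^'n::{finite,linorder}"
  shows "minor A J J = principal_minor J A"
proof -
  define m where "m = card J"
  define \<phi> where "\<phi> = (\<lambda>a. sorted_list_of_set J ! a)"
  let ?N = "{0..<m}"
  have bij: "bij_betw \<phi> ?N J"
    using bij_betw_nth[of "sorted_list_of_set J" "{..<m}" J]
    by (auto simp: \<phi>_def m_def lessThan_atLeast0)
  define \<psi> where "\<psi> = inv_into ?N \<phi>"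
  have bij': "bij_betw \<psi> J ?N" unfolding \<psi>_def by (rule bij_betw_inv_into[OF bij])
  have \<psi>\<phi>: "\<psi> (\<phi> a) = a" if "a \<in> ?N" for a unfolding \<psi>_def using bij that by (rule bij_betw_inv_into_left)
  have \<phi>\<psi>: "\<phi> (\<psi> j) = j" if "j \<in> J" for j unfolding \<psi>_def using bij that by (rule bij_betw_inv_into_right)
  have inv1: "map_permutation J \<psi> (map_permutation ?N \<phi> p) = p" if p: "p permutes ?N" for p
  proof -
    have "map_permutation J \<psi> (map_permutation ?N \<phi> p) = map_permutation ?N (\<psi> \<circ> \<phi>) p"
      by (rule map_permutation_compose[OF bij bij_betw_imp_inj_on[OF bij']])
    also have "\<dots> = map_permutation ?N id p"
      by (rule map_permutation_cong) (use p \<psi>\<phi> in \<open>auto simp: inj_on_def\<close>)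
    finally show ?thesis using p by simp
  qed
  have inv2: "map_permutation ?N \<phi> (map_permutation J \<psi> p) = p" if p: "p permutes J" for p
  proof -
    have "map_permutation ?N \<phi> (map_permutation J \<psi> p) = map_permutation J (\<phi> \<circ> \<psi>) p"
      by (rule map_permutation_compose[OF bij' bij_betw_imp_inj_on[OF bij]])
    also have "\<dots> = map_permutation J id p"
      by (rule map_permutation_cong) (use p \<phi>\<psi> in \<open>auto simp: inj_on_def\<close>)
    finally show ?thesis using p by simp
  qed
  have val: "map_permutation ?N \<phi> p (\<phi> a) = \<phi> (p a)" if "p permutes ?N" "a \<in> ?N" for p a
    using that bij \<psi>\<phi> by (auto simp: map_permutation_def restrict_id_def \<psi>_def[symmetric] bij_betw_def)
  have "minor A J J = (\<Sum>p\<in>{p. p permutes ?N}. of_int (sign p) * (\<Prod>a\<in>?N. A $ \<phi> a $ \<phi> (p a)))"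
  proof -
    have "minor A J J = (\<Sum>p\<in>{p. p permutes ?N}. of_int (sign p) *
       (\<Prod>a\<in>?N. Matrix.mat m m (\<lambda>(a, b). A $ \<phi> a $ \<phi> b) $$ (a, p a)))"
      unfolding minor_def m_def[symmetric] \<phi>_def[symmetric] by (simp add: Determinant.det_def)
    also have "\<dots> = (\<Sum>p\<in>{p. p permutes ?N}. of_int (sign p) * (\<Prod>a\<in>?N. A $ \<phi> a $ \<phi> (p a)))"
    proof (intro sum.cong refl arg_cong2[of _ _ _ _ "(*)"] prod.cong)
      fix p a assume "p \<in> {p. p permutes ?N}" "a \<in> ?N"
      moreover then have "p a \<in> ?N" using permutes_in_image by fastforce
      ultimately show "Matrix.mat m m (\<lambda>(a, b). A $ \<phi> a $ \<phi> b) $$ (a, p a) = A $ \<phi> a $ \<phi> (p a)" by simp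
    qed
    finally show ?thesis .
  qed
  also have "\<dots> = (\<Sum>q\<in>{q. q permutes J}. of_int (sign q) * (\<Prod>i\<in>J. A $ i $ q i))"
  proof (rule sum.reindex_bij_witness[where i = "map_permutation J \<psi>" and j = "map_permutation ?N \<phi>"])
    fix p assume p: "p \<in> {p. p permutes ?N}"
    show "map_permutation J \<psi> (map_permutation ?N \<phi> p) = p" using inv1 p by simp
    show "map_permutation ?N \<phi> p \<in> {q. q permutes J}" using map_permutation_permutes[OF bij] p by simp
    have "(\<Prod>i\<in>J. A $ i $ map_permutation ?N \<phi> p i) = (\<Prod>a\<in>?N. A $ \<phi> a $ map_permutation ?N \<phi> p (\<phi> a))"
      by (rule prod.reindex_bij_betw[OF bij, symmetric])
    also have "\<dots> = (\<Prod>a\<in>?N. A $ \<phi> a $ \<phi> (p a))" using val p by (intro prod.cong) auto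
    finally show "of_int (sign (map_permutation ?N \<phi> p)) * (\<Prod>i\<in>J. A $ i $ map_permutation ?N \<phi> p i)
       = (of_int (sign p) * (\<Prod>a\<in>?N. A $ \<phi> a $ \<phi> (p a)) :: real)"
      using sign_map_permutation[of \<phi> ?N p] bij p by (simp add: bij_betw_def)
  next
    fix q assume q: "q \<in> {q. q permutes J}"
    show "map_permutation ?N \<phi> (map_permutation J \<psi> q) = q" using inv2 q by simp
    show "map_permutation J \<psi> q \<in> {p. p permutes ?N}" using map_permutation_permutes[OF bij'] q by simp
  qed
  also have "\<dots> = (\<Sum>q\<in>{q. q permutes UNIV}. of_int (sign q) * (\<Prod>i\<in>UNIV. principal_block J A $ i $ q i))"
  proof (rule sum.mono_neutral_cong_left)
    show "{q. q permutes J} \<subseteq> {q. q permutes UNIV}" by (auto intro: permutes_subset)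
    show "\<forall>q\<in>{q. q permutes UNIV} - {q. q permutes J}. of_int (sign q) * (\<Prod>i\<in>UNIV. principal_block J A $ i $ q i) = 0"
    proof
      fix q assume q: "q \<in> {q. q permutes (UNIV :: 'n set)} - {q. q permutes J}"
      have "\<exists>i. i \<notin> J \<and> q i \<noteq> i"
      proof (rule ccontr)
        assume "\<not> ?thesis"
        then have "q permutes J" using q by (auto simp: permutes_def)
        with q show False by simp
      qed
      then obtain i where i: "i \<notin> J" "q i \<noteq> i" by blast
      then have "principal_block J A $ i $ q i = 0" by (simp add: principal_block_def)
      then have "(\<Prod>i\<in>UNIV. principal_block J A $ i $ q i) = 0" by (intro prod_zero) auto
      then show "of_int (sign q) * (\<Prod>i\<in>UNIV. principal_block J A $ i $ q i) = 0" by simp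
    qed
    fix q assume "q \<in> {q. q permutes J}"
    then have q: "q permutes J" by simp
    have "(\<Prod>i\<in>UNIV. principal_block J A $ i $ q i) = (\<Prod>i\<in>J. principal_block J A $ i $ q i) * (\<Prod>i\<in>-J. principal_block J A $ i $ q i)"
      by (subst prod.union_disjoint[symmetric]) (auto simp: Compl_partition)
    also have "(\<Prod>i\<in>-J. principal_block J A $ i $ q i) = 1"
      using q by (intro prod.neutral) (auto simp: principal_block_def permutes_not_in)
    also have "(\<Prod>i\<in>J. principal_block J A $ i $ q i) = (\<Prod>i\<in>J. A $ i $ q i)"
      using permutes_in_image[OF q] by (intro prod.cong) (auto simp: principal_block_def)
    finally show "of_int (sign q) * (\<Prod>i\<in>J. A $ i $ q i) = (of_int (sign q) * (\<Prod>i\<in>UNIV. principal_block J A $ i $ q i) :: real)"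
      by simp
  qed simp
  also have "\<dots> = principal_minor J A" by (simp add: principal_minor_def Determinants.det_def)
  finally show ?thesis .
qed

section \<open>Minors under perturbation of the matrix\<close>

text \<open>A determinant is affine in each entry, with the cofactor as slope. That cofactor is, up
  to sign, the minor with row \<open>i\<close> and column \<open>j\<close> removed, in general not a
  principal one even for \<open>I = J\<close>.\<close>

lemma minor_single_entry_change:
  fixes A :: "real^'n::{finite,linorder}^'n::{finite,linorder}"
  assumes IJ: "card I = card J" and A': "\<And>k l. A' $ k $ l = A $ k $ l + (if k = i \<and> l = j then c else 0)"
  shows "\<bar>minor A' I J\<bar> \<le> \<bar>minor A I J\<bar> + (if i \<in> I \<and> j \<in> J then \<bar>c\<bar> * \<bar>minor A (I - {i}) (J - {j})\<bar> else 0)"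
proof (cases "i \<in> I \<and> j \<in> J")
  case False
  have "minor A' I J = minor A I J"
  proof -
    have "sorted_list_of_set I ! a \<in> I" if "a < card I" for a using that nth_mem[of a "sorted_list_of_set I"] by simp
    moreover have "sorted_list_of_set J ! b \<in> J" if "b < card J" for b using that nth_mem[of b "sorted_list_of_set J"] by simp
    ultimately have "Matrix.mat (card I) (card J) (\<lambda>(a, b). A' $ (sorted_list_of_set I ! a) $ (sorted_list_of_set J ! b))
      = Matrix.mat (card I) (card J) (\<lambda>(a, b). A $ (sorted_list_of_set I ! a) $ (sorted_list_of_set J ! b))"
      using False by (intro eq_matI) (auto simp: A')
    then show ?thesis by (simp add: minor_def)
  qed
  then show ?thesis using False by auto
next
  case True
  define m where "m = card I"
  define xs where "xs = sorted_list_of_set I"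
  define ys where "ys = sorted_list_of_set J"
  have xs: "distinct xs" "set xs = I" "length xs = m" by (auto simp: xs_def m_def)
  have ys: "distinct ys" "set ys = J" "length ys = m" using IJ by (auto simp: ys_def m_def)
  obtain a where a: "a < m" "xs ! a = i" using True xs by (metis in_set_conv_nth)
  obtain b where b: "b < m" "ys ! b = j" using True ys by (metis in_set_conv_nth)
  define M where "M = Matrix.mat m m (\<lambda>(a, b). A $ (xs ! a) $ (ys ! b))"
  define M' where "M' = Matrix.mat m m (\<lambda>(a, b). A' $ (xs ! a) $ (ys ! b))"
  have Mc: "M \<in> carrier_mat m m" "M' \<in> carrier_mat m m" by (auto simp: M_def M'_def)
  have ent: "M' $$ (k, l) = M $$ (k, l) + (if k = a \<and> l = b then c else 0)" if "k < m" "l < m" for k l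
  proof -
    have "xs ! k = i \<longleftrightarrow> k = a" "ys ! l = j \<longleftrightarrow> l = b"
      using nth_eq_iff_index_eq[OF xs(1)] nth_eq_iff_index_eq[OF ys(1)] a b that xs ys by auto
    then show ?thesis using that by (simp add: M_def M'_def A')
  qed
  have del: "mat_delete M' a l = mat_delete M a l" if "l < m" for l
    unfolding mat_delete_def using Mc a that by (intro eq_matI) (auto simp: ent)
  have "Determinant.det M' = (\<Sum>l<m. M' $$ (a, l) * cofactor M' a l)" by (rule laplace_expansion_row[OF Mc(2) a(1)])
  also have "\<dots> = (\<Sum>l<m. M $$ (a, l) * cofactor M a l + (if l = b then c * cofactor M a b else 0))"
    using a by (intro sum.cong) (auto simp: ent cofactor_def del distrib_right)
  also have "\<dots> = Determinant.det M + c * cofactor M a b"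
    using b laplace_expansion_row[OF Mc(1) a(1)] by (simp add: sum.distrib)
  finally have det: "Determinant.det M' = Determinant.det M + c * cofactor M a b" .
  \<comment> \<open>Removing an element of the sorted list shifts the later positions by one,
    exactly as \<open>mat_delete\<close> does.\<close>
  have rem: "sorted_list_of_set (S - {zs ! e}) ! k = zs ! (if k < e then k else Suc k)"
    if zs: "zs = sorted_list_of_set S" and e: "e < card S" and k: "k < card S - 1" for S :: "'n set" and zs e k
  proof -
    have d: "distinct zs" "length zs = card S" using zs by auto
    have "sorted_list_of_set (S - {zs ! e}) = remove1 (zs ! e) zs" using zs by (simp add: sorted_list_of_set_remove)
    also have "\<dots> = take e zs @ drop (Suc e) zs"
    proof -
      have "zs = take e zs @ zs ! e # drop (Suc e) zs" using e d by (simp add: id_take_nth_drop)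
      moreover have "zs ! e \<notin> set (take e zs)"
        using d e by (auto simp: in_set_conv_nth nth_eq_iff_index_eq)
      ultimately show ?thesis by (metis remove1.simps(2) remove1_append)
    qed
    finally show ?thesis using k e d by (auto simp: nth_append min_def)
  qed
  have "mat_delete M a b = Matrix.mat (card (I - {i})) (card (J - {j}))
     (\<lambda>(k, l). A $ (sorted_list_of_set (I - {i}) ! k) $ (sorted_list_of_set (J - {j}) ! l))"
    unfolding mat_delete_def
    using rem[OF xs_def, of a] rem[OF ys_def, of b] a b True IJ
    by (intro eq_matI) (auto simp: M_def m_def)
  then have "Determinant.det (mat_delete M a b) = minor A (I - {i}) (J - {j})" by (simp add: minor_def)
  then have "\<bar>cofactor M a b\<bar> = \<bar>minor A (I - {i}) (J - {j})\<bar>" by (simp add: cofactor_def abs_mult power_abs)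
  then have "\<bar>Determinant.det M'\<bar> \<le> \<bar>Determinant.det M\<bar> + \<bar>c\<bar> * \<bar>minor A (I - {i}) (J - {j})\<bar>"
    unfolding det by (metis abs_mult abs_triangle_ineq)
  moreover have "minor A I J = Determinant.det M" "minor A' I J = Determinant.det M'"
    by (simp_all add: minor_def M_def M'_def xs_def ys_def m_def IJ[symmetric])
  ultimately show ?thesis using True by simp
qed

text \<open>The pair of empty sets contributes one, which absorbs the constant that a change of
  entry adds to a minor of size one.\<close>

definition all_minors :: "real^'n::{finite,linorder}^'n::{finite,linorder} \<Rightarrow> real" where
  "all_minors A = (\<Sum>(I,J)\<in>{(I,J). card I = card J}. \<bar>minor A I J\<bar>)"

lemma minor_le_all_minors: "card I = card J \<Longrightarrow> \<bar>minor A I J\<bar> \<le> all_minors A"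
  unfolding all_minors_def
  by (rule member_le_sum[of "(I, J)" _ "\<lambda>(I, J). \<bar>minor A I J\<bar>", simplified]) auto

text \<open>Removing \<open>i\<close> and \<open>j\<close> is injective on the pairs that contain
  them, so the additional terms form a subsum of the old quantity.\<close>

lemma all_minors_single_entry_change:
  fixes A :: "real^'n::{finite,linorder}^'n::{finite,linorder}"
  assumes A': "\<And>k l. A' $ k $ l = A $ k $ l + (if k = i \<and> l = j then c else 0)"
  shows "all_minors A' \<le> (1 + \<bar>c\<bar>) * all_minors A"
proof -
  let ?P = "{(I,J). card (I::'n set) = card (J::'n set)}"
  let ?P' = "{(I,J). card I = card J \<and> i \<in> I \<and> j \<in> J}"
  let ?f = "\<lambda>(I,J). \<bar>minor A I J\<bar>"
  let ?f' = "\<lambda>(I,J). \<bar>minor A' I J\<bar>"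
  let ?t = "\<lambda>(I::'n set,J::'n set). (I - {i}, J - {j})"
  have "all_minors A' \<le> (\<Sum>p\<in>?P. ?f p + (if fst p \<in> {I. i \<in> I} \<and> snd p \<in> {J. j \<in> J} then \<bar>c\<bar> * ?f (?t p) else 0))"
    unfolding all_minors_def
  proof (rule sum_mono)
    fix p assume p: "p \<in> ?P"
    obtain I J where [simp]: "p = (I, J)" by (cases p)
    show "?f' p \<le> ?f p + (if fst p \<in> {I. i \<in> I} \<and> snd p \<in> {J. j \<in> J} then \<bar>c\<bar> * ?f (?t p) else 0)"
    proof -
      have "card I = card J" using p by simp
      from minor_single_entry_change[OF this A'] show ?thesis by (cases "i \<in> I \<and> j \<in> J") auto
    qed
  qed
  also have "\<dots> = all_minors A + (\<Sum>p\<in>?P. (if fst p \<in> {I. i \<in> I} \<and> snd p \<in> {J. j \<in> J} then \<bar>c\<bar> * ?f (?t p) else 0))"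
    by (simp add: sum.distrib all_minors_def)
  also have "(\<Sum>p\<in>?P. (if fst p \<in> {I. i \<in> I} \<and> snd p \<in> {J. j \<in> J} then \<bar>c\<bar> * ?f (?t p) else 0)) = (\<Sum>p\<in>?P'. \<bar>c\<bar> * ?f (?t p))"
    by (rule sum.mono_neutral_cong_right) auto
  also have "\<dots> = \<bar>c\<bar> * (\<Sum>p\<in>?P'. ?f (?t p))" by (simp add: sum_distrib_left)
  also have "(\<Sum>p\<in>?P'. ?f (?t p)) = sum ?f (?t ` ?P')"
  proof -
    have "inj_on ?t ?P'"
    proof (rule inj_onI)
      fix p q assume "p \<in> ?P'" "q \<in> ?P'" "?t p = ?t q"
      then show "p = q" by (auto simp: prod_eq_iff)
    qed
    then show ?thesis by (simp add: sum.reindex)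
  qed
  also have "all_minors A + \<bar>c\<bar> * sum ?f (?t ` ?P') \<le> all_minors A + \<bar>c\<bar> * all_minors A"
    unfolding all_minors_def by (intro add_left_mono mult_left_mono sum_mono2) auto
  finally show ?thesis by (simp add: distrib_right)
qed

text \<open>Entries are altered one after the other; each factor depends on one entry of
  \<open>B\<close>, which makes the constant uniform in \<open>A\<close>.\<close>

lemma all_minors_diff_le:
  fixes B :: "real^'n::{finite,linorder}^'n::{finite,linorder}"
  obtains K where "K \<ge> 0" "\<And>A. all_minors (A - B) \<le> K * all_minors A"
proof -
  define D where "D P A = (\<chi> k l. A $ k $ l - (if (k, l) \<in> P then B $ k $ l else 0))" for P and A :: "real^'n::_^'n::_"
  have "\<exists>K\<ge>0. \<forall>A. all_minors (D P A) \<le> K * all_minors A" if "finite P" for P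
    using that
  proof (induction P rule: finite_induct)
    case empty
    have "D {} A = A" for A by (simp add: D_def vec_eq_iff)
    then show ?case by (intro exI[of _ 1]) simp
  next
    case (insert p P)
    obtain i j where p: "p = (i, j)" by (cases p)
    obtain K where K: "K \<ge> 0" "\<And>A. all_minors (D P A) \<le> K * all_minors A" using insert.IH by blast
    have "all_minors (D (insert p P) A) \<le> (1 + \<bar>- B $ i $ j\<bar>) * all_minors (D P A)" for A
      by (rule all_minors_single_entry_change) (use insert.hyps in \<open>auto simp: D_def p\<close>)
    also have "(1 + \<bar>- B $ i $ j\<bar>) * all_minors (D P A) \<le> (1 + \<bar>- B $ i $ j\<bar>) * (K * all_minors A)" for A
      by (intro mult_left_mono K) auto
    finally show ?case using K(1) by (intro exI[of _ "(1 + \<bar>- B $ i $ j\<bar>) * K"]) (auto simp: mult.assoc)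
  qed
  from this[of UNIV] obtain K where "K \<ge> 0" "\<And>A. all_minors (D UNIV A) \<le> K * all_minors A" by auto
  moreover have "D UNIV A = A - B" for A by (simp add: D_def vec_eq_iff)
  ultimately show ?thesis using that by metis
qed

lemma all_minors_uminus:
  fixes A :: "real^'n::{finite,linorder}^'n::{finite,linorder}"
  shows "all_minors (- A) = all_minors A"
proof -
  have "\<bar>minor (- A) I J\<bar> = \<bar>minor A I J\<bar>" for I J
  proof -
    let ?M = "Matrix.mat (card I) (card J) (\<lambda>(a, b). A $ (sorted_list_of_set I ! a) $ (sorted_list_of_set J ! b))"
    have "Matrix.mat (card I) (card J) (\<lambda>(a, b). (- A) $ (sorted_list_of_set I ! a) $ (sorted_list_of_set J ! b)) = (-1) \<cdot>\<^sub>m ?M"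
      by (intro eq_matI) auto
    then have "minor (- A) I J = (-1) ^ card J * minor A I J" by (simp add: minor_def)
    then show ?thesis by (simp add: abs_mult power_abs)
  qed
  then show ?thesis by (simp add: all_minors_def)
qed

lemma minor_sum_le_all_minors:
  fixes A :: "real^'n::{finite,linorder}^'n::{finite,linorder}"
  shows "minor_sum UNIV A \<le> all_minors A"
proof -
  let ?P = "{(I,J). card (I::'n set) = card (J::'n set)}"
  have "minor_sum UNIV A = (\<Sum>J\<in>UNIV. \<bar>minor A J J\<bar>)"
    by (simp add: minor_sum_def minor_diagonal_eq_principal_minor)
  also have "\<dots> = (\<Sum>p\<in>(\<lambda>J. (J, J)) ` UNIV. (\<lambda>(I,J). \<bar>minor A I J\<bar>) p)"
    by (subst sum.reindex) (auto simp: inj_on_def)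
  also have "\<dots> \<le> all_minors A"
    unfolding all_minors_def by (intro sum_mono2) auto
  finally show ?thesis .
qed

lemma entry_le_all_minors:
  fixes A :: "real^'n::{finite,linorder}^'n::{finite,linorder}"
  shows "\<bar>A $ i $ j\<bar> \<le> all_minors A"
proof -
  have "minor A {i} {j} = A $ i $ j"
    by (simp add: minor_def det_single)
  then show ?thesis using minor_le_all_minors[of "{i}" "{j}" A] by simp
qed

lemma continuous_on_minor:
  fixes A :: "'a::topological_space \<Rightarrow> real^'n::{finite,linorder}^'n::{finite,linorder}"
  assumes "\<And>i j. continuous_on S (\<lambda>x. A x $ i $ j)" "card I = card J"
  shows "continuous_on S (\<lambda>x. minor (A x) I J)"
proof -
  let ?m = "card I"
  have "minor (A x) I J = (\<Sum>p\<in>{p. p permutes {0..<?m}}. of_int (sign p) *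
       (\<Prod>a\<in>{0..<?m}. A x $ (sorted_list_of_set I ! a) $ (sorted_list_of_set J ! p a)))" for x
  proof -
    have "minor (A x) I J = (\<Sum>p\<in>{p. p permutes {0..<?m}}. of_int (sign p) *
       (\<Prod>a\<in>{0..<?m}. Matrix.mat ?m ?m (\<lambda>(a, b). A x $ (sorted_list_of_set I ! a) $ (sorted_list_of_set J ! b)) $$ (a, p a)))"
      using assms(2) by (simp add: minor_def Determinant.det_def)
    also have "\<dots> = (\<Sum>p\<in>{p. p permutes {0..<?m}}. of_int (sign p) *
       (\<Prod>a\<in>{0..<?m}. A x $ (sorted_list_of_set I ! a) $ (sorted_list_of_set J ! p a)))"
    proof (intro sum.cong refl arg_cong2[of _ _ _ _ "(*)"] prod.cong)
      fix p a assume "p \<in> {p. p permutes {0..<?m}}" "a \<in> {0..<?m}"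
      moreover then have "p a \<in> {0..<?m}" using permutes_in_image by fastforce
      ultimately show "Matrix.mat ?m ?m (\<lambda>(a, b). A x $ (sorted_list_of_set I ! a) $ (sorted_list_of_set J ! b)) $$ (a, p a)
        = A x $ (sorted_list_of_set I ! a) $ (sorted_list_of_set J ! p a)" by simp
    qed
    finally show ?thesis .
  qed
  then show ?thesis by (simp only:) (intro continuous_intros assms(1))
qed

lemma continuous_on_all_minors_hessian:
  fixes h :: "real^'n::{finite,linorder} \<Rightarrow> real"
  assumes "Ck_on 2 U h"
  shows "continuous_on U (\<lambda>x. all_minors (hessian h x))"
  unfolding all_minors_def
proof (intro continuous_on_sum)
  fix p :: "'n set \<times> 'n set" assume "p \<in> {(I,J). card I = card J}"
  then show "continuous_on U (\<lambda>x. case p of (I, J) \<Rightarrow> \<bar>minor (hessian h x) I J\<bar>)"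
    using Ck_on_2D(3)[OF assms] by (cases p) (auto simp: hessian_def intro!: continuous_intros continuous_on_minor)
qed

subsection \<open>Blow-up at almost every point\<close>

lemma Ck_on_2I:
  fixes h :: "real^'n::finite \<Rightarrow> real" and p :: "'n \<Rightarrow> real^'n \<Rightarrow> real" and q :: "'n \<Rightarrow> 'n \<Rightarrow> real^'n \<Rightarrow> real"
  assumes U: "open U"
    and d1: "\<And>i z. z \<in> U \<Longrightarrow> ((\<lambda>t. h (z + t *\<^sub>R axis i 1)) has_real_derivative p i z) (at 0)"
    and d2: "\<And>i j z. z \<in> U \<Longrightarrow> ((\<lambda>t. p j (z + t *\<^sub>R axis i 1)) has_real_derivative q i j z) (at 0)"
    and c: "continuous_on U h" "\<And>i. continuous_on U (p i)" "\<And>i j. continuous_on U (q i j)"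
  shows "Ck_on 2 U h" "\<And>z. z \<in> U \<Longrightarrow> hessian h z = (\<chi> i j. q i j z)"
proof -
  have pd1: "partial_deriv i h z = p i z" if "z \<in> U" for i z
    unfolding partial_deriv_def by (rule DERIV_imp_deriv[OF d1[OF that]])
  have der2: "((\<lambda>t. partial_deriv j h (z + t *\<^sub>R axis i 1)) has_real_derivative q i j z) (at 0)" if z: "z \<in> U" for i j z
  proof -
    \<comment> \<open>Openness of \<open>U\<close> lets \<open>partial_deriv j h\<close> be replaced
      by \<open>p j\<close> on a whole neighbourhood along the line, as differentiating it
      requires.\<close>
    let ?S = "(\<lambda>t. z + t *\<^sub>R axis i 1) -` U"
    have S: "open ?S" by (intro open_vimage U continuous_intros)
    show ?thesis
      by (rule has_field_derivative_transform_within_open[OF d2[OF z] S]) (use z pd1 in auto)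
  qed
  have pd2: "partial_deriv i (partial_deriv j h) z = q i j z" if "z \<in> U" for i j z
    unfolding partial_deriv_def[of i] by (rule DERIV_imp_deriv[OF der2[OF that]])
  have D1: "(\<lambda>t. h (z + t *\<^sub>R axis i 1)) differentiable (at 0)" if "z \<in> U" for i z
    unfolding real_differentiable_def using d1[OF that] by blast
  have D2: "(\<lambda>t. partial_deriv j h (z + t *\<^sub>R axis i 1)) differentiable (at 0)" if "z \<in> U" for i j z
    unfolding real_differentiable_def using der2[OF that] by blast
  have "continuous_on U (partial_deriv i h)" for i
    using c(2)[of i] by (rule continuous_on_eq) (simp add: pd1)
  moreover have "continuous_on U (partial_deriv i (partial_deriv j h))" for i j
    using c(3)[of i j] by (rule continuous_on_eq) (simp add: pd2)
  ultimately show "Ck_on 2 U h"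
    using c(1) D1 D2 by (auto simp: numeral_2_eq_2)
  show "hessian h z = (\<chi> i j. q i j z)" if "z \<in> U" for z
    using pd2[OF that] by (simp add: hessian_def)
qed

lemma Ck_on_2_uminus:
  fixes h :: "real^'n::finite \<Rightarrow> real"
  assumes U: "open U" and Ck: "Ck_on 2 U h"
  shows "Ck_on 2 U (\<lambda>z. - h z)" "\<And>z. z \<in> U \<Longrightarrow> hessian (\<lambda>z. - h z) z = - hessian h z"
proof -
  have d1: "((\<lambda>t. - h (z + t *\<^sub>R axis i 1)) has_real_derivative - partial_deriv i h z) (at 0)" if "z \<in> U" for i z
    using Ck_on_2D(4)[OF Ck, of z 0 i] that by (auto intro: DERIV_minus)
  have d2: "((\<lambda>t. - partial_deriv j h (z + t *\<^sub>R axis i 1)) has_real_derivative - partial_deriv i (partial_deriv j h) z) (at 0)"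
    if "z \<in> U" for i j z
    using Ck_on_2D(5)[OF Ck, of z 0 i j] that by (auto intro: DERIV_minus)
  note I = Ck_on_2I[where h = "\<lambda>z. - h z" and p = "\<lambda>i z. - partial_deriv i h z"
      and q = "\<lambda>i j z. - partial_deriv i (partial_deriv j h) z", OF U d1 d2]
  show "Ck_on 2 U (\<lambda>z. - h z)"
    by (rule I(1)) (auto intro!: continuous_on_minus Ck_on_2D[OF Ck])
  show "hessian (\<lambda>z. - h z) z = - hessian h z" if "z \<in> U" for z
    using I(2)[OF _ _ _ _ _ that] Ck_on_2D[OF Ck] by (simp add: hessian_def vec_eq_iff continuous_on_minus)
qed

definition quad_fun :: "real \<Rightarrow> ('n \<Rightarrow> real) \<Rightarrow> real^'n^'n \<Rightarrow> real^'n \<Rightarrow> real" where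
  "quad_fun c u B z = c + (\<Sum>i\<in>UNIV. u i * z $ i) + quad_form B z"

lemma quad_fun_line:
  fixes B :: "real^'n::finite^'n"
  shows "quad_fun c u B (z + t *\<^sub>R axis i 1) = quad_fun c u B z + t * (u i + (\<Sum>l\<in>UNIV. (B $ i $ l + B $ l $ i) * z $ l)) + t\<^sup>2 * B $ i $ i"
proof -
  have 1: "(\<Sum>k\<in>UNIV. u k * (z + t *\<^sub>R axis i 1) $ k) = (\<Sum>k\<in>UNIV. u k * z $ k) + t * u i"
  proof -
    have "(\<Sum>k\<in>UNIV. u k * (z + t *\<^sub>R axis i 1) $ k) = (\<Sum>k\<in>UNIV. u k * z $ k + (if k = i then t * u i else 0))"
      by (intro sum.cong) (auto simp: axis_def algebra_simps)
    then show ?thesis by (simp add: sum.distrib)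
  qed
  have "quad_form B (z + t *\<^sub>R axis i 1) = (\<Sum>k\<in>UNIV. \<Sum>l\<in>UNIV. B $ k $ l * z $ k * z $ l
     + ((if k = i then t * (B $ i $ l * z $ l) else 0) + ((if l = i then t * (B $ k $ i * z $ k) else 0)
     + (if k = i then if l = i then t\<^sup>2 * B $ i $ i else 0 else 0))))"
    unfolding quad_form_def by (intro sum.cong refl) (auto simp: axis_def algebra_simps power2_eq_square)
  also have "\<dots> = quad_form B z + ((\<Sum>k\<in>UNIV. \<Sum>l\<in>UNIV. if k = i then t * (B $ i $ l * z $ l) else 0)
     + ((\<Sum>k\<in>UNIV. \<Sum>l\<in>UNIV. if l = i then t * (B $ k $ i * z $ k) else 0)
     + (\<Sum>k\<in>UNIV. \<Sum>l\<in>UNIV. if k = i then if l = i then t\<^sup>2 * B $ i $ i else 0 else 0)))"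
    unfolding quad_form_def by (simp only: sum.distrib)
  also have "(\<Sum>k\<in>UNIV. \<Sum>l\<in>UNIV. if k = i then t * (B $ i $ l * z $ l) else 0) = t * (\<Sum>l\<in>UNIV. B $ i $ l * z $ l)"
    by (subst sum.swap) (simp add: sum_distrib_left)
  also have "(\<Sum>k\<in>UNIV. \<Sum>l\<in>UNIV. if l = i then t * (B $ k $ i * z $ k) else 0) = t * (\<Sum>l\<in>UNIV. B $ l $ i * z $ l)"
    by (simp add: sum_distrib_left)
  also have "(\<Sum>k\<in>UNIV. \<Sum>l\<in>UNIV. if k = i then if l = i then t\<^sup>2 * B $ i $ i else 0 else 0) = t\<^sup>2 * B $ i $ i"
    by (subst sum.swap) simp
  finally show ?thesis using 1 by (simp add: quad_fun_def sum.distrib algebra_simps)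
qed

lemma continuous_on_quad_fun: "continuous_on S (quad_fun c u (B :: real^'n::finite^'n))"
  unfolding quad_fun_def quad_form_def by (intro continuous_intros)

text \<open>Dividing by the square of \<open>r\<close> leaves the Hessian unscaled, so minors of the
  blow-up compare with minors of \<open>f\<close> at the rescaled point; the matrix of the form
  enters symmetrized.\<close>

lemma rescaled_minus_quadratic:
  fixes f :: "real^'n::finite \<Rightarrow> real" and x :: "real^'n" and u :: "'n \<Rightarrow> real" and B :: "real^'n^'n" and r c :: real
  assumes U: "open U" and Ck: "Ck_on 2 U f" and r: "r > 0"
  defines "U' \<equiv> {z. x + r *\<^sub>R z \<in> U}"
  defines "h \<equiv> (\<lambda>z. f (x + r *\<^sub>R z) / r\<^sup>2 - quad_fun c u B z)"
  shows "open U'" "Ck_on 2 U' h"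
    "\<And>z. z \<in> U' \<Longrightarrow> hessian h z = hessian f (x + r *\<^sub>R z) - (\<chi> i j. B $ i $ j + B $ j $ i)"
proof -
  have "U' = (\<lambda>z. x + r *\<^sub>R z) -` U" by (auto simp: U'_def)
  then show oU: "open U'" using U by (auto intro!: open_vimage continuous_intros)
  define p where "p i z = partial_deriv i f (x + r *\<^sub>R z) / r - (u i + (\<Sum>l\<in>UNIV. (B $ i $ l + B $ l $ i) * z $ l))" for i z
  define q where "q i j z = partial_deriv i (partial_deriv j f) (x + r *\<^sub>R z) - (B $ i $ j + B $ j $ i)" for i j z
  have scale: "((\<lambda>t. g (x + r *\<^sub>R (z + t *\<^sub>R axis i 1))) has_real_derivative r * D) (at 0)"
    if "((\<lambda>s. g (x + r *\<^sub>R z + s *\<^sub>R axis i 1)) has_real_derivative D) (at 0)" for g :: "real^'n \<Rightarrow> real" and D z i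
  proof -
    have "((\<lambda>t. g (x + r *\<^sub>R z + (r * t) *\<^sub>R axis i 1)) has_real_derivative D * r) (at 0)"
      by (rule DERIV_chain'[where f = "\<lambda>t. r * t" and g = "\<lambda>s. g (x + r *\<^sub>R z + s *\<^sub>R axis i 1)"])
         (use that in \<open>auto intro!: derivative_eq_intros\<close>)
    then show ?thesis by (simp add: scaleR_add_right add.assoc mult.commute)
  qed
  have d1: "((\<lambda>t. h (z + t *\<^sub>R axis i 1)) has_real_derivative p i z) (at 0)" if "z \<in> U'" for i z
  proof -
    have "((\<lambda>t. f (x + r *\<^sub>R (z + t *\<^sub>R axis i 1))) has_real_derivative r * partial_deriv i f (x + r *\<^sub>R z)) (at 0)"
      by (rule scale) (use Ck_on_2D(4)[OF Ck, of "x + r *\<^sub>R z" 0 i] that in \<open>auto simp: U'_def\<close>)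
    then show ?thesis
      unfolding h_def quad_fun_line p_def using r
      by (auto intro!: derivative_eq_intros simp: power2_eq_square)
  qed
  have d2: "((\<lambda>t. p j (z + t *\<^sub>R axis i 1)) has_real_derivative q i j z) (at 0)" if "z \<in> U'" for i j z
  proof -
    have 1: "((\<lambda>t. partial_deriv j f (x + r *\<^sub>R (z + t *\<^sub>R axis i 1))) has_real_derivative r * partial_deriv i (partial_deriv j f) (x + r *\<^sub>R z)) (at 0)"
      by (rule scale) (use Ck_on_2D(5)[OF Ck, of "x + r *\<^sub>R z" 0 i j] that in \<open>auto simp: U'_def\<close>)
    have 2: "(\<Sum>l\<in>UNIV. (B $ j $ l + B $ l $ j) * (z + t *\<^sub>R axis i 1) $ l)
       = (\<Sum>l\<in>UNIV. (B $ j $ l + B $ l $ j) * z $ l) + t * (B $ j $ i + B $ i $ j)" for t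
    proof -
      have "(\<Sum>l\<in>UNIV. (B $ j $ l + B $ l $ j) * (z + t *\<^sub>R axis i 1) $ l)
        = (\<Sum>l\<in>UNIV. (B $ j $ l + B $ l $ j) * z $ l + (if l = i then t * (B $ j $ i + B $ i $ j) else 0))"
        by (intro sum.cong) (auto simp: axis_def algebra_simps)
      then show ?thesis by (simp add: sum.distrib)
    qed
    show ?thesis
      unfolding p_def q_def 2 using 1 r by (auto intro!: derivative_eq_intros simp: field_simps)
  qed
  have cc: "continuous_on U' (\<lambda>z. g (x + r *\<^sub>R z))" if "continuous_on U g" for g :: "real^'n \<Rightarrow> real"
    by (rule continuous_on_compose2[OF that]) (auto simp: U'_def intro!: continuous_intros)
  have ch: "continuous_on U' h" unfolding h_def
    using r by (intro continuous_intros continuous_on_quad_fun cc[OF Ck_on_2D(1)[OF Ck]]) auto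
  have cp: "continuous_on U' (p i)" for i unfolding p_def
    using r by (intro continuous_intros cc[OF Ck_on_2D(2)[OF Ck]]) auto
  have cq: "continuous_on U' (q i j)" for i j unfolding q_def
    by (intro continuous_intros cc[OF Ck_on_2D(3)[OF Ck]])
  show "Ck_on 2 U' h" by (rule Ck_on_2I(1)[OF oU d1 d2 ch cp cq])
  show "hessian h z = hessian f (x + r *\<^sub>R z) - (\<chi> i j. B $ i $ j + B $ j $ i)" if "z \<in> U'" for z
    using Ck_on_2I(2)[OF oU d1 d2 ch cp cq that] by (simp add: hessian_def q_def vec_eq_iff)
qed

text \<open>The one-sided bound applied to \<open>h\<close> and to its negative, whose minors differ
  only in sign.\<close>

lemma two_sided_bound_from_measure:
  assumes "\<epsilon> > 0"
  shows "\<exists>\<delta>>0. \<forall>(h :: real^'n::{finite,wellorder} \<Rightarrow> real) U b. open U \<longrightarrow> cube 1 \<subseteq> U \<longrightarrow> Ck_on 2 U h \<longrightarrow>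
     (\<integral>\<^sup>+z\<in>cube 1. ennreal (all_minors (hessian h z)) \<partial>lborel) \<le> ennreal M \<longrightarrow>
     emeasure lborel {z\<in>cube 1. b < \<bar>h z\<bar>} \<le> ennreal \<delta> \<longrightarrow>
     (\<forall>z\<in>cube (1/2). \<bar>h z\<bar> \<le> b + \<epsilon>)"
proof -
  have "\<exists>\<delta>>0. \<forall>h U c b. open U \<longrightarrow> cube 1 \<subseteq> U \<longrightarrow> Ck_on 2 U h \<longrightarrow> c \<in> cube 1 \<longrightarrow>
     (\<integral>\<^sup>+z\<in>cube 1. ennreal (minor_sum (UNIV :: 'n set) (hessian h (slice c UNIV z))) \<partial>lborel) \<le> ennreal M \<longrightarrow>
     emeasure lborel {z\<in>cube 1. b < h (slice c UNIV z)} \<le> ennreal \<delta> \<longrightarrow>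
     (\<forall>z\<in>cube (1/2). h (slice c UNIV z) \<le> b + \<epsilon>)"
    by (rule upper_bound_from_measure) (use assms in auto)
  then obtain \<delta> where \<delta>: "\<delta> > 0" and D: "\<forall>h U c b. open U \<longrightarrow> cube 1 \<subseteq> U \<longrightarrow> Ck_on 2 U h \<longrightarrow> c \<in> cube 1 \<longrightarrow>
     (\<integral>\<^sup>+z\<in>cube 1. ennreal (minor_sum (UNIV :: 'n set) (hessian h (slice c UNIV z))) \<partial>lborel) \<le> ennreal M \<longrightarrow>
     emeasure lborel {z\<in>cube 1. b < h (slice c UNIV z)} \<le> ennreal \<delta> \<longrightarrow>
     (\<forall>z\<in>cube (1/2). h (slice c UNIV z) \<le> b + \<epsilon>)" by blast
  have sl: "slice c UNIV z = z" for c z :: "real^'n::_" by (simp add: vec_eq_iff)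
  have one: "h z \<le> b + \<epsilon>"
    if U: "open U" "cube 1 \<subseteq> U" and Ck: "Ck_on 2 U h"
      and m: "(\<integral>\<^sup>+z\<in>cube 1. ennreal (all_minors (hessian h z)) \<partial>lborel) \<le> ennreal M"
      and e: "emeasure lborel {z\<in>cube 1. b < h z} \<le> ennreal \<delta>" and z: "z \<in> cube (1/2)"
    for h :: "real^'n::_ \<Rightarrow> real" and U b z
  proof -
    have "(\<integral>\<^sup>+z\<in>cube 1. ennreal (minor_sum UNIV (hessian h z)) \<partial>lborel) \<le> (\<integral>\<^sup>+z\<in>cube 1. ennreal (all_minors (hessian h z)) \<partial>lborel)"
      by (intro nn_integral_mono mult_right_mono ennreal_leI minor_sum_le_all_minors) auto
    then have m': "(\<integral>\<^sup>+z\<in>cube 1. ennreal (minor_sum UNIV (hessian h z)) \<partial>lborel) \<le> ennreal M" using m by (rule order_trans)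
    have "0 \<in> (cube 1 :: (real^'n::_) set)" by (simp add: cube_def)
    from D[rule_format, OF U Ck this, unfolded sl, OF m' e z] show ?thesis .
  qed
  show ?thesis
  proof (intro exI[of _ \<delta>] conjI \<delta> allI impI ballI)
    fix h :: "real^'n::_ \<Rightarrow> real" and U and b :: real and z :: "real^'n::_"
    assume U: "open U" "cube 1 \<subseteq> U" and Ck: "Ck_on 2 U h"
      and m: "(\<integral>\<^sup>+z\<in>cube 1. ennreal (all_minors (hessian h z)) \<partial>lborel) \<le> ennreal M"
      and e: "emeasure lborel {z\<in>cube 1. b < \<bar>h z\<bar>} \<le> ennreal \<delta>" and z: "z \<in> cube (1/2)"
    have c: "continuous_on (cube 1) h" using Ck_on_2D(1)[OF Ck] U(2) by (rule continuous_on_subset)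
    then have [measurable]: "(\<lambda>z. indicator (cube 1) z *\<^sub>R h z) \<in> borel_measurable borel"
      by (intro borel_measurable_continuous_on_indicator) auto
    have "{z\<in>cube 1. b < \<bar>h z\<bar>} = {z. b < \<bar>indicator (cube 1) z *\<^sub>R h z\<bar>} \<inter> cube 1" by auto
    also have "\<dots> \<in> sets borel" by measurable
    finally have [measurable]: "{z\<in>cube 1. b < \<bar>h z\<bar>} \<in> sets borel" .
    have e1: "emeasure lborel {z\<in>cube 1. b < h z} \<le> ennreal \<delta>"
      by (rule order_trans[OF emeasure_mono e]) auto
    have e2: "emeasure lborel {z\<in>cube 1. b < - h z} \<le> ennreal \<delta>"
      by (rule order_trans[OF emeasure_mono e]) auto
    have "(\<integral>\<^sup>+z\<in>cube 1. ennreal (all_minors (hessian (\<lambda>z. - h z) z)) \<partial>lborel) = (\<integral>\<^sup>+z\<in>cube 1. ennreal (all_minors (hessian h z)) \<partial>lborel)"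
      by (intro nn_integral_cong)
         (use Ck_on_2_uminus(2)[OF U(1) Ck] U(2) in \<open>auto simp: all_minors_uminus split: split_indicator\<close>)
    then have m2: "(\<integral>\<^sup>+z\<in>cube 1. ennreal (all_minors (hessian (\<lambda>z. - h z) z)) \<partial>lborel) \<le> ennreal M" using m by simp
    have "h z \<le> b + \<epsilon>" by (rule one[OF U Ck m e1 z])
    moreover have "- h z \<le> b + \<epsilon>" by (rule one[OF U Ck_on_2_uminus(1)[OF U(1) Ck] m2 e2 z])
    ultimately show "\<bar>h z\<bar> \<le> b + \<epsilon>" by (simp add: abs_le_iff)
  qed
qed

lemma nn_integral_lborel_scale:
  fixes F :: "real^'n::finite \<Rightarrow> ennreal"
  assumes [measurable]: "F \<in> borel_measurable borel" and r: "r > 0"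
  shows "(\<integral>\<^sup>+y. F y \<partial>lborel) = ennreal (r ^ CARD('n)) * (\<integral>\<^sup>+z. F (x + r *\<^sub>R z) \<partial>lborel)"
proof -
  have "(\<integral>\<^sup>+y. F y \<partial>lborel) = (\<integral>\<^sup>+y. F y \<partial>density (distr lborel borel (\<lambda>z. x + r *\<^sub>R z)) (\<lambda>_. ennreal (\<bar>r\<bar> ^ DIM(real^'n))))"
    using r by (subst lborel_affine[of r x]) auto
  also have "\<dots> = ennreal (r ^ CARD('n)) * (\<integral>\<^sup>+z. F (x + r *\<^sub>R z) \<partial>lborel)"
    using r by (simp add: nn_integral_density nn_integral_distr nn_integral_cmult)
  finally show ?thesis .
qed

lemma le_zero_of_le_ennreal:
  fixes y :: ennreal
  assumes "\<And>\<theta>. \<theta> > 0 \<Longrightarrow> y \<le> ennreal \<theta>" shows "y \<le> 0"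
proof (rule ennreal_le_epsilon)
  fix e :: real assume "e > 0"
  then have "y \<le> ennreal e" by (rule assms)
  then show "y \<le> 0 + ennreal e" by (simp only: add_0_left)
qed

lemma Markov_emeasure:
  fixes F :: "'a::euclidean_space \<Rightarrow> ennreal"
  assumes [measurable]: "F \<in> borel_measurable borel" "S \<in> sets borel" and a: "a > 0" and b: "b \<ge> 0"
    and ge: "\<And>z. z \<in> S \<Longrightarrow> ennreal a \<le> F z" and le: "(\<integral>\<^sup>+z. F z \<partial>lborel) \<le> ennreal (a * b)"
  shows "emeasure lborel S \<le> ennreal b"
proof -
  have "ennreal a * emeasure lborel S = (\<integral>\<^sup>+z. ennreal a * indicator S z \<partial>lborel)"
    by (simp add: nn_integral_cmult)
  also have "\<dots> \<le> (\<integral>\<^sup>+z. F z \<partial>lborel)"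
    by (intro nn_integral_mono) (use ge in \<open>auto split: split_indicator\<close>)
  also note le
  also have "ennreal (a * b) = ennreal a * ennreal b" using a b by (simp add: ennreal_mult)
  finally show ?thesis using a by (subst (asm) ennreal_mult_le_mult_iff) auto
qed

lemma cube_mono: "s \<le> t \<Longrightarrow> cube s \<subseteq> cube t"
  unfolding cube_def using order_trans by blast

lemma cube_subset_cball:
  fixes x :: "real^'n::finite"
  assumes "r > 0" "z \<in> cube 1" shows "x + r *\<^sub>R z \<in> cball x (r * CARD('n))"
  using coord_proj_cube_bound[OF assms(2), of UNIV] assms(1) by (simp add: dist_norm)

lemma quad_fun_scale:
  fixes B :: "real^'n::finite^'n"
  assumes "r > 0"
  shows "quad_fun (c / r\<^sup>2) (\<lambda>i. u i / r) B z = quad_fun c u B (r *\<^sub>R z) / r\<^sup>2"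
proof -
  have "quad_form B (r *\<^sub>R z) = r\<^sup>2 * quad_form B z"
    by (simp add: quad_form_def sum_distrib_left power2_eq_square mult_ac)
  moreover have "(\<Sum>i\<in>UNIV. u i * (r *\<^sub>R z) $ i) / r\<^sup>2 = (\<Sum>i\<in>UNIV. u i / r * z $ i)"
    using assms by (simp add: sum_divide_distrib power2_eq_square)
  ultimately show ?thesis using assms by (simp add: quad_fun_def add_divide_distrib)
qed

section \<open>The two applications of the maximum principle\<close>

locale bounded_minors = bounded_hessians U f g x0 \<rho> C
  for U :: "(real^'n::{finite,wellorder}) set" and f :: "nat \<Rightarrow> real^'n::{finite,wellorder} \<Rightarrow> real"
    and g :: "real^'n::{finite,wellorder} \<Rightarrow> real" and x0 \<rho> C +
  assumes minors: "\<And>k. (\<integral>\<^sup>+x. ennreal (all_minors (hessian (f k) x)) * indicator {x. x - x0 \<in> cube (4 * \<rho>)} x \<partial>lborel) \<le> ennreal C"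
begin

definition S :: "nat \<Rightarrow> real^'n::_ \<Rightarrow> real" where "S k x = indicator (Q 4) x *\<^sub>R all_minors (hessian (f k) x)"

lemma S_borel [measurable]: "S k \<in> borel_measurable borel"
  unfolding S_def[abs_def] using continuous_on_subset[OF continuous_on_all_minors_hessian[OF Ck] Q4_sub]
  by (intro borel_measurable_continuous_on_indicator) auto

lemma S_le: "(\<integral>\<^sup>+x. ennreal (S k x) \<partial>lborel) \<le> ennreal C"
proof -
  have "(\<integral>\<^sup>+x. ennreal (S k x) \<partial>lborel) = (\<integral>\<^sup>+x. ennreal (all_minors (hessian (f k) x)) * indicator {x. x - x0 \<in> cube (4 * \<rho>)} x \<partial>lborel)"
    by (intro nn_integral_cong) (auto simp: S_def Q_def split: split_indicator)
  then show ?thesis using minors by simp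
qed

text \<open>Change of variables only: uniform in \<open>k\<close> and in the centre, but exploding
  as \<open>s\<close> shrinks, hence of use at a fixed scale.\<close>

lemma S_rescaled_le:
  assumes s: "s > 0"
  shows "(\<integral>\<^sup>+z\<in>cube 1. ennreal (S k (x + s *\<^sub>R z)) \<partial>lborel) \<le> ennreal (C / s ^ CARD('n))"
proof -
  let ?n = "CARD('n)"
  have "ennreal (s ^ ?n) * (\<integral>\<^sup>+z\<in>cube 1. ennreal (S k (x + s *\<^sub>R z)) \<partial>lborel)
    \<le> ennreal (s ^ ?n) * (\<integral>\<^sup>+z. ennreal (S k (x + s *\<^sub>R z)) \<partial>lborel)"
    by (intro mult_left_mono nn_integral_mono) (auto split: split_indicator)
  also have "\<dots> = (\<integral>\<^sup>+y. ennreal (S k y) \<partial>lborel)"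
    by (rule nn_integral_lborel_scale[OF _ s, symmetric]) measurable
  also have "\<dots> \<le> ennreal C" by (rule S_le)
  also have "\<dots> = ennreal (s ^ ?n) * ennreal (C / s ^ ?n)" using s C0 by (simp add: ennreal_mult[symmetric])
  finally show ?thesis using s by (subst (asm) ennreal_mult_le_mult_iff) auto
qed

lemma Q_cube:
  assumes "x \<in> Q 1" "0 < r" "r \<le> \<rho>" "z \<in> cube 1" shows "x + r *\<^sub>R z \<in> Q 4"
proof -
  have "\<bar>(x + r *\<^sub>R z - x0) $ i\<bar> \<le> 4 * \<rho>" for i
  proof -
    have "\<bar>(x - x0) $ i\<bar> \<le> \<rho>" using assms(1) by (simp add: Q_def cube_def)
    moreover have "r * \<bar>z $ i\<bar> \<le> \<rho> * 1" using assms by (intro mult_mono) (auto simp: cube_def)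
    then have "\<bar>(r *\<^sub>R z) $ i\<bar> \<le> \<rho>" using assms(2) by (simp add: abs_mult)
    moreover have "(x + r *\<^sub>R z - x0) $ i = (x - x0) $ i + (r *\<^sub>R z) $ i" by simp
    ultimately show ?thesis using \<rho> by linarith
  qed
  then show ?thesis by (simp add: Q_def cube_def)
qed

text \<open>The two-sided bound in original units. The property of \<open>\<delta>\<close> is a
  premise, so that \<open>\<delta>\<close> can be fixed from the mass bound \<open>N\<close> before
  the scale and the index are chosen.\<close>

lemma blow_up_bound:
  assumes x: "x \<in> Q 1" and r: "0 < r" "r \<le> \<rho>" and \<epsilon>: "\<epsilon> > 0" and K0: "K \<ge> 0"
    and K: "\<And>A. all_minors (A - (\<chi> i j. B $ i $ j + B $ j $ i)) \<le> K * all_minors A"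
    and N0: "N \<ge> 0"
    and mass: "(\<integral>\<^sup>+z\<in>cube 1. ennreal (S k (x + r *\<^sub>R z)) \<partial>lborel) \<le> ennreal N"
    and \<delta>: "\<forall>(h :: real^'n::_ \<Rightarrow> real) U b. open U \<longrightarrow> cube 1 \<subseteq> U \<longrightarrow> Ck_on 2 U h \<longrightarrow>
     (\<integral>\<^sup>+z\<in>cube 1. ennreal (all_minors (hessian h z)) \<partial>lborel) \<le> ennreal (K * N) \<longrightarrow>
     emeasure lborel {z\<in>cube 1. b < \<bar>h z\<bar>} \<le> ennreal \<delta> \<longrightarrow>
     (\<forall>z\<in>cube (1/2). \<bar>h z\<bar> \<le> b + \<epsilon>)"
    and bad: "emeasure lborel {z\<in>cube 1. b * r\<^sup>2 < \<bar>F k (x + r *\<^sub>R z) - quad_fun c u B (r *\<^sub>R z)\<bar>} \<le> ennreal \<delta>"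
    and z: "z \<in> cube (1/2)"
  shows "\<bar>f k (x + r *\<^sub>R z) - quad_fun c u B (r *\<^sub>R z)\<bar> \<le> (b + \<epsilon>) * r\<^sup>2"
proof -
  define U' where "U' = {z. x + r *\<^sub>R z \<in> U}"
  define h where "h = (\<lambda>z. f k (x + r *\<^sub>R z) / r\<^sup>2 - quad_fun (c / r\<^sup>2) (\<lambda>i. u i / r) B z)"
  note R = rescaled_minus_quadratic(1)[OF openU Ck[of k] r(1), where x = x, folded U'_def]
    rescaled_minus_quadratic(2-)[OF openU Ck[of k] r(1), where x = x and c = "c / r\<^sup>2" and u = "\<lambda>i. u i / r" and B = B, folded U'_def h_def]
  have hq: "h z = (f k (x + r *\<^sub>R z) - quad_fun c u B (r *\<^sub>R z)) / r\<^sup>2" for z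
    by (simp add: h_def quad_fun_scale[OF r(1)] diff_divide_distrib)
  have habs: "\<bar>h z\<bar> = \<bar>f k (x + r *\<^sub>R z) - quad_fun c u B (r *\<^sub>R z)\<bar> / r\<^sup>2" for z
    by (simp add: hq)
  have sub: "cube 1 \<subseteq> U'" using Q_cube[OF x r] Q4_sub by (auto simp: U'_def)
  have m: "(\<integral>\<^sup>+z\<in>cube 1. ennreal (all_minors (hessian h z)) \<partial>lborel) \<le> ennreal (K * N)"
  proof -
    have "(\<integral>\<^sup>+z\<in>cube 1. ennreal (all_minors (hessian h z)) \<partial>lborel) \<le> (\<integral>\<^sup>+z. ennreal K * (ennreal (S k (x + r *\<^sub>R z)) * indicator (cube 1) z) \<partial>lborel)"
    proof (rule nn_integral_mono)
      fix z :: "real^'n::_"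
      show "ennreal (all_minors (hessian h z)) * indicator (cube 1) z \<le> ennreal K * (ennreal (S k (x + r *\<^sub>R z)) * indicator (cube 1) z)"
      proof (cases "z \<in> cube 1")
        case True
        have "all_minors (hessian h z) \<le> K * all_minors (hessian (f k) (x + r *\<^sub>R z))"
          using R(3)[of z] sub True K by auto
        then have "ennreal (all_minors (hessian h z)) \<le> ennreal (K * S k (x + r *\<^sub>R z))"
          using Q_cube[OF x r True] by (intro ennreal_leI) (simp add: S_def)
        then show ?thesis using True K0 by (simp add: ennreal_mult')
      qed simp
    qed
    also have "\<dots> = ennreal K * (\<integral>\<^sup>+z\<in>cube 1. ennreal (S k (x + r *\<^sub>R z)) \<partial>lborel)"
      by (rule nn_integral_cmult) measurable
    also have "\<dots> \<le> ennreal K * ennreal N" by (intro mult_left_mono mass) auto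
    also have "\<dots> = ennreal (K * N)" using K0 N0 by (simp add: ennreal_mult)
    finally show ?thesis .
  qed
  have "{z\<in>cube 1. b < \<bar>h z\<bar>} = {z\<in>cube 1. b * r\<^sup>2 < \<bar>F k (x + r *\<^sub>R z) - quad_fun c u B (r *\<^sub>R z)\<bar>}"
    using Q_cube[OF x r] r by (auto simp: habs FGH_eq(1) pos_less_divide_eq)
  then have e: "emeasure lborel {z\<in>cube 1. b < \<bar>h z\<bar>} \<le> ennreal \<delta>" using bad by simp
  have "\<bar>h z\<bar> \<le> b + \<epsilon>" by (rule \<delta>[rule_format, OF R(1) sub R(2) m e z])
  then show ?thesis using r by (simp add: habs pos_divide_le_eq)
qed

text \<open>At a fixed scale convergence in the mean gives convergence in measure;
  \<open>r ^ CARD('n)\<close> is the Jacobian of the rescaling.\<close>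

lemma F_tendsto_in_measure:
  assumes r: "0 < r" "r \<le> \<rho>" and x: "x \<in> Q 1" and "\<epsilon> > 0" "\<delta> > 0"
  shows "\<forall>\<^sub>F k in sequentially. emeasure lborel {z\<in>cube 1. \<epsilon> < \<bar>F k (x + r *\<^sub>R z) - g (x + r *\<^sub>R z)\<bar>} \<le> ennreal \<delta>"
proof -
  have "\<forall>\<^sub>F k in sequentially. (\<integral>\<^sup>+y\<in>Q 4. ennreal \<bar>F k y - g y\<bar> \<partial>lborel) \<le> ennreal (r ^ CARD('n) * (\<epsilon> * \<delta>))"
    using conv' assms by (intro tendsto_0_ennrealD) auto
  then show ?thesis
  proof eventually_elim
    case (elim k)
    let ?D = "\<lambda>z. ennreal \<bar>F k (x + r *\<^sub>R z) - g (x + r *\<^sub>R z)\<bar> * indicator (Q 4) (x + r *\<^sub>R z)"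
    have "ennreal (r ^ CARD('n)) * (\<integral>\<^sup>+z. ?D z \<partial>lborel) = (\<integral>\<^sup>+y\<in>Q 4. ennreal \<bar>F k y - g y\<bar> \<partial>lborel)"
      by (rule nn_integral_lborel_scale[OF _ r(1), symmetric]) measurable
    also note elim
    also have "ennreal (r ^ CARD('n) * (\<epsilon> * \<delta>)) = ennreal (r ^ CARD('n)) * ennreal (\<epsilon> * \<delta>)"
      using assms by (intro ennreal_mult) auto
    finally have "(\<integral>\<^sup>+z. ?D z \<partial>lborel) \<le> ennreal (\<epsilon> * \<delta>)"
      using r by (subst (asm) ennreal_mult_le_mult_iff) auto
    then show ?case
      by (rule Markov_emeasure[where F = ?D, rotated -1])
         (use assms Q_cube[OF x r] in \<open>auto intro: ennreal_leI\<close>)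
  qed
qed

text \<open>At each small scale the lower limit of the masses selects infinitely many indices with
  rescaled mass at most \<open>V + 1\<close>. Their uniform closeness to the quadratic function
  passes to \<open>g\<close> off a null set, and at half the scale the cruder mass bound then
  suffices for all large \<open>k\<close>.\<close>

lemma sup_bound_near_AE_point:
  fixes u :: "'n \<Rightarrow> real" and B :: "real^'n::_^'n::_"
  assumes x: "x \<in> Q 1"
    and growth: "d > 0" "\<And>c r. 0 < r \<and> r < d \<and> x \<in> cball c r \<Longrightarrow>
       liminf (\<lambda>k. emeasure (density lborel (\<lambda>x. ennreal (S k x))) (cball c r)) \<le> of_nat N * emeasure lborel (cball c r)"
    and taylor: "(\<lambda>m. \<integral>\<^sup>+z\<in>cube 1. ennreal (min 1 (\<bar>g (x + (1/2)^m *\<^sub>R z) - g x - (1/2)^m * (\<Sum>i\<in>UNIV. u i * z $ i)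
       - ((1/2)^m)\<^sup>2 * quad_form B z\<bar> / ((1/2)^m)\<^sup>2)) \<partial>lborel) \<longlonglongrightarrow> 0"
    and \<epsilon>: "\<epsilon> > 0"
  shows "\<forall>\<^sub>F m in sequentially. \<forall>\<^sub>F k in sequentially. \<forall>z\<in>cube (1/2).
     \<bar>f k (x + (1/2)^m *\<^sub>R z) - quad_fun (g x) u B ((1/2)^m *\<^sub>R z)\<bar> \<le> \<epsilon> * ((1/2)^m)\<^sup>2"
proof -
  let ?n = "CARD('n)"
  let ?q = "quad_fun (g x) u B"
  have qm: "?q \<in> borel_measurable borel"
    by (rule borel_measurable_continuous_onI[OF continuous_on_quad_fun])
  note [measurable] = qm
  define r where "r m = (1/2::real)^m" for m :: nat
  have r0: "r m > 0" for m by (simp add: r_def)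
  have rlim: "r \<longlonglongrightarrow> 0" unfolding r_def by (rule LIMSEQ_power_zero) simp
  have q_expand: "?q (t *\<^sub>R z) = g x + t * (\<Sum>i\<in>UNIV. u i * z $ i) + t\<^sup>2 * quad_form B z" for t z
    by (simp add: quad_fun_def quad_form_def sum_distrib_left power2_eq_square mult_ac)
  \<comment> \<open>The losses add up to \<open>18 * e\<close>: the bound \<open>4 * e\<close> for
    \<open>g\<close> becomes \<open>16 * e\<close> at half the scale, and the closeness of
    \<open>f k\<close> to \<open>g\<close> and the maximum principle add one \<open>e\<close>
    each.\<close>
  define e where "e = \<epsilon> / 20"
  have e: "e > 0" using \<epsilon> by (simp add: e_def)
  obtain K where K: "K \<ge> 0" "\<And>A. all_minors (A - (\<chi> i j. B $ i $ j + B $ j $ i)) \<le> K * all_minors A"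
    by (rule all_minors_diff_le) (rule that)
  \<comment> \<open>\<open>N\<close> times the volume of the ball of radius \<open>CARD('n)\<close>,
    which contains \<open>cube 1\<close>. Adding one turns the bound on the lower limit into a bound
    for infinitely many \<open>k\<close>.\<close>
  define V where "V = real N * (unit_ball_vol (real ?n) * real ?n ^ ?n)"
  have V: "V \<ge> 0" by (simp add: V_def)
  obtain \<delta> where \<delta>0: "\<delta> > 0" and \<delta>: "\<forall>(h :: real^'n::_ \<Rightarrow> real) U b. open U \<longrightarrow> cube 1 \<subseteq> U \<longrightarrow> Ck_on 2 U h \<longrightarrow>
     (\<integral>\<^sup>+z\<in>cube 1. ennreal (all_minors (hessian h z)) \<partial>lborel) \<le> ennreal (K * (V + 1)) \<longrightarrow>
     emeasure lborel {z\<in>cube 1. b < \<bar>h z\<bar>} \<le> ennreal \<delta> \<longrightarrow>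
     (\<forall>z\<in>cube (1/2). \<bar>h z\<bar> \<le> b + e)"
    using two_sided_bound_from_measure[OF e, of "K * (V + 1)"] by blast
  have stepA: "\<forall>\<^sub>F m in sequentially. emeasure lborel {z\<in>cube (1/2). 4 * e * (r m)\<^sup>2 < \<bar>g (x + r m *\<^sub>R z) - ?q (r m *\<^sub>R z)\<bar>} = 0"
  proof -
    have "\<forall>\<^sub>F m in sequentially. r m < \<rho>" by (rule order_tendstoD(2)[OF rlim \<rho>])
    moreover have "\<forall>\<^sub>F m in sequentially. r m < d / ?n" using growth(1) by (intro order_tendstoD(2)[OF rlim]) auto
    moreover have "\<forall>\<^sub>F m in sequentially. (\<integral>\<^sup>+z\<in>cube 1. ennreal (min 1 (\<bar>g (x + r m *\<^sub>R z) - g x - r m * (\<Sum>i\<in>UNIV. u i * z $ i)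
       - (r m)\<^sup>2 * quad_form B z\<bar> / (r m)\<^sup>2)) \<partial>lborel) \<le> ennreal (min 1 e * (\<delta> / 2))"
      using taylor e \<delta>0 unfolding r_def by (intro tendsto_0_ennrealD) auto
    ultimately show ?thesis
    proof eventually_elim
      case (elim m)
      have rm: "0 < r m" "r m \<le> \<rho>" using r0 elim by auto
      have b1: "emeasure lborel {z\<in>cube 1. e * (r m)\<^sup>2 < \<bar>g (x + r m *\<^sub>R z) - ?q (r m *\<^sub>R z)\<bar>} \<le> ennreal (\<delta> / 2)"
      proof (rule Markov_emeasure[OF _ _ _ _ _ elim(3)])
        fix z assume z: "z \<in> {z\<in>cube 1. e * (r m)\<^sup>2 < \<bar>g (x + r m *\<^sub>R z) - ?q (r m *\<^sub>R z)\<bar>}"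
        let ?E = "\<bar>g (x + r m *\<^sub>R z) - g x - r m * (\<Sum>i\<in>UNIV. u i * z $ i) - (r m)\<^sup>2 * quad_form B z\<bar>"
        have "?E = \<bar>g (x + r m *\<^sub>R z) - ?q (r m *\<^sub>R z)\<bar>" by (simp add: q_expand algebra_simps)
        then have "e * (r m)\<^sup>2 < ?E" using z by simp
        then have "e \<le> ?E / (r m)\<^sup>2" using rm by (simp add: pos_le_divide_eq)
        then have "min 1 e \<le> min 1 (?E / (r m)\<^sup>2)" by auto
        then show "ennreal (min 1 e) \<le> ennreal (min 1 (?E / (r m)\<^sup>2)) * indicator (cube 1) z"
          using z by (auto intro: ennreal_leI)
      qed (use e \<delta>0 in \<open>auto\<close>)
      let ?X = "\<lambda>k. emeasure (density lborel (\<lambda>x. ennreal (S k x))) (cball x (r m * ?n))"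
      have "liminf ?X \<le> of_nat N * emeasure lborel (cball x (r m * ?n))"
        by (rule growth(2)) (use rm elim(2) in \<open>auto simp: field_simps\<close>)
      also have "\<dots> = ennreal (V * r m ^ ?n)"
        using rm by (simp add: emeasure_cball V_def ennreal_of_nat_eq_real_of_nat ennreal_mult[symmetric] power_mult_distrib mult_ac)
      also have "\<dots> < ennreal ((V + 1) * r m ^ ?n)"
        using rm V by (intro ennreal_lessI) auto
      finally have lim: "liminf ?X < ennreal ((V + 1) * r m ^ ?n)" .
      have "\<not> (\<forall>\<^sub>F k in sequentially. ennreal ((V + 1) * r m ^ ?n) \<le> ?X k)"
        using lim Liminf_bounded[of "ennreal ((V + 1) * r m ^ ?n)" ?X sequentially] by auto
      then have fr: "\<exists>\<^sub>F k in sequentially. ?X k < ennreal ((V + 1) * r m ^ ?n)" by (simp add: frequently_def not_less)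
      \<comment> \<open>In units of the squared scale: where \<open>g\<close> deviates by more than
        \<open>4 * e\<close>, it differs by more than \<open>e\<close> from \<open>f k\<close>,
        which deviates by at most \<open>3 * e\<close>. Since good indices \<open>k\<close> occur
        arbitrarily late, this set has measure below every \<open>\<theta>\<close>.\<close>
      have "emeasure lborel {z\<in>cube (1/2). 4 * e * (r m)\<^sup>2 < \<bar>g (x + r m *\<^sub>R z) - ?q (r m *\<^sub>R z)\<bar>} \<le> ennreal \<theta>" if \<theta>: "\<theta> > 0" for \<theta>
      proof -
        have ev1: "\<forall>\<^sub>F k in sequentially. emeasure lborel {z\<in>cube 1. e * (r m)\<^sup>2 < \<bar>F k (x + r m *\<^sub>R z) - g (x + r m *\<^sub>R z)\<bar>} \<le> ennreal (\<delta> / 2)"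
          using rm e \<delta>0 by (intro F_tendsto_in_measure[OF rm x]) auto
        have ev2: "\<forall>\<^sub>F k in sequentially. emeasure lborel {z\<in>cube 1. e * (r m)\<^sup>2 < \<bar>F k (x + r m *\<^sub>R z) - g (x + r m *\<^sub>R z)\<bar>} \<le> ennreal \<theta>"
          using rm e \<theta> by (intro F_tendsto_in_measure[OF rm x]) auto
        obtain k where k: "?X k < ennreal ((V + 1) * r m ^ ?n)"
          "emeasure lborel {z\<in>cube 1. e * (r m)\<^sup>2 < \<bar>F k (x + r m *\<^sub>R z) - g (x + r m *\<^sub>R z)\<bar>} \<le> ennreal (\<delta> / 2)"
          "emeasure lborel {z\<in>cube 1. e * (r m)\<^sup>2 < \<bar>F k (x + r m *\<^sub>R z) - g (x + r m *\<^sub>R z)\<bar>} \<le> ennreal \<theta>"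
          using frequently_ex[OF frequently_eventually_frequently[OF frequently_eventually_frequently[OF fr ev1] ev2]] by auto
        have mass: "(\<integral>\<^sup>+z\<in>cube 1. ennreal (S k (x + r m *\<^sub>R z)) \<partial>lborel) \<le> ennreal (V + 1)"
        proof -
          have [measurable]: "cball x (r m * ?n) \<in> sets borel" by simp
          have "ennreal (r m ^ ?n) * (\<integral>\<^sup>+z\<in>cube 1. ennreal (S k (x + r m *\<^sub>R z)) \<partial>lborel)
             \<le> ennreal (r m ^ ?n) * (\<integral>\<^sup>+z. ennreal (S k (x + r m *\<^sub>R z)) * indicator (cball x (r m * ?n)) (x + r m *\<^sub>R z) \<partial>lborel)"
          proof (rule mult_left_mono, rule nn_integral_mono)
            fix z :: "real^'n::_"
            show "ennreal (S k (x + r m *\<^sub>R z)) * indicator (cube 1) z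
              \<le> ennreal (S k (x + r m *\<^sub>R z)) * indicator (cball x (r m * ?n)) (x + r m *\<^sub>R z)"
              using cube_subset_cball[OF rm(1), of z x] by (auto split: split_indicator)
          qed simp
          also have "\<dots> = (\<integral>\<^sup>+y. ennreal (S k y) * indicator (cball x (r m * ?n)) y \<partial>lborel)"
            by (rule nn_integral_lborel_scale[OF _ rm(1), symmetric]) measurable
          also have "\<dots> = ?X k" by (simp add: emeasure_density)
          also have "\<dots> \<le> ennreal (r m ^ ?n) * ennreal (V + 1)"
            using k(1) V rm by (simp add: ennreal_mult[symmetric] mult.commute less_imp_le del: ennreal_plus)
          finally show ?thesis using rm by (subst (asm) ennreal_mult_le_mult_iff) auto
        qed
        have bad: "emeasure lborel {z\<in>cube 1. 2 * e * (r m)\<^sup>2 < \<bar>F k (x + r m *\<^sub>R z) - ?q (r m *\<^sub>R z)\<bar>} \<le> ennreal \<delta>"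
        proof -
          have "emeasure lborel {z\<in>cube 1. 2 * e * (r m)\<^sup>2 < \<bar>F k (x + r m *\<^sub>R z) - ?q (r m *\<^sub>R z)\<bar>}
            \<le> emeasure lborel ({z\<in>cube 1. e * (r m)\<^sup>2 < \<bar>F k (x + r m *\<^sub>R z) - g (x + r m *\<^sub>R z)\<bar>}
                \<union> {z\<in>cube 1. e * (r m)\<^sup>2 < \<bar>g (x + r m *\<^sub>R z) - ?q (r m *\<^sub>R z)\<bar>})"
            by (intro emeasure_mono) auto
          also have "\<dots> \<le> emeasure lborel {z\<in>cube 1. e * (r m)\<^sup>2 < \<bar>F k (x + r m *\<^sub>R z) - g (x + r m *\<^sub>R z)\<bar>}
                + emeasure lborel {z\<in>cube 1. e * (r m)\<^sup>2 < \<bar>g (x + r m *\<^sub>R z) - ?q (r m *\<^sub>R z)\<bar>}"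
            by (intro emeasure_subadditive) measurable
          also have "\<dots> \<le> ennreal (\<delta> / 2) + ennreal (\<delta> / 2)" by (intro add_mono k b1)
          also have "\<dots> = ennreal \<delta>" using \<delta>0 by (simp flip: ennreal_plus)
          finally show ?thesis .
        qed
        have bound: "\<bar>f k (x + r m *\<^sub>R z) - ?q (r m *\<^sub>R z)\<bar> \<le> 3 * e * (r m)\<^sup>2" if z: "z \<in> cube (1/2)" for z
          using blow_up_bound[OF x rm e K _ mass \<delta> bad z] V by (simp add: algebra_simps)
        have "emeasure lborel {z\<in>cube (1/2). 4 * e * (r m)\<^sup>2 < \<bar>g (x + r m *\<^sub>R z) - ?q (r m *\<^sub>R z)\<bar>}
          \<le> emeasure lborel {z\<in>cube 1. e * (r m)\<^sup>2 < \<bar>F k (x + r m *\<^sub>R z) - g (x + r m *\<^sub>R z)\<bar>}"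
        proof (rule emeasure_mono)
          show "{z\<in>cube (1/2). 4 * e * (r m)\<^sup>2 < \<bar>g (x + r m *\<^sub>R z) - ?q (r m *\<^sub>R z)\<bar>}
            \<subseteq> {z\<in>cube 1. e * (r m)\<^sup>2 < \<bar>F k (x + r m *\<^sub>R z) - g (x + r m *\<^sub>R z)\<bar>}"
          proof safe
            fix z :: "real^'n::_"
            assume z: "z \<in> cube (1/2)" and gt: "4 * e * (r m)\<^sup>2 < \<bar>g (x + r m *\<^sub>R z) - ?q (r m *\<^sub>R z)\<bar>"
            show z1: "z \<in> cube 1" using z cube_mono[of "1/2" 1] by auto
            have "F k (x + r m *\<^sub>R z) = f k (x + r m *\<^sub>R z)" using Q_cube[OF x rm z1] by (rule FGH_eq(1))
            then show "e * (r m)\<^sup>2 < \<bar>F k (x + r m *\<^sub>R z) - g (x + r m *\<^sub>R z)\<bar>"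
              using bound[OF z] gt by (simp add: algebra_simps)
          qed
        qed measurable
        then show ?thesis using k(3) by (rule order_trans)
      qed
      then have "emeasure lborel {z\<in>cube (1/2). 4 * e * (r m)\<^sup>2 < \<bar>g (x + r m *\<^sub>R z) - ?q (r m *\<^sub>R z)\<bar>} \<le> 0"
        by (rule le_zero_of_le_ennreal)
      then show ?case by simp
    qed
  qed
  then have stepA': "\<forall>\<^sub>F m in sequentially. emeasure lborel {z\<in>cube (1/2). 4 * e * (r m)\<^sup>2 < \<bar>g (x + r m *\<^sub>R z) - ?q (r m *\<^sub>R z)\<bar>} = 0 \<and> r m \<le> \<rho>"
    using order_tendstoD(2)[OF rlim \<rho>] by eventually_elim auto
  \<comment> \<open>Here \<open>2 * s\<close> is a scale at which the deviation set of
    \<open>g\<close> in the half cube is null; that half cube is the full cube at scale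
    \<open>s\<close>, as the maximum principle requires.\<close>
  have stepB: "\<forall>\<^sub>F k in sequentially. \<forall>z\<in>cube (1/2). \<bar>f k (x + s *\<^sub>R z) - ?q (s *\<^sub>R z)\<bar> \<le> \<epsilon> * s\<^sup>2"
    if s: "0 < s" "2 * s \<le> \<rho>" and null: "emeasure lborel {z\<in>cube (1/2). 4 * e * (2 * s)\<^sup>2 < \<bar>g (x + (2 * s) *\<^sub>R z) - ?q ((2 * s) *\<^sub>R z)\<bar>} = 0" for s
  proof -
    have s': "0 < s" "s \<le> \<rho>" using s by auto
    define N' where "N' = C / s ^ ?n"
    have N': "N' \<ge> 0" using C0 s by (simp add: N'_def)
    have mass: "(\<integral>\<^sup>+z\<in>cube 1. ennreal (S k (x + s *\<^sub>R z)) \<partial>lborel) \<le> ennreal N'" for k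
      unfolding N'_def by (rule S_rescaled_le[OF s(1)])
    obtain \<delta>' where \<delta>'0: "\<delta>' > 0" and \<delta>': "\<forall>(h :: real^'n::_ \<Rightarrow> real) U b. open U \<longrightarrow> cube 1 \<subseteq> U \<longrightarrow> Ck_on 2 U h \<longrightarrow>
       (\<integral>\<^sup>+z\<in>cube 1. ennreal (all_minors (hessian h z)) \<partial>lborel) \<le> ennreal (K * N') \<longrightarrow>
       emeasure lborel {z\<in>cube 1. b < \<bar>h z\<bar>} \<le> ennreal \<delta>' \<longrightarrow>
       (\<forall>z\<in>cube (1/2). \<bar>h z\<bar> \<le> b + e)"
      using two_sided_bound_from_measure[OF e, of "K * N'"] by blast
    have null': "emeasure lborel {z\<in>cube 1. 16 * e * s\<^sup>2 < \<bar>g (x + s *\<^sub>R z) - ?q (s *\<^sub>R z)\<bar>} = 0"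
    proof -
      let ?A = "{z\<in>cube (1/2). 4 * e * (2 * s)\<^sup>2 < \<bar>g (x + (2 * s) *\<^sub>R z) - ?q ((2 * s) *\<^sub>R z)\<bar>}"
      let ?B = "{z\<in>cube 1. 16 * e * s\<^sup>2 < \<bar>g (x + s *\<^sub>R z) - ?q (s *\<^sub>R z)\<bar>}"
      have eq: "indicator ?B (0 + 2 *\<^sub>R z) = (indicator ?A z :: ennreal)" for z
      proof -
        have "2 *\<^sub>R z \<in> cube 1 \<longleftrightarrow> z \<in> cube (1/2)"
          unfolding cube_def mem_Collect_eq by (intro iff_allI) (auto simp: abs_mult)
        then show ?thesis by (auto simp: power2_eq_square mult_ac split: split_indicator)
      qed
      have "emeasure lborel ?B = (\<integral>\<^sup>+y. indicator ?B y \<partial>lborel)" by simp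
      also have "\<dots> = ennreal (2 ^ ?n) * (\<integral>\<^sup>+z. indicator ?B (0 + 2 *\<^sub>R z) \<partial>lborel)"
        by (rule nn_integral_lborel_scale) auto
      also have "\<dots> = ennreal (2 ^ ?n) * emeasure lborel ?A" unfolding eq by simp
      finally show ?thesis using null by simp
    qed
    have "\<forall>\<^sub>F k in sequentially. emeasure lborel {z\<in>cube 1. e * s\<^sup>2 < \<bar>F k (x + s *\<^sub>R z) - g (x + s *\<^sub>R z)\<bar>} \<le> ennreal \<delta>'"
      using s e \<delta>'0 by (intro F_tendsto_in_measure[OF s' x]) auto
    then show ?thesis
    proof eventually_elim
      case (elim k)
      have bad: "emeasure lborel {z\<in>cube 1. 17 * e * s\<^sup>2 < \<bar>F k (x + s *\<^sub>R z) - ?q (s *\<^sub>R z)\<bar>} \<le> ennreal \<delta>'"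
      proof -
        have "emeasure lborel {z\<in>cube 1. 17 * e * s\<^sup>2 < \<bar>F k (x + s *\<^sub>R z) - ?q (s *\<^sub>R z)\<bar>}
          \<le> emeasure lborel ({z\<in>cube 1. e * s\<^sup>2 < \<bar>F k (x + s *\<^sub>R z) - g (x + s *\<^sub>R z)\<bar>}
              \<union> {z\<in>cube 1. 16 * e * s\<^sup>2 < \<bar>g (x + s *\<^sub>R z) - ?q (s *\<^sub>R z)\<bar>})"
          by (intro emeasure_mono) auto
        also have "\<dots> \<le> emeasure lborel {z\<in>cube 1. e * s\<^sup>2 < \<bar>F k (x + s *\<^sub>R z) - g (x + s *\<^sub>R z)\<bar>}
              + emeasure lborel {z\<in>cube 1. 16 * e * s\<^sup>2 < \<bar>g (x + s *\<^sub>R z) - ?q (s *\<^sub>R z)\<bar>}"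
          by (intro emeasure_subadditive) measurable
        also have "\<dots> \<le> ennreal \<delta>'" using elim null' by simp
        finally show ?thesis .
      qed
      show ?case
      proof
        fix z :: "real^'n::_" assume z: "z \<in> cube (1/2)"
        have "\<bar>f k (x + s *\<^sub>R z) - ?q (s *\<^sub>R z)\<bar> \<le> (17 * e + e) * s\<^sup>2"
          by (rule blow_up_bound[OF x s' e K N' mass \<delta>' bad z])
        also have "\<dots> \<le> \<epsilon> * s\<^sup>2" using \<epsilon> by (intro mult_right_mono) (auto simp: e_def)
        finally show "\<bar>f k (x + s *\<^sub>R z) - ?q (s *\<^sub>R z)\<bar> \<le> \<epsilon> * s\<^sup>2" .
      qed
    qed
  qed
  have "\<forall>\<^sub>F m in sequentially. \<forall>\<^sub>F k in sequentially. \<forall>z\<in>cube (1/2). \<bar>f k (x + r (Suc m) *\<^sub>R z) - ?q (r (Suc m) *\<^sub>R z)\<bar> \<le> \<epsilon> * (r (Suc m))\<^sup>2"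
    using stepA'
  proof eventually_elim
    case (elim m)
    have "2 * r (Suc m) = r m" by (simp add: r_def)
    then show ?case using elim r0[of "Suc m"] by (intro stepB) auto
  qed
  then show ?thesis unfolding r_def by (subst (asm) eventually_sequentially_Suc)
qed

theorem AE_uniform_Taylor:
  "AE x in lebesgue. x \<in> interior (Q 1) \<longrightarrow> (\<exists>u B. \<forall>\<epsilon>>0. \<forall>\<^sub>F m in sequentially. \<forall>\<^sub>F k in sequentially. \<forall>z\<in>cube (1/2).
     \<bar>f k (x + (1/2)^m *\<^sub>R z) - quad_fun (g x) u B ((1/2)^m *\<^sub>R z)\<bar> \<le> \<epsilon> * ((1/2)^m)\<^sup>2)"
proof -
  have lim: "(\<lambda>m::nat. (1/2::real)^m) \<longlonglongrightarrow> 0" by (rule LIMSEQ_power_zero) simp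
  obtain u B where "AE x in lborel. x \<in> interior (Q 1) \<longrightarrow> (\<lambda>m. \<integral>\<^sup>+z\<in>cube 1.
     ennreal (min 1 (\<bar>g (x + (1/2)^m *\<^sub>R z) - g x - (1/2)^m * (\<Sum>i\<in>UNIV. u i x * z $ i)
       - ((1/2)^m)\<^sup>2 * quad_form (B x) z\<bar> / ((1/2)^m)\<^sup>2)) \<partial>lborel) \<longlonglongrightarrow> 0"
    using AE_approximate_Taylor[OF lim] by auto
  note taylor = AE_completion[OF this]
  have gr: "AE x in lebesgue. \<exists>N::nat. \<exists>d>0. \<forall>c r. 0 < r \<and> r < d \<and> x \<in> cball c r \<longrightarrow>
     liminf (\<lambda>k. emeasure (density lborel (\<lambda>x. ennreal (S k x))) (cball c r)) \<le> of_nat N * emeasure lborel (cball c r)"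
    by (rule AE_liminf_measure_growth[where M = C]) (auto simp: emeasure_density S_le)
  from taylor gr show ?thesis
  proof eventually_elim
    case (elim x)
    show ?case
    proof
      assume xi: "x \<in> interior (Q 1)"
      then have x: "x \<in> Q 1" using interior_subset by blast
      obtain N :: nat and d where d: "d > 0" and N: "\<And>c r. 0 < r \<and> r < d \<and> x \<in> cball c r \<Longrightarrow>
         liminf (\<lambda>k. emeasure (density lborel (\<lambda>x. ennreal (S k x))) (cball c r)) \<le> of_nat N * emeasure lborel (cball c r)"
        using elim(2) by blast
      have t: "(\<lambda>m. \<integral>\<^sup>+z\<in>cube 1. ennreal (min 1 (\<bar>g (x + (1/2)^m *\<^sub>R z) - g x - (1/2)^m * (\<Sum>i\<in>UNIV. u i x * z $ i)
       - ((1/2)^m)\<^sup>2 * quad_form (B x) z\<bar> / ((1/2)^m)\<^sup>2)) \<partial>lborel) \<longlonglongrightarrow> 0"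
        using elim(1) xi by blast
      show "\<exists>u B. \<forall>\<epsilon>>0. \<forall>\<^sub>F m in sequentially. \<forall>\<^sub>F k in sequentially. \<forall>z\<in>cube (1/2).
         \<bar>f k (x + (1/2)^m *\<^sub>R z) - quad_fun (g x) u B ((1/2)^m *\<^sub>R z)\<bar> \<le> \<epsilon> * ((1/2)^m)\<^sup>2"
        by (intro exI[of _ "\<lambda>i. u i x"] exI[of _ "B x"] allI impI)
           (rule sup_bound_near_AE_point[OF x d N t])
    qed
  qed
qed

end

subsection \<open>Local bounds and upper and lower limits\<close>

lemma compact_shifted_cube: "compact {x :: real^'n. x - x0 \<in> cube s}"
proof -
  have "{x :: real^'n. x - x0 \<in> cube s} = (+) x0 ` cube s"
    by (auto simp: image_iff) (metis add_diff_cancel_left' diff_add_cancel add.commute)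
  then show ?thesis by (simp add: cube_eq_cbox compact_translation)
qed

lemma shifted_cube_in_open:
  fixes x0 :: "real^'n"
  assumes "open U" "x0 \<in> U"
  obtains \<rho> where "\<rho> > 0" "\<And>x. x - x0 \<in> cube (4 * \<rho>) \<Longrightarrow> x \<in> U"
proof -
  obtain e where e: "e > 0" "ball x0 e \<subseteq> U" using assms open_contains_ball by blast
  define \<rho> where "\<rho> = e / (8 * CARD('n))"
  have 0: "\<rho> > 0" using e by (simp add: \<rho>_def)
  have "x \<in> U" if "x - x0 \<in> cube (4 * \<rho>)" for x
  proof -
    have "norm (x - x0) \<le> (\<Sum>i\<in>UNIV. \<bar>(x - x0) $ i\<bar>)" by (rule norm_le_l1_cart)
    also have "\<dots> \<le> (\<Sum>i\<in>(UNIV :: 'n set). 4 * \<rho>)" using that by (intro sum_mono) (simp add: cube_def)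
    also have "\<dots> < e" using e by (simp add: \<rho>_def)
    finally have "x \<in> ball x0 e" by (simp add: dist_norm norm_minus_commute)
    then show ?thesis using e by auto
  qed
  with 0 show thesis by (rule that)
qed

lemma compact_compactly_contained:
  fixes K :: "'a::t2_space set"
  shows "compact K \<Longrightarrow> K \<subseteq> U \<Longrightarrow> K \<subset>\<subset> U"
  by (simp add: compactly_contained_def closure_closed compact_imp_closed)

lemma all_minors_bound_on_compact:
  fixes f :: "nat \<Rightarrow> real^'n::{finite,linorder} \<Rightarrow> real"
  assumes K: "compact K" "K \<subseteq> U" and Ck: "\<And>k. Ck_on 2 U (f k)"
    and B: "\<And>k I J. card I = card J \<Longrightarrow> (LINT x:K|lebesgue. \<bar>minor (hessian (f k) x) I J\<bar>) \<le> B"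
  shows "\<exists>C\<ge>0. \<forall>k. (\<integral>\<^sup>+x. ennreal (all_minors (hessian (f k) x)) * indicator K x \<partial>lborel) \<le> ennreal C"
proof (intro exI conjI allI)
  let ?P = "{(I, J). card I = card J} :: ('n set \<times> 'n set) set"
  define C where "C = of_nat (card ?P) * max B 0"
  show "C \<ge> 0" by (simp add: C_def)
  fix k
  define m where "m p x = indicator K x *\<^sub>R \<bar>minor (hessian (f k) x) (fst p) (snd p)\<bar>" for p :: "'n set \<times> 'n set" and x
  have bd: "m p \<in> borel_measurable borel \<and> (\<integral>\<^sup>+x. ennreal (m p x) \<partial>lborel) \<le> ennreal (max B 0)" if p: "p \<in> ?P" for p
  proof -
    have "continuous_on K (\<lambda>x. \<bar>minor (hessian (f k) x) (fst p) (snd p)\<bar>)"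
      using p Ck_on_2D(3)[OF Ck] K(2)
      by (intro continuous_on_rabs continuous_on_minor) (auto simp: hessian_def intro: continuous_on_subset)
    then have int: "integrable lborel (m p)"
      unfolding m_def[abs_def] by (rule borel_integrable_compact[OF K(1)])
    then have meas: "m p \<in> borel_measurable borel" using borel_measurable_integrable by fastforce
    have "(\<integral>\<^sup>+x. ennreal (m p x) \<partial>lborel) = ennreal (integral\<^sup>L lborel (m p))"
      by (rule nn_integral_eq_integral[OF int]) (simp add: m_def)
    also have "\<dots> \<le> ennreal (max B 0)"
    proof (rule ennreal_leI)
      have "integral\<^sup>L lborel (m p) = integral\<^sup>L lebesgue (m p)"
        using meas by (intro integral_completion[symmetric]) simp
      also have "\<dots> \<le> B"
      proof -
        have "card (fst p) = card (snd p)" using p by auto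
        from B[OF this, of k] show ?thesis unfolding set_lebesgue_integral_def m_def[abs_def] .
      qed
      finally show "integral\<^sup>L lborel (m p) \<le> max B 0" by simp
    qed
    finally show ?thesis using meas by blast
  qed
  have "ennreal (all_minors (hessian (f k) x)) * indicator K x = (\<Sum>p\<in>?P. ennreal (m p x))" for x
    by (cases "x \<in> K") (auto simp: all_minors_def m_def case_prod_beta sum_ennreal)
  then have "(\<integral>\<^sup>+x. ennreal (all_minors (hessian (f k) x)) * indicator K x \<partial>lborel) = (\<integral>\<^sup>+x. (\<Sum>p\<in>?P. ennreal (m p x)) \<partial>lborel)"
    by simp
  also have "\<dots> = (\<Sum>p\<in>?P. \<integral>\<^sup>+x. ennreal (m p x) \<partial>lborel)"
  proof (rule nn_integral_sum)
    fix p assume "p \<in> ?P"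
    then have [measurable]: "m p \<in> borel_measurable borel" using bd by blast
    show "(\<lambda>x. ennreal (m p x)) \<in> borel_measurable lborel" by measurable
  qed
  also have "\<dots> \<le> (\<Sum>p\<in>?P. ennreal (max B 0))" using bd by (intro sum_mono) auto
  also have "\<dots> = ennreal C" by (simp add: C_def ennreal_mult ennreal_of_nat_eq_real_of_nat)
  finally show "(\<integral>\<^sup>+x. ennreal (all_minors (hessian (f k) x)) * indicator K x \<partial>lborel) \<le> ennreal C" .
qed

text \<open>\<open>g\<close> is only Lebesgue measurable, whereas the analysis along lines works
  with Borel functions; on a compact set it is exchanged for a Borel version at the price of a null
  set.\<close>

lemma L1loc_tendsto_Borel_limit:
  fixes f :: "nat \<Rightarrow> 'a::euclidean_space \<Rightarrow> real"
  assumes conv: "L1loc_tendsto U f g" and K: "compact K" "K \<subseteq> U"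
  obtains g' where "g' \<in> borel_measurable borel" "AE x in lebesgue. x \<in> K \<longrightarrow> g x = g' x"
    "(\<lambda>k. \<integral>\<^sup>+x. ennreal \<bar>f k x - g' x\<bar> * indicator K x \<partial>lborel) \<longlonglongrightarrow> 0"
proof -
  have Kb: "K \<in> sets borel" using K(1) by (simp add: compact_imp_closed)
  then have Kl: "K \<in> sets lebesgue" by simp
  have KU: "K \<subset>\<subset> U" using K by (rule compact_compactly_contained)
  have gi: "set_integrable lebesgue K g" and fi: "\<And>k. set_integrable lebesgue K (f k)"
    and lim: "(\<lambda>k. LINT x:K|lebesgue. \<bar>f k x - g x\<bar>) \<longlonglongrightarrow> 0"
    using conv Kl KU unfolding L1loc_tendsto_def locally_integrable_on_def by blast+
  have "(\<lambda>x. indicator K x *\<^sub>R g x) \<in> borel_measurable lebesgue"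
    using gi unfolding set_integrable_def by (rule borel_measurable_integrable)
  then obtain g' where g': "g' \<in> borel_measurable lborel" "AE x in lborel. indicator K x *\<^sub>R g x = g' x"
    using completion_ex_borel_measurable_real by blast
  have ae: "AE x in lebesgue. x \<in> K \<longrightarrow> g x = g' x"
    using AE_completion[OF g'(2)] by eventually_elim auto
  have eq: "(\<integral>\<^sup>+x. ennreal \<bar>f k x - g' x\<bar> * indicator K x \<partial>lborel) = ennreal (LINT x:K|lebesgue. \<bar>f k x - g x\<bar>)" for k
  proof -
    have int: "set_integrable lebesgue K (\<lambda>x. \<bar>f k x - g x\<bar>)"
      by (rule set_integrable_abs[OF set_integral_diff(1)[OF fi gi]])
    have "(\<integral>\<^sup>+x. ennreal \<bar>f k x - g' x\<bar> * indicator K x \<partial>lborel) = (\<integral>\<^sup>+x. ennreal \<bar>f k x - g' x\<bar> * indicator K x \<partial>lebesgue)"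
      by (rule nn_integral_completion[symmetric])
    also have "\<dots> = (\<integral>\<^sup>+x. ennreal (indicator K x *\<^sub>R \<bar>f k x - g x\<bar>) \<partial>lebesgue)"
      by (rule nn_integral_cong_AE) (use ae in eventually_elim, auto split: split_indicator)
    also have "\<dots> = ennreal (LINT x:K|lebesgue. \<bar>f k x - g x\<bar>)"
      unfolding set_lebesgue_integral_def using int by (intro nn_integral_eq_integral) (auto simp: set_integrable_def)
    finally show ?thesis .
  qed
  have "(\<lambda>k. \<integral>\<^sup>+x. ennreal \<bar>f k x - g' x\<bar> * indicator K x \<partial>lborel) \<longlonglongrightarrow> 0"
    unfolding eq using tendsto_ennrealI[OF lim] by simp
  with g' ae show thesis by (intro that) auto
qed

lemma bounded_minors_near_point:
  fixes U :: "(real^'n::{finite,wellorder}) set" and f :: "nat \<Rightarrow> real^'n::{finite,wellorder} \<Rightarrow> real"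
  assumes openU: "open U" and Ck: "\<And>k. Ck_on 2 U (f k)" and conv: "L1loc_tendsto U f g"
    and minors: "\<And>K. K \<in> sets lebesgue \<Longrightarrow> K \<subset>\<subset> U \<Longrightarrow>
           \<exists>C. \<forall>k I J. card I = card J \<longrightarrow> (LINT x:K|lebesgue. \<bar>minor (hessian (f k) x) I J\<bar>) \<le> C"
    and x0: "x0 \<in> U"
  obtains \<rho> C g' where "bounded_minors U f g' x0 \<rho> C" "AE x in lebesgue. x - x0 \<in> cube (4 * \<rho>) \<longrightarrow> g x = g' x"
proof -
  obtain \<rho> where \<rho>: "\<rho> > 0" and sub: "\<And>x. x - x0 \<in> cube (4 * \<rho>) \<Longrightarrow> x \<in> U"
    by (rule shifted_cube_in_open[OF openU x0]) (rule that)
  define K where "K = {x. x - x0 \<in> cube (4 * \<rho>)}"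
  have K: "compact K" "K \<subseteq> U" using sub by (auto simp: K_def compact_shifted_cube)
  have "K \<in> sets lebesgue" using K(1) by (simp add: compact_imp_closed lmeasurable_compact fmeasurableD)
  from minors[OF this compact_compactly_contained[OF K]]
  obtain B where B: "\<And>k I J. card I = card J \<Longrightarrow> (LINT x:K|lebesgue. \<bar>minor (hessian (f k) x) I J\<bar>) \<le> B"
    by blast
  have "\<exists>C\<ge>0. \<forall>k. (\<integral>\<^sup>+x. ennreal (all_minors (hessian (f k) x)) * indicator K x \<partial>lborel) \<le> ennreal C"
    by (rule all_minors_bound_on_compact[OF K Ck B])
  then obtain C where C: "C \<ge> 0" "\<And>k. (\<integral>\<^sup>+x. ennreal (all_minors (hessian (f k) x)) * indicator K x \<partial>lborel) \<le> ennreal C"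
    by blast
  obtain g' where g': "g' \<in> borel_measurable borel" "AE x in lebesgue. x \<in> K \<longrightarrow> g x = g' x"
    "(\<lambda>k. \<integral>\<^sup>+x. ennreal \<bar>f k x - g' x\<bar> * indicator K x \<partial>lborel) \<longlonglongrightarrow> 0"
    by (rule L1loc_tendsto_Borel_limit[OF conv K]) (rule that)
  \<comment> \<open>Second derivatives are minors of size one.\<close>
  have hess: "(\<integral>\<^sup>+x. ennreal \<bar>partial_deriv i (partial_deriv j (f k)) x\<bar> * indicator K x \<partial>lborel) \<le> ennreal C" for i j k
  proof -
    have "\<bar>partial_deriv i (partial_deriv j (f k)) x\<bar> \<le> all_minors (hessian (f k) x)" for x
      using entry_le_all_minors[of "hessian (f k) x" i j] by (simp add: hessian_def)
    then have "(\<integral>\<^sup>+x. ennreal \<bar>partial_deriv i (partial_deriv j (f k)) x\<bar> * indicator K x \<partial>lborel)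
       \<le> (\<integral>\<^sup>+x. ennreal (all_minors (hessian (f k) x)) * indicator K x \<partial>lborel)"
      by (intro nn_integral_mono mult_right_mono ennreal_leI) auto
    then show ?thesis using C(2) by (rule order_trans)
  qed
  have "bounded_minors U f g' x0 \<rho> C"
    by (unfold_locales) (use \<rho> C openU sub Ck g' hess in \<open>auto simp: K_def\<close>)
  with g'(2) show thesis by (intro that) (auto simp: K_def)
qed

section \<open>Uniform bounds near a point\<close>

context bounded_minors
begin

lemma F_norm_bound: "\<exists>L\<ge>0. \<forall>k. (\<integral>\<^sup>+x. ennreal \<bar>F k x\<bar> \<partial>lborel) \<le> ennreal L"
proof -
  let ?I = "\<lambda>k. \<integral>\<^sup>+x. ennreal \<bar>F k x\<bar> \<partial>lborel"
  let ?D = "\<lambda>k. \<integral>\<^sup>+x\<in>Q 4. ennreal \<bar>F k x - g x\<bar> \<partial>lborel"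
  let ?G = "\<integral>\<^sup>+x\<in>Q 4. ennreal \<bar>g x\<bar> \<partial>lborel"
  have zero: "ennreal \<bar>F k x\<bar> = ennreal \<bar>F k x\<bar> * indicator (Q 4) x" for k x
    by (auto simp: F_def split: split_indicator)
  have fin: "?I k < \<infinity>" for k
  proof -
    have c: "compact (Q 4)" by (simp add: Q_def compact_shifted_cube)
    have "integrable lborel (\<lambda>x. indicator (Q 4) x *\<^sub>R f k x)"
      by (rule borel_integrable_compact[OF c continuous_on_subset[OF Ck_on_2D(1)[OF Ck] Q4_sub]])
    then have "integrable lborel (F k)" by (simp add: F_def[abs_def])
    then show ?thesis by (simp add: integrable_iff_bounded)
  qed
  have gF: "?G \<le> ?D k + ?I k" for k
  proof -
    have "?G \<le> (\<integral>\<^sup>+x. ennreal \<bar>F k x - g x\<bar> * indicator (Q 4) x + ennreal \<bar>F k x\<bar> \<partial>lborel)"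
    proof (rule nn_integral_mono)
      fix x
      have "ennreal \<bar>g x\<bar> \<le> ennreal (\<bar>F k x - g x\<bar> + \<bar>F k x\<bar>)" by (intro ennreal_leI) linarith
      then show "ennreal \<bar>g x\<bar> * indicator (Q 4) x \<le> ennreal \<bar>F k x - g x\<bar> * indicator (Q 4) x + ennreal \<bar>F k x\<bar>"
        by (auto split: split_indicator)
    qed
    then show ?thesis by (simp add: nn_integral_add)
  qed
  have Fg: "?I k \<le> ?D k + ?G" for k
  proof -
    have "?I k \<le> (\<integral>\<^sup>+x. ennreal \<bar>F k x - g x\<bar> * indicator (Q 4) x + ennreal \<bar>g x\<bar> * indicator (Q 4) x \<partial>lborel)"
    proof (rule nn_integral_mono)
      fix x
      have "ennreal \<bar>F k x\<bar> \<le> ennreal (\<bar>F k x - g x\<bar> + \<bar>g x\<bar>)" by (intro ennreal_leI) linarith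
      then show "ennreal \<bar>F k x\<bar> \<le> ennreal \<bar>F k x - g x\<bar> * indicator (Q 4) x + ennreal \<bar>g x\<bar> * indicator (Q 4) x"
        by (auto simp: F_def split: split_indicator)
    qed
    then show ?thesis by (simp add: nn_integral_add)
  qed
  have "\<forall>\<^sub>F k in sequentially. ?D k \<le> ennreal 1" using conv' by (rule tendsto_0_ennrealD) simp
  then obtain N where N: "\<And>k. k \<ge> N \<Longrightarrow> ?D k \<le> 1" by (auto simp: eventually_sequentially)
  \<comment> \<open>The norms up to index \<open>N\<close> are bounded by their sum; later ones are
    within one of the norm of \<open>g\<close>, which in turn is within one of that of
    \<open>F N\<close>.\<close>
  define L where "L = (\<Sum>k\<le>N. enn2real (?I k)) + 2"
  have small: "?I k \<le> ennreal (\<Sum>k\<le>N. enn2real (?I k))" if "k \<le> N" for k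
  proof -
    have "?I k = ennreal (enn2real (?I k))" using fin[of k] by simp
    also have "\<dots> \<le> ennreal (\<Sum>k\<le>N. enn2real (?I k))"
      using that by (intro ennreal_leI member_le_sum) auto
    finally show ?thesis .
  qed
  have "?I k \<le> ennreal L" for k
  proof (cases "k \<le> N")
    case True
    then show ?thesis by (intro order_trans[OF small] ennreal_leI) (simp_all add: L_def)
  next
    case False
    have "?I k \<le> ?D k + ?G" by (rule Fg)
    also have "\<dots> \<le> 1 + (1 + ennreal (\<Sum>k\<le>N. enn2real (?I k)))"
      using False by (intro add_mono N order_trans[OF gF[of N]] small) auto
    also have "\<dots> = ennreal L"
      by (simp add: L_def ennreal_plus[symmetric] sum_nonneg flip: ennreal_1 del: ennreal_plus)
    finally show ?thesis .
  qed
  moreover have "L \<ge> 0" by (simp add: L_def sum_nonneg)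
  ultimately show ?thesis by blast
qed

text \<open>The blow-up estimate with zero quadratic polynomial at the fixed scale
  \<open>\<rho>\<close>: there the mass bound and, by Markov's inequality, the smallness of a high
  level set are uniform in \<open>k\<close>.\<close>

lemma uniform_bound_near_center: "\<exists>M. \<forall>k. \<forall>z\<in>cube (1/2). \<bar>f k (x0 + \<rho> *\<^sub>R z)\<bar> \<le> M"
proof -
  let ?n = "CARD('n)"
  define N where "N = C / \<rho> ^ ?n"
  have N: "N \<ge> 0" using C0 \<rho> by (simp add: N_def)
  have x0: "x0 \<in> Q 1" using \<rho> by (simp add: Q_def cube_def)
  obtain L where L: "L \<ge> 0" "\<And>k. (\<integral>\<^sup>+x. ennreal \<bar>F k x\<bar> \<partial>lborel) \<le> ennreal L" using F_norm_bound by blast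
  obtain \<delta> where \<delta>0: "\<delta> > 0" and \<delta>: "\<forall>(h :: real^'n::_ \<Rightarrow> real) U b. open U \<longrightarrow> cube 1 \<subseteq> U \<longrightarrow> Ck_on 2 U h \<longrightarrow>
     (\<integral>\<^sup>+z\<in>cube 1. ennreal (all_minors (hessian h z)) \<partial>lborel) \<le> ennreal (1 * N) \<longrightarrow>
     emeasure lborel {z\<in>cube 1. b < \<bar>h z\<bar>} \<le> ennreal \<delta> \<longrightarrow>
     (\<forall>z\<in>cube (1/2). \<bar>h z\<bar> \<le> b + 1)"
    using two_sided_bound_from_measure[of 1 "1 * N"] by auto
  \<comment> \<open>This level makes the bound for the rescaled norm equal to
    \<open>a * \<delta>\<close>, so that Markov's inequality leaves measure at most
    \<open>\<delta>\<close>; \<open>L + 1\<close> keeps \<open>a\<close> positive.\<close>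
  define a where "a = (L + 1) / (\<rho> ^ ?n * \<delta>)"
  have a: "a > 0" using L \<rho> \<delta>0 by (simp add: a_def add_nonneg_pos)
  have q0: "quad_fun 0 (\<lambda>_. 0) 0 z = 0" for z :: "real^'n::_"
    by (simp add: quad_fun_def quad_form_def)
  have "\<bar>f k (x0 + \<rho> *\<^sub>R z)\<bar> \<le> (a / \<rho>\<^sup>2 + 1) * \<rho>\<^sup>2" if z: "z \<in> cube (1/2)" for k z
  proof -
    have Fl: "(\<integral>\<^sup>+z. ennreal \<bar>F k (x0 + \<rho> *\<^sub>R z)\<bar> \<partial>lborel) \<le> ennreal (a * \<delta>)"
    proof -
      have "ennreal (\<rho> ^ ?n) * (\<integral>\<^sup>+z. ennreal \<bar>F k (x0 + \<rho> *\<^sub>R z)\<bar> \<partial>lborel) = (\<integral>\<^sup>+y. ennreal \<bar>F k y\<bar> \<partial>lborel)"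
        by (rule nn_integral_lborel_scale[OF _ \<rho>, symmetric]) measurable
      also have "\<dots> \<le> ennreal (L + 1)" by (rule order_trans[OF L(2)]) (simp add: ennreal_leI)
      also have "\<dots> = ennreal (\<rho> ^ ?n) * ennreal (a * \<delta>)"
        using \<rho> \<delta>0 L(1) by (simp add: a_def ennreal_mult[symmetric])
      finally show ?thesis using \<rho> by (subst (asm) ennreal_mult_le_mult_iff) auto
    qed
    have bad: "emeasure lborel {z\<in>cube 1. a / \<rho>\<^sup>2 * \<rho>\<^sup>2 < \<bar>F k (x0 + \<rho> *\<^sub>R z) - quad_fun 0 (\<lambda>_. 0) 0 (\<rho> *\<^sub>R z)\<bar>} \<le> ennreal \<delta>"
      unfolding q0
      by (rule Markov_emeasure[OF _ _ a _ _ Fl]) (use \<delta>0 \<rho> in \<open>auto intro: ennreal_leI\<close>)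
    have mass: "(\<integral>\<^sup>+z\<in>cube 1. ennreal (S k (x0 + \<rho> *\<^sub>R z)) \<partial>lborel) \<le> ennreal N"
      unfolding N_def by (rule S_rescaled_le[OF \<rho>])
    have K: "all_minors (A - (\<chi> i j. (0 :: real^'n::_^'n::_) $ i $ j + (0 :: real^'n::_^'n::_) $ j $ i)) \<le> 1 * all_minors A" for A
    proof -
      have "(\<chi> i j. (0 :: real^'n::_^'n::_) $ i $ j + (0 :: real^'n::_^'n::_) $ j $ i) = 0" by (simp add: vec_eq_iff)
      then show ?thesis by simp
    qed
    have "\<bar>f k (x0 + \<rho> *\<^sub>R z) - quad_fun 0 (\<lambda>_. 0) 0 (\<rho> *\<^sub>R z)\<bar> \<le> (a / \<rho>\<^sup>2 + 1) * \<rho>\<^sup>2"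
      by (rule blow_up_bound[where K = 1 and N = N and \<delta> = \<delta>])
        (rule x0 \<rho> order_refl K N mass \<delta> bad z | simp)+
    then show ?thesis by (simp add: q0)
  qed
  then show ?thesis by blast
qed

end

section \<open>From dyadic scales to the limit functions\<close>

text \<open>Evaluate the expansion at \<open>z = 0\<close>; one suitable \<open>m\<close> suffices
  because the squared scale is at most one.\<close>

lemma tendsto_of_uniform_Taylor:
  fixes B :: "real^'n^'n"
  assumes T: "\<And>\<epsilon>. \<epsilon> > 0 \<Longrightarrow> \<forall>\<^sub>F m in sequentially. \<forall>\<^sub>F k in sequentially. \<forall>z\<in>cube (1/2).
     \<bar>f k (x + (1/2)^m *\<^sub>R z) - quad_fun a u B ((1/2)^m *\<^sub>R z)\<bar> \<le> \<epsilon> * ((1/2)^m)\<^sup>2"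
  shows "(\<lambda>k. f k x) \<longlonglongrightarrow> a"
proof (rule tendstoI)
  fix e :: real assume e: "e > 0"
  obtain m :: nat where "\<forall>\<^sub>F k in sequentially. \<forall>z\<in>cube (1/2).
     \<bar>f k (x + (1/2)^m *\<^sub>R z) - quad_fun a u B ((1/2)^m *\<^sub>R z)\<bar> \<le> e / 2 * ((1/2)^m)\<^sup>2"
    using eventually_happens[OF T[of "e / 2"]] e by auto
  then show "\<forall>\<^sub>F k in sequentially. dist (f k x) a < e"
  proof eventually_elim
    case (elim k)
    have "\<bar>f k x - a\<bar> \<le> e / 2 * ((1/2)^m)\<^sup>2"
      using elim[rule_format, of 0] by (simp add: quad_fun_def quad_form_def cube_def)
    also have "\<dots> \<le> e / 2 * 1" using e by (intro mult_left_mono) (auto simp: power_le_one)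
    finally show ?case using e by (simp add: dist_real_def)
  qed
qed

lemma quadratic_polynomial_quad_fun:
  fixes B :: "real^'n^'n"
  shows "quadratic_polynomial (\<lambda>y. quad_fun c u B (y - x))"
proof -
  define c' where "c' = c - (\<Sum>i\<in>UNIV. u i * x $ i) + quad_form B x"
  define b where "b = (\<chi> i. u i - (\<Sum>l\<in>UNIV. (B $ i $ l + B $ l $ i) * x $ l))"
  have "quad_fun c u B (y - x) = c' + (\<Sum>i\<in>UNIV. b $ i * y $ i) + (\<Sum>i\<in>UNIV. \<Sum>j\<in>UNIV. B $ i $ j * y $ i * y $ j)" for y
  proof -
    have 1: "(\<Sum>i\<in>UNIV. b $ i * y $ i) = (\<Sum>i\<in>UNIV. u i * y $ i)
       - ((\<Sum>i\<in>UNIV. \<Sum>l\<in>UNIV. B $ i $ l * y $ i * x $ l) + (\<Sum>i\<in>UNIV. \<Sum>l\<in>UNIV. B $ l $ i * y $ i * x $ l))"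
      by (simp add: b_def sum_distrib_right sum_distrib_left algebra_simps sum_subtractf sum.distrib)
    have 2: "(\<Sum>i\<in>UNIV. \<Sum>l\<in>UNIV. B $ l $ i * y $ i * x $ l) = (\<Sum>i\<in>UNIV. \<Sum>l\<in>UNIV. B $ i $ l * x $ i * y $ l)"
      by (subst sum.swap) (simp add: mult_ac)
    have 3: "quad_form B (y - x) = quad_form B y - (\<Sum>i\<in>UNIV. \<Sum>l\<in>UNIV. B $ i $ l * y $ i * x $ l)
       - (\<Sum>i\<in>UNIV. \<Sum>l\<in>UNIV. B $ i $ l * x $ i * y $ l) + quad_form B x"
      by (simp add: quad_form_def algebra_simps sum_subtractf sum.distrib)
    show ?thesis unfolding quad_fun_def c'_def 1 2 3
      by (simp add: quad_form_def algebra_simps sum_subtractf)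
  qed
  then show ?thesis unfolding quadratic_polynomial_def by blast
qed

text \<open>\<open>L\<close> stands for the upper or the lower limit: both preserve an eventual
  bound around a fixed value. Passing from dyadic scales to arbitrary increments costs only a
  constant, since each small increment fits into a cube of comparable size.\<close>

lemma twice_differentiable_at_of_uniform_Taylor:
  fixes B :: "real^'n^'n" and L :: "(nat \<Rightarrow> real) \<Rightarrow> real"
  assumes T: "\<And>\<epsilon>. \<epsilon> > 0 \<Longrightarrow> \<forall>\<^sub>F m in sequentially. \<forall>\<^sub>F k in sequentially. \<forall>z\<in>cube (1/2).
     \<bar>f k (x + (1/2)^m *\<^sub>R z) - quad_fun a u B ((1/2)^m *\<^sub>R z)\<bar> \<le> \<epsilon> * ((1/2)^m)\<^sup>2"
    and L: "\<And>s q e. \<forall>\<^sub>F k in sequentially. \<bar>s k - q\<bar> \<le> e \<Longrightarrow> \<bar>L s - q\<bar> \<le> e"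
  shows "twice_differentiable_at U (\<lambda>y. L (\<lambda>k. f k y)) x"
proof -
  let ?Q = "\<lambda>y. quad_fun a u B (y - x)"
  have "((\<lambda>y. (L (\<lambda>k. f k y) - ?Q y) / (norm (y - x))\<^sup>2) \<longlongrightarrow> 0) (at x within U)"
    unfolding Lim_within
  proof (intro allI impI)
    fix e :: real assume e: "e > 0"
    obtain M where M: "\<And>m. m \<ge> M \<Longrightarrow> \<forall>\<^sub>F k in sequentially. \<forall>z\<in>cube (1/2).
      \<bar>f k (x + (1/2)^m *\<^sub>R z) - quad_fun a u B ((1/2)^m *\<^sub>R z)\<bar> \<le> e / 32 * ((1/2)^m)\<^sup>2"
      using T[of "e / 32"] e by (auto simp: eventually_sequentially)
    have "dist ((L (\<lambda>k. f k y) - ?Q y) / (norm (y - x))\<^sup>2) 0 < e"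
      if y: "0 < dist y x" "dist y x < (1/2)^(M + 1)" for y
    proof -
      define t where "t = norm (y - x)"
      have t: "0 < t" "t < (1/2)^(M + 1)" using y by (auto simp: t_def dist_norm)
      \<comment> \<open>The first dyadic scale below \<open>t\<close>. Two steps up, at
        \<open>m = j - 2\<close>, the scale lies between \<open>2 * t\<close> and
        \<open>4 * t\<close>, so the increment fits into the half cube, and
        \<open>16 * e / 32\<close> gives the final \<open>e / 2\<close>.\<close>
      define j where "j = (LEAST j. (1/2::real)^j < t)"
      have "\<exists>j. (1/2::real)^j < t" using real_arch_pow_inv[OF t(1), of "1/2"] by auto
      then have j: "(1/2)^j < t" unfolding j_def by (rule LeastI_ex)
      have jM: "M + 1 < j"
      proof (rule ccontr)
        assume "\<not> M + 1 < j"
        then have "(1/2::real)^(M + 1) \<le> (1/2)^j" by (intro power_decreasing) auto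
        then show False using j t by linarith
      qed
      define m where "m = j - 2"
      have jm: "j = Suc (Suc m)" "m \<ge> M" using jM by (auto simp: m_def)
      have "\<not> (1/2::real)^(Suc m) < t" unfolding j_def by (rule not_less_Least) (simp add: jm j_def[symmetric])
      then have t2: "t \<le> (1/2)^m / 2" by simp
      have t1: "(1/2)^m < 4 * t" using j by (simp add: jm)
      define z where "z = 2^m *\<^sub>R (y - x)"
      have yz: "x + (1/2)^m *\<^sub>R z = y" "(1/2)^m *\<^sub>R z = y - x"
        by (simp_all add: z_def power_one_over)
      have z: "z \<in> cube (1/2)"
        unfolding cube_def
      proof safe
        fix i
        have "\<bar>z $ i\<bar> \<le> norm z" by (rule component_le_norm_cart)
        also have "\<dots> = 2^m * t" by (simp add: z_def t_def)
        also have "\<dots> \<le> 2^m * ((1/2)^m / 2)" using t2 by (intro mult_left_mono) auto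
        also have "\<dots> = 1/2" by (simp add: power_one_over)
        finally show "\<bar>z $ i\<bar> \<le> 1/2" .
      qed
      have "\<forall>\<^sub>F k in sequentially. \<bar>f k y - ?Q y\<bar> \<le> e / 32 * ((1/2)^m)\<^sup>2"
        using M[OF jm(2)] by eventually_elim (use z yz in force)
      then have "\<bar>L (\<lambda>k. f k y) - ?Q y\<bar> \<le> e / 32 * ((1/2)^m)\<^sup>2" by (rule L)
      also have "\<dots> \<le> e / 32 * (4 * t)\<^sup>2"
        using t1 e by (intro mult_left_mono power_mono) auto
      also have "\<dots> = e / 2 * t\<^sup>2" by (simp add: power2_eq_square)
      finally have "\<bar>L (\<lambda>k. f k y) - ?Q y\<bar> / t\<^sup>2 \<le> e / 2" using t by (simp add: divide_le_eq)
      then have "\<bar>L (\<lambda>k. f k y) - ?Q y\<bar> / t\<^sup>2 < e" using e by linarith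
      then show ?thesis by (simp add: t_def)
    qed
    then show "\<exists>d>0. \<forall>y\<in>U. 0 < dist y x \<and> dist y x < d \<longrightarrow> dist ((L (\<lambda>k. f k y) - ?Q y) / (norm (y - x))\<^sup>2) 0 < e"
      by (intro exI[of _ "(1/2)^(M + 1)"]) auto
  qed
  then show ?thesis unfolding twice_differentiable_at_def
    using quadratic_polynomial_quad_fun[of a u B x] by (intro exI[of _ ?Q]) auto
qed

text \<open>The eventual bound excludes infinite limits, so \<open>real_of_ereal\<close> never falls
  back on zero here.\<close>

lemma limsup_liminf_close:
  fixes s :: "nat \<Rightarrow> real"
  assumes ev: "\<forall>\<^sub>F k in sequentially. \<bar>s k - q\<bar> \<le> e"
  shows "\<bar>real_of_ereal (limsup (\<lambda>k. ereal (s k))) - q\<bar> \<le> e" "\<bar>real_of_ereal (liminf (\<lambda>k. ereal (s k))) - q\<bar> \<le> e"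
proof -
  have "limsup (\<lambda>k. ereal (s k)) \<le> ereal (q + e)"
    by (rule Limsup_bounded) (use ev in eventually_elim, auto)
  moreover have "ereal (q - e) \<le> liminf (\<lambda>k. ereal (s k))"
    by (rule Liminf_bounded) (use ev in eventually_elim, auto)
  moreover have "liminf (\<lambda>k. ereal (s k)) \<le> limsup (\<lambda>k. ereal (s k))" by (simp add: Liminf_le_Limsup)
  ultimately show "\<bar>real_of_ereal (limsup (\<lambda>k. ereal (s k))) - q\<bar> \<le> e" "\<bar>real_of_ereal (liminf (\<lambda>k. ereal (s k))) - q\<bar> \<le> e"
    by (cases "limsup (\<lambda>k. ereal (s k))"; cases "liminf (\<lambda>k. ereal (s k))"; simp add: abs_le_iff)+
qed

lemma SUP_abs_finite_on_compact:
  fixes f :: "nat \<Rightarrow> 'a::topological_space \<Rightarrow> real"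
  assumes K: "compact K" and loc: "\<And>x. x \<in> K \<Longrightarrow> \<exists>V M. open V \<and> x \<in> V \<and> (\<forall>k. \<forall>y\<in>V. \<bar>f k y\<bar> \<le> M)"
  shows "(SUP k. SUP x\<in>K. ereal \<bar>f k x\<bar>) < \<infinity>"
proof -
  obtain V M where VM: "\<And>x. x \<in> K \<Longrightarrow> open (V x) \<and> x \<in> V x \<and> (\<forall>k. \<forall>y\<in>V x. \<bar>f k y\<bar> \<le> M x)"
    using loc by metis
  obtain T where T: "T \<subseteq> K" "finite T" "K \<subseteq> (\<Union>x\<in>T. V x)"
    by (rule compactE_image[OF K, of K V]) (use VM in auto)
  have "\<bar>f k y\<bar> \<le> (\<Sum>x\<in>T. \<bar>M x\<bar>)" if "y \<in> K" for k y
  proof -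
    obtain x where x: "x \<in> T" "y \<in> V x" using T(3) \<open>y \<in> K\<close> by auto
    then have "\<bar>f k y\<bar> \<le> M x" using VM[of x] T(1) by blast
    also have "M x \<le> \<bar>M x\<bar>" by simp
    also have "\<dots> \<le> (\<Sum>x\<in>T. \<bar>M x\<bar>)" using x T(2) by (intro member_le_sum) auto
    finally show ?thesis .
  qed
  then have "(SUP k. SUP x\<in>K. ereal \<bar>f k x\<bar>) \<le> ereal (\<Sum>x\<in>T. \<bar>M x\<bar>)"
    by (intro SUP_least) simp
  also have "\<dots> < \<infinity>" by simp
  finally show ?thesis .
qed

text \<open>By Lindelof's theorem countably many of the neighbourhoods cover \<open>U\<close>, and
  countably many null sets have a null union.\<close>

lemma AE_of_locally_AE:
  fixes U :: "'a::euclidean_space set"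
  assumes "\<And>x. x \<in> U \<Longrightarrow> \<exists>V. open V \<and> x \<in> V \<and> (AE y in lebesgue. y \<in> V \<longrightarrow> P y)"
  shows "AE x in lebesgue. x \<in> U \<longrightarrow> P x"
proof -
  define \<F> where "\<F> = {V. open V \<and> (AE y in lebesgue. y \<in> V \<longrightarrow> P y)}"
  obtain \<F>' where F': "\<F>' \<subseteq> \<F>" "countable \<F>'" "\<Union>\<F>' = \<Union>\<F>"
    by (rule Lindelof[of \<F>]) (auto simp: \<F>_def)
  have ae: "AE y in lebesgue. \<forall>V\<in>\<F>'. y \<in> V \<longrightarrow> P y"
    using F'(1) by (intro AE_ball_countable'[OF _ F'(2)]) (auto simp: \<F>_def)
  have sub: "U \<subseteq> \<Union>\<F>'" unfolding F'(3) using assms by (auto simp: \<F>_def)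
  from ae show ?thesis by eventually_elim (use sub in blast)
qed

theorem theorem1p1:
  fixes U :: "(real^'n::{finite,wellorder}) set"
    and f :: "nat \<Rightarrow> real^'n::{finite,wellorder} \<Rightarrow> real"
    and g :: "real^'n::{finite,wellorder} \<Rightarrow> real"
  assumes "open U"
    and "\<And>k. Ck_on 2 U (f k)"
    and "L1loc_tendsto U f g"
    and "\<And>K. K \<in> sets lebesgue \<Longrightarrow> K \<subset>\<subset> U \<Longrightarrow>
           \<exists>C. \<forall>k I J. card I = card J \<longrightarrow>
             (LINT x:K|lebesgue. \<bar>minor (hessian (f k) x) I J\<bar>) \<le> C"
  shows "(\<forall>K. compact K \<and> K \<subseteq> U \<longrightarrow> (SUP k. SUP x\<in>K. ereal \<bar>f k x\<bar>) < \<infinity>) \<and>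
         (AE x in lebesgue. x \<in> U \<longrightarrow> (\<lambda>k. f k x) \<longlonglongrightarrow> g x) \<and>
         (AE x in lebesgue. x \<in> U \<longrightarrow> twice_differentiable_at U (pointwise_limsup f) x) \<and>
         (AE x in lebesgue. x \<in> U \<longrightarrow> twice_differentiable_at U (pointwise_liminf f) x)"
proof -
  have bounded: "\<exists>V M. open V \<and> x0 \<in> V \<and> (\<forall>k. \<forall>y\<in>V. \<bar>f k y\<bar> \<le> M)" if x0: "x0 \<in> U" for x0
  proof -
    obtain \<rho> C g' where "bounded_minors U f g' x0 \<rho> C"
      by (rule bounded_minors_near_point[where U = U and f = f and g = g, OF assms x0]) (assumption | rule that)+
    then interpret bounded_minors U f g' x0 \<rho> C .
    obtain M where M: "\<And>k z. z \<in> cube (1/2) \<Longrightarrow> \<bar>f k (x0 + \<rho> *\<^sub>R z)\<bar> \<le> M"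
      using uniform_bound_near_center by blast
    \<comment> \<open>The ball of radius \<open>\<rho>/2\<close> lies in the half cube at scale
      \<open>\<rho>\<close>.\<close>
    have "\<bar>f k y\<bar> \<le> M" if y: "y \<in> ball x0 (\<rho> / 2)" for k y
    proof -
      define z where "z = (1 / \<rho>) *\<^sub>R (y - x0)"
      have "z \<in> cube (1/2)"
        unfolding cube_def
      proof safe
        fix i
        have "\<bar>z $ i\<bar> \<le> norm z" by (rule component_le_norm_cart)
        also have "\<dots> = norm (y - x0) / \<rho>" using \<rho> by (simp add: z_def)
        also have "\<dots> \<le> 1/2" using y \<rho> by (simp add: dist_norm norm_minus_commute divide_le_eq)
        finally show "\<bar>z $ i\<bar> \<le> 1/2" .
      qed
      from M[OF this, of k] show ?thesis using \<rho> by (simp add: z_def)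
    qed
    then show ?thesis using \<rho> by (intro exI[of _ "ball x0 (\<rho> / 2)"] exI[of _ M]) auto
  qed
  \<comment> \<open>All almost everywhere claims follow from this one expansion at \<open>x\<close>.
    It is centred at the value \<open>g x\<close>, so the Borel versions used near each point have
    to be exchanged for \<open>g\<close> off a null set.\<close>
  define T where "T x \<longleftrightarrow> (\<exists>u B. \<forall>\<epsilon>>0. \<forall>\<^sub>F m in sequentially. \<forall>\<^sub>F k in sequentially. \<forall>z\<in>cube (1/2).
     \<bar>f k (x + (1/2)^m *\<^sub>R z) - quad_fun (g x) u B ((1/2)^m *\<^sub>R z)\<bar> \<le> \<epsilon> * ((1/2)^m)\<^sup>2)" for x
  have T: "AE x in lebesgue. x \<in> U \<longrightarrow> T x"
  proof (rule AE_of_locally_AE)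
    fix x0 assume x0: "x0 \<in> U"
    obtain \<rho> C g' where "bounded_minors U f g' x0 \<rho> C" and eq: "AE x in lebesgue. x - x0 \<in> cube (4 * \<rho>) \<longrightarrow> g x = g' x"
      by (rule bounded_minors_near_point[where U = U and f = f and g = g, OF assms x0]) (assumption | rule that)+
    then interpret bounded_minors U f g' x0 \<rho> C by simp
    have "ball x0 \<rho> \<subseteq> Q 1"
    proof
      fix y assume y: "y \<in> ball x0 \<rho>"
      have "\<bar>(y - x0) $ i\<bar> \<le> \<rho>" for i
        using component_le_norm_cart[of "y - x0" i] y by (simp add: dist_norm norm_minus_commute)
      then show "y \<in> Q 1" by (simp add: Q_def cube_def)
    qed
    then have "x0 \<in> interior (Q 1)" using \<rho> by (auto simp: mem_interior)
    moreover have "AE x in lebesgue. x \<in> interior (Q 1) \<longrightarrow> T x"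
      using AE_uniform_Taylor eq
    proof eventually_elim
      case (elim x)
      show ?case
      proof
        assume x: "x \<in> interior (Q 1)"
        then have "x \<in> Q 4" using interior_subset Q_mono[of 1 4] by auto
        then have "g x = g' x" using elim(2) by (simp add: Q_def)
        with elim(1) x show "T x" by (simp add: T_def)
      qed
    qed
    ultimately show "\<exists>V. open V \<and> x0 \<in> V \<and> (AE y in lebesgue. y \<in> V \<longrightarrow> T y)" by blast
  qed
  have lim: "(\<lambda>k. f k x) \<longlonglongrightarrow> g x" if "T x" for x
    using that unfolding T_def by (blast intro: tendsto_of_uniform_Taylor)
  have sup: "twice_differentiable_at U (pointwise_limsup f) x" and inf: "twice_differentiable_at U (pointwise_liminf f) x"
    if Tx: "T x" for x
  proof -
    obtain u B where uB: "\<And>\<epsilon>. \<epsilon> > 0 \<Longrightarrow> \<forall>\<^sub>F m in sequentially. \<forall>\<^sub>F k in sequentially. \<forall>z\<in>cube (1/2).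
      \<bar>f k (x + (1/2)^m *\<^sub>R z) - quad_fun (g x) u B ((1/2)^m *\<^sub>R z)\<bar> \<le> \<epsilon> * ((1/2)^m)\<^sup>2"
      using Tx unfolding T_def by blast
    show "twice_differentiable_at U (pointwise_limsup f) x"
      unfolding pointwise_limsup_def[abs_def]
      by (rule twice_differentiable_at_of_uniform_Taylor[OF uB, where L = "\<lambda>s. real_of_ereal (limsup (\<lambda>k. ereal (s k)))"])
         (auto intro: limsup_liminf_close)
    show "twice_differentiable_at U (pointwise_liminf f) x"
      unfolding pointwise_liminf_def[abs_def]
      by (rule twice_differentiable_at_of_uniform_Taylor[OF uB, where L = "\<lambda>s. real_of_ereal (liminf (\<lambda>k. ereal (s k)))"])
         (auto intro: limsup_liminf_close)
  qed
  show ?thesis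
  proof (intro conjI allI impI)
    fix K assume "compact K \<and> K \<subseteq> U"
    then show "(SUP k. SUP x\<in>K. ereal \<bar>f k x\<bar>) < \<infinity>"
      using bounded by (intro SUP_abs_finite_on_compact) auto
  next
    show "AE x in lebesgue. x \<in> U \<longrightarrow> (\<lambda>k. f k x) \<longlonglongrightarrow> g x"
      using T by eventually_elim (use lim in auto)
    show "AE x in lebesgue. x \<in> U \<longrightarrow> twice_differentiable_at U (pointwise_limsup f) x"
      using T by eventually_elim (use sup in auto)
    show "AE x in lebesgue. x \<in> U \<longrightarrow> twice_differentiable_at U (pointwise_liminf f) x"
      using T by eventually_elim (use inf in auto)
  qed
qed

end
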